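(* Consider the massive MIMO systems described in the context with $M$-ary PAM, PSK or square QAM constellations, the zero-forcing detector, $N_r=\beta N_t$ with $\beta>1$ fixed, fixed SNR $\eta>0$, and channel covariance matrix $\mathbf\Sigma$ equal to the $N_t\times N_t$ Kac-Murdock-Szegő (KMS) matrix with parameter $\rho\in\mathbb C$: $[\mathbf\Sigma]_{mn}=\rho^{\,n-m}$ for $m\le n$ and $[\mathbf\Sigma]_{mn}=[\mathbf\Sigma]_{nm}^*$ for $m>n$. Use the precoder $$\widetilde{\mathbf F}=\frac1{\sqrt{\mathrm{tr}(\mathbf\Lambda^{-1/2})}}\,\mathbf W\mathbf\Lambda^{-1/4}\widetilde{\mathbf V}_2,$$ where $\mathbf\Sigma=\mathbf W\mathbf\Lambda\mathbf W^H$ is the eigenvalue decomposition ($\mathbf W$ unitary, $\mathbf\Lambda$ diagonal with the eigenvalues of $\mathbf\Sigma$ in nondecreasing order) and $\widetilde{\mathbf V}_2$ is the $N_t\times N_t$ normalized DFT matrix. If $0<|\rho|<1$, then the limit of the average SEP, $\lim_{N_t\to\infty}\mathrm P_{N_t}(\widetilde{\mathbf F})=\widetilde{\mathrm P}$, exists and, writing $\mathtt E(k)=\int_0^{\pi/2}\sqrt{1-k^2\sin^2\theta}\,d\theta$ for the complete elliptic integral of the second kind and $\mathtt E^2(k)=(\mathtt E(k))^2$, $$\widetilde{\mathrm P}_{\mathrm{PAM}}=\frac{2(M-1)}MQ\left(\sqrt{\frac{3\pi^2\eta(1-|\rho|)(\beta-1)}{2(1+|\rho|)(M^2-1)\,\mathtt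 E^2\big(\frac{2\sqrt{|\rho|}}{1+|\rho|}\big)}}\right),$$ $$\widetilde{\mathrm P}_{\mathrm{PSK}}=\frac1\pi\int_0^{(M-1)\pi/M}\exp\left(\frac{-\pi^2\eta(1-|\rho|)(\beta-1)\sin^2(\pi/M)}{4(1+|\rho|)\,\mathtt E^2\big(\frac{2\sqrt{|\rho|}}{1+|\rho|}\big)\sin^2\theta}\right)d\theta,$$ $$\widetilde{\mathrm P}_{\mathrm{QAM}}=\frac{4(\sqrt M-1)}{\sqrt M}Q\left(\sqrt{\frac{3\pi^2\eta(1-|\rho|)(\beta-1)}{4(1+|\rho|)(M-1)\,\mathtt E^2\big(\frac{2\sqrt{|\rho|}}{1+|\rho|}\big)}}\right)-\frac{4(\sqrt M-1)^2}{M}Q^2\left(\sqrt{\frac{3\pi^2\eta(1-|\rho|)(\beta-1)}{4(1+|\rho|)(M-1)\,\mathtt E^2\big(\frac{2\sqrt{|\rho|}}{1+|\rho|}\big)}}\right)$$ for PAM, PSK and square QAM respectively.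
   Context: System model. The received vector is $\mathbf r=\mathbf H\mathbf F\mathbf s+\boldsymbol\xi\in\mathbb C^{N_r}$, where: $\mathbf H$ is an $N_r\times N_t$ random matrix whose rows $\mathbf h_1^T,\dots,\mathbf h_{N_r}^T$ are i.i.d. zero-mean circularly-symmetric complex Gaussian with $\mathbb E[(\mathbf h_m^T)^H\mathbf h_m^T]=\mathbf\Sigma$; $\mathbf F$ is an $N_t\times N_t$ nonsingular deterministic precoding matrix; $\boldsymbol\xi$ is circularly-symmetric complex Gaussian noise with covariance $\sigma^2\mathbf I$; $\mathbf s=[s_1,\dots,s_{N_t}]^T$ has i.i.d. entries, each uniform on a constellation $\mathcal S\subset\mathbb C$ of size $M$ with unit average energy; $\mathbf H,\mathbf s,\boldsymbol\xi$ are independent. The system SNR is $\eta=1/\sigma^2$. Constellations. $M$-PAM ($M\ge2$): $\{\delta(2i-1-M):i=1,\dots,M\}\subset\mathbb R$ with $\delta=\sqrt{3/(M^2-1)}$. $M$-PSK ($M\ge2$): $\{e^{2\pi j i/M}:i=0,\dots,M-1\}$ (with $j=\sqrt{-1}$). Square $M$-QAM ($\sqrt M\ge 2$ an integer): $\{a+jb\}$ with $a,b$ ranging over $\{\delta(2i-1-\sqrt M):i=1,\dots,\sqrt M\}$, $\delta=\sqrt{3/(2(M-1))}$. Zero-forcing detection. With $(\mathbf H\mathbf F)^+=(\mathbf F^H\mathbf H^H\mathbf H\mathbf F)^{-1}\mathbf F^H\mathbf H^H$, the receiver forms $\mathbf r'=(\mathbf H\mathbf F)^+\mathbf r$ and decides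 $\hat s_k=\arg\min_{s\in\mathcal S}|r'_k-s|^2$ for each $k$. Average SEP. $\mathrm P_{N_t}(\mathbf F)=\frac1{N_t}\sum_{k=1}^{N_t}\Pr(\hat s_k\ne s_k)$, the probability being over $\mathbf H$, $\mathbf s$ and $\boldsymbol\xi$. Conventions. The limit is over $N_t$ with $N_r=\beta N_t$ (an integer). The normalized DFT matrix has $(m,n)$ entry $N_t^{-1/2}e^{-2\pi j(m-1)(n-1)/N_t}$. $Q(x)=\frac1{\sqrt{2\pi}}\int_x^\infty e^{-t^2/2}dt$, and $Q^2(x)=(Q(x))^2$. *)

theory Defs
  imports
    "HOL-Probability.Probability"
    "Jordan_Normal_Form.Gauss_Jordan_Elimination"
    "Jordan_Normal_Form.Schur_Decomposition"
begin

unbundle no vec_syntax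
hide_const (open) Finite_Cartesian_Product.vec Finite_Cartesian_Product.row Finite_Cartesian_Product.mat

text \<open>Matrices and vectors are those of Jordan_Normal_Form, indexed from 0, so that their sizes
  can vary with the number of antennas.  The measurable spaces below carry the smallest
  sigma-algebra that makes all entries Borel measurable.\<close>

definition vec_borel :: "nat \<Rightarrow> complex Matrix.vec measure" where
  "vec_borel n =
     vimage_algebra (carrier_vec n) (\<lambda>v. \<lambda>i\<in>{..<n}. v $ i) (PiM {..<n} (\<lambda>_. borel))"

definition mat_borel :: "nat \<Rightarrow> nat \<Rightarrow> complex Matrix.mat measure" where
  "mat_borel nr nc =
     vimage_algebra (carrier_mat nr nc) (\<lambda>A. \<lambda>ij\<in>{..<nr} \<times> {..<nc}. A $$ ij)
       (PiM ({..<nr} \<times> {..<nc}) (\<lambda>_. borel))"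


section \<open>Gaussian vectors\<close>

text \<open>Gaussian variables may be degenerate (almost surely constant).\<close>

definition gaussian_rv :: "'a measure \<Rightarrow> ('a \<Rightarrow> real) \<Rightarrow> bool" where
  "gaussian_rv P X \<longleftrightarrow>
     (\<exists>\<mu> \<sigma>. 0 < \<sigma> \<and> distributed P lborel X (normal_density \<mu> \<sigma>)) \<or>
     X \<in> borel_measurable P \<and> (\<exists>\<mu>. AE \<omega> in P. X \<omega> = \<mu>)"

definition complex_gaussian_vec :: "'a measure \<Rightarrow> nat \<Rightarrow> ('a \<Rightarrow> complex Matrix.vec) \<Rightarrow> bool" where
  "complex_gaussian_vec P n z \<longleftrightarrow>
     z \<in> measurable P (vec_borel n) \<and>
     (\<forall>a b :: nat \<Rightarrow> real.
        gaussian_rv P (\<lambda>\<omega>. \<Sum>i<n. a i * Re (z \<omega> $ i) + b i * Im (z \<omega> $ i)))"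

text \<open>The covariance convention is \<open>C\<^sub>i\<^sub>j = E(cnj z\<^sub>i * z\<^sub>j)\<close>, i.e. the expectation of
  \<open>(z\<^sup>T)\<^sup>H z\<^sup>T\<close> where \<open>z\<^sup>T\<close> is the row vector.\<close>

definition zero_mean_cscg ::
  "'a measure \<Rightarrow> nat \<Rightarrow> complex Matrix.mat \<Rightarrow> ('a \<Rightarrow> complex Matrix.vec) \<Rightarrow> bool" where
  "zero_mean_cscg P n C z \<longleftrightarrow>
     complex_gaussian_vec P n z \<and>
     (\<forall>\<phi>::real. distr P (vec_borel n) (\<lambda>\<omega>. cis \<phi> \<cdot>\<^sub>v z \<omega>) = distr P (vec_borel n) z) \<and>
     (\<forall>i<n. integral\<^sup>L P (\<lambda>\<omega>. z \<omega> $ i) = 0) \<and>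
     (\<forall>i<n. \<forall>j<n. integral\<^sup>L P (\<lambda>\<omega>. cnj (z \<omega> $ i) * z \<omega> $ j) = C $$ (i, j))"


section \<open>Constellations\<close>

definition amplitudes :: "real \<Rightarrow> real \<Rightarrow> real set" where
  "amplitudes \<delta> L = {\<delta> * (2 * real i - 1 - L) | i::nat. 1 \<le> i \<and> real i \<le> L}"

definition pam :: "nat \<Rightarrow> complex set" where
  "pam M = complex_of_real ` amplitudes (sqrt (3 / ((real M)\<^sup>2 - 1))) (real M)"

definition psk :: "nat \<Rightarrow> complex set" where
  "psk M = (\<lambda>i. cis (2 * pi * real i / real M)) ` {..<M}"

definition square_qam :: "nat \<Rightarrow> complex set" where
  "square_qam M =
     (let A = amplitudes (sqrt (3 / (2 * (real M - 1)))) (sqrt (real M))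
      in {Complex a b | a b. a \<in> A \<and> b \<in> A})"


section \<open>System model, detector and symbol error probability\<close>

text \<open>The symbols are uniform up to null sets: with probability one they lie in \<open>S\<close>.
  Independence of \<open>H\<close>, \<open>s\<close> and \<open>\<xi>\<close> is stated as factorization of the joint law, since
  \<open>indep_vars\<close> requires a common value type.\<close>

locale mimo_system = prob_space P for P :: "'a measure" +
  fixes nr nt :: nat
    and \<Sigma> :: "complex Matrix.mat"
    and \<sigma>2 :: real
    and S :: "complex set"
    and H :: "'a \<Rightarrow> complex Matrix.mat"
    and s \<xi> :: "'a \<Rightarrow> complex Matrix.vec"
  assumes H_measurable: "H \<in> measurable P (mat_borel nr nt)"
    and H_rows_indep: "indep_vars (\<lambda>_. vec_borel nt) (\<lambda>m \<omega>. Matrix.row (H \<omega>) m) {..<nr}"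
    and H_rows_law: "\<And>m. m < nr \<Longrightarrow> zero_mean_cscg P nt \<Sigma> (\<lambda>\<omega>. Matrix.row (H \<omega>) m)"
    and noise_law: "zero_mean_cscg P nr (complex_of_real \<sigma>2 \<cdot>\<^sub>m 1\<^sub>m nr) \<xi>"
    and s_measurable: "s \<in> measurable P (vec_borel nt)"
    and s_indep: "indep_vars (\<lambda>_. borel) (\<lambda>k \<omega>. s \<omega> $ k) {..<nt}"
    and s_uniform:
      "\<And>k x. k < nt \<Longrightarrow> x \<in> S \<Longrightarrow> \<P>(\<omega> in P. s \<omega> $ k = x) = 1 / real (card S)"
    and indep:
      "distr P (mat_borel nr nt \<Otimes>\<^sub>M (vec_borel nt \<Otimes>\<^sub>M vec_borel nr)) (\<lambda>\<omega>. (H \<omega>, s \<omega>, \<xi> \<omega>)) =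
       distr P (mat_borel nr nt) H \<Otimes>\<^sub>M (distr P (vec_borel nt) s \<Otimes>\<^sub>M distr P (vec_borel nr) \<xi>)"

text \<open>The zero matrix returned for a rank-deficient \<open>G\<close> is an arbitrary choice; for
  \<open>G = HF\<close> this case has probability zero.\<close>

definition left_pinv :: "complex Matrix.mat \<Rightarrow> complex Matrix.mat" where
  "left_pinv G =
     (case mat_inverse (mat_adjoint G * G) of
        Some B \<Rightarrow> B * mat_adjoint G
      | None \<Rightarrow> 0\<^sub>m (dim_col G) (dim_row G))"

definition received ::
  "complex Matrix.mat \<Rightarrow> complex Matrix.mat \<Rightarrow> complex Matrix.vec \<Rightarrow> complex Matrix.vec \<Rightarrow> complex Matrix.vec"
  where "received H F s \<xi> = (H * F) *\<^sub>v s + \<xi>"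

definition zf_decision ::
  "complex set \<Rightarrow> complex Matrix.mat \<Rightarrow> complex Matrix.mat \<Rightarrow> complex Matrix.vec \<Rightarrow> nat \<Rightarrow> complex" where
  "zf_decision S H F r k =
     (let r' = left_pinv (H * F) *\<^sub>v r in arg_min_on (\<lambda>x. (cmod (r' $ k - x))\<^sup>2) S)"

definition avg_sep ::
  "'a measure \<Rightarrow> nat \<Rightarrow> complex set \<Rightarrow> ('a \<Rightarrow> complex Matrix.mat) \<Rightarrow> ('a \<Rightarrow> complex Matrix.vec) \<Rightarrow>
   ('a \<Rightarrow> complex Matrix.vec) \<Rightarrow> complex Matrix.mat \<Rightarrow> real" where
  "avg_sep P nt S H s \<xi> F =
     (\<Sum>k<nt. \<P>(\<omega> in P. zf_decision S (H \<omega>) F (received (H \<omega>) F (s \<omega>) (\<xi> \<omega>)) k \<noteq> s \<omega> $ k))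
       / real nt"


section \<open>Covariance matrix and precoder\<close>

definition kms :: "nat \<Rightarrow> complex \<Rightarrow> complex Matrix.mat" where
  "kms n \<rho> = Matrix.mat n n (\<lambda>(i, j). if i \<le> j then \<rho> ^ (j - i) else cnj (\<rho> ^ (i - j)))"

definition sorted_eigendecomposition ::
  "nat \<Rightarrow> complex Matrix.mat \<Rightarrow> complex Matrix.mat \<Rightarrow> (nat \<Rightarrow> real) \<Rightarrow> bool" where
  "sorted_eigendecomposition n A W l \<longleftrightarrow>
     W \<in> carrier_mat n n \<and> mat_adjoint W * W = 1\<^sub>m n \<and> W * mat_adjoint W = 1\<^sub>m n \<and>
     (\<forall>i j. i \<le> j \<longrightarrow> j < n \<longrightarrow> l i \<le> l j) \<and>
     A = W * mat_diag n (\<lambda>i. complex_of_real (l i)) * mat_adjoint W"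

definition dft :: "nat \<Rightarrow> complex Matrix.mat" where
  "dft n = Matrix.mat n n
     (\<lambda>(i, j). complex_of_real (1 / sqrt (real n)) * cis (- 2 * pi * real i * real j / real n))"

definition precoder :: "nat \<Rightarrow> complex Matrix.mat \<Rightarrow> (nat \<Rightarrow> real) \<Rightarrow> complex Matrix.mat" where
  "precoder n W l =
     complex_of_real (1 / sqrt (\<Sum>i<n. l i powr (-1/2))) \<cdot>\<^sub>m
       (W * mat_diag n (\<lambda>i. complex_of_real (l i powr (-1/4))) * dft n)"


section \<open>Special functions\<close>

definition Qfun :: "real \<Rightarrow> real" where
  "Qfun x = 1 / sqrt (2 * pi) * integral {x..} (\<lambda>t. exp (- t\<^sup>2 / 2))"

definition ellE :: "real \<Rightarrow> real" where
  "ellE k = integral {0..pi/2} (\<lambda>\<theta>. sqrt (1 - k\<^sup>2 * (sin \<theta>)\<^sup>2))"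

end

theory Submission
  imports Defs
begin

text \<open>Column \<open>k\<close> of \<open>HF\<close> has squared distance \<open>1 / |row k of (HF)\<^sup>+|\<^sup>2\<close> from the span of the other columns.
  Conditionally on those columns this distance is the squared norm of the projection of a circular Gaussian vector,
  whose covariance is \<open>1 / \<tau>\<close> times the identity, onto a space of dimension \<open>N\<^sub>r - N\<^sub>t + 1\<close>; here \<open>\<tau>\<close> is the \<open>k\<close>-th
  diagonal entry of \<open>(F\<^sup>H \<Sigma> F)\<^sup>-\<^sup>1\<close>.  For the given precoder the Fourier matrix makes this entry the same for all \<open>k\<close>, with
  \<open>\<tau> = (tr \<Lambda>\<^sup>-\<^sup>1\<^sup>/\<^sup>2)\<^sup>2 / N\<^sub>t\<close>.  By Chebyshev the post-detection noise variance concentrates, and the error probability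
  is a bounded continuous function of it.  The inverse of the Kac-Murdock-Szego matrix differs from a (twisted)
  circulant matrix by four corner entries, so \<open>tr \<Lambda>\<^sup>-\<^sup>1\<^sup>/\<^sup>2\<close> is a Riemann sum up to a bounded error, and the integral is
  elliptic of the second kind.\<close>

section \<open>Characteristic functions determine finite measures\<close>

text \<open>The Gaussian hypothesis \<open>zero_mean_cscg\<close> speaks of linear functionals,
  admits degenerate cases and offers no joint density. Every distributional fact, independence
  included, is therefore derived from characteristic functions, and a Cramer-Wold uniqueness
  statement for finite products carries the probabilistic part. The chi-square law of the projected
  vector is avoided as well: Chebyshev needs only its mean and variance, which come from fourth
  moments of linear forms. Origin of the constants: let \<open>m\<close> be the limit of the trace
  of \<open>\<Lambda>\<close> to the power -1/2, divided by the number of transmit antennas. The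
  projection dimension divided by \<open>\<tau>\<close> then tends to
  \<open>(\<beta> - 1) / m\<^sup>2\<close>, and the effective signal-to-noise ratio is
  \<open>\<eta> * (\<beta> - 1) / m\<^sup>2\<close>. The square root of
  \<open>1 - |\<rho>|\<^sup>2\<close>, from the normalisation of the inverse covariance, and the
  factor \<open>1 + |\<rho>|\<close>, taken out of the elliptic integral, combine in
  \<open>m\<^sup>2\<close> to the quotient of \<open>1 + |\<rho>|\<close> and
  \<open>1 - |\<rho>|\<close>.\<close>

definition determines :: "'a measure \<Rightarrow> ('a \<Rightarrow> real) set \<Rightarrow> bool" where
  "determines N \<Theta> \<longleftrightarrow> \<Theta> \<subseteq> borel_measurable N \<and>
     (\<forall>\<mu> \<nu>. finite_measure \<mu> \<longrightarrow> finite_measure \<nu> \<longrightarrow> sets \<mu> = sets N \<longrightarrow> sets \<nu> = sets N \<longrightarrow>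
        (\<forall>\<theta>\<in>\<Theta>. (\<integral>x. iexp (\<theta> x) \<partial>\<mu>) = (\<integral>x. iexp (\<theta> x) \<partial>\<nu>)) \<longrightarrow> \<mu> = \<nu>)"

lemma determinesD:
  assumes "determines N \<Theta>" "finite_measure \<mu>" "finite_measure \<nu>" "sets \<mu> = sets N" "sets \<nu> = sets N"
    and "\<And>\<theta>. \<theta> \<in> \<Theta> \<Longrightarrow> (\<integral>x. iexp (\<theta> x) \<partial>\<mu>) = (\<integral>x. iexp (\<theta> x) \<partial>\<nu>)"
  shows "\<mu> = \<nu>"
  using assms unfolding determines_def by blast

lemma determines_measurable: "determines N \<Theta> \<Longrightarrow> \<theta> \<in> \<Theta> \<Longrightarrow> \<theta> \<in> borel_measurable N"
  unfolding determines_def by blast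

lemma (in finite_measure) integrable_iexp:
  assumes [measurable]: "f \<in> borel_measurable M"
  shows "integrable M (\<lambda>x. iexp (f x))"
  by (rule integrable_const_bound[where B=1]) auto

lemma finite_measure_weighted:
  fixes g :: "'a \<Rightarrow> real"
  assumes "finite_measure \<mu>" "g \<in> borel_measurable \<mu>" "\<And>x. 0 \<le> g x" "\<And>x. g x \<le> B" "f \<in> measurable \<mu> N"
  shows "finite_measure (distr (density \<mu> (\<lambda>x. ennreal (g x))) N f)"
proof (rule finite_measure.finite_measure_distr)
  interpret finite_measure \<mu> by fact
  show "f \<in> measurable (density \<mu> (\<lambda>x. ennreal (g x))) N" using assms(5) by simp
  have "integrable \<mu> g"
    by (rule integrable_const_bound[where B=B]) (use assms in auto)
  then have "(\<integral>\<^sup>+x. ennreal (g x) \<partial>\<mu>) < \<infinity>"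
    using assms(3) by (simp add: nn_integral_eq_integral)
  then show "finite_measure (density \<mu> (\<lambda>x. ennreal (g x)))"
    using assms(2) by (intro finite_measureI) (simp add: emeasure_density cong: nn_integral_cong)
qed

text \<open>The two sides of \<open>eq\<close> are characteristic functions of the images, under
  \<open>f\<close> and \<open>f'\<close>, of the measures with densities \<open>g\<close> and
  \<open>g'\<close>. Boundedness of the weights makes these images finite, so
  \<open>determines\<close> applies to them.\<close>

lemma weighted_law_eq:
  fixes g :: "'a \<Rightarrow> real" and g' :: "'c \<Rightarrow> real"
  assumes det: "determines N \<Theta>"
    and fin: "finite_measure \<mu>" "finite_measure \<nu>"
    and gm[measurable]: "g \<in> borel_measurable \<mu>" "g' \<in> borel_measurable \<nu>"
    and g: "\<And>x. 0 \<le> g x" "\<And>x. 0 \<le> g' x" "\<And>x. g x \<le> B" "\<And>x. g' x \<le> B"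
    and f[measurable]: "f \<in> measurable \<mu> N" "f' \<in> measurable \<nu> N"
    and eq: "\<And>\<theta>. \<theta> \<in> \<Theta> \<Longrightarrow>
      (\<integral>x. g x *\<^sub>R iexp (\<theta> (f x)) \<partial>\<mu>) = (\<integral>x. g' x *\<^sub>R iexp (\<theta> (f' x)) \<partial>\<nu>)"
    and A: "A \<in> sets N"
  shows "(\<integral>x. g x * indicator A (f x) \<partial>\<mu>) = (\<integral>x. g' x * indicator A (f' x) \<partial>\<nu>)"
proof -
  define m where "m = distr (density \<mu> (\<lambda>x. ennreal (g x))) N f"
  define m' where "m' = distr (density \<nu> (\<lambda>x. ennreal (g' x))) N f'"
  have "m = m'"
  proof (rule determinesD[OF det])
    show "finite_measure m" "finite_measure m'"
      unfolding m_def m'_def by (rule finite_measure_weighted[where B=B]; use fin gm g f in blast)+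
    show "sets m = sets N" "sets m' = sets N" by (auto simp: m_def m'_def)
    fix \<theta> assume t: "\<theta> \<in> \<Theta>"
    note [measurable] = determines_measurable[OF det t]
    show "(\<integral>x. iexp (\<theta> x) \<partial>m) = (\<integral>x. iexp (\<theta> x) \<partial>m')"
      unfolding m_def m'_def using eq[OF t] g
      by (simp add: integral_distr integral_density)
  qed
  moreover have "(\<integral>x. indicator A x \<partial>m) = (\<integral>x. g x * indicator A (f x) \<partial>\<mu>)"
    unfolding m_def using A g by (subst integral_distr) (auto simp: integral_density)
  moreover have "(\<integral>x. indicator A x \<partial>m') = (\<integral>x. g' x * indicator A (f' x) \<partial>\<nu>)"
    unfolding m'_def using A g by (subst integral_distr) (auto simp: integral_density)
  ultimately show ?thesis by metis
qed

lemma integral_indicator_real: "A \<in> sets m \<Longrightarrow> (\<integral>p. indicator A p \<partial>m) = measure m A"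
  by (simp add: sets.Int_space_eq2)

text \<open>One coordinate is handled at a time, the other acting as a weight. The complex factor
  \<open>iexp (\<theta>2 y)\<close> is not a density, so it is replaced by the nonnegative weights
  \<open>1 + cos\<close> and \<open>1 + sin\<close>. Euler's formulas express these through the
  functionals \<open>0\<close>, \<open>\<theta>2\<close> and \<open>- \<theta>2\<close>, which
  explains the two closure assumptions. Uniqueness on \<open>N1\<close> then yields indicators of
  sets \<open>A\<close>, and uniqueness on \<open>N2\<close>, with that indicator as weight, yields
  rectangles.\<close>

lemma determines_pair:
  assumes d1: "determines N1 \<Theta>1" and d2: "determines N2 \<Theta>2"
    and zero: "(\<lambda>_. 0) \<in> \<Theta>2" and minus: "\<And>\<theta>. \<theta> \<in> \<Theta>2 \<Longrightarrow> (\<lambda>x. - \<theta> x) \<in> \<Theta>2"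
  shows "determines (N1 \<Otimes>\<^sub>M N2) {\<lambda>(x, y). \<theta>1 x + \<theta>2 y | \<theta>1 \<theta>2. \<theta>1 \<in> \<Theta>1 \<and> \<theta>2 \<in> \<Theta>2}"
    (is "determines ?N ?\<Theta>")
  unfolding determines_def
proof (intro conjI allI impI)
  show "?\<Theta> \<subseteq> borel_measurable (N1 \<Otimes>\<^sub>M N2)"
  proof (clarify)
    fix \<theta>1 \<theta>2 assume "\<theta>1 \<in> \<Theta>1" "\<theta>2 \<in> \<Theta>2"
    then have [measurable]: "\<theta>1 \<in> borel_measurable N1" "\<theta>2 \<in> borel_measurable N2"
      using d1 d2 determines_measurable by blast+
    show "(\<lambda>(x, y). \<theta>1 x + \<theta>2 y) \<in> borel_measurable (N1 \<Otimes>\<^sub>M N2)" by measurable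
  qed
  fix \<mu> \<nu> :: "('a \<times> 'b) measure"
  assume fin: "finite_measure \<mu>" "finite_measure \<nu>"
    and sets[measurable_cong]: "sets \<mu> = sets ?N" "sets \<nu> = sets ?N"
    and "\<forall>\<theta>\<in>?\<Theta>. (\<integral>x. iexp (\<theta> x) \<partial>\<mu>) = (\<integral>x. iexp (\<theta> x) \<partial>\<nu>)"
  then have eq: "(\<integral>p. iexp (\<theta>1 (fst p) + \<theta>2 (snd p)) \<partial>\<mu>) = (\<integral>p. iexp (\<theta>1 (fst p) + \<theta>2 (snd p)) \<partial>\<nu>)"
    if "\<theta>1 \<in> \<Theta>1" "\<theta>2 \<in> \<Theta>2" for \<theta>1 \<theta>2
    using that by (fastforce simp: case_prod_beta)
  have dec: "(\<integral>p. (1 + cos (\<theta>2 (snd p))) *\<^sub>R iexp (\<theta>1 (fst p)) \<partial>m) =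
      (\<integral>p. iexp (\<theta>1 (fst p) + 0) \<partial>m) + (1/2) * (\<integral>p. iexp (\<theta>1 (fst p) + \<theta>2 (snd p)) \<partial>m)
       + (1/2) * (\<integral>p. iexp (\<theta>1 (fst p) + - \<theta>2 (snd p)) \<partial>m)"
    and des: "(\<integral>p. (1 + sin (\<theta>2 (snd p))) *\<^sub>R iexp (\<theta>1 (fst p)) \<partial>m) =
      (\<integral>p. iexp (\<theta>1 (fst p) + 0) \<partial>m) + (1/(2*\<i>)) * (\<integral>p. iexp (\<theta>1 (fst p) + \<theta>2 (snd p)) \<partial>m)
       - (1/(2*\<i>)) * (\<integral>p. iexp (\<theta>1 (fst p) + - \<theta>2 (snd p)) \<partial>m)"
    if t: "\<theta>1 \<in> \<Theta>1" "\<theta>2 \<in> \<Theta>2" and m: "finite_measure m" "sets m = sets ?N" for \<theta>1 \<theta>2 m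
  proof -
    interpret finite_measure m by fact
    note [measurable] = determines_measurable[OF d1 t(1)] determines_measurable[OF d2 t(2)]
    note [measurable_cong] = m(2)
    have i: "integrable m (\<lambda>p. iexp (\<theta>1 (fst p) + 0))"
       "integrable m (\<lambda>p. iexp (\<theta>1 (fst p) + \<theta>2 (snd p)))"
       "integrable m (\<lambda>p. iexp (\<theta>1 (fst p) + - \<theta>2 (snd p)))"
      by (rule integrable_iexp; measurable)+
    have c: "(1 + cos y) *\<^sub>R iexp x = iexp (x+0) + (1/2) * iexp (x+y) + (1/2) * iexp (x + - y)" for x y
      by (simp add: exp_eq_polar complex_eq_iff cos_add sin_add cos_diff sin_diff field_simps)
    have s: "(1 + sin y) *\<^sub>R iexp x = iexp (x+0) + (1/(2*\<i>)) * iexp (x+y) - (1/(2*\<i>)) * iexp (x + - y)" for x y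
      by (simp add: exp_eq_polar complex_eq_iff cos_add sin_add cos_diff sin_diff field_simps Re_divide Im_divide power2_eq_square)
    show "(\<integral>p. (1 + cos (\<theta>2 (snd p))) *\<^sub>R iexp (\<theta>1 (fst p)) \<partial>m) =
      (\<integral>p. iexp (\<theta>1 (fst p) + 0) \<partial>m) + (1/2) * (\<integral>p. iexp (\<theta>1 (fst p) + \<theta>2 (snd p)) \<partial>m)
       + (1/2) * (\<integral>p. iexp (\<theta>1 (fst p) + - \<theta>2 (snd p)) \<partial>m)"
      unfolding c using i by simp
    show "(\<integral>p. (1 + sin (\<theta>2 (snd p))) *\<^sub>R iexp (\<theta>1 (fst p)) \<partial>m) =
      (\<integral>p. iexp (\<theta>1 (fst p) + 0) \<partial>m) + (1/(2*\<i>)) * (\<integral>p. iexp (\<theta>1 (fst p) + \<theta>2 (snd p)) \<partial>m)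
       - (1/(2*\<i>)) * (\<integral>p. iexp (\<theta>1 (fst p) + - \<theta>2 (snd p)) \<partial>m)"
      unfolding s using i by (subst Bochner_Integration.integral_diff) auto
  qed
  have cs: "(\<integral>p. (1 + cos (\<theta>2 (snd p))) * indicator A (fst p) \<partial>\<mu>) = (\<integral>p. (1 + cos (\<theta>2 (snd p))) * indicator A (fst p) \<partial>\<nu>)"
     "(\<integral>p. (1 + sin (\<theta>2 (snd p))) * indicator A (fst p) \<partial>\<mu>) = (\<integral>p. (1 + sin (\<theta>2 (snd p))) * indicator A (fst p) \<partial>\<nu>)"
    if t2: "\<theta>2 \<in> \<Theta>2" and A: "A \<in> sets N1" for \<theta>2 A
  proof -
    note [measurable] = determines_measurable[OF d2 t2]
    have b: "0 \<le> 1 + cos x" "0 \<le> 1 + sin x" "1 + cos x \<le> 2" "1 + sin x \<le> 2" for x :: real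
      using cos_ge_minus_one[of x] sin_ge_minus_one[of x] cos_le_one[of x] sin_le_one[of x] by linarith+
    have e: "(\<integral>p. iexp (\<theta>1 (fst p) + 0) \<partial>\<mu>) = (\<integral>p. iexp (\<theta>1 (fst p) + 0) \<partial>\<nu>)"
      "(\<integral>p. iexp (\<theta>1 (fst p) + \<theta>2 (snd p)) \<partial>\<mu>) = (\<integral>p. iexp (\<theta>1 (fst p) + \<theta>2 (snd p)) \<partial>\<nu>)"
      "(\<integral>p. iexp (\<theta>1 (fst p) + - \<theta>2 (snd p)) \<partial>\<mu>) = (\<integral>p. iexp (\<theta>1 (fst p) + - \<theta>2 (snd p)) \<partial>\<nu>)"
      if "\<theta>1 \<in> \<Theta>1" for \<theta>1
      using eq[OF that zero] eq[OF that t2] eq[OF that minus[OF t2]] by simp_all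
    show "(\<integral>p. (1 + cos (\<theta>2 (snd p))) * indicator A (fst p) \<partial>\<mu>) = (\<integral>p. (1 + cos (\<theta>2 (snd p))) * indicator A (fst p) \<partial>\<nu>)"
    proof (rule weighted_law_eq[OF d1 fin, where B=2])
      fix \<theta> assume t: "\<theta> \<in> \<Theta>1"
      show "(\<integral>p. (1 + cos (\<theta>2 (snd p))) *\<^sub>R iexp (\<theta> (fst p)) \<partial>\<mu>) = (\<integral>p. (1 + cos (\<theta>2 (snd p))) *\<^sub>R iexp (\<theta> (fst p)) \<partial>\<nu>)"
        unfolding dec[OF t t2 fin(1) sets(1)] dec[OF t t2 fin(2) sets(2)] e[OF t] ..
    qed (use b A in auto)
    show "(\<integral>p. (1 + sin (\<theta>2 (snd p))) * indicator A (fst p) \<partial>\<mu>) = (\<integral>p. (1 + sin (\<theta>2 (snd p))) * indicator A (fst p) \<partial>\<nu>)"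
    proof (rule weighted_law_eq[OF d1 fin, where B=2])
      fix \<theta> assume t: "\<theta> \<in> \<Theta>1"
      show "(\<integral>p. (1 + sin (\<theta>2 (snd p))) *\<^sub>R iexp (\<theta> (fst p)) \<partial>\<mu>) = (\<integral>p. (1 + sin (\<theta>2 (snd p))) *\<^sub>R iexp (\<theta> (fst p)) \<partial>\<nu>)"
        unfolding des[OF t t2 fin(1) sets(1)] des[OF t t2 fin(2) sets(2)] e[OF t] ..
    qed (use b A in auto)
  qed
  \<comment> \<open>The mass of \<open>A\<close> is subtracted again to return from the positive
    weights to the complex exponential. That mass is itself controlled by \<open>cs\<close>, since
    the functional \<open>0\<close> has weight \<open>1 + cos 0 = 2\<close>.\<close>
  have expand: "(\<integral>p. indicator A (fst p) *\<^sub>R iexp (\<theta>2 (snd p)) \<partial>m) =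
      complex_of_real ((\<integral>p. (1 + cos (\<theta>2 (snd p))) * indicator A (fst p) \<partial>m) - (\<integral>p. indicator A (fst p) \<partial>m))
       + \<i> * complex_of_real ((\<integral>p. (1 + sin (\<theta>2 (snd p))) * indicator A (fst p) \<partial>m) - (\<integral>p. indicator A (fst p) \<partial>m))"
    if t2: "\<theta>2 \<in> \<Theta>2" and A[measurable]: "A \<in> sets N1" and m: "finite_measure m" "sets m = sets ?N" for \<theta>2 A m
  proof -
    interpret finite_measure m by fact
    note [measurable] = determines_measurable[OF d2 t2]
    note [measurable_cong] = m(2)
    have b: "\<bar>1 + cos x\<bar> \<le> 2" "\<bar>1 + sin x\<bar> \<le> 2" for x :: real
      using cos_ge_minus_one[of x] sin_ge_minus_one[of x] cos_le_one[of x] sin_le_one[of x] by linarith+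
    have i: "integrable m (\<lambda>p. (1 + cos (\<theta>2 (snd p))) * indicator A (fst p))"
       "integrable m (\<lambda>p. (1 + sin (\<theta>2 (snd p))) * indicator A (fst p))"
       "integrable m (\<lambda>p. indicator A (fst p) :: real)"
      by (rule integrable_const_bound[where B=2]; use b in \<open>auto simp: indicator_def\<close>)+
    have pt: "indicator A x *\<^sub>R iexp y = complex_of_real ((1 + cos y) * indicator A x - indicator A x)
       + \<i> * complex_of_real ((1 + sin y) * indicator A x - indicator A x)" for x y
      by (simp add: exp_eq_polar complex_eq_iff algebra_simps indicator_def)
    have key: "(\<integral>p. complex_of_real (u p) + \<i> * complex_of_real (v p) \<partial>m) =
        complex_of_real (\<integral>p. u p \<partial>m) + \<i> * complex_of_real (\<integral>p. v p \<partial>m)"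
      if "integrable m u" "integrable m v" for u v
      using that by (subst Bochner_Integration.integral_add) auto
    show ?thesis
      unfolding pt
      unfolding key[OF Bochner_Integration.integrable_diff[OF i(1) i(3)] Bochner_Integration.integrable_diff[OF i(2) i(3)]]
      unfolding Bochner_Integration.integral_diff[OF i(1) i(3)] Bochner_Integration.integral_diff[OF i(2) i(3)] ..
  qed
  have rect: "(\<integral>p. indicator A (fst p) * indicator B (snd p) \<partial>\<mu>) = (\<integral>p. indicator A (fst p) * indicator B (snd p) \<partial>\<nu> :: real)"
    if A[measurable]: "A \<in> sets N1" and B: "B \<in> sets N2" for A B
  proof (rule weighted_law_eq[OF d2 fin, where B=1])
    fix \<theta> assume t: "\<theta> \<in> \<Theta>2"
    have "(\<integral>p. indicator A (fst p) \<partial>\<mu>) = (\<integral>p. indicator A (fst p) \<partial>\<nu> :: real)"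
      using cs(1)[OF zero A] by simp
    then show "(\<integral>p. indicator A (fst p) *\<^sub>R iexp (\<theta> (snd p)) \<partial>\<mu>) = (\<integral>p. indicator A (fst p) *\<^sub>R iexp (\<theta> (snd p)) \<partial>\<nu>)"
      unfolding expand[OF t A fin(1) sets(1)] expand[OF t A fin(2) sets(2)] cs[OF t A] by simp
  qed (use B in auto)
  interpret M: finite_measure \<mu> by fact
  interpret N: finite_measure \<nu> by fact
  have sp: "space \<mu> = space N1 \<times> space N2" "space \<nu> = space N1 \<times> space N2"
    using sets_eq_imp_space_eq[OF sets(1)] sets_eq_imp_space_eq[OF sets(2)] by (auto simp: space_pair_measure)
  show "\<mu> = \<nu>"
  proof (rule measure_eqI_generator_eq[OF Int_stable_pair_measure_generator, where A="\<lambda>_. space N1 \<times> space N2" and \<Omega>="space N1 \<times> space N2"])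
    show "{a \<times> b |a b. a \<in> sets N1 \<and> b \<in> sets N2} \<subseteq> Pow (space N1 \<times> space N2)"
      by (rule pair_measure_closed)
    fix X assume "X \<in> {a \<times> b |a b. a \<in> sets N1 \<and> b \<in> sets N2}"
    then obtain a b where X: "X = a \<times> b" and ab[measurable]: "a \<in> sets N1" "b \<in> sets N2" by auto
    have Xs: "X \<in> sets ?N" unfolding X by simp
    have ind: "indicator a (fst p) * indicator b (snd p) = (indicator X p :: real)" for p
      by (cases p) (auto simp: X indicator_def)
    have "measure \<mu> X = measure \<nu> X"
    proof -
      have "X \<in> sets \<mu>" "X \<in> sets \<nu>" using Xs sets by simp_all
      then show ?thesis using rect[OF ab] unfolding ind by (simp only: integral_indicator_real)
    qed
    then show "emeasure \<mu> X = emeasure \<nu> X"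
      by (simp add: M.emeasure_eq_measure N.emeasure_eq_measure)
  next
    show "sets \<mu> = sigma_sets (space N1 \<times> space N2) {a \<times> b |a b. a \<in> sets N1 \<and> b \<in> sets N2}"
       "sets \<nu> = sigma_sets (space N1 \<times> space N2) {a \<times> b |a b. a \<in> sets N1 \<and> b \<in> sets N2}"
      using sets by (simp_all add: sets_pair_measure)
    show "range (\<lambda>_::nat. space N1 \<times> space N2) \<subseteq> {a \<times> b |a b. a \<in> sets N1 \<and> b \<in> sets N2}" by auto
    show "(\<Union>i::nat. space N1 \<times> space N2) = space N1 \<times> space N2" by simp
    show "emeasure \<mu> (space N1 \<times> space N2) \<noteq> \<infinity>" for i :: nat by simp
  qed
qed

lemma determines_mono:
  assumes "determines N \<Theta>" "\<Theta> \<subseteq> \<Theta>'" "\<Theta>' \<subseteq> borel_measurable N"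
  shows "determines N \<Theta>'"
  using assms unfolding determines_def by blast

text \<open>A measure on \<open>N'\<close> is recovered as the image under \<open>h\<close> of its
  image under \<open>f\<close>, and that image is determined on \<open>N\<close>.\<close>

lemma determines_transport:
  assumes det: "determines N \<Theta>" and f[measurable]: "f \<in> measurable N' N" and h[measurable]: "h \<in> measurable N N'"
    and inv: "\<And>x. x \<in> space N' \<Longrightarrow> h (f x) = x"
  shows "determines N' ((\<lambda>\<theta> x. \<theta> (f x)) ` \<Theta>)"
  unfolding determines_def
proof (intro conjI allI impI)
  show "(\<lambda>\<theta> x. \<theta> (f x)) ` \<Theta> \<subseteq> borel_measurable N'"
    using measurable_compose[OF f determines_measurable[OF det]] by blast
  fix \<mu> \<nu> assume fin: "finite_measure \<mu>" "finite_measure \<nu>"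
    and s[measurable_cong]: "sets \<mu> = sets N'" "sets \<nu> = sets N'"
    and eq: "\<forall>\<theta>\<in>(\<lambda>\<theta> x. \<theta> (f x)) ` \<Theta>. (\<integral>x. iexp (\<theta> x) \<partial>\<mu>) = (\<integral>x. iexp (\<theta> x) \<partial>\<nu>)"
  have "distr \<mu> N f = distr \<nu> N f"
  proof (rule determinesD[OF det])
    show "finite_measure (distr \<mu> N f)" "finite_measure (distr \<nu> N f)"
      using fin by (auto intro!: finite_measure.finite_measure_distr)
    fix \<theta> assume t: "\<theta> \<in> \<Theta>"
    note [measurable] = determines_measurable[OF det t]
    show "(\<integral>x. iexp (\<theta> x) \<partial>distr \<mu> N f) = (\<integral>x. iexp (\<theta> x) \<partial>distr \<nu> N f)"
      using eq t by (simp add: integral_distr)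
  qed auto
  then have "distr (distr \<mu> N f) N' h = distr (distr \<nu> N f) N' h" by simp
  moreover have "distr (distr m N f) N' h = m" if m[measurable_cong]: "sets m = sets N'" for m
  proof -
    have "distr (distr m N f) N' h = distr m N' (h \<circ> f)" by (rule distr_distr) auto
    also have "\<dots> = distr m m (\<lambda>x. x)"
      using inv sets_eq_imp_space_eq[OF m] by (intro distr_cong) (auto simp: m)
    finally show ?thesis by simp
  qed
  ultimately show "\<mu> = \<nu>" using s by simp
qed

lemma finite_measure_zero_eq:
  assumes "finite_measure \<mu>" "measure \<mu> (space \<mu>) = 0" "sets \<mu> = sets N"
  shows "\<mu> = null_measure N"
proof (rule measure_eqI)
  interpret finite_measure \<mu> by fact
  fix A assume A: "A \<in> sets \<mu>"
  have "emeasure \<mu> A \<le> emeasure \<mu> (space \<mu>)" by (rule emeasure_space)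
  also have "\<dots> = 0" using assms(2) by (simp add: emeasure_eq_measure)
  finally show "emeasure \<mu> A = emeasure (null_measure N) A" by simp
qed (use assms in simp)

text \<open>Levy's uniqueness theorem concerns probability measures, so both measures are divided by
  their common mass \<open>c\<close>, the value of the characteristic function at 0. Mass zero has
  to be treated apart.\<close>

lemma determines_real: "determines (borel :: real measure) (range (\<lambda>t x. t * x))"
  unfolding determines_def
proof (intro conjI allI impI)
  show "range (\<lambda>t x. t * x) \<subseteq> borel_measurable (borel :: real measure)" by auto
  fix \<mu> \<nu> :: "real measure" assume fin: "finite_measure \<mu>" "finite_measure \<nu>"
    and s: "sets \<mu> = sets borel" "sets \<nu> = sets borel"
    and eq': "\<forall>\<theta>\<in>range (\<lambda>t x. t * x). (\<integral>x. iexp (\<theta> x) \<partial>\<mu>) = (\<integral>x. iexp (\<theta> x) \<partial>\<nu>)"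
  have eq: "(\<integral>x. iexp (t * x) \<partial>\<mu>) = (\<integral>x. iexp (t * x) \<partial>\<nu>)" for t using eq' by blast
  define c where "c = measure \<mu> (space \<mu>)"
  have c': "measure \<nu> (space \<nu>) = c" using eq[of 0] by (simp add: c_def)
  note sm = s[measurable_cong]
  show "\<mu> = \<nu>"
  proof (cases "c = 0")
    case True
    then show ?thesis using finite_measure_zero_eq[OF fin(1) _ s(1)] finite_measure_zero_eq[OF fin(2) _ s(2)] c' c_def by metis
  next
    case False
    then have c: "0 < c" using measure_nonneg[of \<mu> "space \<mu>"] unfolding c_def by linarith
    have rd: "real_distribution (density m (\<lambda>_. ennreal (1/c)))" "char (density m (\<lambda>_. ennreal (1/c))) = (\<lambda>t. (\<integral>x. iexp (t * x) \<partial>m) / c)"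
      "density (density m (\<lambda>_. ennreal (1/c))) (\<lambda>_. ennreal c) = m"
      if m: "finite_measure m" "sets m = sets borel" "measure m (space m) = c" for m
    proof -
      interpret finite_measure m by fact
      note [measurable_cong] = m(2)
      have "prob_space (density m (\<lambda>_. ennreal (1/c)))"
        using c m(3) by (intro prob_spaceI) (simp add: emeasure_density emeasure_eq_measure ennreal_mult'[symmetric])
      then show "real_distribution (density m (\<lambda>_. ennreal (1/c)))"
        using m(2) sets_eq_imp_space_eq[OF m(2)] by (simp add: real_distribution_def real_distribution_axioms_def)
      show "char (density m (\<lambda>_. ennreal (1/c))) = (\<lambda>t. (\<integral>x. iexp (t * x) \<partial>m) / c)"
        using c by (simp add: char_def integral_density scaleR_conv_of_real fun_eq_iff divide_inverse mult.commute)
      show "density (density m (\<lambda>_. ennreal (1/c))) (\<lambda>_. ennreal c) = m"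
        using c by (simp add: density_density_eq ennreal_mult'[symmetric] density_1)
    qed
    have "density \<mu> (\<lambda>_. ennreal (1/c)) = density \<nu> (\<lambda>_. ennreal (1/c))"
      using rd[OF fin(1) s(1)] rd[OF fin(2) s(2)] c' c_def eq by (intro Levy_uniqueness) auto
    then show ?thesis using rd(3)[OF fin(1) s(1)] rd(3)[OF fin(2) s(2)] c' c_def by metis
  qed
qed

text \<open>The plane is a product of two lines, and \<open>a * Re z + b * Im z\<close> equals
  \<open>Re (c * z)\<close> for \<open>c = Complex a (-b)\<close>.\<close>

lemma determines_complex: "determines (borel :: complex measure) (range (\<lambda>c z. Re (c * z)))"
proof -
  have "determines (borel \<Otimes>\<^sub>M borel) {\<lambda>(x::real, y::real). \<theta>1 x + \<theta>2 y | \<theta>1 \<theta>2. \<theta>1 \<in> range (\<lambda>t x. t * x) \<and> \<theta>2 \<in> range (\<lambda>t x. t * x)}"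
  proof (rule determines_pair[OF determines_real determines_real])
    show "(\<lambda>_. 0) \<in> range (\<lambda>t x::real. t * x)" by (rule range_eqI[of _ _ 0]) auto
    fix \<theta> assume "\<theta> \<in> range (\<lambda>t x::real. t * x)"
    then obtain t where "\<theta> = (\<lambda>x. t * x)" by auto
    then show "(\<lambda>x. - \<theta> x) \<in> range (\<lambda>t x. t * x)" by (intro range_eqI[of _ _ "-t"]) auto
  qed
  from determines_transport[OF this, of "\<lambda>z. (Re z, Im z)" borel "\<lambda>(a, b). Complex a b"]
  have "determines (borel :: complex measure) ((\<lambda>\<theta> x. \<theta> (Re x, Im x)) ` {\<lambda>(x::real, y::real). \<theta>1 x + \<theta>2 y | \<theta>1 \<theta>2. \<theta>1 \<in> range (\<lambda>t x. t * x) \<and> \<theta>2 \<in> range (\<lambda>t x. t * x)})"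
    by (simp add: complex_eq_iff Complex_eq)
  then show ?thesis
  proof (rule determines_mono)
    show "((\<lambda>\<theta> x. \<theta> (Re x, Im x)) ` {\<lambda>(x::real, y::real). \<theta>1 x + \<theta>2 y | \<theta>1 \<theta>2. \<theta>1 \<in> range (\<lambda>t x. t * x) \<and> \<theta>2 \<in> range (\<lambda>t x. t * x)}) \<subseteq> range (\<lambda>c z. Re (c * z))"
      (is "?L \<subseteq> _")
    proof
      fix \<phi> assume "\<phi> \<in> ?L"
      then obtain a b where "\<phi> = (\<lambda>x. a * Re x + b * Im x)" by auto
      then show "\<phi> \<in> range (\<lambda>c z. Re (c * z))"
        by (intro range_eqI[of _ _ "Complex a (-b)"]) auto
    qed
  qed auto
qed

text \<open>Induction over the index set, splitting off one factor. The empty product is a one-point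
  space, where the total mass decides.\<close>

lemma determines_PiM:
  assumes "finite I"
  shows "determines (PiM I (\<lambda>_. borel :: complex measure)) (range (\<lambda>c x. \<Sum>i\<in>I. Re (c i * x i)))"
  using assms
proof (induction I)
  case empty
  show ?case unfolding determines_def
  proof (intro conjI allI impI)
    fix \<mu> \<nu> :: "('a \<Rightarrow> complex) measure"
    assume fin: "finite_measure \<mu>" "finite_measure \<nu>"
      and s: "sets \<mu> = sets (PiM {} (\<lambda>_. borel))" "sets \<nu> = sets (PiM {} (\<lambda>_. borel))"
      and eq: "\<forall>\<theta>\<in>range (\<lambda>c x. \<Sum>i\<in>{}. Re (c i * x i)). (\<integral>x. iexp (\<theta> x) \<partial>\<mu>) = (\<integral>x. iexp (\<theta> x) \<partial>\<nu>)"
    have sp: "space \<mu> = {\<lambda>_. undefined}" "space \<nu> = {\<lambda>_. undefined}"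
      using s[THEN sets_eq_imp_space_eq] by (auto simp: space_PiM_empty)
    have m: "measure \<mu> (space \<mu>) = measure \<nu> (space \<nu>)" using eq by simp
    show "\<mu> = \<nu>"
    proof (rule measure_eqI)
      fix A assume "A \<in> sets \<mu>"
      then have "A = {} \<or> A = space \<mu>" using sets.sets_into_space[of A \<mu>] unfolding sp by auto
      then show "emeasure \<mu> A = emeasure \<nu> A"
        using m sp finite_measure.emeasure_eq_measure[OF fin(1)] finite_measure.emeasure_eq_measure[OF fin(2)] by auto
    qed (use s in simp)
  qed auto
next
  case (insert i I)
  let ?T = "\<lambda>I::'a set. range (\<lambda>c x. \<Sum>i\<in>I. Re (c i * x i))"
  let ?P = "{\<lambda>(x, y). \<theta>1 x + \<theta>2 y | \<theta>1 \<theta>2. \<theta>1 \<in> range (\<lambda>c z. Re (c * z)) \<and> \<theta>2 \<in> ?T I}"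
  have 1: "determines (borel \<Otimes>\<^sub>M PiM I (\<lambda>_. borel)) ?P"
  proof (rule determines_pair[OF determines_complex insert.IH])
    show "(\<lambda>_. 0) \<in> ?T I" by (rule range_eqI[of _ _ "\<lambda>_. 0"]) auto
    fix \<theta> assume "\<theta> \<in> ?T I"
    then obtain t where "\<theta> = (\<lambda>x. \<Sum>i\<in>I. Re (t i * x i))" by auto
    then show "(\<lambda>x. - \<theta> x) \<in> ?T I" by (intro range_eqI[of _ _ "\<lambda>i. - t i"]) (auto simp: fun_eq_iff simp flip: sum_negf)
  qed
  have "determines (PiM (insert i I) (\<lambda>_. borel)) ((\<lambda>\<theta> x. \<theta> (x i, restrict x I)) ` ?P)"
  proof (rule determines_transport[OF 1])
    show "(\<lambda>x. (x i, restrict x I)) \<in> measurable (PiM (insert i I) (\<lambda>_. borel)) (borel \<Otimes>\<^sub>M PiM I (\<lambda>_. borel))"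
      by (intro measurable_Pair measurable_component_singleton measurable_restrict_subset) auto
    show "(\<lambda>p. (snd p)(i := fst p)) \<in> measurable (borel \<Otimes>\<^sub>M PiM I (\<lambda>_. borel)) (PiM (insert i I) (\<lambda>_. borel :: complex measure))"
      by measurable
    fix x assume "x \<in> space (PiM (insert i I) (\<lambda>_. borel :: complex measure))"
    then show "(snd (x i, restrict x I))(i := fst (x i, restrict x I)) = x"
      using insert.hyps by (auto simp: space_PiM PiE_def extensional_def fun_eq_iff)
  qed
  then show ?case
  proof (rule determines_mono)
    show "(\<lambda>\<theta> x. \<theta> (x i, restrict x I)) ` ?P \<subseteq> ?T (insert i I)"
      (is "?L \<subseteq> _")
    proof
      fix \<phi> assume "\<phi> \<in> ?L"
      then obtain a t where \<phi>: "\<phi> = (\<lambda>x. Re (a * x i) + (\<Sum>j\<in>I. Re (t j * restrict x I j)))" by auto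
      have ne: "j \<noteq> i" if "j \<in> I" for j using that insert.hyps by auto
      show "\<phi> \<in> ?T (insert i I)"
        using insert.hyps unfolding \<phi> by (intro range_eqI[of _ _ "t(i := a)"]) (auto simp: fun_eq_iff ne intro!: sum.cong)
    qed
    show "?T (insert i I) \<subseteq> borel_measurable (PiM (insert i I) (\<lambda>_. borel))"
      by (auto intro!: borel_measurable_sum borel_measurable_Re[THEN measurable_compose[rotated]]
          measurable_compose[OF measurable_component_singleton])
  qed
qed

section \<open>Centred Gaussian laws on the line and in the plane\<close>

text \<open>An image of the standard normal law instead of a density, so that variance 0 is included
  as the point mass at 0.\<close>

definition gauss :: "real \<Rightarrow> real measure" where
  "gauss v = distr std_normal_distribution borel (\<lambda>x. sqrt v * x)"

text \<open>Here \<open>v\<close> is the variance of each real coordinate, so the squared modulus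
  has mean \<open>2 * v\<close>. This convention causes the divisions by 2 in the noise variances
  further on.\<close>

definition cgauss :: "real \<Rightarrow> complex measure" where
  "cgauss v = distr (std_normal_distribution \<Otimes>\<^sub>M std_normal_distribution) borel
     (\<lambda>(x, y). Complex (sqrt v * x) (sqrt v * y))"

lemma prob_space_std_normal: "prob_space std_normal_distribution"
  using prob_space_normal_density by simp

lemma real_distribution_gauss: "real_distribution (gauss v)"
proof -
  interpret prob_space std_normal_distribution by (rule prob_space_std_normal)
  show ?thesis unfolding gauss_def by (intro real_distribution_distr) simp
qed

lemma sets_gauss[simp, measurable_cong]: "sets (gauss v) = sets borel"
  and sets_cgauss[simp, measurable_cong]: "sets (cgauss v) = sets borel"
  and space_gauss[simp]: "space (gauss v) = UNIV"
  and space_cgauss[simp]: "space (cgauss v) = UNIV"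
  by (simp_all add: gauss_def cgauss_def)

lemma prob_space_gauss: "prob_space (gauss v)"
  using real_distribution_gauss by (simp add: real_distribution_def)

lemma measurable_Complex[measurable]:
  assumes [measurable]: "f \<in> borel_measurable M" "g \<in> borel_measurable M"
  shows "(\<lambda>x. Complex (f x) (g x)) \<in> borel_measurable M"
  unfolding Complex_eq by measurable

lemma prob_space_cgauss: "prob_space (cgauss v)"
proof -
  interpret prob_space std_normal_distribution by (rule prob_space_std_normal)
  interpret pair_prob_space std_normal_distribution std_normal_distribution ..
  show ?thesis unfolding cgauss_def by (intro P.prob_space_distr) measurable
qed

lemma char_gauss:
  assumes "0 \<le> v"
  shows "char (gauss v) t = exp (- v * t\<^sup>2 / 2)"
proof -
  have "char (gauss v) t = char std_normal_distribution (t * sqrt v)"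
    unfolding gauss_def char_def by (simp add: integral_distr mult.assoc)
  also have "\<dots> = exp (- v * t\<^sup>2 / 2)"
    using assms unfolding char_std_normal_distribution by (simp add: power_mult_distrib mult.commute)
  finally show ?thesis .
qed

lemma integral_iexp_cgauss:
  assumes "0 \<le> v"
  shows "(\<integral>z. iexp (Re (c * z)) \<partial>cgauss v) = exp (- v * (cmod c)\<^sup>2 / 2)"
proof -
  interpret prob_space std_normal_distribution by (rule prob_space_std_normal)
  interpret pair_prob_space std_normal_distribution std_normal_distribution ..
  have 1: "(\<integral>x. iexp (t * x) \<partial>std_normal_distribution) = exp (- t\<^sup>2 / 2)" for t :: real
    using fun_cong[OF char_std_normal_distribution, of t] by (simp add: char_def)
  have "(\<integral>z. iexp (Re (c * z)) \<partial>cgauss v) =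
     (\<integral>p. iexp (Re c * sqrt v * fst p) * iexp (- Im c * sqrt v * snd p) \<partial>(std_normal_distribution \<Otimes>\<^sub>M std_normal_distribution))"
    unfolding cgauss_def by (simp add: integral_distr case_prod_beta algebra_simps flip: exp_add)
  also have "\<dots> = (\<integral>x. \<integral>y. iexp (Re c * sqrt v * x) * iexp (- Im c * sqrt v * y) \<partial>std_normal_distribution \<partial>std_normal_distribution)"
    by (subst integral_fst'[symmetric]) (auto intro!: P.integrable_const_bound[where B=1] simp: norm_mult)
  also have "\<dots> = exp (- (Re c * sqrt v)\<^sup>2 / 2) * exp (- (- Im c * sqrt v)\<^sup>2 / 2)"
    by (simp only: 1 integral_mult_right_zero integral_mult_left_zero) (simp only: of_real_mult)
  also have "\<dots> = exp (- v * (cmod c)\<^sup>2 / 2)"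
    using assms by (simp add: power_mult_distrib cmod_power2 field_simps flip: exp_add of_real_mult exp_of_real)
  finally show ?thesis .
qed

lemma gauss_moments:
  assumes "0 \<le> v"
  shows "integrable (gauss v) (\<lambda>x. x ^ k)" "(\<integral>x. x\<^sup>2 \<partial>gauss v) = v" "(\<integral>x. x ^ 4 \<partial>gauss v) = 3 * v\<^sup>2"
proof -
  show "integrable (gauss v) (\<lambda>x. x ^ k)"
    unfolding gauss_def by (simp add: integrable_distr_eq power_mult_distrib integrable_std_normal_distribution_moment)
  show "(\<integral>x. x\<^sup>2 \<partial>gauss v) = v"
    unfolding gauss_def using assms std_normal_distribution_even_moments(1)[of 1]
    by (simp add: integral_distr power_mult_distrib)
  have "sqrt v ^ 4 = v\<^sup>2" using assms by (simp add: power4_eq_xxxx power2_eq_square)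
  then show "(\<integral>x. x ^ 4 \<partial>gauss v) = 3 * v\<^sup>2"
    unfolding gauss_def using std_normal_distribution_even_moments(1)[of 2]
    by (simp add: integral_distr power_mult_distrib fact_numeral)
qed

lemma gauss_null_singleton:
  assumes "0 < v"
  shows "measure (gauss v) {x} = 0"
proof -
  have "(\<lambda>y. sqrt v * y) -` {x} = {x / sqrt v}" using assms by (auto simp: field_simps)
  moreover have "emeasure std_normal_distribution {y} = 0" for y
    using AE_lborel_singleton[of y]
    by (subst emeasure_density) (auto simp: nn_integral_0_iff_AE elim!: eventually_mono split: split_indicator)
  ultimately show ?thesis unfolding gauss_def
    by (simp add: measure_distr measure_def emeasure_distr)
qed

section \<open>Gaussian vectors\<close>

lemma measurable_vec_entry[measurable]: "i < n \<Longrightarrow> (\<lambda>v. v $ i) \<in> borel_measurable (vec_borel n)"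
proof -
  assume i: "i < n"
  have "(\<lambda>v. \<lambda>i\<in>{..<n}. v $ i) \<in> measurable (vec_borel n) (PiM {..<n} (\<lambda>_. borel :: complex measure))"
    unfolding vec_borel_def by (rule measurable_vimage_algebra1) (auto simp: space_PiM)
  from measurable_compose[OF this measurable_component_singleton[of i]]
  show ?thesis using i by simp
qed

lemma space_vec_borel[simp]: "space (vec_borel n) = carrier_vec n"
  by (simp add: vec_borel_def)

lemma space_mat_borel[simp]: "space (mat_borel n m) = carrier_mat n m"
  by (simp add: mat_borel_def)

lemma measurable_vec_borelI:
  assumes "\<And>x. x \<in> space M \<Longrightarrow> f x \<in> carrier_vec n" "\<And>i. i < n \<Longrightarrow> (\<lambda>x. f x $ i) \<in> borel_measurable M"
  shows "f \<in> measurable M (vec_borel n)"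
  unfolding vec_borel_def
proof (rule measurable_vimage_algebra2)
  show "f \<in> space M \<rightarrow> carrier_vec n" using assms by auto
  show "(\<lambda>x. \<lambda>i\<in>{..<n}. f x $ i) \<in> measurable M (PiM {..<n} (\<lambda>_. borel))"
    using assms(2) by (intro measurable_restrict) auto
qed

lemma measurable_mat_entry[measurable]:
  "i < n \<Longrightarrow> j < m \<Longrightarrow> (\<lambda>A. A $$ (i, j)) \<in> borel_measurable (mat_borel n m)"
proof -
  assume i: "i < n" "j < m"
  have "(\<lambda>A. \<lambda>ij\<in>{..<n} \<times> {..<m}. A $$ ij) \<in> measurable (mat_borel n m) (PiM ({..<n} \<times> {..<m}) (\<lambda>_. borel :: complex measure))"
    unfolding mat_borel_def by (rule measurable_vimage_algebra1) (auto simp: space_PiM)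
  from measurable_compose[OF this measurable_component_singleton[of "(i, j)"]]
  show ?thesis using i by simp
qed

context prob_space
begin

lemma gaussian_rv_integrable:
  assumes "gaussian_rv M X"
  shows "integrable M X" "X \<in> borel_measurable M"
proof -
  have *: "integrable M X \<and> X \<in> borel_measurable M"
    using assms unfolding gaussian_rv_def
  proof (elim disjE exE conjE)
    fix \<mu> \<sigma> :: real assume s: "0 < \<sigma>" and d: "distributed M lborel X (normal_density \<mu> \<sigma>)"
    have "integrable M (\<lambda>x. X x)"
      using distributed_integrable[OF d, of "\<lambda>x. x"] integrable_normal_moment_nz_1[OF s, of \<mu>] by simp
    then show ?thesis by auto
  next
    fix \<mu> assume [measurable]: "X \<in> borel_measurable M" and ae: "AE \<omega> in M. X \<omega> = \<mu>"
    have "integrable M X \<longleftrightarrow> integrable M (\<lambda>_. \<mu>)"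
      by (rule integrable_cong_AE) (use ae in auto)
    then show ?thesis by simp
  qed
  from * show "integrable M X" "X \<in> borel_measurable M" by auto
qed

text \<open>A centred Gaussian variable is fixed by its second moment. In the degenerate branch the
  constant must be 0, which is the law \<open>gauss 0\<close>.\<close>

lemma gaussian_rv_law:
  assumes g: "gaussian_rv M X" and zero: "expectation X = 0"
  shows "integrable M (\<lambda>\<omega>. (X \<omega>)\<^sup>2)" "distr M borel X = gauss (expectation (\<lambda>\<omega>. (X \<omega>)\<^sup>2))"
proof -
  have "integrable M (\<lambda>\<omega>. (X \<omega>)\<^sup>2) \<and> distr M borel X = gauss (expectation (\<lambda>\<omega>. (X \<omega>)\<^sup>2))"
    using g unfolding gaussian_rv_def
  proof (elim disjE exE conjE)
    fix \<mu> \<sigma> :: real assume s: "0 < \<sigma>" and d: "distributed M lborel X (normal_density \<mu> \<sigma>)"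
    have \<mu>: "\<mu> = 0" using normal_distributed_expectation[OF s d] zero by simp
    have "integrable M (\<lambda>x. (X x)\<^sup>2)"
      using distributed_integrable[OF d, of "\<lambda>x. x\<^sup>2"] integrable_normal_moment[OF s, of \<mu> 2] \<mu> by simp
    moreover have "expectation (\<lambda>\<omega>. (X \<omega>)\<^sup>2) = \<sigma>\<^sup>2"
      using normal_distributed_variance[OF s d] zero by simp
    moreover have "distr M borel X = gauss (\<sigma>\<^sup>2)"
    proof -
      interpret N: prob_space std_normal_distribution by (rule prob_space_std_normal)
      have "distributed std_normal_distribution lborel (\<lambda>x. x) std_normal_density"
        by (auto simp: distributed_def intro!: distr_id2)
      from N.normal_density_affine[OF this, of \<sigma> 0] s
      have "distr std_normal_distribution lborel (\<lambda>x. \<sigma> * x) = density lborel (normal_density 0 \<sigma>)"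
        by (simp add: distributed_def)
      moreover have "distr M lborel X = density lborel (normal_density 0 \<sigma>)"
        using d \<mu> by (simp add: distributed_def)
      moreover have "distr M lborel X = distr M borel X"
        "distr std_normal_distribution lborel (\<lambda>x. \<sigma> * x) = distr std_normal_distribution borel (\<lambda>x. \<sigma> * x)"
        by (rule distr_cong; simp)+
      ultimately show ?thesis using s by (simp add: gauss_def)
    qed
    ultimately show ?thesis by simp
  next
    fix \<mu> assume [measurable]: "X \<in> borel_measurable M" and ae: "AE \<omega> in M. X \<omega> = \<mu>"
    have "expectation X = expectation (\<lambda>_. \<mu>)" by (rule integral_cong_AE) (use ae in auto)
    then have "\<mu> = 0" using zero prob_space by simp
    then have ae0: "AE \<omega> in M. X \<omega> = 0" using ae by simp
    have i: "integrable M (\<lambda>\<omega>. (X \<omega>)\<^sup>2) \<longleftrightarrow> integrable M (\<lambda>_. 0 :: real)"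
      by (rule integrable_cong_AE) (use ae0 in auto)
    have e: "expectation (\<lambda>\<omega>. (X \<omega>)\<^sup>2) = expectation (\<lambda>_. 0)" by (rule integral_cong_AE) (use ae0 in auto)
    interpret N: prob_space std_normal_distribution by (rule prob_space_std_normal)
    have "distr M borel X = distr M borel (\<lambda>_. 0)"
      by (rule distr_cong_AE) (use ae0 in auto)
    also have "\<dots> = distr std_normal_distribution borel (\<lambda>_. 0)"
      by (rule measure_eqI) (auto simp: emeasure_distr emeasure_space_1 N.emeasure_space_1[simplified] vimage_def)
    finally show ?thesis using i e by (simp add: gauss_def)
  qed
  then show "integrable M (\<lambda>\<omega>. (X \<omega>)\<^sup>2)" "distr M borel X = gauss (expectation (\<lambda>\<omega>. (X \<omega>)\<^sup>2))" by auto
qed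

text \<open>The real part of \<open>\<Sum>i c i * z i\<close> is a centred Gaussian variable.
  Circular symmetry gives it half of the second moment of the modulus, and the Gaussian exponent
  halves once more, hence the division by 4.\<close>

lemma cscg_char:
  fixes c :: "nat \<Rightarrow> complex"
  assumes z: "zero_mean_cscg M n C z"
  shows "(\<integral>\<omega>. iexp (Re (\<Sum>i<n. c i * z \<omega> $ i)) \<partial>M) =
    exp (- Re (\<Sum>i<n. \<Sum>j<n. cnj (c i) * c j * C $$ (i, j)) / 4)"
proof -
  have zm[measurable]: "z \<in> measurable M (vec_borel n)"
    and g: "\<And>a b. gaussian_rv M (\<lambda>\<omega>. \<Sum>i<n. a i * Re (z \<omega> $ i) + b i * Im (z \<omega> $ i))"
    and rot: "\<And>\<phi>. distr M (vec_borel n) (\<lambda>\<omega>. cis \<phi> \<cdot>\<^sub>v z \<omega>) = distr M (vec_borel n) z"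
    and mean: "\<And>i. i < n \<Longrightarrow> (\<integral>\<omega>. z \<omega> $ i \<partial>M) = 0"
    and cov: "\<And>i j. i < n \<Longrightarrow> j < n \<Longrightarrow> (\<integral>\<omega>. cnj (z \<omega> $ i) * z \<omega> $ j \<partial>M) = C $$ (i, j)"
    using z unfolding zero_mean_cscg_def complex_gaussian_vec_def by auto
  have entry[measurable]: "i < n \<Longrightarrow> (\<lambda>\<omega>. z \<omega> $ i) \<in> borel_measurable M" for i
    using measurable_compose[OF zm measurable_vec_entry] by blast
  have car: "\<omega> \<in> space M \<Longrightarrow> z \<omega> \<in> carrier_vec n" for \<omega> using measurable_space[OF zm] by simp
  have comp: "gaussian_rv M (\<lambda>\<omega>. Re (z \<omega> $ i))" "gaussian_rv M (\<lambda>\<omega>. Im (z \<omega> $ i))" if i: "i < n" for i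
  proof -
    have "(\<Sum>k<n. (if k = i then 1 else 0) * Re (z \<omega> $ k) + 0 * Im (z \<omega> $ k)) = Re (z \<omega> $ i)"
      "(\<Sum>k<n. 0 * Re (z \<omega> $ k) + (if k = i then 1 else 0) * Im (z \<omega> $ k)) = Im (z \<omega> $ i)" for \<omega>
      using i by (simp_all add: if_distrib[of "\<lambda>x. x * _"] sum.delta cong: if_cong)
    then show "gaussian_rv M (\<lambda>\<omega>. Re (z \<omega> $ i))" "gaussian_rv M (\<lambda>\<omega>. Im (z \<omega> $ i))"
      using g[of "\<lambda>k. if k = i then 1 else 0" "\<lambda>_. 0"] g[of "\<lambda>_. 0" "\<lambda>k. if k = i then 1 else 0"] by simp_all
  qed
  have int: "integrable M (\<lambda>\<omega>. z \<omega> $ i)" if i: "i < n" for i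
  proof -
    have "integrable M (\<lambda>\<omega>. complex_of_real (Re (z \<omega> $ i)) + \<i> * complex_of_real (Im (z \<omega> $ i)))"
      using gaussian_rv_integrable(1)[OF comp(1)[OF i]] gaussian_rv_integrable(1)[OF comp(2)[OF i]] by auto
    then show ?thesis by (simp flip: complex_eq)
  qed
  have mean0: "expectation (\<lambda>\<omega>. Re (z \<omega> $ i)) = 0" "expectation (\<lambda>\<omega>. Im (z \<omega> $ i)) = 0" if i: "i < n" for i
    using mean[OF i] integral_Re[OF int[OF i]] integral_Im[OF int[OF i]] by simp_all
  have sq: "integrable M (\<lambda>\<omega>. (cmod (z \<omega> $ i))\<^sup>2)" if i: "i < n" for i
    unfolding cmod_power2
    using gaussian_rv_law(1)[OF comp(1)[OF i] mean0(1)[OF i]] gaussian_rv_law(1)[OF comp(2)[OF i] mean0(2)[OF i]] by auto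
  have prodint: "integrable M (\<lambda>\<omega>. cnj (z \<omega> $ i) * z \<omega> $ j)" if i: "i < n" "j < n" for i j
  proof (rule Bochner_Integration.integrable_bound)
    show "integrable M (\<lambda>\<omega>. (cmod (z \<omega> $ i))\<^sup>2 + (cmod (z \<omega> $ j))\<^sup>2)" using sq i by auto
    have [measurable]: "cnj \<in> borel_measurable borel"
      by (intro borel_measurable_continuous_onI continuous_intros)
    show "(\<lambda>\<omega>. cnj (z \<omega> $ i) * z \<omega> $ j) \<in> borel_measurable M"
      using entry[OF i(1)] entry[OF i(2)] by measurable
    have "x * y \<le> x\<^sup>2 + y\<^sup>2" for x y :: real
      using sum_squares_bound[of x y] zero_le_power2[of x] zero_le_power2[of y] by linarith
    then show "AE \<omega> in M. norm (cnj (z \<omega> $ i) * z \<omega> $ j) \<le> norm ((cmod (z \<omega> $ i))\<^sup>2 + (cmod (z \<omega> $ j))\<^sup>2)"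
      by (simp add: norm_mult)
  qed
  define Z where "Z = (\<lambda>\<omega>. \<Sum>i<n. c i * z \<omega> $ i)"
  have Zm[measurable]: "Z \<in> borel_measurable M" unfolding Z_def by measurable
  have gRe: "gaussian_rv M (\<lambda>\<omega>. Re (Z \<omega>))"
    using g[of "\<lambda>i. Re (c i)" "\<lambda>i. - Im (c i)"] by (simp add: Z_def)
  have gIm: "gaussian_rv M (\<lambda>\<omega>. Im (Z \<omega>))"
    using g[of "\<lambda>i. Im (c i)" "\<lambda>i. Re (c i)"] by (simp add: Z_def add.commute)
  have EZ: "(\<integral>\<omega>. Z \<omega> \<partial>M) = 0" unfolding Z_def
    by (subst Bochner_Integration.integral_sum) (use int mean in auto)
  have Zi: "integrable M Z" unfolding Z_def using int by auto
  have EReZ: "expectation (\<lambda>\<omega>. Re (Z \<omega>)) = 0" "expectation (\<lambda>\<omega>. Im (Z \<omega>)) = 0"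
    using EZ integral_Re[OF Zi] integral_Im[OF Zi] by simp_all
  define q where "q = (\<Sum>i<n. \<Sum>j<n. cnj (c i) * c j * C $$ (i, j))"
  have "(\<integral>\<omega>. cnj (Z \<omega>) * Z \<omega> \<partial>M) = (\<integral>\<omega>. (\<Sum>i<n. \<Sum>j<n. cnj (c i) * c j * (cnj (z \<omega> $ i) * z \<omega> $ j)) \<partial>M)"
    unfolding Z_def cnj_sum sum_product by (simp add: mult_ac)
  also have "\<dots> = q"
    unfolding q_def
  proof (subst Bochner_Integration.integral_sum)
    show "integrable M (\<lambda>\<omega>. \<Sum>j<n. cnj (c i) * c j * (cnj (z \<omega> $ i) * z \<omega> $ j))" if "i \<in> {..<n}" for i
      using prodint that by auto
    show "(\<Sum>i<n. \<integral>\<omega>. (\<Sum>j<n. cnj (c i) * c j * (cnj (z \<omega> $ i) * z \<omega> $ j)) \<partial>M) =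
        (\<Sum>i<n. \<Sum>j<n. cnj (c i) * c j * C $$ (i, j))"
    proof (intro sum.cong refl)
      fix i assume "i \<in> {..<n}"
      then show "(\<integral>\<omega>. (\<Sum>j<n. cnj (c i) * c j * (cnj (z \<omega> $ i) * z \<omega> $ j)) \<partial>M) = (\<Sum>j<n. cnj (c i) * c j * C $$ (i, j))"
        using prodint cov by (subst Bochner_Integration.integral_sum) (auto intro!: sum.cong)
    qed
  qed
  finally have q: "(\<integral>\<omega>. cnj (Z \<omega>) * Z \<omega> \<partial>M) = q" .
  note R2 = gaussian_rv_law[OF gRe EReZ(1)] and I2 = gaussian_rv_law[OF gIm EReZ(2)]
  have "(\<integral>\<omega>. complex_of_real ((Re (Z \<omega>))\<^sup>2 + (Im (Z \<omega>))\<^sup>2) \<partial>M) = q"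
    using q by (simp add: complex_mult_cnj mult.commute)
  then have q2: "Re q = expectation (\<lambda>\<omega>. (Re (Z \<omega>))\<^sup>2) + expectation (\<lambda>\<omega>. (Im (Z \<omega>))\<^sup>2)"
    unfolding integral_complex_of_real Bochner_Integration.integral_add[OF R2(1) I2(1)]
    by (metis Re_complex_of_real)
  \<comment> \<open>Multiplication by \<open>cis (pi/2)\<close> turns \<open>Re Z\<close> into
    \<open>- Im Z\<close>, so rotation invariance forces equal second moments of both parts, each
    being \<open>Re q / 2\<close>.\<close>
  let ?h = "\<lambda>v. (Re (\<Sum>i<n. c i * v $ i))\<^sup>2"
  have hm: "?h \<in> borel_measurable (vec_borel n)" by measurable
  have rm: "(\<lambda>\<omega>. cis (pi/2) \<cdot>\<^sub>v z \<omega>) \<in> measurable M (vec_borel n)"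
  proof (rule measurable_vec_borelI)
    fix i assume i: "i < n"
    have "(\<lambda>\<omega>. cis (pi/2) * z \<omega> $ i) \<in> borel_measurable M" using i by measurable
    then show "(\<lambda>\<omega>. (cis (pi/2) \<cdot>\<^sub>v z \<omega>) $ i) \<in> borel_measurable M"
      by (rule measurable_cong[THEN iffD1, rotated]) (use car i in \<open>auto dest!: car\<close>)
  qed (use car in auto)
  have "expectation (\<lambda>\<omega>. ?h (cis (pi/2) \<cdot>\<^sub>v z \<omega>)) = expectation (\<lambda>\<omega>. ?h (z \<omega>))"
    using integral_distr[OF rm hm] integral_distr[OF zm hm] rot[of "pi/2"] by simp
  moreover have "expectation (\<lambda>\<omega>. ?h (cis (pi/2) \<cdot>\<^sub>v z \<omega>)) = expectation (\<lambda>\<omega>. (Im (Z \<omega>))\<^sup>2)"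
  proof (rule Bochner_Integration.integral_cong)
    fix \<omega> assume w: "\<omega> \<in> space M"
    have "(\<Sum>i<n. c i * (cis (pi/2) \<cdot>\<^sub>v z \<omega>) $ i) = \<i> * Z \<omega>"
      unfolding Z_def sum_distrib_left using car[OF w] by (intro sum.cong) (auto simp: algebra_simps)
    then show "?h (cis (pi/2) \<cdot>\<^sub>v z \<omega>) = (Im (Z \<omega>))\<^sup>2" by simp
  qed simp
  ultimately have e: "expectation (\<lambda>\<omega>. (Re (Z \<omega>))\<^sup>2) = Re q / 2" using q2 by (simp add: Z_def)
  have law: "distr M borel (\<lambda>\<omega>. Re (Z \<omega>)) = gauss (Re q / 2)" using R2(2) unfolding e .
  have pos: "0 \<le> Re q / 2" unfolding e[symmetric] by simp
  have "(\<integral>\<omega>. iexp (Re (Z \<omega>)) \<partial>M) = char (gauss (Re q / 2)) 1"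
    unfolding char_def law[symmetric] by (subst integral_distr) auto
  then show ?thesis using char_gauss[OF pos, of 1] by (simp add: q_def Z_def)
qed

end

section \<open>Linear images of the channel\<close>

text \<open>For a row \<open>h\<close> with covariance \<open>C\<close> in the convention used here,
  this is the expectation of \<open>cnj (\<Sum>i x i * h i) * (\<Sum>j y j * h j)\<close>. It is
  thus the inner product for which orthogonality means that images under the channel are
  uncorrelated.\<close>

definition herm :: "nat \<Rightarrow> complex Matrix.mat \<Rightarrow> (nat \<Rightarrow> complex) \<Rightarrow> (nat \<Rightarrow> complex) \<Rightarrow> complex" where
  "herm n C x y = (\<Sum>i<n. \<Sum>j<n. cnj (x i) * y j * C $$ (i, j))"

lemma herm_add_left: "herm n C (\<lambda>i. x i + y i) z = herm n C x z + herm n C y z"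
  and herm_add_right: "herm n C z (\<lambda>i. x i + y i) = herm n C z x + herm n C z y"
  and herm_scale_left: "herm n C (\<lambda>i. a * x i) z = cnj a * herm n C x z"
  and herm_scale_right: "herm n C z (\<lambda>i. a * x i) = a * herm n C z x"
  by (simp_all add: herm_def sum_distrib_left algebra_simps sum.distrib)

lemma herm_sum_left: "herm n C (\<lambda>i. \<Sum>j\<in>J. t j * f j i) z = (\<Sum>j\<in>J. cnj (t j) * herm n C (f j) z)"
proof -
  have "herm n C (\<lambda>i. \<Sum>j\<in>J. t j * f j i) z = (\<Sum>i<n. \<Sum>k<n. \<Sum>j\<in>J. cnj (t j) * (cnj (f j i) * z k * C $$ (i, k)))"
    unfolding herm_def cnj_sum complex_cnj_mult sum_distrib_right by (simp only: mult.assoc)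
  also have "\<dots> = (\<Sum>i<n. \<Sum>j\<in>J. \<Sum>k<n. cnj (t j) * (cnj (f j i) * z k * C $$ (i, k)))"
    by (intro sum.cong refl sum.swap)
  also have "\<dots> = (\<Sum>j\<in>J. \<Sum>i<n. \<Sum>k<n. cnj (t j) * (cnj (f j i) * z k * C $$ (i, k)))"
    by (rule sum.swap)
  finally show ?thesis by (simp add: herm_def sum_distrib_left)
qed

lemma herm_cnj:
  assumes "\<And>i j. i < n \<Longrightarrow> j < n \<Longrightarrow> C $$ (j, i) = cnj (C $$ (i, j))"
  shows "herm n C y x = cnj (herm n C x y)"
proof -
  have "cnj (herm n C x y) = (\<Sum>i<n. \<Sum>j<n. cnj (y j) * x i * C $$ (j, i))"
    unfolding herm_def cnj_sum
  proof (intro sum.cong refl)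
    fix i j assume "i \<in> {..<n}" "j \<in> {..<n}"
    then have "C $$ (j, i) = cnj (C $$ (i, j))" by (intro assms) simp_all
    then show "cnj (cnj (x i) * y j * C $$ (i, j)) = cnj (y j) * x i * C $$ (j, i)"
      by (simp only: complex_cnj_mult complex_cnj_cnj mult_ac)
  qed
  also have "\<dots> = herm n C y x" unfolding herm_def by (rule sum.swap)
  finally show ?thesis by simp
qed

lemma sum_Times: "(\<Sum>p\<in>A \<times> B. h p) = (\<Sum>x\<in>A. \<Sum>y\<in>B. h (x, y))"
  by (simp add: sum.cartesian_product)

lemma iexp_sum: "finite A \<Longrightarrow> iexp (\<Sum>m\<in>A. f m) = (\<Prod>m\<in>A. iexp (f m))"
  by (simp add: sum_distrib_left exp_sum)

text \<open>Independent circular Gaussian coordinates with \<open>E|x m|\<^sup>2 = \<tau>\<close>, given by the characteristic function.\<close>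

definition iid_cgauss :: "nat \<Rightarrow> real \<Rightarrow> (nat \<Rightarrow> complex) measure \<Rightarrow> bool" where
  "iid_cgauss N \<tau> \<mu> \<longleftrightarrow> prob_space \<mu> \<and> sets \<mu> = sets (PiM {..<N} (\<lambda>_. borel)) \<and> 0 \<le> \<tau> \<and>
     (\<forall>u. (\<integral>x. iexp (\<Sum>m<N. Re (u m * x m)) \<partial>\<mu>) = exp (- \<tau> * (\<Sum>m<N. (cmod (u m))\<^sup>2) / 4))"

definition lin :: "nat \<Rightarrow> ('a \<Rightarrow> complex Matrix.mat) \<Rightarrow> (nat \<Rightarrow> complex) \<Rightarrow> 'a \<Rightarrow> nat \<Rightarrow> complex" where
  "lin n H f \<omega> m = (\<Sum>i<n. H \<omega> $$ (m, i) * f i)"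

context mimo_system
begin

lemma H_carrier: "\<omega> \<in> space P \<Longrightarrow> H \<omega> \<in> carrier_mat nr nt"
  using measurable_space[OF H_measurable] by simp

lemma H_entry_measurable[measurable]: "m < nr \<Longrightarrow> i < nt \<Longrightarrow> (\<lambda>\<omega>. H \<omega> $$ (m, i)) \<in> borel_measurable P"
  using measurable_compose[OF H_measurable measurable_mat_entry] by blast

lemma lin_measurable[measurable]: "m < nr \<Longrightarrow> (\<lambda>\<omega>. lin nt H f \<omega> m) \<in> borel_measurable P"
  unfolding lin_def by measurable

text \<open>Independence of the rows makes this a product over \<open>m\<close>. The coefficient
  vector \<open>c m\<close> may vary with the row, so every real linear functional of the channel
  entries is covered.\<close>

lemma H_char:
  "(\<integral>\<omega>. iexp (\<Sum>m<nr. Re (lin nt H (c m) \<omega> m)) \<partial>P) = exp (- (\<Sum>m<nr. Re (herm nt \<Sigma> (c m) (c m))) / 4)"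
proof -
  let ?X = "\<lambda>m \<omega>. iexp (Re (\<Sum>i<nt. c m i * Matrix.row (H \<omega>) m $ i))"
  have row: "(\<Sum>i<nt. c m i * Matrix.row (H \<omega>) m $ i) = lin nt H (c m) \<omega> m" if "\<omega> \<in> space P" "m < nr" for \<omega> m
    using H_carrier[OF that(1)] that(2) unfolding lin_def by (intro sum.cong) auto
  have ind: "indep_vars (\<lambda>_. borel) ?X {..<nr}"
    by (rule indep_vars_compose2[OF H_rows_indep]) measurable
  have one: "(\<integral>\<omega>. ?X m \<omega> \<partial>P) = exp (- Re (herm nt \<Sigma> (c m) (c m)) / 4)" if "m < nr" for m
    using cscg_char[OF H_rows_law[OF that]] by (simp add: herm_def)
  have "(\<integral>\<omega>. iexp (\<Sum>m<nr. Re (lin nt H (c m) \<omega> m)) \<partial>P) = (\<integral>\<omega>. (\<Prod>m<nr. ?X m \<omega>) \<partial>P)"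
    by (intro Bochner_Integration.integral_cong refl) (simp only: iexp_sum finite_lessThan, intro prod.cong refl, simp only: row lessThan_iff)
  also have "\<dots> = (\<Prod>m<nr. (\<integral>\<omega>. ?X m \<omega> \<partial>P))"
  proof (rule indep_vars_lebesgue_integral[OF _ ind])
    fix m assume m: "m \<in> {..<nr}"
    have "integrable P (\<lambda>\<omega>. iexp (Re (lin nt H (c m) \<omega> m)))"
    proof (rule integrable_const_bound[where B=1])
      have [measurable]: "(\<lambda>\<omega>. lin nt H (c m) \<omega> m) \<in> borel_measurable P" using m by (intro lin_measurable) simp
      show "(\<lambda>\<omega>. iexp (Re (lin nt H (c m) \<omega> m))) \<in> borel_measurable P" by measurable
    qed simp
    then show "integrable P (?X m)"
      by (rule Bochner_Integration.integrable_cong[THEN iffD1, rotated -1]) (use row m in auto)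
  qed simp
  also have "\<dots> = (\<Prod>m<nr. complex_of_real (exp (- Re (herm nt \<Sigma> (c m) (c m)) / 4)))"
    by (intro prod.cong refl one) simp
  also have "\<dots> = exp (- (\<Sum>m<nr. Re (herm nt \<Sigma> (c m) (c m))) / 4)"
    by (simp only: of_real_prod[symmetric] exp_sum[symmetric] finite_lessThan) (simp add: sum_divide_distrib sum_negf)
  finally show ?thesis .
qed

text \<open>Restriction to the index set makes the image of \<open>p\<close> a point of a product
  space, on which \<open>determines_PiM\<close> is available. Later \<open>p\<close> is a dual
  vector, and \<open>R_of\<close> collects the columns of \<open>HF\<close> other than the
  distinguished one.\<close>

definition W_of :: "(nat \<Rightarrow> complex) \<Rightarrow> 'a \<Rightarrow> nat \<Rightarrow> complex" where
  "W_of p \<omega> = (\<lambda>m\<in>{..<nr}. lin nt H p \<omega> m)"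

definition R_of :: "nat set \<Rightarrow> (nat \<Rightarrow> nat \<Rightarrow> complex) \<Rightarrow> 'a \<Rightarrow> nat \<times> nat \<Rightarrow> complex" where
  "R_of J f \<omega> = (\<lambda>mj\<in>{..<nr} \<times> J. lin nt H (f (snd mj)) \<omega> (fst mj))"

lemma W_of_measurable[measurable]: "W_of p \<in> measurable P (PiM {..<nr} (\<lambda>_. borel))"
  unfolding W_of_def by (rule measurable_restrict) (auto intro: lin_measurable)

lemma R_of_measurable[measurable]: "R_of J f \<in> measurable P (PiM ({..<nr} \<times> J) (\<lambda>_. borel))"
  unfolding R_of_def by (rule measurable_restrict) (auto intro: lin_measurable)

text \<open>A functional of the pair of images is one functional of \<open>H\<close> with
  row-dependent coefficients, the form that \<open>H_char\<close> evaluates.\<close>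

lemma W_R_phase:
  assumes "finite J"
  shows "(\<Sum>m<nr. Re (u m * W_of p \<omega> m)) + (\<Sum>mj\<in>{..<nr}\<times>J. Re (t mj * R_of J f \<omega> mj)) =
    (\<Sum>m<nr. Re (lin nt H (\<lambda>i. u m * p i + (\<Sum>j\<in>J. t (m, j) * f j i)) \<omega> m))"
proof -
  have "lin nt H (\<lambda>i. u m * p i + (\<Sum>j\<in>J. t (m, j) * f j i)) \<omega> m =
      u m * lin nt H p \<omega> m + (\<Sum>j\<in>J. t (m, j) * lin nt H (f j) \<omega> m)" for m
  proof -
    have "(\<Sum>i<nt. H \<omega> $$ (m, i) * (\<Sum>j\<in>J. t (m, j) * f j i)) = (\<Sum>i<nt. \<Sum>j\<in>J. t (m, j) * (H \<omega> $$ (m, i) * f j i))"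
      by (simp add: sum_distrib_left mult_ac)
    also have "\<dots> = (\<Sum>j\<in>J. \<Sum>i<nt. t (m, j) * (H \<omega> $$ (m, i) * f j i))" by (rule sum.swap)
    finally show ?thesis
      by (simp add: lin_def distrib_left sum.distrib sum_distrib_left mult_ac)
  qed
  then show ?thesis
    by (simp add: W_of_def R_of_def sum_Times sum.distrib Re_sum del: times_complex.sel)
qed

lemma W_law:
  assumes tau: "0 \<le> Re (herm nt \<Sigma> p p)"
  shows "iid_cgauss nr (Re (herm nt \<Sigma> p p)) (distr P (PiM {..<nr} (\<lambda>_. borel)) (W_of p))"
  unfolding iid_cgauss_def
proof (intro conjI allI)
  show "prob_space (distr P (PiM {..<nr} (\<lambda>_. borel)) (W_of p))" by (rule prob_space_distr) measurable
  fix u :: "nat \<Rightarrow> complex"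
  have "(\<integral>x. iexp (\<Sum>m<nr. Re (u m * x m)) \<partial>distr P (PiM {..<nr} (\<lambda>_. borel)) (W_of p)) =
     (\<integral>\<omega>. iexp (\<Sum>m<nr. Re (u m * W_of p \<omega> m)) \<partial>P)"
    by (rule integral_distr) measurable
  also have "\<dots> = exp (- (\<Sum>m<nr. Re (herm nt \<Sigma> (\<lambda>i. u m * p i) (\<lambda>i. u m * p i))) / 4)"
    using W_R_phase[of "{}" u p] H_char[of "\<lambda>m i. u m * p i"] by (simp del: times_complex.sel)
  also have "(\<Sum>m<nr. Re (herm nt \<Sigma> (\<lambda>i. u m * p i) (\<lambda>i. u m * p i))) = (\<Sum>m<nr. Re (herm nt \<Sigma> p p) * (cmod (u m))\<^sup>2)"
  proof (intro sum.cong refl)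
    fix m
    have "u m * (cnj (u m) * herm nt \<Sigma> p p) = complex_of_real ((cmod (u m))\<^sup>2) * herm nt \<Sigma> p p"
      unfolding complex_norm_square by (simp only: mult.assoc)
    then have "herm nt \<Sigma> (\<lambda>i. u m * p i) (\<lambda>i. u m * p i) = complex_of_real ((cmod (u m))\<^sup>2) * herm nt \<Sigma> p p"
      unfolding herm_scale_left herm_scale_right by (metis mult.left_commute)
    then show "Re (herm nt \<Sigma> (\<lambda>i. u m * p i) (\<lambda>i. u m * p i)) = Re (herm nt \<Sigma> p p) * (cmod (u m))\<^sup>2"
      by (simp del: of_real_power)
  qed
  finally show "(\<integral>x. iexp (\<Sum>m<nr. Re (u m * x m)) \<partial>distr P (PiM {..<nr} (\<lambda>_. borel)) (W_of p)) =
     exp (- Re (herm nt \<Sigma> p p) * (\<Sum>m<nr. (cmod (u m))\<^sup>2) / 4)"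
    by (simp add: sum_distrib_left sum_negf del: times_complex.sel)
qed (use tau in auto)

text \<open>Orthogonality with respect to \<open>herm\<close> removes the cross terms from the
  quadratic exponent of \<open>H_char\<close>. The joint characteristic function therefore factors,
  and uniqueness on the product space turns this into independence.\<close>

lemma W_R_indep:
  assumes J: "finite J" and orth: "\<And>j. j \<in> J \<Longrightarrow> herm nt \<Sigma> (f j) p = 0"
    and hm: "\<And>i j. i < nt \<Longrightarrow> j < nt \<Longrightarrow> \<Sigma> $$ (j, i) = cnj (\<Sigma> $$ (i, j))"
  shows "distr P (PiM {..<nr} (\<lambda>_. borel) \<Otimes>\<^sub>M PiM ({..<nr} \<times> J) (\<lambda>_. borel)) (\<lambda>\<omega>. (W_of p \<omega>, R_of J f \<omega>)) =
    distr P (PiM {..<nr} (\<lambda>_. borel)) (W_of p) \<Otimes>\<^sub>M distr P (PiM ({..<nr} \<times> J) (\<lambda>_. borel)) (R_of J f)"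
    (is "?L = ?A \<Otimes>\<^sub>M ?B")
proof -
  have fin: "finite ({..<nr} \<times> J)" using J by simp
  let ?\<Theta>1 = "range (\<lambda>c x. \<Sum>i\<in>{..<nr}. Re (c i * x i))" and ?\<Theta>2 = "range (\<lambda>c x. \<Sum>i\<in>{..<nr}\<times>J. Re (c i * x i))"
  interpret A: prob_space ?A by (rule prob_space_distr) measurable
  interpret B: prob_space ?B by (rule prob_space_distr) measurable
  interpret AB: pair_prob_space ?A ?B ..
  show ?thesis
  proof (rule determinesD[OF determines_pair[OF determines_PiM[OF finite_lessThan[of nr]] determines_PiM[OF fin]]])
    show "(\<lambda>_. 0) \<in> ?\<Theta>2" by (rule range_eqI[of _ _ "\<lambda>_. 0"]) auto
    show "(\<lambda>x. - \<theta> x) \<in> ?\<Theta>2" if "\<theta> \<in> ?\<Theta>2" for \<theta>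
    proof -
      from that obtain t where "\<theta> = (\<lambda>x. \<Sum>i\<in>{..<nr}\<times>J. Re (t i * x i))" by auto
      then show ?thesis by (intro range_eqI[of _ _ "\<lambda>i. - t i"]) (auto simp: fun_eq_iff simp flip: sum_negf)
    qed
    show "finite_measure ?L"
      by (rule prob_space.finite_measure, rule prob_space_distr) measurable
    show "finite_measure (?A \<Otimes>\<^sub>M ?B)" by (rule AB.P.finite_measure_axioms)
    show "sets ?L = sets (PiM {..<nr} (\<lambda>_. borel) \<Otimes>\<^sub>M PiM ({..<nr} \<times> J) (\<lambda>_. borel))" by simp
    show "sets (?A \<Otimes>\<^sub>M ?B) = sets (PiM {..<nr} (\<lambda>_. borel) \<Otimes>\<^sub>M PiM ({..<nr} \<times> J) (\<lambda>_. borel))"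
      by (intro sets_pair_measure_cong) auto
    fix \<theta> :: "(nat \<Rightarrow> complex) \<times> (nat \<times> nat \<Rightarrow> complex) \<Rightarrow> real"
    assume "\<theta> \<in> {\<lambda>(x, y). \<theta>1 x + \<theta>2 y |\<theta>1 \<theta>2. \<theta>1 \<in> ?\<Theta>1 \<and> \<theta>2 \<in> ?\<Theta>2}"
    then obtain \<theta>1 \<theta>2 where th0: "\<theta> = (\<lambda>(x, y). \<theta>1 x + \<theta>2 y)" "\<theta>1 \<in> ?\<Theta>1" "\<theta>2 \<in> ?\<Theta>2" by (auto simp del: times_complex.sel)
    then obtain u t where "\<theta>1 = (\<lambda>x. \<Sum>m<nr. Re (u m * x m))" "\<theta>2 = (\<lambda>x. \<Sum>mj\<in>{..<nr}\<times>J. Re (t mj * x mj))" by blast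
    with th0(1) have th: "\<theta> = (\<lambda>p. (\<Sum>m<nr. Re (u m * fst p m)) + (\<Sum>mj\<in>{..<nr}\<times>J. Re (t mj * snd p mj)))"
      by (auto simp: fun_eq_iff simp del: times_complex.sel)
    define g where "g m = (\<lambda>i. \<Sum>j\<in>J. t (m, j) * f j i)" for m
    have gp: "herm nt \<Sigma> (g m) p = 0" for m
      unfolding g_def herm_sum_left using orth by simp
    have pg: "herm nt \<Sigma> p (g m) = 0" for m
      using herm_cnj[OF hm, where y=p and x="g m"] gp by simp
    have m1: "(\<lambda>x. iexp (\<Sum>m<nr. Re (u m * x m))) \<in> borel_measurable (PiM {..<nr} (\<lambda>_. borel))" by measurable
    have m2: "(\<lambda>x. iexp (\<Sum>mj\<in>{..<nr}\<times>J. Re (t mj * x mj))) \<in> borel_measurable (PiM ({..<nr} \<times> J) (\<lambda>_. borel))" by measurable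
    let ?f = "\<lambda>p. iexp (\<Sum>m<nr. Re (u m * fst p m)) * iexp (\<Sum>mj\<in>{..<nr}\<times>J. Re (t mj * snd p mj))"
    have f\<theta>: "iexp (\<theta> p) = ?f p" for p
      unfolding th of_real_add distrib_left exp_add ..
    have fm: "?f \<in> borel_measurable (PiM {..<nr} (\<lambda>_. borel) \<Otimes>\<^sub>M PiM ({..<nr} \<times> J) (\<lambda>_. borel))"
      by (rule borel_measurable_times[OF measurable_compose[OF measurable_fst m1] measurable_compose[OF measurable_snd m2]])
    have WR: "(\<lambda>\<omega>. (W_of p \<omega>, R_of J f \<omega>)) \<in> measurable P (PiM {..<nr} (\<lambda>_. borel) \<Otimes>\<^sub>M PiM ({..<nr} \<times> J) (\<lambda>_. borel))"
      by (rule measurable_Pair[OF W_of_measurable R_of_measurable])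
    have "(\<integral>x. iexp (\<theta> x) \<partial>?L) = (\<integral>\<omega>. ?f (W_of p \<omega>, R_of J f \<omega>) \<partial>P)"
      unfolding f\<theta> by (rule integral_distr[OF WR fm])
    also have "\<dots> = (\<integral>\<omega>. iexp (\<Sum>m<nr. Re (lin nt H (\<lambda>i. u m * p i + g m i) \<omega> m)) \<partial>P)"
      unfolding g_def W_R_phase[OF J, symmetric] of_real_add distrib_left exp_add fst_conv snd_conv ..
    also have "\<dots> = exp (- (\<Sum>m<nr. Re (herm nt \<Sigma> (\<lambda>i. u m * p i + g m i) (\<lambda>i. u m * p i + g m i))) / 4)"
      by (rule H_char)
    also have "\<dots> = exp (- (\<Sum>m<nr. Re (herm nt \<Sigma> (\<lambda>i. u m * p i) (\<lambda>i. u m * p i))) / 4)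
        * exp (- (\<Sum>m<nr. Re (herm nt \<Sigma> (g m) (g m))) / 4)"
      unfolding herm_add_left herm_add_right herm_scale_left herm_scale_right gp pg
      by (simp only: of_real_mult[symmetric] exp_add[symmetric] mult_zero_right add_0_left add_0_right plus_complex.sel sum.distrib
           minus_add_distrib add_divide_distrib)
    also have "\<dots> = (\<integral>\<omega>. iexp (\<Sum>m<nr. Re (lin nt H (\<lambda>i. u m * p i) \<omega> m)) \<partial>P) * (\<integral>\<omega>. iexp (\<Sum>m<nr. Re (lin nt H (g m) \<omega> m)) \<partial>P)"
      unfolding H_char by simp
    also have "(\<integral>\<omega>. iexp (\<Sum>m<nr. Re (lin nt H (\<lambda>i. u m * p i) \<omega> m)) \<partial>P) = (\<integral>x. iexp (\<Sum>m<nr. Re (u m * x m)) \<partial>?A)"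
      unfolding integral_distr[OF W_of_measurable m1]
      by (intro Bochner_Integration.integral_cong refl arg_cong[of _ _ iexp] sum.cong)
         (simp add: W_of_def lin_def sum_distrib_left mult_ac del: times_complex.sel)
    also have "(\<integral>\<omega>. iexp (\<Sum>m<nr. Re (lin nt H (g m) \<omega> m)) \<partial>P) = (\<integral>x. iexp (\<Sum>mj\<in>{..<nr}\<times>J. Re (t mj * x mj)) \<partial>?B)"
      unfolding integral_distr[OF R_of_measurable m2]
    proof (intro Bochner_Integration.integral_cong refl arg_cong[of _ _ iexp])
      fix \<omega>
      have "(\<Sum>m<nr. Re (0 * W_of p \<omega> m)) + (\<Sum>mj\<in>{..<nr}\<times>J. Re (t mj * R_of J f \<omega> mj)) =
        (\<Sum>m<nr. Re (lin nt H (\<lambda>i. 0 * p i + g m i) \<omega> m))"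
        unfolding g_def by (rule W_R_phase[OF J])
      then show "(\<Sum>m<nr. Re (lin nt H (g m) \<omega> m)) = (\<Sum>mj\<in>{..<nr}\<times>J. Re (t mj * R_of J f \<omega> mj))"
        by (simp only: mult_zero_left zero_complex.sel sum.neutral_const add_0_left)
    qed
    also have "(\<integral>x. iexp (\<Sum>m<nr. Re (u m * x m)) \<partial>?A) * (\<integral>x. iexp (\<Sum>mj\<in>{..<nr}\<times>J. Re (t mj * x mj)) \<partial>?B)
       = (\<integral>x. \<integral>y. iexp (\<Sum>m<nr. Re (u m * x m)) * iexp (\<Sum>mj\<in>{..<nr}\<times>J. Re (t mj * y mj)) \<partial>?B \<partial>?A)"
      by (simp only: integral_mult_right_zero integral_mult_left_zero)
    also have "\<dots> = (\<integral>p. iexp (\<Sum>m<nr. Re (u m * fst p m)) * iexp (\<Sum>mj\<in>{..<nr}\<times>J. Re (t mj * snd p mj)) \<partial>(?A \<Otimes>\<^sub>M ?B))"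
    proof -
      have "?f \<in> borel_measurable (?A \<Otimes>\<^sub>M ?B)"
        by (rule borel_measurable_times[OF measurable_compose[OF measurable_fst] measurable_compose[OF measurable_snd]];
            simp only: measurable_distr_eq1 m1 m2)
      moreover have "AE p in ?A \<Otimes>\<^sub>M ?B. norm (?f p) \<le> 1"
        by (rule AE_I2) (simp only: norm_mult norm_exp_i_times mult_1 order_refl)
      ultimately have "integrable (?A \<Otimes>\<^sub>M ?B) ?f"
        by (intro AB.P.integrable_const_bound)
      from AB.integral_fst'[OF this] show ?thesis by (simp only: fst_conv snd_conv)
    qed
    also have "\<dots> = (\<integral>x. iexp (\<theta> x) \<partial>(?A \<Otimes>\<^sub>M ?B))" unfolding f\<theta> ..
    finally show "(\<integral>x. iexp (\<theta> x) \<partial>?L) = (\<integral>x. iexp (\<theta> x) \<partial>(?A \<Otimes>\<^sub>M ?B))" .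
  qed
qed

end

section \<open>Moments and concentration for circular Gaussian coordinates\<close>

lemma iid_cgauss_linear:
  assumes "iid_cgauss N \<tau> \<mu>"
  shows "distr \<mu> borel (\<lambda>x. Re (\<Sum>m<N. v m * x m)) = gauss (\<tau> * (\<Sum>m<N. (cmod (v m))\<^sup>2) / 2)"
proof -
  have p: "prob_space \<mu>" and s[measurable_cong]: "sets \<mu> = sets (PiM {..<N} (\<lambda>_. borel))" and t: "0 \<le> \<tau>"
    and ch: "(\<integral>x. iexp (\<Sum>m<N. Re (u m * x m)) \<partial>\<mu>) = exp (- \<tau> * (\<Sum>m<N. (cmod (u m))\<^sup>2) / 4)" for u
    using assms by (auto simp: iid_cgauss_def)
  interpret prob_space \<mu> by fact
  have m: "(\<lambda>x. Re (\<Sum>m<N. v m * x m)) \<in> borel_measurable \<mu>" by measurable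
  show ?thesis
  proof (rule Levy_uniqueness)
    show "real_distribution (distr \<mu> borel (\<lambda>x. Re (\<Sum>m<N. v m * x m)))"
      by (rule real_distribution_distr) (rule m)
    show "real_distribution (gauss (\<tau> * (\<Sum>m<N. (cmod (v m))\<^sup>2) / 2))" by (rule real_distribution_gauss)
    show "char (distr \<mu> borel (\<lambda>x. Re (\<Sum>m<N. v m * x m))) = char (gauss (\<tau> * (\<Sum>m<N. (cmod (v m))\<^sup>2) / 2))"
    proof
      fix r :: real
      have "char (distr \<mu> borel (\<lambda>x. Re (\<Sum>m<N. v m * x m))) r = (\<integral>x. iexp (r * Re (\<Sum>m<N. v m * x m)) \<partial>\<mu>)"
        unfolding char_def by (rule integral_distr) (use m in auto)
      also have "\<dots> = (\<integral>x. iexp (\<Sum>m<N. Re ((r * v m) * x m)) \<partial>\<mu>)"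
        by (simp add: sum_distrib_left algebra_simps)
      also have "\<dots> = exp (- \<tau> * (\<Sum>m<N. (cmod (r * v m))\<^sup>2) / 4)" unfolding ch ..
      also have "(\<Sum>m<N. (cmod (r * v m))\<^sup>2) = r\<^sup>2 * (\<Sum>m<N. (cmod (v m))\<^sup>2)"
        by (simp add: norm_mult power_mult_distrib sum_distrib_left)
      also have "exp (- \<tau> * (r\<^sup>2 * (\<Sum>m<N. (cmod (v m))\<^sup>2)) / 4) = char (gauss (\<tau> * (\<Sum>m<N. (cmod (v m))\<^sup>2) / 2)) r"
        using t by (subst char_gauss) (auto simp: sum_nonneg mult_ac)
      finally show "char (distr \<mu> borel (\<lambda>x. Re (\<Sum>m<N. v m * x m))) r = char (gauss (\<tau> * (\<Sum>m<N. (cmod (v m))\<^sup>2) / 2)) r" .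
    qed
  qed
qed

lemma iid_cgauss_moments:
  assumes "iid_cgauss N \<tau> \<mu>"
  defines "q \<equiv> \<lambda>v. \<tau> * (\<Sum>m<N. (cmod (v m))\<^sup>2) / 2"
  shows "(\<integral>x. (Re (\<Sum>m<N. v m * x m))\<^sup>2 \<partial>\<mu>) = q v"
    "(\<integral>x. (Re (\<Sum>m<N. v m * x m)) ^ 4 \<partial>\<mu>) = 3 * (q v)\<^sup>2"
    "integrable \<mu> (\<lambda>x. (Re (\<Sum>m<N. v m * x m)) ^ k)"
proof -
  have s[measurable_cong]: "sets \<mu> = sets (PiM {..<N} (\<lambda>_. borel))" and t: "0 \<le> \<tau>"
    using assms by (auto simp: iid_cgauss_def)
  have m: "(\<lambda>x. Re (\<Sum>m<N. v m * x m)) \<in> borel_measurable \<mu>" by measurable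
  have law: "distr \<mu> borel (\<lambda>x. Re (\<Sum>m<N. v m * x m)) = gauss (q v)"
    unfolding q_def by (rule iid_cgauss_linear[OF assms(1)])
  have q: "0 \<le> q v" unfolding q_def using t by (simp add: sum_nonneg)
  show "(\<integral>x. (Re (\<Sum>m<N. v m * x m))\<^sup>2 \<partial>\<mu>) = q v" "(\<integral>x. (Re (\<Sum>m<N. v m * x m)) ^ 4 \<partial>\<mu>) = 3 * (q v)\<^sup>2"
    using gauss_moments[OF q] unfolding law[symmetric] by (simp_all add: integral_distr m)
  show "integrable \<mu> (\<lambda>x. (Re (\<Sum>m<N. v m * x m)) ^ k)"
    using gauss_moments(1)[OF q, of k] unfolding law[symmetric] by (simp add: integrable_distr_eq m)
qed

text \<open>On the hyperplane the real part of the linear form is constant, while its law is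
  Gaussian with positive variance \<open>\<tau> / 2\<close> and has no atoms.\<close>

lemma iid_cgauss_null_hyperplane:
  assumes "iid_cgauss N \<tau> \<mu>" "0 < \<tau>" "(\<Sum>m<N. (cmod (v m))\<^sup>2) = 1"
  shows "measure \<mu> {x\<in>space \<mu>. (\<Sum>m<N. v m * x m) = c} = 0"
proof -
  have p: "prob_space \<mu>" and s[measurable_cong]: "sets \<mu> = sets (PiM {..<N} (\<lambda>_. borel))"
    using assms by (auto simp: iid_cgauss_def)
  interpret prob_space \<mu> by fact
  have m[measurable]: "(\<lambda>x. Re (\<Sum>m<N. v m * x m)) \<in> borel_measurable \<mu>" by measurable
  have "measure \<mu> {x\<in>space \<mu>. (\<Sum>m<N. v m * x m) = c} \<le> measure \<mu> ((\<lambda>x. Re (\<Sum>m<N. v m * x m)) -` {Re c} \<inter> space \<mu>)"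
    by (rule finite_measure_mono) (auto intro!: measurable_sets[OF m])
  also have "\<dots> = measure (gauss (\<tau> * (\<Sum>m<N. (cmod (v m))\<^sup>2) / 2)) {Re c}"
    unfolding iid_cgauss_linear[OF assms(1), symmetric] by (rule measure_distr[symmetric]) (use m in auto)
  also have "\<dots> = 0" using assms by (intro gauss_null_singleton) simp
  finally show ?thesis by (simp add: measure_le_0_iff)
qed

text \<open>The covariance of \<open>X\<^sup>2\<close> and \<open>Y\<^sup>2\<close> is read off from the fourth moments of \<open>X + Y\<close> and \<open>X - Y\<close>.\<close>

lemma iid_cgauss_square_moment:
  assumes g: "iid_cgauss N \<tau> \<mu>"
    and u: "(\<Sum>m<N. (cmod (u m))\<^sup>2) = 1" and v: "(\<Sum>m<N. (cmod (v m))\<^sup>2) = 1"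
    and uv: "(\<Sum>m<N. Re (cnj (u m) * v m)) = 0"
  shows "integrable \<mu> (\<lambda>x. (Re (\<Sum>m<N. u m * x m))\<^sup>2 * (Re (\<Sum>m<N. v m * x m))\<^sup>2)"
    "(\<integral>x. (Re (\<Sum>m<N. u m * x m))\<^sup>2 * (Re (\<Sum>m<N. v m * x m))\<^sup>2 \<partial>\<mu>) = \<tau>\<^sup>2 / 4"
proof -
  define X where "X = (\<lambda>x. Re (\<Sum>m<N. u m * x m))"
  define Y where "Y = (\<lambda>x. Re (\<Sum>m<N. v m * x m))"
  have n: "(\<Sum>m<N. (cmod (u m + s * v m))\<^sup>2) = 2" if "s = 1 \<or> s = -1" for s :: real
  proof -
    have "(cmod (u m + s * v m))\<^sup>2 = (cmod (u m))\<^sup>2 + (cmod (v m))\<^sup>2 + 2 * s * Re (cnj (u m) * v m)" for m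
      using that unfolding cmod_power2 by (auto simp: power2_eq_square algebra_simps)
    then have "(\<Sum>m<N. (cmod (u m + s * v m))\<^sup>2) = 1 + 1 + 2 * s * (\<Sum>m<N. Re (cnj (u m) * v m))"
      by (simp add: sum.distrib u v flip: sum_distrib_left)
    then show ?thesis by (simp only: uv)
  qed
  have lin: "Re (\<Sum>m<N. (u m + complex_of_real s * v m) * x m) = X x + s * Y x" for x s
    unfolding X_def Y_def Re_sum sum_distrib_left sum.distrib[symmetric]
    by (intro sum.cong) (auto simp: algebra_simps)
  have M: "(\<integral>x. (X x + s * Y x) ^ 4 \<partial>\<mu>) = 3 * \<tau>\<^sup>2" "integrable \<mu> (\<lambda>x. (X x + s * Y x) ^ 4)" if "s = 1 \<or> s = -1" for s :: real
    using iid_cgauss_moments(2)[OF g, of "\<lambda>m. u m + s * v m"] iid_cgauss_moments(3)[OF g, of "\<lambda>m. u m + s * v m" 4]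
    unfolding lin n[OF that] by auto
  have X4: "(\<integral>x. X x ^ 4 \<partial>\<mu>) = 3 * \<tau>\<^sup>2 / 4" "integrable \<mu> (\<lambda>x. X x ^ 4)"
    and Y4: "(\<integral>x. Y x ^ 4 \<partial>\<mu>) = 3 * \<tau>\<^sup>2 / 4" "integrable \<mu> (\<lambda>x. Y x ^ 4)"
    using iid_cgauss_moments(2,3)[OF g, where v=u] iid_cgauss_moments(2,3)[OF g, where v=v]
    unfolding X_def Y_def u v by (simp_all add: power_divide)
  have Xx: "Re (\<Sum>m<N. u m * x m) = X x" and Yx: "Re (\<Sum>m<N. v m * x m) = Y x" for x
    by (simp_all only: X_def Y_def)
  \<comment> \<open>The variances are \<open>\<tau> / 2\<close> for \<open>X\<close> and
    \<open>Y\<close> and \<open>\<tau>\<close> for \<open>X + Y\<close> and \<open>X - Y\<close>.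
    The fourth moments thus contribute \<open>(3 + 3 - 3/2 - 3/2) / 12 = 1/4\<close> times
    \<open>\<tau>\<^sup>2\<close>.\<close>
  have e: "(X x)\<^sup>2 * (Y x)\<^sup>2 = ((X x + 1 * Y x) ^ 4 + (X x + (-1) * Y x) ^ 4 - 2 * X x ^ 4 - 2 * Y x ^ 4) / 12" for x
    by (simp add: power4_eq_xxxx power2_eq_square algebra_simps)
  have i1: "integrable \<mu> (\<lambda>x. (X x + 1 * Y x) ^ 4)" and i2: "integrable \<mu> (\<lambda>x. (X x + (-1) * Y x) ^ 4)"
    and v1: "(\<integral>x. (X x + 1 * Y x) ^ 4 \<partial>\<mu>) = 3 * \<tau>\<^sup>2" and v2: "(\<integral>x. (X x + (-1) * Y x) ^ 4 \<partial>\<mu>) = 3 * \<tau>\<^sup>2"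
    by (rule M; simp)+
  have lin4: "integrable \<mu> (\<lambda>x. (A x + B x - 2 * C x - 2 * D x) / 12)"
    "(\<integral>x. (A x + B x - 2 * C x - 2 * D x) / 12 \<partial>\<mu>) = ((\<integral>x. A x \<partial>\<mu>) + (\<integral>x. B x \<partial>\<mu>) - 2 * (\<integral>x. C x \<partial>\<mu>) - 2 * (\<integral>x. D x \<partial>\<mu>)) / 12"
    if "integrable \<mu> A" "integrable \<mu> B" "integrable \<mu> C" "integrable \<mu> D" for A B C D :: "_ \<Rightarrow> real"
    using that by simp_all
  have "integrable \<mu> (\<lambda>x. ((X x + 1 * Y x) ^ 4 + (X x + (-1) * Y x) ^ 4 - 2 * X x ^ 4 - 2 * Y x ^ 4) / 12)"
    by (rule lin4(1)[OF i1 i2 X4(2) Y4(2)])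
  moreover have "(\<integral>x. ((X x + 1 * Y x) ^ 4 + (X x + (-1) * Y x) ^ 4 - 2 * X x ^ 4 - 2 * Y x ^ 4) / 12 \<partial>\<mu>) = \<tau>\<^sup>2 / 4"
    unfolding lin4(2)[OF i1 i2 X4(2) Y4(2)] v1 v2 X4(1) Y4(1) by (simp add: field_simps)
  ultimately show "integrable \<mu> (\<lambda>x. (Re (\<Sum>m<N. u m * x m))\<^sup>2 * (Re (\<Sum>m<N. v m * x m))\<^sup>2)"
    "(\<integral>x. (Re (\<Sum>m<N. u m * x m))\<^sup>2 * (Re (\<Sum>m<N. v m * x m))\<^sup>2 \<partial>\<mu>) = \<tau>\<^sup>2 / 4"
    unfolding Xx Yx e by (simp_all only:)
qed

text \<open>The projection onto \<open>d\<close> orthonormal vectors has squared norm equal to a sum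
  of \<open>2 * d\<close> squared real Gaussian forms. These squares have pairwise zero covariance,
  so the variance is linear in \<open>d\<close> and Chebyshev's inequality applies.\<close>

lemma iid_cgauss_projection:
  fixes d :: nat and \<tau> :: real
  assumes g: "iid_cgauss N \<tau> \<mu>" and e: "0 < e"
    and on: "\<And>i j. i < d \<Longrightarrow> j < d \<Longrightarrow> (\<Sum>m<N. cnj (v i m) * v j m) = (if i = j then 1 else 0)"
  shows "measure \<mu> {x\<in>space \<mu>. e \<le> \<bar>(\<Sum>i<d. (cmod (\<Sum>m<N. cnj (v i m) * x m))\<^sup>2) - d * \<tau>\<bar>} \<le> d * \<tau>\<^sup>2 / e\<^sup>2"
proof -
  have p: "prob_space \<mu>" and s[measurable_cong]: "sets \<mu> = sets (PiM {..<N} (\<lambda>_. borel))"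
    using g by (auto simp: iid_cgauss_def)
  interpret prob_space \<mu> by fact
  \<comment> \<open>Each complex coefficient is split into two real ones. The flag
    \<open>True\<close> stands for the imaginary part, obtained as a real part after multiplication
    by \<open>- \<i>\<close>, so all \<open>2 * d\<close> forms have the shape required by the
    moment lemmas.\<close>
  define A where "A = {..<d} \<times> (UNIV :: bool set)"
  have finA[simp]: "finite A" and cardA: "card A = 2 * d" by (simp_all add: A_def card_cartesian_product)
  define u where "u a m = (if snd a then - \<i> else 1) * cnj (v (fst a) m)" for a :: "nat \<times> bool" and m
  define X where "X a x = Re (\<Sum>m<N. u a m * x m)" for a x
  have [measurable]: "X a \<in> borel_measurable \<mu>" for a unfolding X_def by measurable
  have D: "(\<Sum>i<d. (cmod (\<Sum>m<N. cnj (v i m) * x m))\<^sup>2) = (\<Sum>a\<in>A. (X a x)\<^sup>2)" for x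
  proof -
    have 1: "X (i, False) x = Re (\<Sum>m<N. cnj (v i m) * x m)" for i
      by (simp add: X_def u_def)
    have "X (i, True) x = Re (- \<i> * (\<Sum>m<N. cnj (v i m) * x m))" for i
      unfolding X_def u_def sum_distrib_left by (simp add: mult.assoc)
    then have 2: "X (i, True) x = Im (\<Sum>m<N. cnj (v i m) * x m)" for i by simp
    show ?thesis unfolding A_def sum_Times cmod_power2 1[symmetric] 2[symmetric]
      by (simp add: UNIV_bool add.commute)
  qed
  have nrm: "(\<Sum>m<N. (cmod (u a m))\<^sup>2) = 1" if "a \<in> A" for a
  proof -
    have "fst a < d" using that by (auto simp: A_def)
    from on[OF this this] have "complex_of_real (\<Sum>m<N. (cmod (v (fst a) m))\<^sup>2) = 1"
      by (simp only: of_real_sum complex_norm_square mult.commute) simp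
    then have "(\<Sum>m<N. (cmod (v (fst a) m))\<^sup>2) = 1" using of_real_eq_1_iff by blast
    then show ?thesis by (simp add: u_def norm_mult cong: if_cong)
  qed
  have orth: "(\<Sum>m<N. Re (cnj (u a m) * u b m)) = 0" if "a \<in> A" "b \<in> A" "a \<noteq> b" for a b
  proof -
    define k where "k = cnj (if snd a then - \<i> else 1) * (if snd b then - \<i> else 1 :: complex)"
    have "(\<Sum>m<N. Re (cnj (u a m) * u b m)) = Re (k * (\<Sum>m<N. cnj (v (fst b) m) * v (fst a) m))"
      unfolding Re_sum[symmetric] sum_distrib_left by (intro arg_cong[of _ _ Re] sum.cong) (auto simp: u_def k_def)
    also have "\<dots> = 0"
    proof (cases "fst a = fst b")
      case True
      then have "snd a \<noteq> snd b" using that(3) by (auto simp: prod_eq_iff)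
      then show ?thesis using that on[of "fst b" "fst a"] True by (auto simp: k_def A_def)
    next
      case False
      then have "(\<Sum>m<N. cnj (v (fst b) m) * v (fst a) m) = 0" using that on[of "fst b" "fst a"] by (auto simp: A_def)
      then show ?thesis by (simp only: mult_zero_right zero_complex.sel)
    qed
    finally show ?thesis .
  qed
  have m2: "(\<integral>x. (X a x)\<^sup>2 \<partial>\<mu>) = \<tau> / 2" "integrable \<mu> (\<lambda>x. (X a x)\<^sup>2)" "integrable \<mu> (\<lambda>x. (X a x) ^ 4)"
      "(\<integral>x. (X a x) ^ 4 \<partial>\<mu>) = 3 * \<tau>\<^sup>2 / 4" if "a \<in> A" for a
    using iid_cgauss_moments[OF g, where v="u a"] nrm[OF that] unfolding X_def by (auto simp: power_divide)
  have prod: "integrable \<mu> (\<lambda>x. (X a x)\<^sup>2 * (X b x)\<^sup>2)"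
     "(\<integral>x. (X a x)\<^sup>2 * (X b x)\<^sup>2 \<partial>\<mu>) = (if a = b then 3 * \<tau>\<^sup>2 / 4 else \<tau>\<^sup>2 / 4)" if "a \<in> A" "b \<in> A" for a b
  proof -
    have q: "y\<^sup>2 * y\<^sup>2 = y ^ 4" for y :: real by (simp add: power4_eq_xxxx power2_eq_square)
    show "integrable \<mu> (\<lambda>x. (X a x)\<^sup>2 * (X b x)\<^sup>2)"
     "(\<integral>x. (X a x)\<^sup>2 * (X b x)\<^sup>2 \<partial>\<mu>) = (if a = b then 3 * \<tau>\<^sup>2 / 4 else \<tau>\<^sup>2 / 4)"
      using iid_cgauss_square_moment[OF g nrm[OF that(1)] nrm[OF that(2)] orth[OF that]] m2[OF that(1)]
      by (cases "a = b"; simp add: X_def q)+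
  qed
  define Z where "Z x = (\<Sum>a\<in>A. (X a x)\<^sup>2)" for x
  have Zm[measurable]: "Z \<in> borel_measurable \<mu>" unfolding Z_def by measurable
  have EZ: "expectation Z = d * \<tau>"
    unfolding Z_def by (simp add: m2 cardA)
  have Z2: "(Z x)\<^sup>2 = (\<Sum>a\<in>A. \<Sum>b\<in>A. (X a x)\<^sup>2 * (X b x)\<^sup>2)" for x
    unfolding Z_def power2_eq_square[of "sum _ _"] sum_product by simp
  have iZ: "integrable \<mu> Z" unfolding Z_def by (rule Bochner_Integration.integrable_sum) (use m2 in auto)
  have iZ2: "integrable \<mu> (\<lambda>x. (Z x)\<^sup>2)"
    unfolding Z2 by (intro Bochner_Integration.integrable_sum prod)
  have "expectation (\<lambda>x. (Z x)\<^sup>2) = (\<Sum>a\<in>A. \<Sum>b\<in>A. \<integral>x. (X a x)\<^sup>2 * (X b x)\<^sup>2 \<partial>\<mu>)"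
  proof -
    have "expectation (\<lambda>x. (Z x)\<^sup>2) = (\<Sum>a\<in>A. \<integral>x. (\<Sum>b\<in>A. (X a x)\<^sup>2 * (X b x)\<^sup>2) \<partial>\<mu>)"
      unfolding Z2 by (intro Bochner_Integration.integral_sum Bochner_Integration.integrable_sum prod)
    also have "\<dots> = (\<Sum>a\<in>A. \<Sum>b\<in>A. \<integral>x. (X a x)\<^sup>2 * (X b x)\<^sup>2 \<partial>\<mu>)"
      by (intro sum.cong refl Bochner_Integration.integral_sum prod)
    finally show ?thesis .
  qed
  \<comment> \<open>All \<open>(2 * d)\<^sup>2\<close> pairs contribute
    \<open>\<tau>\<^sup>2 / 4\<close>, which sums to the squared mean. The \<open>2 * d\<close>
    diagonal pairs contribute \<open>\<tau>\<^sup>2 / 2\<close> in addition, and this surplus is the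
    variance.\<close>
  also have "\<dots> = (\<Sum>a\<in>A. \<Sum>b\<in>A. \<tau>\<^sup>2 / 4 + (if a = b then \<tau>\<^sup>2 / 2 else 0))"
    by (intro sum.cong refl) (auto simp: prod)
  also have "\<dots> = (d * \<tau>)\<^sup>2 + d * \<tau>\<^sup>2"
    by (simp add: sum.distrib cardA power2_eq_square algebra_simps)
  finally have var: "variance Z = d * \<tau>\<^sup>2" using variance_eq[OF iZ iZ2] EZ by simp
  have "measure \<mu> {x\<in>space \<mu>. e \<le> \<bar>Z x - expectation Z\<bar>} \<le> variance Z / e\<^sup>2"
    by (rule Chebyshev_inequality[OF _ iZ2 e]) measurable
  then show ?thesis using var unfolding EZ D Z_def[symmetric] by simp
qed

section \<open>Linear algebra\<close>

lemma det_eq_0_iff_kernel: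
  fixes B :: "nat \<Rightarrow> nat \<Rightarrow> complex"
  shows "Determinant.det (Matrix.mat N N (\<lambda>(i, j). B i j)) = 0 \<longleftrightarrow>
    (\<exists>x. (\<exists>m<N. x m \<noteq> 0) \<and> (\<forall>i<N. (\<Sum>m<N. B i m * x m) = 0))"
proof -
  let ?A = "Matrix.mat N N (\<lambda>(i, j). B i j)"
  have mv: "(?A *\<^sub>v v) $ i = (\<Sum>m<N. B i m * v $ m)" if "v \<in> carrier_vec N" "i < N" for v i
    using that by (auto simp: scalar_prod_def atLeast0LessThan intro!: sum.cong)
  have "Determinant.det ?A = 0 \<longleftrightarrow> (\<exists>v. v \<in> carrier_vec N \<and> v \<noteq> 0\<^sub>v N \<and> ?A *\<^sub>v v = 0\<^sub>v N)"
    by (rule det_0_iff_vec_prod_zero_field) simp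
  also have "\<dots> \<longleftrightarrow> (\<exists>x. (\<exists>m<N. x m \<noteq> 0) \<and> (\<forall>i<N. (\<Sum>m<N. B i m * x m) = 0))"
  proof
    assume "\<exists>v. v \<in> carrier_vec N \<and> v \<noteq> 0\<^sub>v N \<and> ?A *\<^sub>v v = 0\<^sub>v N"
    then obtain v where v: "v \<in> carrier_vec N" "v \<noteq> 0\<^sub>v N" "?A *\<^sub>v v = 0\<^sub>v N" by blast
    have "\<exists>m<N. v $ m \<noteq> 0" using v(1,2) by (metis carrier_vecD eq_vecI index_zero_vec(1) index_zero_vec(2))
    moreover have "\<forall>i<N. (\<Sum>m<N. B i m * v $ m) = 0" using mv[OF v(1)] v(3) by (metis index_zero_vec(1))
    ultimately show "\<exists>x. (\<exists>m<N. x m \<noteq> 0) \<and> (\<forall>i<N. (\<Sum>m<N. B i m * x m) = 0)" by blast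
  next
    assume "\<exists>x. (\<exists>m<N. x m \<noteq> 0) \<and> (\<forall>i<N. (\<Sum>m<N. B i m * x m) = 0)"
    then obtain x where x: "\<exists>m<N. x m \<noteq> 0" "\<forall>i<N. (\<Sum>m<N. B i m * x m) = 0" by blast
    have "?A *\<^sub>v Matrix.vec N x = 0\<^sub>v N"
      by (rule eq_vecI) (use x(2) mv[of "Matrix.vec N x"] in auto)
    moreover have "Matrix.vec N x \<noteq> 0\<^sub>v N" using x(1) by (metis index_vec index_zero_vec(1))
    ultimately show "\<exists>v. v \<in> carrier_vec N \<and> v \<noteq> 0\<^sub>v N \<and> ?A *\<^sub>v v = 0\<^sub>v N"
      by (intro exI[of _ "Matrix.vec N x"]) simp
  qed
  finally show ?thesis .
qed

text \<open>A matrix and its transpose have the same determinant. This replaces dimension counting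
  below: a visible null vector on one side yields a linear dependence on the other.\<close>

lemma kernel_transpose:
  fixes B :: "nat \<Rightarrow> nat \<Rightarrow> complex"
  assumes "\<exists>x. (\<exists>m<N. x m \<noteq> 0) \<and> (\<forall>i<N. (\<Sum>m<N. B i m * x m) = 0)"
  shows "\<exists>c. (\<exists>i<N. c i \<noteq> 0) \<and> (\<forall>m<N. (\<Sum>i<N. c i * B i m) = 0)"
proof -
  have "Determinant.det (Matrix.mat N N (\<lambda>(i, j). B i j)) = 0" using assms det_eq_0_iff_kernel by blast
  moreover have "transpose_mat (Matrix.mat N N (\<lambda>(i, j). B i j)) = Matrix.mat N N (\<lambda>(i, j). B j i)" by auto
  ultimately have "Determinant.det (Matrix.mat N N (\<lambda>(i, j). B j i)) = 0"
    using det_transpose[of "Matrix.mat N N (\<lambda>(i, j). B i j)" N] by simp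
  then show ?thesis unfolding det_eq_0_iff_kernel by (simp add: mult.commute)
qed

text \<open>The given vectors, padded by zero columns, form an \<open>N\<close> by \<open>N\<close>
  matrix whose last column vanishes because \<open>card J < N\<close>. The last unit vector is then
  in the kernel, and a null vector of the transpose, conjugated and normalised, is the one
  sought.\<close>

lemma orthogonal_vector_exists:
  fixes r :: "'j \<Rightarrow> nat \<Rightarrow> complex"
  assumes J: "finite J" "card J < N"
  shows "\<exists>v. (\<Sum>m<N. (cmod (v m))\<^sup>2) = 1 \<and> (\<forall>j\<in>J. (\<Sum>m<N. cnj (v m) * r j m) = 0)"
proof -
  obtain h where h: "bij_betw h {0..<card J} J" using ex_bij_betw_nat_finite[OF J(1)] by blast
  define B where "B i m = (if m < card J then r (h m) i else 0)" for i m
  have "\<exists>c. (\<exists>i<N. c i \<noteq> 0) \<and> (\<forall>m<N. (\<Sum>i<N. c i * B i m) = 0)"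
  proof (rule kernel_transpose, intro exI[of _ "\<lambda>i. if i = N - 1 then 1 else 0"] conjI allI impI)
    show "\<exists>m<N. (if m = N - 1 then 1 else 0) \<noteq> (0::complex)" using J(2) by (intro exI[of _ "N-1"]) auto
    show "(\<Sum>m<N. B i m * (if m = N - 1 then 1 else 0)) = 0" for i
      using J(2) by (simp add: B_def if_distrib[of "\<lambda>x. _ * x"] sum.delta' cong: if_cong)
  qed
  then obtain c i0 where c: "i0 < N" "c i0 \<noteq> 0" "\<forall>m<N. (\<Sum>i<N. c i * B i m) = 0" by blast
  define s where "s = (\<Sum>m<N. (cmod (c m))\<^sup>2)"
  have "0 < s" unfolding s_def by (rule sum_pos2[of _ i0]) (use c in auto)
  then have s: "0 < sqrt s" by simp
  show ?thesis
  proof (intro exI[of _ "\<lambda>m. cnj (c m) / sqrt s"] conjI ballI)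
    have "(\<Sum>m<N. (cmod (cnj (c m) / sqrt s))\<^sup>2) = (\<Sum>m<N. (cmod (c m))\<^sup>2) / s"
      unfolding sum_divide_distrib using \<open>0 < s\<close> by (intro sum.cong) (simp_all add: norm_divide power_divide)
    then show "(\<Sum>m<N. (cmod (cnj (c m) / sqrt s))\<^sup>2) = 1" using \<open>0 < s\<close> by (simp add: s_def[symmetric])
    fix j assume "j \<in> J"
    then have "j \<in> h ` {0..<card J}" using h by (simp add: bij_betw_def)
    then obtain k where k: "k < card J" "h k = j" by auto
    then have "(\<Sum>i<N. c i * r j i) = 0" using c(3)[rule_format, of k] J(2) by (simp add: B_def)
    then have "(\<Sum>i<N. c i * r j i) / sqrt s = 0" by simp
    then show "(\<Sum>m<N. cnj (cnj (c m) / sqrt s) * r j m) = 0" by (simp add: sum_divide_distrib)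
  qed
qed

lemma sum_Plus: "finite A \<Longrightarrow> finite B \<Longrightarrow> (\<Sum>x\<in>A <+> B. f x) = (\<Sum>a\<in>A. f (Inl a)) + (\<Sum>b\<in>B. f (Inr b))"
  unfolding Plus_def by (subst sum.union_disjoint) (auto simp: sum.reindex inj_on_def)

lemma complex_sum_cmod2: "complex_of_real (\<Sum>m\<in>A. (cmod (v m))\<^sup>2) = (\<Sum>m\<in>A. cnj (v m) * v m)"
  by (simp only: of_real_sum complex_norm_square mult.commute)

lemma sum_cnj_swap: "(\<Sum>m\<in>A. cnj (v m) * u m) = cnj (\<Sum>m\<in>A. cnj (u m) * v m)"
  by (simp add: mult.commute)

lemma orth_sym: "(\<Sum>m\<in>A. cnj (v m) * u m) = 0 \<Longrightarrow> (\<Sum>m\<in>A. cnj (u m) * v m) = 0"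
  using sum_cnj_swap[of u v A] by (simp only: complex_cnj_zero)

lemma sum_mult_delta: "i < d \<Longrightarrow> (\<Sum>k<d. a k * (if i = k then 1 else 0)) = (a i :: complex)" for i d :: nat
  by (simp add: if_distrib[of "\<lambda>x. _ * x"] cong: if_cong)

text \<open>Each new vector is chosen orthogonal both to the family \<open>r\<close> and to the
  vectors already found. The disjoint sum \<open>J <+> {..<d}\<close> joins the two families under
  one index set.\<close>

lemma orthonormal_complement_exists:
  fixes r :: "'j \<Rightarrow> nat \<Rightarrow> complex"
  assumes J: "finite J" "card J + d \<le> N"
  shows "\<exists>v. (\<forall>i<d. \<forall>j<d. (\<Sum>m<N. cnj (v i m) * v j m) = (if i = j then 1 else 0)) \<and>
     (\<forall>i<d. \<forall>j\<in>J. (\<Sum>m<N. cnj (v i m) * r j m) = 0)"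
  using J(2)
proof (induction d)
  case (Suc d)
  then obtain v where v: "\<And>i j. i < d \<Longrightarrow> j < d \<Longrightarrow> (\<Sum>m<N. cnj (v i m) * v j m) = (if i = j then 1 else 0)"
    "\<And>i j. i < d \<Longrightarrow> j \<in> J \<Longrightarrow> (\<Sum>m<N. cnj (v i m) * r j m) = 0" by fastforce
  have "card (J <+> {..<d}) < N" using Suc.prems J(1) by (simp add: card_Plus)
  from orthogonal_vector_exists[OF _ this, of "case_sum r v"] J(1)
  obtain w where w: "(\<Sum>m<N. (cmod (w m))\<^sup>2) = 1"
    "\<And>x. x \<in> J <+> {..<d} \<Longrightarrow> (\<Sum>m<N. cnj (w m) * case_sum r v x m) = 0" by auto
  have wr: "(\<Sum>m<N. cnj (w m) * r j m) = 0" if "j \<in> J" for j using w(2)[OF InlI[OF that]] by simp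
  have wv: "(\<Sum>m<N. cnj (w m) * v i m) = 0" if "i < d" for i using w(2)[of "Inr i"] that by (simp add: InrI)
  have vw: "(\<Sum>m<N. cnj (v i m) * w m) = 0" if "i < d" for i
    by (rule orth_sym[OF wv[OF that]])
  have ww: "(\<Sum>m<N. cnj (w m) * w m) = 1"
    using w(1) complex_sum_cmod2[of w "{..<N}"] by simp
  show ?case
  proof (intro exI[of _ "v(d := w)"] conjI allI impI ballI)
    fix i j assume "i < Suc d" "j < Suc d"
    then show "(\<Sum>m<N. cnj ((v(d := w)) i m) * (v(d := w)) j m) = (if i = j then 1 else 0)"
      using v(1)[of i j] wv[of j] vw[of i] ww by (auto simp: less_Suc_eq)
  next
    fix i j assume "i < Suc d" "j \<in> J"
    then show "(\<Sum>m<N. cnj ((v(d := w)) i m) * r j m) = 0"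
      using v(2)[of i j] wr by (auto simp: less_Suc_eq)
  qed
qed simp

definition indep_cols :: "'j set \<Rightarrow> nat \<Rightarrow> ('j \<Rightarrow> nat \<Rightarrow> complex) \<Rightarrow> bool" where
  "indep_cols J N r \<longleftrightarrow> (\<forall>c. (\<forall>m<N. (\<Sum>j\<in>J. c j * r j m) = 0) \<longrightarrow> (\<forall>j\<in>J. c j = 0))"

text \<open>The remainder \<open>y\<close> of \<open>x\<close> after subtracting its expansion in
  the \<open>v i\<close> is orthogonal to all \<open>N\<close> vectors \<open>r j\<close> and
  \<open>v i\<close>. A nonzero \<open>y\<close> would make these vectors linearly dependent.
  Orthonormality removes the coefficients of the \<open>v i\<close> and \<open>ind\<close> those of
  the \<open>r j\<close>, so \<open>y\<close> vanishes and the expansion is exact.\<close>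

lemma parseval_complement:
  fixes r :: "'j \<Rightarrow> nat \<Rightarrow> complex"
  assumes J: "finite J" "card J + d = N" and ind: "indep_cols J N r"
    and on: "\<And>i j. i < d \<Longrightarrow> j < d \<Longrightarrow> (\<Sum>m<N. cnj (v i m) * v j m) = (if i = j then 1 else 0)"
    and vr: "\<And>i j. i < d \<Longrightarrow> j \<in> J \<Longrightarrow> (\<Sum>m<N. cnj (v i m) * r j m) = 0"
    and xr: "\<And>j. j \<in> J \<Longrightarrow> (\<Sum>m<N. cnj (x m) * r j m) = 0"
  shows "(\<Sum>m<N. (cmod (x m))\<^sup>2) = (\<Sum>i<d. (cmod (\<Sum>m<N. cnj (v i m) * x m))\<^sup>2)"
proof -
  define a where "a i = (\<Sum>m<N. cnj (v i m) * x m)" for i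
  define y where "y m = x m - (\<Sum>i<d. a i * v i m)" for m
  have vy: "(\<Sum>m<N. cnj (v i m) * y m) = 0" if "i < d" for i
  proof -
    have "(\<Sum>m<N. cnj (v i m) * y m) = a i - (\<Sum>m<N. \<Sum>k<d. a k * (cnj (v i m) * v k m))"
      unfolding y_def a_def right_diff_distrib sum_subtractf sum_distrib_left by (simp only: mult.left_commute)
    also have "(\<Sum>m<N. \<Sum>k<d. a k * (cnj (v i m) * v k m)) = (\<Sum>k<d. a k * (\<Sum>m<N. cnj (v i m) * v k m))"
      unfolding sum_distrib_left by (rule sum.swap)
    also have "\<dots> = (\<Sum>k<d. a k * (if i = k then 1 else 0))" using on that by (intro sum.cong) auto
    also have "\<dots> = a i" using that by (rule sum_mult_delta)
    finally show ?thesis by simp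
  qed
  have ry: "(\<Sum>m<N. cnj (r j m) * y m) = 0" if "j \<in> J" for j
  proof -
    have "(\<Sum>m<N. \<Sum>k<d. a k * (cnj (r j m) * v k m)) = (\<Sum>k<d. a k * (\<Sum>m<N. cnj (r j m) * v k m))"
      unfolding sum_distrib_left by (rule sum.swap)
    also have "\<dots> = 0"
    proof (rule sum.neutral, rule ballI)
      fix k assume "k \<in> {..<d}"
      then have "(\<Sum>m<N. cnj (r j m) * v k m) = 0" using vr[OF _ that, of k] by (rule_tac orth_sym) simp
      then show "a k * (\<Sum>m<N. cnj (r j m) * v k m) = 0" by simp
    qed
    finally have e: "(\<Sum>m<N. \<Sum>k<d. a k * (cnj (r j m) * v k m)) = 0" .
    have "cnj (r j m) * y m = cnj (r j m) * x m - (\<Sum>k<d. a k * (cnj (r j m) * v k m))" for m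
      unfolding y_def right_diff_distrib sum_distrib_left by (simp only: mult.left_commute)
    then show ?thesis using e orth_sym[OF xr[OF that]] by (simp only: sum_subtractf diff_self)
  qed
  have y0: "y m = 0" if "m < N" for m
  proof (rule ccontr)
    assume ym: "y m \<noteq> 0"
    define K where "K = case_sum r v"
    have fin: "finite (J <+> {..<d})" and card: "card (J <+> {..<d}) = N" using J by (auto simp: card_Plus)
    obtain h where "bij_betw h {0..<card (J <+> {..<d})} (J <+> {..<d})" using ex_bij_betw_nat_finite[OF fin] by blast
    then have h: "bij_betw h {..<N} (J <+> {..<d})" unfolding card atLeast0LessThan .
    have "\<exists>c. (\<exists>i<N. c i \<noteq> 0) \<and> (\<forall>m<N. (\<Sum>i<N. c i * cnj (K (h i) m)) = 0)"
    proof (rule kernel_transpose, intro exI[of _ y] conjI allI impI)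
      show "\<exists>m<N. y m \<noteq> 0" using ym that by blast
      fix i assume "i < N"
      then have "h i \<in> J <+> {..<d}" using h by (auto simp: bij_betw_def)
      then show "(\<Sum>m<N. cnj (K (h i) m) * y m) = 0" using ry vy by (auto simp: K_def)
    qed
    then obtain c i0 where c: "i0 < N" "c i0 \<noteq> 0" "\<And>m. m < N \<Longrightarrow> (\<Sum>i<N. c i * cnj (K (h i) m)) = 0" by blast
    \<comment> \<open>The dependence obtained from \<open>kernel_transpose\<close> involves
      conjugated vectors. Conjugating its coefficients and moving them back along \<open>h\<close>
      gives a dependence of the vectors themselves.\<close>
    define c' where "c' s = cnj (c (the_inv_into {..<N} h s))" for s
    have c'h: "c' (h i) = cnj (c i)" if "i < N" for i
      using h that by (simp add: c'_def bij_betw_def the_inv_into_f_f)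
    have sum0: "(\<Sum>j\<in>J. c' (Inl j) * r j m) + (\<Sum>i<d. c' (Inr i) * v i m) = 0" if "m < N" for m
    proof -
      have "(\<Sum>j\<in>J. c' (Inl j) * r j m) + (\<Sum>i<d. c' (Inr i) * v i m) = (\<Sum>s\<in>J <+> {..<d}. c' s * K s m)"
        using J(1) by (simp add: sum_Plus K_def)
      also have "\<dots> = (\<Sum>i<N. c' (h i) * K (h i) m)" by (rule sum.reindex_bij_betw[OF h, symmetric])
      also have "\<dots> = (\<Sum>i<N. cnj (c i * cnj (K (h i) m)))" by (intro sum.cong) (auto simp: c'h)
      also have "\<dots> = 0" using c(3)[OF that] unfolding cnj_sum[symmetric] by simp
      finally show ?thesis .
    qed
    have r0: "c' (Inr i) = 0" if i: "i < d" for i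
    proof -
      have "0 = (\<Sum>m<N. cnj (v i m) * ((\<Sum>j\<in>J. c' (Inl j) * r j m) + (\<Sum>k<d. c' (Inr k) * v k m)))"
        using sum0 by simp
      also have "\<dots> = (\<Sum>m<N. \<Sum>j\<in>J. c' (Inl j) * (cnj (v i m) * r j m)) + (\<Sum>m<N. \<Sum>k<d. c' (Inr k) * (cnj (v i m) * v k m))"
        unfolding distrib_left sum.distrib sum_distrib_left by (simp only: mult.left_commute)
      also have "(\<Sum>m<N. \<Sum>j\<in>J. c' (Inl j) * (cnj (v i m) * r j m)) = (\<Sum>j\<in>J. c' (Inl j) * (\<Sum>m<N. cnj (v i m) * r j m))"
        unfolding sum_distrib_left by (rule sum.swap)
      also have "\<dots> = 0" using vr[OF i] by simp
      also have "(\<Sum>m<N. \<Sum>k<d. c' (Inr k) * (cnj (v i m) * v k m)) = (\<Sum>k<d. c' (Inr k) * (\<Sum>m<N. cnj (v i m) * v k m))"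
        unfolding sum_distrib_left by (rule sum.swap)
      also have "\<dots> = (\<Sum>k<d. c' (Inr k) * (if i = k then 1 else 0))" using on i by (intro sum.cong) auto
      also have "\<dots> = c' (Inr i)" using i by (rule sum_mult_delta)
      finally show ?thesis by simp
    qed
    have "(\<Sum>j\<in>J. c' (Inl j) * r j m) = 0" if "m < N" for m
    proof -
      have "(\<Sum>i<d. c' (Inr i) * v i m) = 0" using r0 by (intro sum.neutral) auto
      then show ?thesis using sum0[OF that] by (simp only: add_0_right)
    qed
    then have "\<forall>j\<in>J. c' (Inl j) = 0"
      using ind[unfolded indep_cols_def, THEN spec, of "\<lambda>j. c' (Inl j)"] by blast
    moreover have "h i0 \<in> J <+> {..<d}" using h c(1) by (auto simp: bij_betw_def)
    ultimately have "c' (h i0) = 0" using r0 by auto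
    then show False using c(1,2) c'h by simp
  qed
  have x: "x m = (\<Sum>i<d. a i * v i m)" if "m < N" for m using y0[OF that] by (simp add: y_def)
  have "complex_of_real (\<Sum>m<N. (cmod (x m))\<^sup>2) = (\<Sum>m<N. \<Sum>i<d. a i * (cnj (x m) * v i m))"
    unfolding complex_sum_cmod2
    by (intro sum.cong refl, subst (2) x) (simp, simp only: sum_distrib_left mult.left_commute)
  also have "\<dots> = (\<Sum>i<d. a i * (\<Sum>m<N. cnj (x m) * v i m))"
    unfolding sum_distrib_left by (rule sum.swap)
  also have "\<dots> = (\<Sum>i<d. cnj (a i) * a i)"
    unfolding sum_cnj_swap[of x] a_def by (simp only: mult.commute)
  also have "\<dots> = complex_of_real (\<Sum>i<d. (cmod (a i))\<^sup>2)" by (rule complex_sum_cmod2[symmetric])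
  finally show ?thesis unfolding a_def of_real_eq_iff .
qed

section \<open>Gram matrices and the left pseudoinverse\<close>

text \<open>The quadratic form of the Gram matrix at \<open>c\<close> is the squared norm of
  \<open>\<Sum>j c j * r j\<close>. This also expresses independence of columns by one polynomial in
  the entries, from which its measurability follows.\<close>

lemma gram_det:
  "Determinant.det (Matrix.mat k k (\<lambda>(i, j). \<Sum>m<N. cnj (r i m) * r j m)) \<noteq> 0 \<longleftrightarrow> indep_cols {..<k} N r"
proof -
  have "(\<forall>i<k. (\<Sum>j<k. (\<Sum>m<N. cnj (r i m) * r j m) * c j) = 0) \<longleftrightarrow> (\<forall>m<N. (\<Sum>j<k. c j * r j m) = 0)" for c
  proof
    assume *: "\<forall>m<N. (\<Sum>j<k. c j * r j m) = 0"
    show "\<forall>i<k. (\<Sum>j<k. (\<Sum>m<N. cnj (r i m) * r j m) * c j) = 0"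
    proof (intro allI impI)
      fix i
      have "(\<Sum>j<k. (\<Sum>m<N. cnj (r i m) * r j m) * c j) = (\<Sum>j<k. \<Sum>m<N. cnj (r i m) * (c j * r j m))"
        unfolding sum_distrib_right by (simp only: mult_ac)
      also have "\<dots> = (\<Sum>m<N. cnj (r i m) * (\<Sum>j<k. c j * r j m))"
        unfolding sum_distrib_left by (rule sum.swap)
      finally show "(\<Sum>j<k. (\<Sum>m<N. cnj (r i m) * r j m) * c j) = 0" using * by simp
    qed
  next
    assume *: "\<forall>i<k. (\<Sum>j<k. (\<Sum>m<N. cnj (r i m) * r j m) * c j) = 0"
    define z where "z m = (\<Sum>j<k. c j * r j m)" for m
    have rz: "(\<Sum>m<N. cnj (r i m) * z m) = 0" if "i < k" for i
    proof -
      have "(\<Sum>m<N. cnj (r i m) * z m) = (\<Sum>m<N. \<Sum>j<k. cnj (r i m) * r j m * c j)"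
        unfolding z_def sum_distrib_left by (simp only: mult_ac)
      also have "\<dots> = (\<Sum>j<k. (\<Sum>m<N. cnj (r i m) * r j m) * c j)"
        unfolding sum_distrib_right by (rule sum.swap)
      finally show ?thesis using * that by simp
    qed
    have "complex_of_real (\<Sum>m<N. (cmod (z m))\<^sup>2) = (\<Sum>m<N. \<Sum>i<k. cnj (c i) * (cnj (r i m) * z m))"
    proof -
      have "cnj (z m) = (\<Sum>i<k. cnj (c i) * cnj (r i m))" for m by (simp add: z_def)
      then show ?thesis unfolding complex_sum_cmod2 by (simp only: sum_distrib_right mult.assoc)
    qed
    also have "\<dots> = (\<Sum>i<k. cnj (c i) * (\<Sum>m<N. cnj (r i m) * z m))"
      unfolding sum_distrib_left by (rule sum.swap)
    also have "\<dots> = 0" using rz by simp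
    finally have "(\<Sum>m<N. (cmod (z m))\<^sup>2) = 0" by (simp only: of_real_eq_0_iff)
    then show "\<forall>m<N. (\<Sum>j<k. c j * r j m) = 0" unfolding z_def[symmetric] by (simp add: sum_nonneg_eq_0_iff)
  qed
  then show ?thesis
    unfolding det_eq_0_iff_kernel indep_cols_def by blast
qed

lemma mat_adjoint_index[simp]:
  "i < dim_col A \<Longrightarrow> j < dim_row A \<Longrightarrow> mat_adjoint A $$ (i, j) = cnj (A $$ (j, i))"
  unfolding mat_adjoint_def by (simp add: mat_of_rows_def)

lemma mat_adjoint_carrier: "A \<in> carrier_mat N n \<Longrightarrow> mat_adjoint A \<in> carrier_mat n N"
  unfolding mat_adjoint_def by (auto simp: mat_of_rows_def)

lemma mat_adjoint_dim[simp]: "dim_row (mat_adjoint A) = dim_col A" "dim_col (mat_adjoint A) = dim_row A"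
  unfolding mat_adjoint_def by (auto simp: mat_of_rows_def)

lemma mult_index:
  fixes A B :: "complex Matrix.mat"
  assumes "A \<in> carrier_mat a b" "B \<in> carrier_mat b c" "i < a" "j < c"
  shows "(A * B) $$ (i, j) = (\<Sum>k<b. A $$ (i, k) * B $$ (k, j))"
  using assms by (auto simp: scalar_prod_def atLeast0LessThan intro!: sum.cong)

lemma gram_index:
  fixes G :: "complex Matrix.mat"
  assumes "G \<in> carrier_mat N n"
  shows "mat_adjoint G * G = Matrix.mat n n (\<lambda>(i, j). \<Sum>m<N. cnj (G $$ (m, i)) * G $$ (m, j))"
  using assms by (intro eq_matI) (auto simp: mult_index[OF mat_adjoint_carrier[OF assms] assms] simp del: index_mult_mat(1))

lemma smult_one_inverse: "(d :: complex) \<noteq> 0 \<Longrightarrow> (1 / d) \<cdot>\<^sub>m (d \<cdot>\<^sub>m 1\<^sub>m n) = 1\<^sub>m n"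
  by (rule eq_matI) auto

text \<open>The adjugate formula replaces the inverse produced by Gauss-Jordan elimination by an
  expression rational in the entries, with the zero matrix in the singular case. This form makes the
  receiver measurable.\<close>

lemma left_pinv_formula:
  assumes G: "G \<in> carrier_mat N n"
  defines "A \<equiv> Matrix.mat n n (\<lambda>(i, j). \<Sum>m<N. cnj (G $$ (m, i)) * G $$ (m, j))"
  shows "left_pinv G = (if Determinant.det A = 0 then 0\<^sub>m n N else (1 / Determinant.det A) \<cdot>\<^sub>m adj_mat A * mat_adjoint G)"
    and "Determinant.det A \<noteq> 0 \<Longrightarrow> left_pinv G * G = 1\<^sub>m n"
proof -
  have gi: "mat_adjoint G * G = A" unfolding A_def by (rule gram_index[OF G])
  have A: "A \<in> carrier_mat n n" by (simp add: A_def)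
  have G': "mat_adjoint G \<in> carrier_mat n N" by (rule mat_adjoint_carrier[OF G])
  show 1: "left_pinv G = (if Determinant.det A = 0 then 0\<^sub>m n N else (1 / Determinant.det A) \<cdot>\<^sub>m adj_mat A * mat_adjoint G)"
  proof (cases "Determinant.det A = 0")
    case True
    have "mat_inverse A = None"
    proof (cases "mat_inverse A")
      case (Some B)
      then have "A * B = 1\<^sub>m n" "B \<in> carrier_mat n n" using mat_inverse(2)[OF A] by auto
      then have "Determinant.det A * Determinant.det B = 1" using det_mult[OF A, of B] by simp
      then show ?thesis using True by simp
    qed
    then show ?thesis using G True unfolding left_pinv_def gi by simp
  next
    case False
    define B where "B = (1 / Determinant.det A) \<cdot>\<^sub>m adj_mat A"
    have B: "B \<in> carrier_mat n n" using adj_mat(1)[OF A] by (simp add: B_def)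
    have AB: "A * B = 1\<^sub>m n"
      unfolding B_def using adj_mat[OF A] False
      by (simp add: mult_smult_distrib[OF A adj_mat(1)[OF A]] smult_one_inverse)
    have "mat_inverse A \<noteq> None"
    proof
      assume "mat_inverse A = None"
      then have "A \<notin> Units (ring_mat TYPE(complex) n ())" by (rule mat_inverse(1)[OF A])
      then show False using det_non_zero_imp_unit[OF A False, of "()"] by blast
    qed
    then obtain C where C: "mat_inverse A = Some C" by auto
    then have "C * A = 1\<^sub>m n" "C \<in> carrier_mat n n" using mat_inverse(2)[OF A] by auto
    then have "C = B" using AB A B by (metis assoc_mult_mat left_mult_one_mat right_mult_one_mat)
    then show ?thesis using False unfolding left_pinv_def gi C by (simp add: B_def)
  qed
  assume d: "Determinant.det A \<noteq> 0"
  define B where "B = (1 / Determinant.det A) \<cdot>\<^sub>m adj_mat A"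
  have B: "B \<in> carrier_mat n n" using adj_mat(1)[OF A] by (simp add: B_def)
  have "left_pinv G * G = B * (mat_adjoint G * G)"
    using 1 d B G G' by (simp add: B_def)
  also have "\<dots> = 1\<^sub>m n" unfolding gi B_def using adj_mat[OF A] d A
    by (simp add: mult_smult_assoc_mat[OF adj_mat(1)[OF A] A] smult_one_inverse)
  finally show "left_pinv G * G = 1\<^sub>m n" .
qed

lemma left_pinv_carrier:
  assumes G: "G \<in> carrier_mat N n"
  shows "left_pinv G \<in> carrier_mat n N"
proof -
  have "adj_mat (Matrix.mat n n (\<lambda>(i, j). \<Sum>m<N. cnj (G $$ (m, i)) * G $$ (m, j))) \<in> carrier_mat n n"
    by (rule adj_mat(1)) simp
  then show ?thesis
    unfolding left_pinv_formula(1)[OF G] using mat_adjoint_carrier[OF G]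
    by (simp add: mult_carrier_mat[of _ n n])
qed

text \<open>The reciprocal of the \<open>k\<close>-th diagonal entry of \<open>(G\<^sup>H G)\<^sup>-\<^sup>1\<close> is the squared distance of column \<open>k\<close> of \<open>G\<close>
  from the span of the other columns.\<close>

lemma left_pinv_row_norm:
  assumes G: "G \<in> carrier_mat N n" and k: "k < n" and d: "n + d = Suc N"
    and ind: "indep_cols {..<n} N (\<lambda>j m. G $$ (m, j))"
    and on: "\<And>i j. i < d \<Longrightarrow> j < d \<Longrightarrow> (\<Sum>m<N. cnj (v i m) * v j m) = (if i = j then 1 else 0)"
    and vr: "\<And>i j. i < d \<Longrightarrow> j < n \<Longrightarrow> j \<noteq> k \<Longrightarrow> (\<Sum>m<N. cnj (v i m) * G $$ (m, j)) = 0"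
  defines "a \<equiv> \<Sum>m<N. (cmod (left_pinv G $$ (k, m)))\<^sup>2"
  shows "0 < a" "1 / a = (\<Sum>i<d. (cmod (\<Sum>m<N. cnj (v i m) * G $$ (m, k)))\<^sup>2)"
proof -
  define A where "A = Matrix.mat n n (\<lambda>(i, j). \<Sum>m<N. cnj (G $$ (m, i)) * G $$ (m, j))"
  have Ac: "A \<in> carrier_mat n n" by (simp add: A_def)
  have dA: "Determinant.det A \<noteq> 0" unfolding A_def gram_det by (rule ind)
  define B where "B = (1 / Determinant.det A) \<cdot>\<^sub>m adj_mat A"
  have B: "B \<in> carrier_mat n n" using adj_mat(1)[OF Ac] by (simp add: B_def)
  define L where "L = left_pinv G"
  have Lc: "L \<in> carrier_mat n N" unfolding L_def by (rule left_pinv_carrier[OF G])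
  have L: "L = B * mat_adjoint G"
    using left_pinv_formula(1)[OF G] dA by (simp add: L_def A_def B_def)
  have LG: "(\<Sum>m<N. L $$ (k, m) * G $$ (m, j)) = (if k = j then 1 else 0)" if "j < n" for j
    using left_pinv_formula(2)[OF G] dA k that mult_index[OF Lc G k that] by (simp add: L_def A_def)
  \<comment> \<open>This vector is the dual vector of column \<open>k\<close>: it lies in the column
    span of \<open>G\<close>, is orthogonal to the other columns and has inner product 1 with column
    \<open>k\<close>.\<close>
  define x where "x m = cnj (L $$ (k, m))" for m
  define b where "b j = cnj (B $$ (k, j))" for j
  have x: "x m = (\<Sum>j<n. b j * G $$ (m, j))" if "m < N" for m
    unfolding x_def L using mult_index[OF B mat_adjoint_carrier[OF G] k that] G that by (simp add: b_def)
  have xG: "(\<Sum>m<N. cnj (x m) * G $$ (m, j)) = (if k = j then 1 else 0)" if "j < n" for j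
    using LG[OF that] by (simp add: x_def)
  have ax: "a = (\<Sum>m<N. (cmod (x m))\<^sup>2)" by (simp add: a_def x_def L_def)
  have "complex_of_real a = (\<Sum>m<N. \<Sum>j<n. b j * (cnj (x m) * G $$ (m, j)))"
    unfolding ax complex_sum_cmod2
    by (intro sum.cong refl, subst (2) x) (simp, simp only: sum_distrib_left mult.left_commute)
  also have "\<dots> = (\<Sum>j<n. b j * (\<Sum>m<N. cnj (x m) * G $$ (m, j)))"
    unfolding sum_distrib_left by (rule sum.swap)
  also have "\<dots> = (\<Sum>j<n. b j * (if k = j then 1 else 0))" by (intro sum.cong) (auto simp: xG)
  also have "\<dots> = b k" using k by (rule sum_mult_delta)
  finally have ab: "b k = complex_of_real a" by simp
  have "a \<noteq> 0"
  proof
    assume "a = 0"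
    then have "\<forall>m<N. x m = 0" unfolding ax by (simp add: sum_nonneg_eq_0_iff)
    then show False using xG[OF k] by simp
  qed
  moreover have "0 \<le> a" unfolding ax by (simp add: sum_nonneg)
  ultimately show a: "0 < a" by simp
  have card: "card ({..<n} - {k}) + d = N" using k d by simp
  have ind': "indep_cols ({..<n} - {k}) N (\<lambda>j m. G $$ (m, j))"
    unfolding indep_cols_def
  proof (intro allI impI)
    fix c assume c: "\<forall>m<N. (\<Sum>j\<in>{..<n} - {k}. c j * G $$ (m, j)) = 0"
    have "(\<Sum>j<n. (c(k := 0)) j * G $$ (m, j)) = (\<Sum>j\<in>{..<n} - {k}. c j * G $$ (m, j))" for m
      using k by (subst sum.remove[of _ k]) (auto intro!: sum.cong)
    then have "\<forall>j\<in>{..<n}. (c(k := 0)) j = 0" using ind[unfolded indep_cols_def, rule_format, of "c(k := 0)"] c by auto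
    then show "\<forall>j\<in>{..<n} - {k}. c j = 0" by (metis DiffE fun_upd_other singletonI)
  qed
  have "a = (\<Sum>i<d. (cmod (\<Sum>m<N. cnj (v i m) * x m))\<^sup>2)"
    unfolding ax by (rule parseval_complement[OF _ card ind' on]) (use vr xG in auto)
  \<comment> \<open>In the expansion of \<open>x\<close> in the columns only column \<open>k\<close>
    is seen by \<open>v i\<close>, and its coefficient \<open>b k\<close> equals \<open>a\<close>.
    Hence \<open>a\<close> is \<open>a\<^sup>2\<close> times the squared distance, which gives the
    reciprocal relation.\<close>
  also have "\<dots> = (\<Sum>i<d. a\<^sup>2 * (cmod (\<Sum>m<N. cnj (v i m) * G $$ (m, k)))\<^sup>2)"
  proof (intro sum.cong refl)
    fix i assume i: "i \<in> {..<d}"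
    have "(\<Sum>m<N. cnj (v i m) * x m) = (\<Sum>m<N. \<Sum>j<n. b j * (cnj (v i m) * G $$ (m, j)))"
      by (intro sum.cong refl, subst x) (simp, simp only: sum_distrib_left mult.left_commute)
    also have "\<dots> = (\<Sum>j<n. b j * (\<Sum>m<N. cnj (v i m) * G $$ (m, j)))"
      unfolding sum_distrib_left by (rule sum.swap)
    also have "\<dots> = b k * (\<Sum>m<N. cnj (v i m) * G $$ (m, k)) + (\<Sum>j\<in>{..<n}-{k}. b j * (\<Sum>m<N. cnj (v i m) * G $$ (m, j)))"
      using k by (subst sum.remove[of _ k]) auto
    also have "(\<Sum>j\<in>{..<n}-{k}. b j * (\<Sum>m<N. cnj (v i m) * G $$ (m, j))) = 0"
      using vr i by (intro sum.neutral) auto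
    finally show "(cmod (\<Sum>m<N. cnj (v i m) * x m))\<^sup>2 = a\<^sup>2 * (cmod (\<Sum>m<N. cnj (v i m) * G $$ (m, k)))\<^sup>2"
      using a by (simp add: ab norm_mult power_mult_distrib)
  qed
  also have "\<dots> = a\<^sup>2 * (\<Sum>i<d. (cmod (\<Sum>m<N. cnj (v i m) * G $$ (m, k)))\<^sup>2)" by (simp add: sum_distrib_left)
  finally show "1 / a = (\<Sum>i<d. (cmod (\<Sum>m<N. cnj (v i m) * G $$ (m, k)))\<^sup>2)"
    using a by (simp add: field_simps power2_eq_square)
qed

section \<open>The spectrum of the Kac-Murdock-Szego matrix\<close>

text \<open>On each of the \<open>n\<close> cells of length \<open>1 / n\<close> the function varies
  by at most \<open>L / n\<close>, so the total error is at most \<open>L / n\<close>.\<close>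

lemma lipschitz_left_riemann_sum:
  fixes f :: "real \<Rightarrow> real"
  assumes lip: "\<And>x y. \<bar>f x - f y\<bar> \<le> L * \<bar>x - y\<bar>"
  shows "(\<lambda>n. (\<Sum>k<n. f (real k / real n)) / real n) \<longlonglongrightarrow> integral {0..1} f"
proof -
  have L: "0 \<le> L" using order_trans[OF abs_ge_zero lip[of 0 1]] by simp
  have "L-lipschitz_on UNIV f"
    using lip L by (auto simp: lipschitz_on_def dist_real_def)
  then have cont: "continuous_on A f" for A
    using lipschitz_on_continuous_on continuous_on_subset by blast
  have bound: "\<bar>(\<Sum>k<n. f (real k / real n)) / real n - integral {0..1} f\<bar> \<le> L / real n" if n: "0 < n" for n
  proof -
    have int: "f integrable_on {a..b}" for a b by (rule integrable_continuous_interval[OF cont])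
    have split: "integral {0..real m / real n} f = (\<Sum>k<m. integral {real k / real n..real (Suc k) / real n} f)" for m
    proof (induction m)
      case (Suc m)
      have "integral {0..real m / real n} f + integral {real m / real n..real (Suc m) / real n} f = integral {0..real (Suc m) / real n} f"
        by (rule Henstock_Kurzweil_Integration.integral_combine) (auto simp: int divide_right_mono)
      then show ?case using Suc by simp
    qed simp
    have one: "\<bar>f (real k / real n) / real n - integral {real k / real n..real (Suc k) / real n} f\<bar> \<le> L / real n / real n" for k
    proof -
      define u w where "u = real k / real n" and "w = real (Suc k) / real n"
      have len: "w - u = 1 / real n" by (simp add: u_def w_def diff_divide_distrib[symmetric])
      then have uw: "u \<le> w" using n by (simp add: u_def w_def divide_right_mono)
      have "norm (integral {u..w} (\<lambda>x. f u - f x)) \<le> L / real n * (w - u)"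
      proof (rule integral_bound[OF uw])
        show "continuous_on {u..w} (\<lambda>x. f u - f x)" by (intro continuous_intros cont)
        fix x assume x: "x \<in> {u..w}"
        have "norm (f u - f x) \<le> L * \<bar>u - x\<bar>" using lip by simp
        also have "\<dots> \<le> L * (1 / real n)" using x len L by (intro mult_left_mono) auto
        finally show "norm (f u - f x) \<le> L / real n" by simp
      qed
      moreover have "integral {u..w} (\<lambda>x. f u - f x) = f u / real n - integral {u..w} f"
        using int uw len by (subst integral_diff) (auto simp: mult.commute[of "f u"])
      ultimately have "norm (f u / real n - integral {u..w} f) \<le> L / real n * (1 / real n)" by (simp only: len)
      then show ?thesis by (simp add: u_def w_def)
    qed
    have "\<bar>(\<Sum>k<n. f (real k / real n)) / real n - integral {0..1} f\<bar> = \<bar>\<Sum>k<n. f (real k / real n) / real n - integral {real k / real n..real (Suc k) / real n} f\<bar>"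
      using split[of n] n by (simp add: sum_divide_distrib sum_subtractf)
    also have "\<dots> \<le> (\<Sum>k<n. L / real n / real n)"
      by (rule order_trans[OF sum_abs sum_mono]) (rule one)
    also have "\<dots> = L / real n" using n by simp
    finally show ?thesis .
  qed
  show ?thesis
  proof (rule LIM_zero_cancel, rule Lim_null_comparison)
    show "\<forall>\<^sub>F n in sequentially. norm ((\<Sum>k<n. f (real k / real n)) / real n - integral {0..1} f) \<le> L / real n"
      using eventually_gt_at_top[of 0] by eventually_elim (use bound in auto)
    show "(\<lambda>n. L / real n) \<longlonglongrightarrow> 0" by (rule lim_const_over_n)
  qed
qed

text \<open>The squared modulus of \<open>1 - r * cis (2 * pi * x)\<close>, the symbol of the
  tridiagonal inverse after scaling by \<open>1 - r\<^sup>2\<close>.\<close>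

definition symbol :: "real \<Rightarrow> real \<Rightarrow> real" where
  "symbol r x = 1 + r\<^sup>2 - 2 * r * cos (2 * pi * x)"

lemma symbol_bounds:
  assumes "0 \<le> r" "r < 1"
  shows "(1 - r)\<^sup>2 \<le> symbol r x"
proof -
  have "2 * r * cos (2 * pi * x) \<le> 2 * r * 1" using assms by (intro mult_left_mono) auto
  then show ?thesis by (simp add: symbol_def power2_eq_square algebra_simps)
qed

lemma sqrt_tangent:
  assumes "0 < y" "0 \<le> x"
  shows "sqrt x \<le> sqrt y + (x - y) / (2 * sqrt y)"
proof -
  have "0 \<le> (sqrt x - sqrt y)\<^sup>2" by simp
  also have "\<dots> = x + y - 2 * sqrt x * sqrt y" using assms by (simp add: power2_diff)
  finally have "2 * sqrt x * sqrt y \<le> x + y" by simp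
  also have "x + y = (sqrt y + (x - y) / (2 * sqrt y)) * (2 * sqrt y)"
    using assms by (simp add: distrib_right)
  finally have "sqrt x * (2 * sqrt y) \<le> (sqrt y + (x - y) / (2 * sqrt y)) * (2 * sqrt y)" by (simp only: mult_ac)
  then show ?thesis using assms by (simp add: mult_le_cancel_right)
qed

lemma sqrt_diff_le:
  assumes "0 < c" "c\<^sup>2 \<le> x" "c\<^sup>2 \<le> y"
  shows "\<bar>sqrt x - sqrt y\<bar> \<le> \<bar>x - y\<bar> / (2 * c)"
proof -
  have s: "c \<le> sqrt x" "c \<le> sqrt y" using assms by (simp_all add: real_le_rsqrt)
  have "0 \<le> x" "0 \<le> y" using assms(2,3) by (smt (verit) zero_le_power2)+
  then have "\<bar>x - y\<bar> = \<bar>sqrt x - sqrt y\<bar> * (sqrt x + sqrt y)"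
  proof -
    have "x - y = (sqrt x - sqrt y) * (sqrt x + sqrt y)" using \<open>0 \<le> x\<close> \<open>0 \<le> y\<close> by (simp add: algebra_simps)
    then have "\<bar>x - y\<bar> = \<bar>sqrt x - sqrt y\<bar> * \<bar>sqrt x + sqrt y\<bar>" by (metis abs_mult)
    then show ?thesis using s assms(1) by simp
  qed
  also have "\<dots> \<ge> \<bar>sqrt x - sqrt y\<bar> * (2 * c)" using s by (intro mult_left_mono) auto
  finally show ?thesis using assms(1) by (simp add: field_simps)
qed

text \<open>The symbol stays above \<open>(1 - r)\<^sup>2\<close>, so its square root inherits a
  Lipschitz bound from the cosine.\<close>

lemma symbol_riemann:
  assumes r: "0 \<le> r" "r < 1"
  shows "(\<lambda>n. (\<Sum>k<n. sqrt (symbol r (real k / real n))) / real n) \<longlonglongrightarrow> integral {0..1} (\<lambda>x. sqrt (symbol r x))"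
proof (rule lipschitz_left_riemann_sum)
  fix x y :: real
  have "\<bar>symbol r x - symbol r y\<bar> = 2 * r * \<bar>cos (2 * pi * x) - cos (2 * pi * y)\<bar>"
  proof -
    have "symbol r x - symbol r y = - (2 * r * (cos (2 * pi * x) - cos (2 * pi * y)))" by (simp add: symbol_def algebra_simps)
    then show ?thesis using r by (simp only: abs_minus_cancel abs_mult abs_of_nonneg abs_numeral)
  qed
  also have "\<bar>cos (2 * pi * x) - cos (2 * pi * y)\<bar> \<le> \<bar>2 * pi * x - 2 * pi * y\<bar>"
  proof -
    have "\<bar>cos a - cos b\<bar> \<le> \<bar>a - b\<bar>" for a b :: real
    proof -
      have "\<bar>cos a - cos b\<bar> = 2 * (\<bar>sin ((a + b) / 2)\<bar> * \<bar>sin ((b - a) / 2)\<bar>)" by (simp add: cos_diff_cos abs_mult)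
      also have "\<dots> \<le> 2 * (1 * \<bar>(b - a) / 2\<bar>)"
        by (intro mult_left_mono mult_mono abs_sin_le_one abs_sin_x_le_abs_x) auto
      finally show ?thesis by (simp add: abs_minus_commute)
    qed
    then show ?thesis .
  qed
  also have "\<bar>2 * pi * x - 2 * pi * y\<bar> = 2 * pi * \<bar>x - y\<bar>" by (simp add: abs_mult right_diff_distrib[symmetric])
  finally have "\<bar>symbol r x - symbol r y\<bar> \<le> 2 * r * (2 * pi * \<bar>x - y\<bar>)" using r by (simp add: mult_left_mono)
  then have "\<bar>symbol r x - symbol r y\<bar> / (2 * (1 - r)) \<le> 2 * r * (2 * pi * \<bar>x - y\<bar>) / (2 * (1 - r))"
    using r by (intro divide_right_mono) auto
  moreover have "\<bar>sqrt (symbol r x) - sqrt (symbol r y)\<bar> \<le> \<bar>symbol r x - symbol r y\<bar> / (2 * (1 - r))"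
    using r by (intro sqrt_diff_le symbol_bounds) auto
  ultimately show "\<bar>sqrt (symbol r x) - sqrt (symbol r y)\<bar> \<le> (2 * r * (2 * pi) / (2 * (1 - r))) * \<bar>x - y\<bar>"
    by simp
qed

text \<open>With \<open>k\<^sup>2 * (1 + r)\<^sup>2 = 4 * r\<close> the double-angle formula turns
  the symbol into \<open>(1 + r)\<^sup>2 * (1 - k\<^sup>2 * (cos (pi * x))\<^sup>2)\<close>. A shift
  by \<open>pi / 2\<close> makes the cosine a sine, and the even integrand over
  \<open>[-pi/2, pi/2]\<close> gives two copies of \<open>ellE k\<close>; rescaling by
  \<open>pi\<close> accounts for \<open>2 / pi\<close>.\<close>

lemma symbol_integral:
  assumes r: "0 \<le> r" "r < 1"
  shows "integral {0..1} (\<lambda>x. sqrt (symbol r x)) = 2 / pi * (1 + r) * ellE (2 * sqrt r / (1 + r))"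
proof -
  define k where "k = 2 * sqrt r / (1 + r)"
  define g where "g \<theta> = sqrt (1 - k\<^sup>2 * (sin \<theta>)\<^sup>2)" for \<theta>
  have sym: "sqrt (symbol r x) = (1 + r) * g (pi * x - pi / 2)" for x
  proof -
    have "k\<^sup>2 * (1 + r)\<^sup>2 = 4 * r" using r by (simp add: k_def power_divide power_mult_distrib)
    moreover have "cos (2 * pi * x) = 2 * (cos (pi * x))\<^sup>2 - 1" using cos_double_cos[of "pi * x"] by (simp add: mult.assoc mult.left_commute)
    moreover have "(1 + r)\<^sup>2 * (1 - k\<^sup>2 * (cos (pi * x))\<^sup>2) = (1 + r)\<^sup>2 - (k\<^sup>2 * (1 + r)\<^sup>2) * (cos (pi * x))\<^sup>2"
      by (simp add: algebra_simps)
    ultimately have "symbol r x = (1 + r)\<^sup>2 * (1 - k\<^sup>2 * (cos (pi * x))\<^sup>2)"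
      unfolding symbol_def by (simp only:) (simp add: power2_sum algebra_simps)
    then show ?thesis using r by (simp add: g_def real_sqrt_mult sin_diff)
  qed
  have gsin: "g (- \<theta>) = g \<theta>" for \<theta> by (simp add: g_def)
  have k1: "k\<^sup>2 \<le> 1"
  proof -
    have "4 * r \<le> (1 + r)\<^sup>2" using zero_le_power2[of "1 - r"] by (simp add: power2_eq_square algebra_simps)
    then show ?thesis using r by (simp add: k_def power_divide power_mult_distrib)
  qed
  have cont: "continuous_on A g" for A unfolding g_def by (intro continuous_intros)
  have E: "(g has_integral ellE k) {0..pi/2}"
    unfolding ellE_def g_def[symmetric] by (rule integrable_integral[OF integrable_continuous_interval[OF cont]])
  have E': "(g has_integral ellE k) {-(pi/2)..0}"
    using has_integral_reflect_real[THEN iffD2, OF E] by (simp add: gsin)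
  have all: "(g has_integral (ellE k + ellE k)) {-(pi/2)..pi/2}"
    by (rule has_integral_combine[OF _ _ E' E]) auto
  then have "(g has_integral (ellE k + ellE k)) (cbox (-(pi/2)) (pi/2))" by simp
  from has_integral_affinity'[OF this pi_gt_zero, of "-(pi/2)"]
  have "((\<lambda>x. g (pi * x - pi/2)) has_integral (2 / pi * ellE k)) {0..1}" by (simp add: field_simps)
  then have "((\<lambda>x. (1 + r) * g (pi * x - pi/2)) has_integral (1 + r) * (2 / pi * ellE k)) {0..1}"
    by (rule has_integral_mult_right)
  then show ?thesis unfolding sym k_def[symmetric] by (simp only: integral_unique mult_ac)
qed

section \<open>Orthonormal bases, quadratic forms and comparison of spectra\<close>

lemma roots_of_unity_sum:
  assumes "i < n" "m < n"
  shows "(\<Sum>k<n. cis (2 * pi * real k * real i / real n) * cnj (cis (2 * pi * real k * real m / real n))) = (if i = m then of_nat n else 0)"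
proof (cases "i = m")
  case True
  then show ?thesis by (simp add: cis_cnj cis_mult)
next
  case False
  have n: "0 < n" using assms by simp
  define z where "z = cis (2 * pi * (real i - real m) / real n)"
  have "z \<noteq> 1"
  proof
    assume "z = 1"
    then have "cis (2 * pi * real i / real n) = cis (2 * pi * real m / real n)"
      by (simp add: z_def right_diff_distrib diff_divide_distrib flip: cis_divide)
    then have "exp (2 * of_real pi * \<i> * of_nat i / of_nat n) = exp (2 * of_real pi * \<i> * of_nat m / of_nat n)"
      by (simp add: cis_conv_exp mult_ac)
    then have "i mod n = m mod n" using complex_root_unity_eq[of n i m] n by simp
    then show False using assms False by simp
  qed
  moreover have "z ^ n = 1"
  proof -
    have "z ^ n = cis (2 * pi * (real i - real m))"
      unfolding z_def Complex.DeMoivre using n by simp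
    then show ?thesis by simp
  qed
  ultimately have "(\<Sum>k<n. z ^ k) = 0" by (simp add: geometric_sum)
  moreover have "cis (2 * pi * real k * real i / real n) * cnj (cis (2 * pi * real k * real m / real n)) = z ^ k" for k
    unfolding z_def Complex.DeMoivre cis_cnj cis_mult by (simp add: algebra_simps diff_divide_distrib)
  ultimately show ?thesis using False by simp
qed

text \<open>The first index selects the vector and the second its coordinate, so
  \<open>b j i\<close> is the entry \<open>(i, j)\<close> of a unitary matrix. Orthonormality of the
  vectors and resolution of the identity are both carried along.\<close>

definition complete_onb :: "nat \<Rightarrow> (nat \<Rightarrow> nat \<Rightarrow> complex) \<Rightarrow> bool" where
  "complete_onb n b \<longleftrightarrow> (\<forall>i<n. \<forall>j<n. (\<Sum>m<n. cnj (b i m) * b j m) = (if i = j then 1 else 0)) \<and>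
     (\<forall>i<n. \<forall>m<n. (\<Sum>j<n. b j i * cnj (b j m)) = (if i = m then 1 else 0))"

definition qform :: "nat \<Rightarrow> (nat \<Rightarrow> nat \<Rightarrow> complex) \<Rightarrow> (nat \<Rightarrow> complex) \<Rightarrow> complex" where
  "qform n a x = (\<Sum>i<n. cnj (x i) * (\<Sum>m<n. a i m * x m))"

text \<open>Resolving the identity writes the matrix as the sum of the rank-one projections onto the
  \<open>b j\<close> with real weights \<open>\<nu> j\<close>.\<close>

lemma qform_spectral:
  assumes b: "complete_onb n b"
    and eig: "\<And>i j. i < n \<Longrightarrow> j < n \<Longrightarrow> (\<Sum>m<n. a i m * b j m) = complex_of_real (\<nu> j) * b j i"
  shows "qform n a x = complex_of_real (\<Sum>j<n. \<nu> j * (cmod (\<Sum>i<n. cnj (b j i) * x i))\<^sup>2)"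
proof -
  have comp: "(\<Sum>j<n. b j i * cnj (b j m)) = (if i = m then 1 else 0)" if "i < n" "m < n" for i m
    using b that by (simp add: complete_onb_def)
  have a: "a i m = (\<Sum>j<n. complex_of_real (\<nu> j) * b j i * cnj (b j m))" if "i < n" "m < n" for i m
  proof -
    have "a i m = (\<Sum>k<n. a i k * (if k = m then 1 else 0))" using that by (simp add: if_distrib[of "\<lambda>x. _ * x"] cong: if_cong)
    also have "\<dots> = (\<Sum>k<n. a i k * (\<Sum>j<n. b j k * cnj (b j m)))" using that by (intro sum.cong) (simp_all add: comp)
    also have "\<dots> = (\<Sum>k<n. \<Sum>j<n. a i k * b j k * cnj (b j m))" by (simp only: sum_distrib_left mult.assoc)
    also have "\<dots> = (\<Sum>j<n. (\<Sum>k<n. a i k * b j k) * cnj (b j m))" unfolding sum_distrib_right by (rule sum.swap)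
    also have "\<dots> = (\<Sum>j<n. complex_of_real (\<nu> j) * b j i * cnj (b j m))"
      using eig that by (intro sum.cong refl) simp
    finally show ?thesis .
  qed
  define c where "c j = (\<Sum>i<n. cnj (b j i) * x i)" for j
  have "(\<Sum>m<n. a i m * x m) = (\<Sum>j<n. complex_of_real (\<nu> j) * b j i * c j)" if "i < n" for i
  proof -
    have "(\<Sum>m<n. a i m * x m) = (\<Sum>m<n. \<Sum>j<n. complex_of_real (\<nu> j) * b j i * (cnj (b j m) * x m))"
      using that by (intro sum.cong refl) (simp add: a sum_distrib_right mult.assoc)
    also have "\<dots> = (\<Sum>j<n. complex_of_real (\<nu> j) * b j i * c j)" unfolding c_def sum_distrib_left by (rule sum.swap)
    finally show ?thesis .
  qed
  then have "qform n a x = (\<Sum>i<n. \<Sum>j<n. complex_of_real (\<nu> j) * c j * (cnj (x i) * b j i))"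
    unfolding qform_def by (intro sum.cong refl) (simp add: sum_distrib_left mult_ac)
  also have "\<dots> = (\<Sum>j<n. complex_of_real (\<nu> j) * c j * (\<Sum>i<n. cnj (x i) * b j i))"
    unfolding sum_distrib_left by (rule sum.swap)
  also have "\<dots> = (\<Sum>j<n. complex_of_real (\<nu> j) * (cnj (c j) * c j))"
    unfolding c_def sum_cnj_swap[of x] by (simp only: mult.assoc mult.commute[of "sum _ _" "cnj _"])
  also have "\<dots> = (\<Sum>j<n. complex_of_real (\<nu> j * (cmod (c j))\<^sup>2))"
  proof (intro sum.cong refl)
    fix j show "complex_of_real (\<nu> j) * (cnj (c j) * c j) = complex_of_real (\<nu> j * (cmod (c j))\<^sup>2)"
      using complex_norm_square[of "c j"] by (simp only: of_real_mult mult.commute[of "cnj (c j)"])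
  qed
  finally show ?thesis unfolding c_def by (simp only: of_real_sum)
qed

text \<open>This is \<open>qform_spectral\<close> for the identity matrix, all of whose eigenvalues
  are 1.\<close>

lemma onb_parseval:
  assumes b: "complete_onb n b"
  shows "(\<Sum>j<n. (cmod (\<Sum>i<n. cnj (b j i) * x i))\<^sup>2) = (\<Sum>i<n. (cmod (x i))\<^sup>2)"
proof -
  have d: "(\<Sum>m<n. (if i = m then 1 else 0) * y m) = y i" if "i < n" for i and y :: "nat \<Rightarrow> complex"
    using that by (simp add: if_distrib[of "\<lambda>x. x * _"] cong: if_cong)
  have "qform n (\<lambda>i m. if i = m then 1 else 0) x = complex_of_real (\<Sum>j<n. 1 * (cmod (\<Sum>i<n. cnj (b j i) * x i))\<^sup>2)"
    by (rule qform_spectral[OF b]) (simp add: d)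
  moreover have "qform n (\<lambda>i m. if i = m then 1 else 0) x = complex_of_real (\<Sum>i<n. (cmod (x i))\<^sup>2)"
    unfolding qform_def complex_sum_cmod2 by (intro sum.cong refl) (simp add: d)
  ultimately show ?thesis by (simp only: of_real_eq_iff mult_1)
qed

text \<open>The matrix \<open>|\<langle>e k, w j\<rangle>|\<^sup>2\<close> is doubly stochastic, so the concavity of the square root compares the two spectra in
  both directions.\<close>

lemma sqrt_trace_le:
  assumes e: "complete_onb n e" and w: "complete_onb n w"
    and eigK: "\<And>i j. i < n \<Longrightarrow> j < n \<Longrightarrow> (\<Sum>m<n. K i m * w j m) = complex_of_real (\<mu> j) * w j i"
    and pos: "0 < c" "\<And>j. j < n \<Longrightarrow> 0 \<le> \<mu> j" "\<And>k. k < n \<Longrightarrow> c\<^sup>2 \<le> \<kappa> k"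
    and pert: "\<And>k. k < n \<Longrightarrow> Re (qform n K (e k)) \<le> \<kappa> k + \<epsilon> k" "\<And>k. k < n \<Longrightarrow> 0 \<le> \<epsilon> k"
  shows "(\<Sum>j<n. sqrt (\<mu> j)) \<le> (\<Sum>k<n. sqrt (\<kappa> k)) + (\<Sum>k<n. \<epsilon> k) / (2 * c)"
proof -
  define D where "D k j = (cmod (\<Sum>i<n. cnj (w j i) * e k i))\<^sup>2" for k j
  have D1: "(\<Sum>j<n. D k j) = 1" if "k < n" for k
  proof -
    have "complex_of_real (\<Sum>i<n. (cmod (e k i))\<^sup>2) = 1"
      using e that unfolding complex_sum_cmod2 by (simp add: complete_onb_def)
    then have "(\<Sum>i<n. (cmod (e k i))\<^sup>2) = 1" by (simp only: of_real_eq_1_iff)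
    then show ?thesis unfolding D_def onb_parseval[OF w] .
  qed
  have D2: "(\<Sum>k<n. D k j) = 1" if "j < n" for j
  proof -
    have "D k j = (cmod (\<Sum>i<n. cnj (e k i) * w j i))\<^sup>2" for k
      unfolding D_def sum_cnj_swap[of "w j" "e k"] complex_mod_cnj ..
    moreover have "complex_of_real (\<Sum>i<n. (cmod (w j i))\<^sup>2) = 1"
      using w that unfolding complex_sum_cmod2 by (simp add: complete_onb_def)
    then have "(\<Sum>i<n. (cmod (w j i))\<^sup>2) = 1" by (simp only: of_real_eq_1_iff)
    ultimately show ?thesis by (simp only: onb_parseval[OF e])
  qed
  have D0: "0 \<le> D k j" for k j by (simp add: D_def)
  have lam: "0 < \<kappa> k" "c \<le> sqrt (\<kappa> k)" if "k < n" for k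
    using pos(3)[OF that] pos(1) by (auto intro: less_le_trans[of 0 "c\<^sup>2"] real_le_rsqrt)
  \<comment> \<open>Each \<open>sqrt (\<mu> j)\<close> is spread over \<open>k\<close> with weights
    \<open>D k j\<close> and bounded by the tangent of the square root at \<open>\<kappa> k\<close>.
    Summing over \<open>j\<close> first turns the linear terms into the value of the form
    \<open>K\<close> at \<open>e k\<close>, so the first-order error is exactly what
    \<open>pert\<close> controls.\<close>
  have "(\<Sum>j<n. sqrt (\<mu> j)) = (\<Sum>j<n. \<Sum>k<n. D k j * sqrt (\<mu> j))"
    using D2 by (simp flip: sum_distrib_right)
  also have "\<dots> \<le> (\<Sum>j<n. \<Sum>k<n. D k j * (sqrt (\<kappa> k) + (\<mu> j - \<kappa> k) / (2 * sqrt (\<kappa> k))))"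
    by (intro sum_mono mult_left_mono sqrt_tangent D0) (auto simp: lam pos)
  also have "\<dots> = (\<Sum>k<n. \<Sum>j<n. D k j * (sqrt (\<kappa> k) + (\<mu> j - \<kappa> k) / (2 * sqrt (\<kappa> k))))"
    by (rule sum.swap)
  also have "\<dots> = (\<Sum>k<n. sqrt (\<kappa> k) + (Re (qform n K (e k)) - \<kappa> k) / (2 * sqrt (\<kappa> k)))"
  proof (intro sum.cong refl)
    fix k assume "k \<in> {..<n}"
    then have k: "k < n" by simp
    have q: "Re (qform n K (e k)) = (\<Sum>j<n. \<mu> j * D k j)"
      using qform_spectral[OF w eigK, of "e k"] by (simp only: D_def Re_complex_of_real)
    have "D k j * (sqrt (\<kappa> k) + (\<mu> j - \<kappa> k) / (2 * sqrt (\<kappa> k))) =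
       D k j * (sqrt (\<kappa> k) - \<kappa> k / (2 * sqrt (\<kappa> k))) + \<mu> j * D k j / (2 * sqrt (\<kappa> k))" for j
      by (simp add: algebra_simps diff_divide_distrib)
    then have "(\<Sum>j<n. D k j * (sqrt (\<kappa> k) + (\<mu> j - \<kappa> k) / (2 * sqrt (\<kappa> k)))) =
      (\<Sum>j<n. D k j) * (sqrt (\<kappa> k) - \<kappa> k / (2 * sqrt (\<kappa> k))) + (\<Sum>j<n. \<mu> j * D k j) / (2 * sqrt (\<kappa> k))"
      by (simp only: sum.distrib sum_distrib_right sum_divide_distrib)
    then show "(\<Sum>j<n. D k j * (sqrt (\<kappa> k) + (\<mu> j - \<kappa> k) / (2 * sqrt (\<kappa> k)))) = sqrt (\<kappa> k) + (Re (qform n K (e k)) - \<kappa> k) / (2 * sqrt (\<kappa> k))"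
      unfolding D1[OF k] q by (simp add: diff_divide_distrib)
  qed
  also have "\<dots> \<le> (\<Sum>k<n. sqrt (\<kappa> k) + \<epsilon> k / (2 * c))"
  proof (rule sum_mono)
    fix k assume "k \<in> {..<n}"
    then have k: "k < n" by simp
    have "(Re (qform n K (e k)) - \<kappa> k) / (2 * sqrt (\<kappa> k)) \<le> \<epsilon> k / (2 * sqrt (\<kappa> k))"
      using pert(1)[OF k] lam[OF k] by (intro divide_right_mono) auto
    also have "\<dots> \<le> \<epsilon> k / (2 * c)" using pert(2)[OF k] lam[OF k] pos(1) by (intro divide_left_mono) auto
    finally show "sqrt (\<kappa> k) + (Re (qform n K (e k)) - \<kappa> k) / (2 * sqrt (\<kappa> k)) \<le> sqrt (\<kappa> k) + \<epsilon> k / (2 * c)" by simp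
  qed
  also have "\<dots> = (\<Sum>k<n. sqrt (\<kappa> k)) + (\<Sum>k<n. \<epsilon> k) / (2 * c)"
    by (simp add: sum.distrib sum_divide_distrib)
  finally show ?thesis .
qed

section \<open>The inverse Kac-Murdock-Szego matrix and its circulant comparison\<close>

text \<open>\<open>1 - |\<rho>|\<^sup>2\<close> times the inverse of \<open>kms n \<rho>\<close>.\<close>

definition kms_inv :: "nat \<Rightarrow> complex \<Rightarrow> nat \<Rightarrow> nat \<Rightarrow> complex" where
  "kms_inv n \<rho> i m =
     (if m = i then 1 + complex_of_real ((cmod \<rho>)\<^sup>2) * (1 - (if i = 0 then 1 else 0) - (if Suc i = n then 1 else 0)) else 0)
     + (if m = Suc i then - \<rho> else 0) + (if Suc m = i then - cnj \<rho> else 0)"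

lemma kms_inv_apply:
  assumes "i < n"
  shows "(\<Sum>m<n. kms_inv n \<rho> i m * x m) =
    (1 + complex_of_real ((cmod \<rho>)\<^sup>2) * (1 - (if i = 0 then 1 else 0) - (if Suc i = n then 1 else 0))) * x i
    - (if Suc i < n then \<rho> * x (Suc i) else 0) - (if i = 0 then 0 else cnj \<rho> * x (i - 1))"
proof -
  have m: "Suc m = i \<longleftrightarrow> i \<noteq> 0 \<and> m = i - 1" for m by auto
  show ?thesis
    unfolding kms_inv_def distrib_right sum.distrib if_distrib[of "\<lambda>y. y * _"] mult_zero_left m
    using assms by (auto simp: sum.delta)
qed

lemma cmod_sq: "complex_of_real ((cmod \<rho>)\<^sup>2) = \<rho> * cnj \<rho>"
  by (rule complex_norm_square)

text \<open>Splitting the product with the Kac-Murdock-Szego matrix at the diagonal gives sums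
  \<open>A\<close> and \<open>B\<close>, each obeying a one-step recursion, with
  \<open>A n = 0\<close> and \<open>B 0 = 0\<close>. The tridiagonal combination of neighbouring
  values of \<open>A + B\<close> collapses to a multiple of \<open>w i\<close>; the corrected corner
  diagonals fit the two boundary values.\<close>

lemma kms_inv_kms:
  assumes n: "2 \<le> n" and i: "i < n"
    and y: "\<And>i. i < n \<Longrightarrow> y i = (\<Sum>j<n. kms n \<rho> $$ (i, j) * w j)"
  shows "(\<Sum>m<n. kms_inv n \<rho> i m * y m) = (1 - complex_of_real ((cmod \<rho>)\<^sup>2)) * w i"
proof -
  define A where "A i = (\<Sum>j\<in>{i..<n}. \<rho> ^ (j - i) * w j)" for i
  define B where "B i = (\<Sum>j<i. cnj \<rho> ^ (i - j) * w j)" for i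
  have yAB: "y i = A i + B i" if "i < n" for i
  proof -
    have "y i = (\<Sum>j<n. kms n \<rho> $$ (i, j) * w j)" by (rule y[OF that])
    also have "\<dots> = (\<Sum>j\<in>{..<i} \<union> {i..<n}. kms n \<rho> $$ (i, j) * w j)"
      using that by (intro sum.cong refl) auto
    also have "\<dots> = (\<Sum>j<i. kms n \<rho> $$ (i, j) * w j) + (\<Sum>j\<in>{i..<n}. kms n \<rho> $$ (i, j) * w j)"
      by (rule sum.union_disjoint) auto
    also have "(\<Sum>j<i. kms n \<rho> $$ (i, j) * w j) = B i" unfolding B_def using that by (intro sum.cong) (auto simp: kms_def)
    also have "(\<Sum>j\<in>{i..<n}. kms n \<rho> $$ (i, j) * w j) = A i" unfolding A_def using that by (intro sum.cong) (auto simp: kms_def)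
    finally show ?thesis by simp
  qed
  have An: "A n = 0" by (simp add: A_def)
  have A: "A i = w i + \<rho> * A (Suc i)" if "i < n" for i
  proof -
    have "(\<Sum>j\<in>{Suc i..<n}. \<rho> ^ (j - i) * w j) = (\<Sum>j\<in>{Suc i..<n}. \<rho> * (\<rho> ^ (j - Suc i) * w j))"
    proof (intro sum.cong refl)
      fix j assume "j \<in> {Suc i..<n}"
      then have "j - i = Suc (j - Suc i)" by auto
      then show "\<rho> ^ (j - i) * w j = \<rho> * (\<rho> ^ (j - Suc i) * w j)" by simp
    qed
    then show ?thesis using that by (simp add: A_def sum.atLeast_Suc_lessThan sum_distrib_left)
  qed
  have B0: "B 0 = 0" by (simp add: B_def)
  have B: "B (Suc i) = cnj \<rho> * (B i + w i)" for i
  proof -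
    have "(\<Sum>j<i. cnj \<rho> ^ (Suc i - j) * w j) = (\<Sum>j<i. cnj \<rho> * (cnj \<rho> ^ (i - j) * w j))"
      by (intro sum.cong) (auto simp: Suc_diff_le)
    then show ?thesis by (simp add: B_def sum_distrib_left distrib_left)
  qed
  consider "i = 0" | "Suc i = n" "0 < i" | "0 < i" "Suc i < n" using i n by linarith
  then show ?thesis
  proof cases
    case 1
    then have "Suc i < n" "Suc i \<noteq> n" using n by auto
    then show ?thesis
      unfolding kms_inv_apply[OF i] using 1 i
      by (simp add: yAB A[of 0] B[of 0] B0 cmod_sq algebra_simps del: of_real_power)
  next
    case 2
    then obtain k where k: "i = Suc k" by (cases i) auto
    have "A i = w i" using A[OF i] An 2 by simp
    moreover have "A k = w k + \<rho> * A i" using A[of k] i k by simp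
    ultimately show ?thesis
      unfolding kms_inv_apply[OF i] using 2 i
      by (simp add: yAB k B[of k] cmod_sq algebra_simps del: of_real_power)
  next
    case 3
    then obtain k where k: "i = Suc k" by (cases i) auto
    have "A k = w k + \<rho> * A i" using A[of k] i k by simp
    moreover have "B i = cnj \<rho> * (B k + w k)" using B k by simp
    ultimately show ?thesis
      unfolding kms_inv_apply[OF i] cmod_sq using 3 i k A[OF i] B[of i]
      by (simp add: yAB algebra_simps)
  qed
qed

text \<open>Added to \<open>kms_inv\<close>, these corner entries produce a matrix that the twisted Fourier basis \<open>fourier n \<rho>\<close> diagonalizes,
  with eigenvalues \<open>symbol |\<rho>| (k / n)\<close>.\<close>

definition kms_corner :: "nat \<Rightarrow> complex \<Rightarrow> nat \<Rightarrow> nat \<Rightarrow> complex" where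
  "kms_corner n \<rho> i m =
     (if i = 0 \<and> m = 0 then complex_of_real ((cmod \<rho>)\<^sup>2) else 0) + (if Suc i = n \<and> Suc m = n then complex_of_real ((cmod \<rho>)\<^sup>2) else 0)
     + (if Suc i = n \<and> m = 0 then - \<rho> * cis (- Arg \<rho> * real n) else 0)
     + (if i = 0 \<and> Suc m = n then - cnj \<rho> * cis (Arg \<rho> * real n) else 0)"

lemma kms_corner_apply:
  assumes "i < n"
  shows "(\<Sum>m<n. kms_corner n \<rho> i m * x m) =
    (if i = 0 then complex_of_real ((cmod \<rho>)\<^sup>2) * x 0 - cnj \<rho> * cis (Arg \<rho> * real n) * x (n - 1) else 0) +
    (if Suc i = n then complex_of_real ((cmod \<rho>)\<^sup>2) * x (n - 1) - \<rho> * cis (- Arg \<rho> * real n) * x 0 else 0)"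
proof -
  have m: "Suc m = n \<longleftrightarrow> m = n - 1" for m using assms by auto
  have d: "(\<Sum>m<n. (if P \<and> m = k then c else 0) * x m) = (if P then c * x k else 0)" if "k < n" for P k c
    using that by (cases P) (auto simp: if_distrib[of "\<lambda>y. y * _"] cong: if_cong)
  have "0 < n" "n - 1 < n" using assms by auto
  then show ?thesis
    unfolding kms_corner_def distrib_right sum.distrib m[of "_"] by (simp add: d)
qed

text \<open>The factor \<open>cis (- Arg \<rho> * real i)\<close> absorbs the phase of
  \<open>\<rho>\<close>, so that eigenvalues depend on \<open>cmod \<rho>\<close> only. For
  \<open>\<rho> = 1\<close> this is the ordinary Fourier basis.\<close>

definition fourier :: "nat \<Rightarrow> complex \<Rightarrow> nat \<Rightarrow> nat \<Rightarrow> complex" where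
  "fourier n \<rho> k i = complex_of_real (1 / sqrt (real n)) * (cis (- Arg \<rho> * real i) * cis (2 * pi * real k * real i / real n))"

lemma fourier_onb:
  assumes n: "0 < n"
  shows "complete_onb n (fourier n \<rho>)"
  unfolding complete_onb_def
proof (intro conjI allI impI)
  have s: "complex_of_real (1 / sqrt (real n)) * complex_of_real (1 / sqrt (real n)) = 1 / of_nat n"
    using n by (simp flip: of_real_mult)
  fix i j assume ij: "i < n" "j < n"
  have "cnj (fourier n \<rho> i m) * fourier n \<rho> j m = (1 / of_nat n) *
      (cis (2 * pi * real m * real j / real n) * cnj (cis (2 * pi * real m * real i / real n)))" for m
  proof -
    have "cnj (fourier n \<rho> i m) * fourier n \<rho> j m = (complex_of_real (1 / sqrt (real n)) * complex_of_real (1 / sqrt (real n))) *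
       ((cnj (cis (- Arg \<rho> * real m)) * cis (- Arg \<rho> * real m)) *
        (cis (2 * pi * real j * real m / real n) * cnj (cis (2 * pi * real i * real m / real n))))"
      unfolding fourier_def complex_cnj_mult complex_cnj_complex_of_real by (simp only: mult_ac)
    also have "cnj (cis (- Arg \<rho> * real m)) * cis (- Arg \<rho> * real m) = 1" by (simp add: cis_cnj cis_mult)
    finally show ?thesis unfolding s by (simp only: mult_1 mult.assoc mult.commute[of "real m"])
  qed
  then have "(\<Sum>m<n. cnj (fourier n \<rho> i m) * fourier n \<rho> j m) = (1 / of_nat n) *
      (\<Sum>m<n. cis (2 * pi * real m * real j / real n) * cnj (cis (2 * pi * real m * real i / real n)))"
    by (simp only: sum_distrib_left)
  then show "(\<Sum>m<n. cnj (fourier n \<rho> i m) * fourier n \<rho> j m) = (if i = j then 1 else 0)"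
    unfolding roots_of_unity_sum[OF ij(2,1)] using n by auto
  have "fourier n \<rho> k i * cnj (fourier n \<rho> k j) = (1 / of_nat n) * (cis (- Arg \<rho> * real i) * cnj (cis (- Arg \<rho> * real j))) *
      (cis (2 * pi * real k * real i / real n) * cnj (cis (2 * pi * real k * real j / real n)))" for k
    unfolding fourier_def complex_cnj_mult complex_cnj_complex_of_real s[symmetric] by (simp only: mult_ac)
  then have "(\<Sum>k<n. fourier n \<rho> k i * cnj (fourier n \<rho> k j)) = (1 / of_nat n) * (cis (- Arg \<rho> * real i) * cnj (cis (- Arg \<rho> * real j))) *
      (\<Sum>k<n. cis (2 * pi * real k * real i / real n) * cnj (cis (2 * pi * real k * real j / real n)))"
    by (simp only: sum_distrib_left)
  then show "(\<Sum>k<n. fourier n \<rho> k i * cnj (fourier n \<rho> k j)) = (if i = j then 1 else 0)"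
    unfolding roots_of_unity_sum[OF ij] using n by (auto simp: cis_cnj cis_mult)
qed

text \<open>A shift of the twisted basis vector, combined with \<open>\<rho>\<close> or its
  conjugate, amounts to multiplication by \<open>cmod \<rho>\<close> and a phase. At the two ends
  the shift leaves the index range; the corner phases are those that identify \<open>x n\<close>
  with a multiple of \<open>x 0\<close> and so close the cycle.\<close>

lemma circulant_eigen:
  assumes n: "2 \<le> n" and i: "i < n" and r: "\<rho> \<noteq> 0"
  shows "(\<Sum>m<n. (kms_inv n \<rho> i m + kms_corner n \<rho> i m) * fourier n \<rho> k m) =
    complex_of_real (symbol (cmod \<rho>) (real k / real n)) * fourier n \<rho> k i"
proof -
  define \<theta> where "\<theta> = 2 * pi * (real k / real n)"
  define x where "x = fourier n \<rho> k"
  have \<rho>: "\<rho> = complex_of_real (cmod \<rho>) * cis (Arg \<rho>)" using r by (simp add: cis_Arg sgn_eq)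
  have \<rho>c: "cnj \<rho> = complex_of_real (cmod \<rho>) * cis (- Arg \<rho>)"
    by (subst \<rho>) (simp add: cis_cnj)
  have xs: "x i = complex_of_real (1 / sqrt (real n)) * cis (real i * (\<theta> - Arg \<rho>))" for i
    unfolding x_def fourier_def cis_mult \<theta>_def by (simp add: algebra_simps)
  have up: "\<rho> * x (Suc i) = complex_of_real (cmod \<rho>) * cis \<theta> * x i" for i
    by (subst \<rho>) (simp add: xs algebra_simps cis_mult flip: mult.assoc)
  have down: "cnj \<rho> * x i = complex_of_real (cmod \<rho>) * cis (- \<theta>) * x (Suc i)" for i
    by (subst \<rho>c) (simp add: xs algebra_simps cis_mult flip: mult.assoc)
  have wrap: "x n = cis (- Arg \<rho> * real n) * x 0"
  proof -
    have "real n * (\<theta> - Arg \<rho>) = - Arg \<rho> * real n + 2 * pi * real k" using n by (simp add: \<theta>_def algebra_simps)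
    moreover have "cis (2 * pi * real k) = 1" by simp
    ultimately have "cis (real n * (\<theta> - Arg \<rho>)) = cis (- Arg \<rho> * real n)"
      by (simp only: cis_mult[symmetric] mult_1_right)
    then show ?thesis by (simp add: xs)
  qed
  have c1: "\<rho> * cis (- Arg \<rho> * real n) * x 0 = complex_of_real (cmod \<rho>) * cis \<theta> * x (n - 1)"
    using up[of "n - 1"] wrap n by (simp add: mult.assoc)
  have c2: "cnj \<rho> * cis (Arg \<rho> * real n) * x (n - 1) = complex_of_real (cmod \<rho>) * cis (- \<theta>) * x 0"
  proof -
    have "cnj \<rho> * cis (Arg \<rho> * real n) * x (n - 1) = cis (Arg \<rho> * real n) * (complex_of_real (cmod \<rho>) * cis (- \<theta>) * x n)"
      using down[of "n - 1"] n by (simp add: mult.assoc mult.left_commute)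
    also have "\<dots> = (cis (Arg \<rho> * real n) * cis (- Arg \<rho> * real n)) * (complex_of_real (cmod \<rho>) * cis (- \<theta>) * x 0)"
      unfolding wrap by (simp only: mult_ac)
    finally show ?thesis by (simp add: cis_mult)
  qed
  define q where "q = complex_of_real ((cmod \<rho>)\<^sup>2)"
  define a where "a = complex_of_real (cmod \<rho>) * cis \<theta>"
  define b where "b = complex_of_real (cmod \<rho>) * cis (- \<theta>)"
  have sym: "complex_of_real (symbol (cmod \<rho>) (real k / real n)) = 1 + q - a - b"
    by (simp add: symbol_def q_def a_def b_def \<theta>_def complex_eq_iff)
  have dn: "cnj \<rho> * x (i - 1) = b * x i" if "i \<noteq> 0" using down[of "i - 1"] that by (simp add: b_def)
  have "(\<Sum>m<n. (kms_inv n \<rho> i m + kms_corner n \<rho> i m) * x m) = (1 + q - a - b) * x i"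
    unfolding distrib_right sum.distrib kms_inv_apply[OF i] kms_corner_apply[OF i] c1 c2 up q_def[symmetric] a_def[symmetric] b_def[symmetric]
    using dn n i by (cases "i = 0"; cases "Suc i = n") (auto simp: algebra_simps)
  then show ?thesis unfolding sym x_def .
qed

lemma qform_add: "qform n (\<lambda>i m. a i m + b i m) x = qform n a x + qform n b x"
  by (simp add: qform_def distrib_right distrib_left sum.distrib)

text \<open>Only the first and last coordinates \<open>u\<close>, \<open>v\<close> enter, and all
  four corner entries have modulus at most 1. The form is thus bounded by the square of the sum of
  their moduli, and this by twice the sum of the squares.\<close>

lemma qform_corner_bound:
  assumes n: "2 \<le> n" and r: "cmod \<rho> < 1"
  shows "\<bar>Re (qform n (kms_corner n \<rho>) x)\<bar> \<le> 2 * ((cmod (x 0))\<^sup>2 + (cmod (x (n - 1)))\<^sup>2)"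
proof -
  let ?u = "cmod (x 0)" and ?v = "cmod (x (n - 1))"
  let ?q = "complex_of_real ((cmod \<rho>)\<^sup>2)"
  define T where "T = cnj (x 0) * (?q * x 0 - cnj \<rho> * cis (Arg \<rho> * real n) * x (n - 1))"
  define U where "U = cnj (x (n - 1)) * (?q * x (n - 1) - \<rho> * cis (- Arg \<rho> * real n) * x 0)"
  have "qform n (kms_corner n \<rho>) x = (\<Sum>i<n. (if i = 0 then T else 0) + (if i = n - 1 then U else 0))"
    unfolding qform_def
  proof (intro sum.cong refl)
    fix i assume "i \<in> {..<n}"
    then have i: "i < n" by simp
    show "cnj (x i) * (\<Sum>m<n. kms_corner n \<rho> i m * x m) = (if i = 0 then T else 0) + (if i = n - 1 then U else 0)"
      unfolding kms_corner_apply[OF i] T_def U_def using n i by auto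
  qed
  also have "\<dots> = T + U" using n by (simp add: sum.distrib)
  finally have e: "qform n (kms_corner n \<rho>) x = T + U" .
  have q1: "cmod ((complex_of_real (cmod \<rho>))\<^sup>2) \<le> 1" using r by (simp add: norm_power power_le_one)
  have "cmod T \<le> ?u * (1 * ?u + 1 * 1 * ?v)"
    unfolding T_def norm_mult complex_mod_cnj
    by (intro mult_left_mono order_trans[OF norm_triangle_ineq4] add_mono) (auto simp: norm_mult intro!: mult_mono q1 mult_right_le_one_le mult_left_le_one_le less_imp_le[OF r] power_le_one)
  moreover have "cmod U \<le> ?v * (1 * ?v + 1 * 1 * ?u)"
    unfolding U_def norm_mult complex_mod_cnj
    by (intro mult_left_mono order_trans[OF norm_triangle_ineq4] add_mono) (auto simp: norm_mult intro!: mult_mono q1 mult_right_le_one_le mult_left_le_one_le less_imp_le[OF r] power_le_one)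
  moreover have "\<bar>Re (T + U)\<bar> \<le> cmod T + cmod U"
    by (rule order_trans[OF abs_Re_le_cmod norm_triangle_ineq])
  moreover have "2 * (?u * ?v) \<le> ?u\<^sup>2 + ?v\<^sup>2" using sum_squares_bound[of ?u ?v] by simp
  ultimately show ?thesis unfolding e by (simp add: algebra_simps power2_eq_square)
qed

text \<open>Positivity of the \<open>l j\<close> is derived, not assumed: the scaled inverse has
  eigenvalues \<open>\<mu> j\<close>, and a Gershgorin estimate puts them above
  \<open>(1 - cmod \<rho>)\<^sup>2\<close>. The same bound serves as \<open>c\<^sup>2\<close> in
  \<open>sqrt_trace_le\<close>, used once in each direction. The corner perturbation has total cost
  4 for every \<open>n\<close>, which leaves \<open>4 / (2 * (1 - cmod \<rho>))\<close>.\<close>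

lemma kms_spectrum:
  assumes n: "2 \<le> n" and r: "0 < cmod \<rho>" "cmod \<rho> < 1"
    and w: "complete_onb n w"
    and eig: "\<And>i j. i < n \<Longrightarrow> j < n \<Longrightarrow> (\<Sum>m<n. kms n \<rho> $$ (i, m) * w j m) = complex_of_real (l j) * w j i"
  shows "\<And>j. j < n \<Longrightarrow> 0 < l j"
    and "\<bar>(\<Sum>j<n. sqrt ((1 - (cmod \<rho>)\<^sup>2) / l j)) - (\<Sum>k<n. sqrt (symbol (cmod \<rho>) (real k / real n)))\<bar> \<le> 2 / (1 - cmod \<rho>)"
proof -
  let ?r = "cmod \<rho>"
  define \<mu> where "\<mu> j = (1 - ?r\<^sup>2) / l j" for j
  have rr: "0 < 1 - ?r\<^sup>2" using r by (simp add: power_less_one_iff abs_square_less_1)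
  have nrm: "(\<Sum>i<n. (cmod (w j i))\<^sup>2) = 1" if "j < n" for j
  proof -
    have "complex_of_real (\<Sum>i<n. (cmod (w j i))\<^sup>2) = 1"
      using w that unfolding complex_sum_cmod2 by (simp add: complete_onb_def)
    then show ?thesis by (simp only: of_real_eq_1_iff)
  qed
  have lK: "complex_of_real (l j) * (\<Sum>m<n. kms_inv n \<rho> i m * w j m) = complex_of_real (1 - ?r\<^sup>2) * w j i" if "i < n" "j < n" for i j
  proof -
    have "(\<Sum>m<n. kms_inv n \<rho> i m * (complex_of_real (l j) * w j m)) = (1 - complex_of_real (?r\<^sup>2)) * w j i"
      by (rule kms_inv_kms[OF n that(1)]) (use eig that in simp)
    then show ?thesis by (simp add: sum_distrib_left mult.left_commute)
  qed
  have l0: "l j \<noteq> 0" if "j < n" for j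
  proof
    assume "l j = 0"
    then have "w j i = 0" if "i < n" for i
    proof -
      have "complex_of_real (1 - ?r\<^sup>2) * w j i = 0" using lK[OF that \<open>j < n\<close>] \<open>l j = 0\<close> by simp
      then show ?thesis using rr by (simp del: of_real_diff)
    qed
    then show False using nrm[OF that] by simp
  qed
  have K: "(\<Sum>m<n. kms_inv n \<rho> i m * w j m) = complex_of_real (\<mu> j) * w j i" if "i < n" "j < n" for i j
    using lK[OF that] l0[OF that(2)] by (simp add: \<mu>_def field_simps)
  \<comment> \<open>Gershgorin's argument: the eigenvalue equation is read at a coordinate
    \<open>i\<close> where the eigenvector has maximal modulus, so the off-diagonal terms are
    dominated by that coordinate.\<close>
  have mu: "(1 - ?r)\<^sup>2 \<le> \<mu> j" if j: "j < n" for j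
  proof -
    have "Max ((\<lambda>m. cmod (w j m)) ` {..<n}) \<in> (\<lambda>m. cmod (w j m)) ` {..<n}"
      using j by (intro Max_in) auto
    then obtain i where i: "i < n" and "cmod (w j i) = Max ((\<lambda>m. cmod (w j m)) ` {..<n})" by auto
    then have max: "\<And>m. m < n \<Longrightarrow> cmod (w j m) \<le> cmod (w j i)" by simp
    note K' = K[OF i j, unfolded kms_inv_apply[OF i], symmetric]
    have sq: "(1 - ?r)\<^sup>2 = 1 - 2 * ?r + ?r * ?r" by (simp add: power2_eq_square algebra_simps)
    have wi: "0 < cmod (w j i)"
    proof (rule ccontr)
      assume "\<not> 0 < cmod (w j i)"
      then have "w j m = 0" if "m < n" for m using max[OF that] by (metis norm_ge_zero norm_le_zero_iff not_less order_trans)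
      then show False using nrm[OF j] by simp
    qed
    have ge: "x - y \<le> \<mu> j" if eq: "complex_of_real (\<mu> j) * w j i = complex_of_real x * w j i - t" and t: "cmod t \<le> y * cmod (w j i)" for x y t
    proof -
      have "complex_of_real (x - \<mu> j) * w j i = t" using eq by (simp add: algebra_simps)
      then have "\<bar>x - \<mu> j\<bar> * cmod (w j i) \<le> y * cmod (w j i)" using t by (metis norm_mult norm_of_real)
      then have "\<bar>x - \<mu> j\<bar> \<le> y" using wi by simp
      then show ?thesis by linarith
    qed
    have tm: "cmod (\<rho> * w j m) \<le> ?r * cmod (w j i)" "cmod (cnj \<rho> * w j m) \<le> ?r * cmod (w j i)" if "m < n" for m
      using max[OF that] by (simp_all add: norm_mult mult_left_mono)
    have q: "?r * ?r \<le> ?r" using r by (intro mult_left_le) auto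
    consider "i = 0" | "Suc i = n" "0 < i" | "0 < i" "Suc i < n" using i n by linarith
    then show ?thesis
    proof cases
      \<comment> \<open>In the first and the last row the diagonal entry is 1 and only one
        off-diagonal entry of modulus \<open>cmod \<rho>\<close> remains. This gives
        \<open>1 - cmod \<rho>\<close>, which is at least its own square.\<close>
      case 1
      have "1 - ?r \<le> \<mu> j"
        by (rule ge[of 1 "\<rho> * w j 1"]) (use K' tm[of 1] 1 n in auto)
      then show ?thesis using q r unfolding sq by linarith
    next
      case 2
      have "1 - ?r \<le> \<mu> j"
        by (rule ge[of 1 "cnj \<rho> * w j (i - 1)"]) (use K' tm[of "i - 1"] 2 n in auto)
      then show ?thesis using q r unfolding sq by linarith
    next
      case 3
      have "(1 + ?r\<^sup>2) - 2 * ?r \<le> \<mu> j"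
      proof (rule ge[of "1 + ?r\<^sup>2" "\<rho> * w j (Suc i) + cnj \<rho> * w j (i - 1)"])
        show "complex_of_real (\<mu> j) * w j i = complex_of_real (1 + ?r\<^sup>2) * w j i - (\<rho> * w j (Suc i) + cnj \<rho> * w j (i - 1))"
          using K' 3 n by (auto simp: algebra_simps)
        show "cmod (\<rho> * w j (Suc i) + cnj \<rho> * w j (i - 1)) \<le> 2 * ?r * cmod (w j i)"
        proof -
          have "i - 1 < n" using i by simp
          then show ?thesis
            using tm(1)[OF 3(2)] tm(2)[of "i - 1"] norm_triangle_ineq[of "\<rho> * w j (Suc i)" "cnj \<rho> * w j (i - 1)"] by linarith
        qed
      qed
      then show ?thesis by (simp add: power2_eq_square algebra_simps)
    qed
  qed
  have c: "0 < 1 - ?r" using r by simp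
  have mu0: "0 < \<mu> j" if "j < n" for j using mu[OF that] c by (meson less_le_trans zero_less_power)
  show pos: "0 < l j" if "j < n" for j
    using mu0[OF that] rr by (simp add: \<mu>_def zero_less_divide_iff)
  have \<rho>0: "\<rho> \<noteq> 0" using r by auto
  note F = fourier_onb[of n \<rho>]
  let ?C = "\<lambda>i m. kms_inv n \<rho> i m + kms_corner n \<rho> i m"
  let ?\<kappa> = "\<lambda>k. symbol ?r (real k / real n)"
  have fo: "complete_onb n (fourier n \<rho>)" using n by (intro fourier_onb) simp
  have fn: "(cmod (fourier n \<rho> k i))\<^sup>2 = 1 / real n" for k i
    using n by (simp add: fourier_def norm_mult norm_divide power_divide)
  have sym: "(1 - ?r)\<^sup>2 \<le> ?\<kappa> k" for k using r by (intro symbol_bounds) auto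
  \<comment> \<open>A Fourier vector has entries of squared modulus \<open>1 / n\<close>, so the
    corner form costs at most \<open>2 * (1/n + 1/n)\<close>, which sums to 4 over all
    \<open>k\<close>.\<close>
  have qK: "Re (qform n (kms_inv n \<rho>) (fourier n \<rho> k)) \<le> ?\<kappa> k + 4 / real n" if "k < n" for k
  proof -
    have "qform n ?C (fourier n \<rho> k) = complex_of_real (?\<kappa> k) * (\<Sum>i<n. cnj (fourier n \<rho> k i) * fourier n \<rho> k i)"
    proof -
      have "qform n ?C (fourier n \<rho> k) = (\<Sum>i<n. complex_of_real (?\<kappa> k) * (cnj (fourier n \<rho> k i) * fourier n \<rho> k i))"
        unfolding qform_def by (intro sum.cong refl) (simp add: circulant_eigen[OF n _ \<rho>0] mult.left_commute)
      then show ?thesis by (simp only: sum_distrib_left)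
    qed
    also have "(\<Sum>i<n. cnj (fourier n \<rho> k i) * fourier n \<rho> k i) = 1" using fo that by (simp add: complete_onb_def)
    finally have "Re (qform n (kms_inv n \<rho>) (fourier n \<rho> k)) + Re (qform n (kms_corner n \<rho>) (fourier n \<rho> k)) = ?\<kappa> k"
      unfolding qform_add by (metis Re_complex_of_real mult.right_neutral plus_complex.sel(1))
    then show ?thesis using qform_corner_bound[OF n r(2), of "fourier n \<rho> k"] unfolding fn by simp
  qed
  have f1: "(\<Sum>j<n. sqrt (\<mu> j)) \<le> (\<Sum>k<n. sqrt (?\<kappa> k)) + (\<Sum>k<n. 4 / real n) / (2 * (1 - ?r))"
    by (rule sqrt_trace_le[OF fo w K c _ sym qK]) (use mu0 in \<open>auto intro: less_imp_le\<close>)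
  \<comment> \<open>In the reverse direction the individual corner costs of the eigenvectors are
    unknown, but completeness of the eigenbasis makes their sum over \<open>j\<close> equal to
    4.\<close>
  have f2: "(\<Sum>k<n. sqrt (?\<kappa> k)) \<le> (\<Sum>j<n. sqrt (\<mu> j)) + (\<Sum>j<n. 2 * ((cmod (w j 0))\<^sup>2 + (cmod (w j (n - 1)))\<^sup>2)) / (2 * (1 - ?r))"
  proof (rule sqrt_trace_le[OF w fo circulant_eigen[OF n _ \<rho>0] c _ mu])
    show "0 \<le> ?\<kappa> k" for k using sym[of k] zero_le_power2[of "1 - ?r"] by linarith
    fix k assume k: "k < n"
    show "0 \<le> 2 * ((cmod (w k 0))\<^sup>2 + (cmod (w k (n - 1)))\<^sup>2)" by simp
    have "qform n (kms_inv n \<rho>) (w k) = complex_of_real (\<mu> k) * (\<Sum>i<n. cnj (w k i) * w k i)"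
    proof -
      have "qform n (kms_inv n \<rho>) (w k) = (\<Sum>i<n. complex_of_real (\<mu> k) * (cnj (w k i) * w k i))"
        unfolding qform_def by (intro sum.cong refl) (simp add: K[OF _ k] mult.left_commute)
      then show ?thesis by (simp only: sum_distrib_left)
    qed
    also have "(\<Sum>i<n. cnj (w k i) * w k i) = 1" using w k by (simp add: complete_onb_def)
    finally have "Re (qform n ?C (w k)) = \<mu> k + Re (qform n (kms_corner n \<rho>) (w k))"
      unfolding qform_add by simp
    then show "Re (qform n ?C (w k)) \<le> \<mu> k + 2 * ((cmod (w k 0))\<^sup>2 + (cmod (w k (n - 1)))\<^sup>2)"
      using qform_corner_bound[OF n r(2), of "w k"] by simp
  qed auto
  have "(\<Sum>j<n. (cmod (w j i))\<^sup>2) = 1" if "i < n" for i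
  proof -
    have "complex_of_real (\<Sum>j<n. (cmod (w j i))\<^sup>2) = (\<Sum>j<n. w j i * cnj (w j i))"
      by (simp only: of_real_sum complex_norm_square)
    also have "\<dots> = 1" using w that by (simp add: complete_onb_def)
    finally show ?thesis by (simp only: of_real_eq_1_iff)
  qed
  then have s1: "(\<Sum>j<n. 2 * ((cmod (w j 0))\<^sup>2 + (cmod (w j (n - 1)))\<^sup>2)) = 4"
    using n by (simp add: sum.distrib flip: sum_distrib_left)
  have s2: "(\<Sum>k<n. 4 / real n) = 4" using n by simp
  have four: "4 / (2 * (1 - ?r)) = 2 / (1 - ?r)" using c by (simp add: divide_simps)
  show "\<bar>(\<Sum>j<n. sqrt ((1 - ?r\<^sup>2) / l j)) - (\<Sum>k<n. sqrt (?\<kappa> k))\<bar> \<le> 2 / (1 - ?r)"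
    using f1 f2 unfolding s1 s2 four \<mu>_def by linarith
qed

lemma sorted_eigendecompositionD:
  assumes "sorted_eigendecomposition n A W l" "A \<in> carrier_mat n n"
  shows "complete_onb n (\<lambda>j m. W $$ (m, j))"
    and "\<And>i j. i < n \<Longrightarrow> j < n \<Longrightarrow> (\<Sum>m<n. A $$ (i, m) * W $$ (m, j)) = complex_of_real (l j) * W $$ (i, j)"
proof -
  have W: "W \<in> carrier_mat n n" and WW: "mat_adjoint W * W = 1\<^sub>m n" "W * mat_adjoint W = 1\<^sub>m n"
    and A: "A = W * mat_diag n (\<lambda>i. complex_of_real (l i)) * mat_adjoint W"
    using assms(1) by (auto simp: sorted_eigendecomposition_def)
  have W': "mat_adjoint W \<in> carrier_mat n n" by (rule mat_adjoint_carrier[OF W])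
  let ?D = "mat_diag n (\<lambda>i. complex_of_real (l i))"
  have D: "?D \<in> carrier_mat n n" by (simp add: mat_diag_def)
  show "complete_onb n (\<lambda>j m. W $$ (m, j))"
    unfolding complete_onb_def
  proof (intro conjI allI impI)
    fix i j assume ij: "i < n" "j < n"
    have "(\<Sum>m<n. cnj (W $$ (m, i)) * W $$ (m, j)) = (mat_adjoint W * W) $$ (i, j)"
      using W ij by (simp add: mult_index[OF W' W ij])
    then show "(\<Sum>m<n. cnj (W $$ (m, i)) * W $$ (m, j)) = (if i = j then 1 else 0)" unfolding WW using ij by simp
    have "(\<Sum>k<n. W $$ (i, k) * cnj (W $$ (j, k))) = (W * mat_adjoint W) $$ (i, j)"
      using W ij by (simp add: mult_index[OF W W' ij])
    then show "(\<Sum>k<n. W $$ (i, k) * cnj (W $$ (j, k))) = (if i = j then 1 else 0)" unfolding WW using ij by simp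
  qed
  have "A * W = W * ?D * (mat_adjoint W * W)"
    unfolding A by (rule assoc_mult_mat[OF mult_carrier_mat[OF W D] W' W])
  then have AW: "A * W = W * ?D" unfolding WW using W D by simp
  fix i j assume ij: "i < n" "j < n"
  have "(\<Sum>m<n. A $$ (i, m) * W $$ (m, j)) = (W * ?D) $$ (i, j)"
    unfolding AW[symmetric] by (rule mult_index[OF assms(2) W ij, symmetric])
  also have "\<dots> = (\<Sum>k<n. W $$ (i, k) * (if k = j then complex_of_real (l j) else 0))"
    unfolding mult_index[OF W D ij] using ij by (intro sum.cong refl) (auto simp: mat_diag_def)
  also have "\<dots> = complex_of_real (l j) * W $$ (i, j)"
    using ij by (simp add: if_distrib[of "\<lambda>x. _ * x"] mult.commute cong: if_cong)
  finally show "(\<Sum>m<n. A $$ (i, m) * W $$ (m, j)) = complex_of_real (l j) * W $$ (i, j)" .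
qed

section \<open>Decision regions\<close>

definition decide :: "complex set \<Rightarrow> complex \<Rightarrow> complex" where
  "decide S y = arg_min_on (\<lambda>x. (cmod (y - x))\<^sup>2) S"

lemma decide_eq: "decide S y = (SOME x. x \<in> S \<and> (\<forall>x'\<in>S. cmod (y - x) \<le> cmod (y - x')))"
  unfolding decide_def arg_min_on_def arg_min_def is_arg_min_def
  by (simp add: not_less Ball_def power_mono_iff)

lemma decide_nearest:
  assumes "finite S" "S \<noteq> {}"
  shows "decide S y \<in> S" "\<And>x'. x' \<in> S \<Longrightarrow> cmod (y - decide S y) \<le> cmod (y - x')"
proof -
  have "\<exists>x. x \<in> S \<and> (\<forall>x'\<in>S. cmod (y - x) \<le> cmod (y - x'))"
    using ex_is_arg_min_if_finite[OF assms, of "\<lambda>x. cmod (y - x)"] by (auto simp: is_arg_min_linorder)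
  then have "decide S y \<in> S \<and> (\<forall>x'\<in>S. cmod (y - decide S y) \<le> cmod (y - x'))"
    unfolding decide_eq by (rule someI_ex)
  then show "decide S y \<in> S" "\<And>x'. x' \<in> S \<Longrightarrow> cmod (y - decide S y) \<le> cmod (y - x')" by auto
qed

lemma decide_eqI:
  assumes "finite S" "x \<in> S" "\<And>x'. x' \<in> S \<Longrightarrow> x' \<noteq> x \<Longrightarrow> cmod z < cmod (x + z - x')"
  shows "decide S (x + z) = x"
proof (rule ccontr)
  assume n: "decide S (x + z) \<noteq> x"
  have "S \<noteq> {}" using assms by auto
  note D = decide_nearest[OF assms(1) this, where y="x + z"]
  have "cmod z < cmod (x + z - decide S (x + z))" using assms(3)[OF D(1) n] .
  then show False using D(2)[OF assms(2)] by simp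
qed

lemma decide_eqD:
  assumes "finite S" "S \<noteq> {}" "decide S (x + z) = x" "x' \<in> S"
  shows "cmod z \<le> cmod (x + z - x')"
  using decide_nearest(2)[OF assms(1,2,4), of "x + z"] unfolding assms(3) by simp

text \<open>The choice among nearest points depends on \<open>y\<close> only through the set
  \<open>N y\<close> of nearest points. As \<open>S\<close> is finite, only finitely many such sets
  occur, and each is described by finitely many inequalities.\<close>

lemma decide_measurable:
  assumes S: "finite S"
  shows "{y. decide S y = x} \<in> sets borel"
proof -
  define N where "N y = {x\<in>S. \<forall>x'\<in>S. cmod (y - x) \<le> cmod (y - x')}" for y
  have 1: "decide S y = (SOME x. x \<in> N y)" for y unfolding decide_eq N_def by simp
  have "{y. decide S y = x} = (\<Union>T\<in>{T. T \<subseteq> S \<and> (SOME x. x \<in> T) = x}. {y. N y = T})"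
    unfolding 1 by (auto simp: N_def)
  moreover have "{y. N y = T} \<in> sets borel" if T: "T \<subseteq> S" for T
  proof -
    have eq: "{y. N y = T} = {y\<in>space borel. \<forall>x\<in>S. (\<forall>x'\<in>S. cmod (y - x) \<le> cmod (y - x')) = (x \<in> T)}"
      using T by (auto simp: N_def)
    show ?thesis unfolding eq using S by measurable
  qed
  ultimately show ?thesis using S by (auto intro!: sets.finite_UN)
qed

text \<open>Symbol error probability of nearest-point detection for a uniform symbol in additive
  circular noise of variance \<open>v\<close> per real coordinate. Conditionally on the channel each
  stream has an error probability of this form.\<close>

definition serr :: "complex set \<Rightarrow> real \<Rightarrow> real" where
  "serr S v = (\<Sum>x\<in>S. measure (cgauss v) {z. decide S (x + z) \<noteq> x}) / card S"

lemma decide_shift_measurable: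
  assumes "finite S"
  shows "{z. decide S (x + z) = x'} \<in> sets borel" "{z. decide S (x + z) \<noteq> x'} \<in> sets borel"
proof -
  have m: "(\<lambda>z. x + z) \<in> measurable borel borel" by measurable
  have "(\<lambda>z. x + z) -` {y. decide S y = x'} \<inter> space borel \<in> sets borel"
    by (rule measurable_sets[OF m decide_measurable[OF assms]])
  then show 1: "{z. decide S (x + z) = x'} \<in> sets borel" by (simp add: vimage_def)
  have "{z. decide S (x + z) \<noteq> x'} = UNIV - {z. decide S (x + z) = x'}" by auto
  then show "{z. decide S (x + z) \<noteq> x'} \<in> sets borel" using 1 by (metis borel_comp Compl_eq_Diff_UNIV)
qed

lemma serr_bounds:
  assumes "finite S" "S \<noteq> {}"
  shows "0 \<le> serr S v" "serr S v \<le> 1"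
proof -
  interpret prob_space "cgauss v" by (rule prob_space_cgauss)
  show "0 \<le> serr S v" unfolding serr_def by (intro divide_nonneg_nonneg sum_nonneg) auto
  have "(\<Sum>x\<in>S. measure (cgauss v) {z. decide S (x + z) \<noteq> x}) \<le> (\<Sum>x\<in>S. 1)" by (rule sum_mono) simp
  then show "serr S v \<le> 1" using assms by (simp add: serr_def divide_le_eq card_gt_0_iff)
qed

lemma serr_correct:
  assumes S: "finite S" "S \<noteq> {}" and p: "\<And>x. x \<in> S \<Longrightarrow> measure (cgauss v) {z. decide S (x + z) = x} = p x"
  shows "serr S v = 1 - (\<Sum>x\<in>S. p x) / card S"
proof -
  interpret prob_space "cgauss v" by (rule prob_space_cgauss)
  have "measure (cgauss v) {z. decide S (x + z) \<noteq> x} = 1 - p x" if "x \<in> S" for x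
  proof -
    have "{z. decide S (x + z) \<noteq> x} = space (cgauss v) - {z. decide S (x + z) = x}" by auto
    moreover have "measure (cgauss v) (space (cgauss v) - {z. decide S (x + z) = x}) = 1 - measure (cgauss v) {z. decide S (x + z) = x}"
      by (rule prob_compl) (simp add: decide_shift_measurable[OF S(1)])
    ultimately show ?thesis by (simp only: p[OF that])
  qed
  then have "(\<Sum>x\<in>S. measure (cgauss v) {z. decide S (x + z) \<noteq> x}) = card S - (\<Sum>x\<in>S. p x)"
    by (simp add: sum_subtractf)
  then show ?thesis using S by (simp add: serr_def diff_divide_distrib)
qed

text \<open>The tie-breaking rule disappears when an inner and an outer approximation of the
  decision region have the same probability.\<close>

lemma cell_measure:
  assumes S: "finite S" "S \<noteq> {}" and m: "O' \<in> sets borel" "C \<in> sets borel"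
    and sub: "\<And>z. z \<in> O' \<Longrightarrow> decide S (x + z) = x" "\<And>z. decide S (x + z) = x \<Longrightarrow> z \<in> C"
    and eq: "measure (cgauss v) O' = p" "measure (cgauss v) C = p"
  shows "measure (cgauss v) {z. decide S (x + z) = x} = p"
proof -
  interpret prob_space "cgauss v" by (rule prob_space_cgauss)
  have "measure (cgauss v) O' \<le> measure (cgauss v) {z. decide S (x + z) = x}"
    by (rule finite_measure_mono) (use sub decide_shift_measurable[OF S(1)] in auto)
  moreover have "measure (cgauss v) {z. decide S (x + z) = x} \<le> measure (cgauss v) C"
    by (rule finite_measure_mono) (use sub m in auto)
  ultimately show ?thesis using eq by simp
qed

section \<open>Gaussian tails\<close>

lemma Qfun_eq: "Qfun x = measure std_normal_distribution {x..}"
proof -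
  interpret prob_space std_normal_distribution by (rule prob_space_std_normal)
  have i: "set_integrable lborel {x..} std_normal_density"
    unfolding set_integrable_def by (intro integrable_mult_indicator) auto
  have "measure std_normal_distribution {x..} = (\<integral>t. indicator {x..} t \<partial>std_normal_distribution)" by simp
  also have "\<dots> = (\<integral>t. std_normal_density t *\<^sub>R indicator {x..} t \<partial>lborel)"
    by (subst integral_density) auto
  also have "\<dots> = (LINT t:{x..}|lborel. std_normal_density t)"
    unfolding set_lebesgue_integral_def by (simp add: mult.commute)
  also have "\<dots> = integral {x..} std_normal_density" by (rule set_borel_integral_eq_integral(2)[OF i])
  also have "\<dots> = integral {x..} (\<lambda>t. 1 / sqrt (2 * pi) * exp (- t\<^sup>2 / 2))"
    by (rule Henstock_Kurzweil_Integration.integral_cong) (simp add: std_normal_density_def)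
  also have "\<dots> = Qfun x" unfolding Qfun_def by (rule integral_mult_right)
  finally show ?thesis by simp
qed

lemma std_normal_null: "measure std_normal_distribution {x} = 0"
  using gauss_null_singleton[of 1 x] by (simp add: gauss_def distr_id2)

text \<open>The tail is one minus a distribution function, which is continuous because the normal
  law has no atoms.\<close>

lemma isCont_Qfun: "isCont Qfun x"
proof -
  interpret real_distribution std_normal_distribution by (rule real_dist_normal_dist)
  have "Qfun y = 1 - cdf std_normal_distribution y" for y
  proof -
    have "cdf std_normal_distribution y = measure std_normal_distribution {..<y} + measure std_normal_distribution {y}"
      unfolding cdf_def by (subst finite_measure_Union[symmetric]) (auto intro!: arg_cong[of _ _ "measure _"])
    moreover have "measure std_normal_distribution {y..} = 1 - measure std_normal_distribution {..<y}"
      by (subst prob_compl[symmetric]) (auto intro!: arg_cong[of _ _ "measure _"])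
    ultimately show ?thesis by (simp add: Qfun_eq std_normal_null)
  qed
  then have "Qfun = (\<lambda>y. 1 - cdf std_normal_distribution y)" by auto
  moreover have "isCont (cdf std_normal_distribution) x" using isCont_cdf[of x] by (simp add: std_normal_null)
  then have "isCont (\<lambda>y. 1 - cdf std_normal_distribution y) x" by (intro continuous_intros)
  ultimately show ?thesis by simp
qed

lemma gauss_tails:
  assumes "0 < v"
  shows "measure (gauss v) {x..} = Qfun (x / sqrt v)" "measure (gauss v) {x<..} = Qfun (x / sqrt v)"
    "measure (gauss v) {..-x} = Qfun (x / sqrt v)" "measure (gauss v) {..<-x} = Qfun (x / sqrt v)"
proof -
  interpret prob_space "gauss v" by (rule prob_space_gauss)
  have "(\<lambda>y. sqrt v * y) -` {x..} = {x / sqrt v..}" for x using assms by (auto simp: field_simps)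
  then show 1: "measure (gauss v) {x..} = Qfun (x / sqrt v)" for x
    unfolding Qfun_eq by (simp add: gauss_def measure_distr)
  have "{x..} = {x<..} \<union> {x}" for x :: real by auto
  then have "measure (gauss v) {x..} = measure (gauss v) {x<..} + measure (gauss v) {x}" for x
    by (simp only:) (rule finite_measure_Union, auto)
  then show 2: "measure (gauss v) {x<..} = Qfun (x / sqrt v)" for x
    using 1 gauss_null_singleton[OF assms, of x] by simp
  have neg: "distr (gauss v) borel uminus = gauss v"
  proof (rule Levy_uniqueness)
    show "real_distribution (distr (gauss v) borel uminus)" by (rule real_distribution_distr) simp
    have "char (distr (gauss v) borel uminus) t = char (gauss v) (- t)" for t
      unfolding char_def by (simp add: integral_distr)
    then show "char (distr (gauss v) borel uminus) = char (gauss v)"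
      using assms by (simp add: fun_eq_iff char_gauss)
  qed (rule real_distribution_gauss)
  have "measure (gauss v) (uminus -` A) = measure (gauss v) A" if "A \<in> sets borel" for A
    by (subst (2) neg[symmetric]) (use that in \<open>simp add: measure_distr\<close>)
  from this[of "{x..}"] this[of "{x<..}"]
  show "measure (gauss v) {..-x} = Qfun (x / sqrt v)" "measure (gauss v) {..<-x} = Qfun (x / sqrt v)"
    using 1[of x] 2[of x] by (simp_all add: vimage_def atLeast_def greaterThan_def atMost_def lessThan_def le_minus_iff less_minus_iff)
qed

lemma rectangle_sets:
  assumes "A \<in> sets borel" "B \<in> sets borel"
  shows "{z. Re z \<in> A \<and> Im z \<in> B} \<in> sets borel"
proof -
  have "{z. Re z \<in> A \<and> Im z \<in> B} = (Re -` A \<inter> space borel) \<inter> (Im -` B \<inter> space borel)" by auto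
  also have "\<dots> \<in> sets borel"
    using assms by (intro sets.Int measurable_sets[of _ borel borel]) auto
  finally show ?thesis .
qed

lemma cgauss_rectangle:
  assumes A: "A \<in> sets borel" "B \<in> sets borel"
  shows "measure (cgauss v) {z. Re z \<in> A \<and> Im z \<in> B} = measure (gauss v) A * measure (gauss v) B"
proof -
  interpret S: prob_space std_normal_distribution by (rule prob_space_std_normal)
  interpret SS: pair_prob_space std_normal_distribution std_normal_distribution ..
  let ?f = "\<lambda>y. sqrt v * y"
  note [measurable] = rectangle_sets[OF A]
  have [measurable]: "?f -` A \<in> sets borel" "?f -` B \<in> sets borel"
    using measurable_sets[of ?f borel borel A] measurable_sets[of ?f borel borel B] A by auto
  have "emeasure (cgauss v) {z. Re z \<in> A \<and> Im z \<in> B} =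
    emeasure (std_normal_distribution \<Otimes>\<^sub>M std_normal_distribution) ((?f -` A) \<times> (?f -` B))"
    unfolding cgauss_def by (subst emeasure_distr) (auto simp: space_pair_measure intro!: arg_cong[of _ _ "emeasure _"])
  also have "\<dots> = emeasure (gauss v) A * emeasure (gauss v) B"
    unfolding gauss_def using A by (subst S.emeasure_pair_measure_Times) (auto simp: emeasure_distr)
  finally show ?thesis by (simp add: measure_def enn2real_mult)
qed

section \<open>PAM and QAM\<close>

text \<open>How a tie is broken is unspecified in \<open>arg_min_on\<close>, so a decision region is only known to lie between an open and a
  closed cell; the coordinate is taken relative to the \<open>i\<close>-th of \<open>q\<close> amplitudes.\<close>

definition ocell :: "real \<Rightarrow> nat \<Rightarrow> nat \<Rightarrow> real set" where
  "ocell \<delta> q i = {t. (i \<noteq> 1 \<longrightarrow> - \<delta> < t) \<and> (i \<noteq> q \<longrightarrow> t < \<delta>)}"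

definition ccell :: "real \<Rightarrow> nat \<Rightarrow> nat \<Rightarrow> real set" where
  "ccell \<delta> q i = {t. (i \<noteq> 1 \<longrightarrow> - \<delta> \<le> t) \<and> (i \<noteq> q \<longrightarrow> t \<le> \<delta>)}"

lemma cell_sets[measurable]: "ocell \<delta> q i \<in> sets borel" "ccell \<delta> q i \<in> sets borel"
proof -
  have "ocell \<delta> q i = {t\<in>space borel. (i \<noteq> 1 \<longrightarrow> - \<delta> < t) \<and> (i \<noteq> q \<longrightarrow> t < \<delta>)}"
    "ccell \<delta> q i = {t\<in>space borel. (i \<noteq> 1 \<longrightarrow> - \<delta> \<le> t) \<and> (i \<noteq> q \<longrightarrow> t \<le> \<delta>)}"
    by (auto simp: ocell_def ccell_def)
  then show "ocell \<delta> q i \<in> sets borel" "ccell \<delta> q i \<in> sets borel" by simp_all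
qed

text \<open>Every neighbouring amplitude costs one tail \<open>Q\<close>; the first and last
  amplitudes lack a neighbour on one side.\<close>

definition cellprob :: "real \<Rightarrow> nat \<Rightarrow> nat \<Rightarrow> real" where
  "cellprob Q q i = 1 - (if i = 1 then 0 else Q) - (if i = q then 0 else Q)"

lemma cell_prob:
  assumes v: "0 < v" and \<delta>: "0 < \<delta>"
  shows "measure (gauss v) (ocell \<delta> q i) = cellprob (Qfun (\<delta> / sqrt v)) q i"
    "measure (gauss v) (ccell \<delta> q i) = cellprob (Qfun (\<delta> / sqrt v)) q i"
proof -
  interpret prob_space "gauss v" by (rule prob_space_gauss)
  have u: "UNIV = space (gauss v)" by simp
  have "ocell \<delta> q i = space (gauss v) - ((if i = 1 then {} else {..-\<delta>}) \<union> (if i = q then {} else {\<delta>..}))"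
    by (auto simp: ocell_def)
  then have "measure (gauss v) (ocell \<delta> q i) = 1 - measure (gauss v) ((if i = 1 then {} else {..-\<delta>}) \<union> (if i = q then {} else {\<delta>..}))"
    by (simp only:) (rule prob_compl, auto)
  also have "measure (gauss v) ((if i = 1 then {} else {..-\<delta>}) \<union> (if i = q then {} else {\<delta>..})) =
      measure (gauss v) (if i = 1 then {} else {..-\<delta>}) + measure (gauss v) (if i = q then {} else {\<delta>..})"
    by (rule finite_measure_Union) (use \<delta> in auto)
  finally show "measure (gauss v) (ocell \<delta> q i) = cellprob (Qfun (\<delta> / sqrt v)) q i"
    by (simp add: cellprob_def gauss_tails[OF v])
  have "ccell \<delta> q i = space (gauss v) - ((if i = 1 then {} else {..<-\<delta>}) \<union> (if i = q then {} else {\<delta><..}))"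
    by (auto simp: ccell_def)
  then have "measure (gauss v) (ccell \<delta> q i) = 1 - measure (gauss v) ((if i = 1 then {} else {..<-\<delta>}) \<union> (if i = q then {} else {\<delta><..}))"
    by (simp only:) (rule prob_compl, auto)
  also have "measure (gauss v) ((if i = 1 then {} else {..<-\<delta>}) \<union> (if i = q then {} else {\<delta><..})) =
      measure (gauss v) (if i = 1 then {} else {..<-\<delta>}) + measure (gauss v) (if i = q then {} else {\<delta><..})"
    by (rule finite_measure_Union) (use \<delta> in auto)
  finally show "measure (gauss v) (ccell \<delta> q i) = cellprob (Qfun (\<delta> / sqrt v)) q i"
    by (simp add: cellprob_def gauss_tails[OF v])
qed

lemma sum_cellprob:
  assumes "2 \<le> q"
  shows "(\<Sum>i\<in>{1..q}. cellprob Q q i) = q - 2 * (real q - 1) * Q"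
proof -
  have "(\<Sum>i\<in>{1..q}. cellprob Q q i) = (\<Sum>i\<in>{1..q}. 1 - 2 * Q + (if i = 1 then Q else 0) + (if i = q then Q else 0))"
    by (intro sum.cong) (auto simp: cellprob_def)
  also have "\<dots> = q - 2 * (real q - 1) * Q"
    using assms by (simp add: sum.distrib) (simp add: algebra_simps)
  finally show ?thesis .
qed

text \<open>Consecutive points are \<open>2 * \<delta>\<close> apart, which places the decision
  thresholds at distance \<open>\<delta>\<close> on either side.\<close>

definition pt :: "real \<Rightarrow> nat \<Rightarrow> nat \<Rightarrow> real" where
  "pt \<delta> q i = \<delta> * (2 * real i - 1 - real q)"

lemma pt_eq_iff: "0 < \<delta> \<Longrightarrow> pt \<delta> q i = pt \<delta> q j \<longleftrightarrow> i = j"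
  by (auto simp: pt_def)

lemma amplitudes_eq: "amplitudes \<delta> (real q) = pt \<delta> q ` {1..q}"
  unfolding amplitudes_def pt_def by auto

text \<open>With \<open>k = i - j\<close> the difference of the two squares is
  \<open>4 * \<delta> * k * (t + \<delta> * k)\<close>. On the open cell both factors
  \<open>k\<close> and \<open>t + \<delta> * k\<close> have the same sign.\<close>

lemma ocell_closer:
  assumes \<delta>: "0 < \<delta>" and i: "i \<in> {1..q}" "j \<in> {1..q}" "i \<noteq> j" and t: "t \<in> ocell \<delta> q i"
  shows "t\<^sup>2 < (pt \<delta> q i + t - pt \<delta> q j)\<^sup>2"
proof -
  define k where "k = real i - real j"
  have "(pt \<delta> q i + t - pt \<delta> q j)\<^sup>2 - t\<^sup>2 = 4 * \<delta> * (k * (t + \<delta> * k))"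
    unfolding pt_def k_def by (simp add: power2_eq_square algebra_simps)
  moreover have "0 < k * (t + \<delta> * k)"
  proof (cases "j < i")
    case True
    then have k: "1 \<le> k" "i \<noteq> 1" using i by (auto simp: k_def)
    have "\<delta> * 1 \<le> \<delta> * k" using k \<delta> by (intro mult_left_mono) auto
    then show ?thesis using t k by (intro mult_pos_pos) (auto simp: ocell_def)
  next
    case False
    then have k: "k \<le> -1" "i \<noteq> q" using i by (auto simp: k_def)
    have "\<delta> * k \<le> \<delta> * -1" using k \<delta> by (intro mult_left_mono) auto
    then show ?thesis using t k by (intro mult_neg_neg) (auto simp: ocell_def)
  qed
  ultimately show ?thesis using \<delta> by (smt (verit) mult_pos_pos)
qed

text \<open>Comparison with the two immediate neighbours, where they exist, already confines
  \<open>t\<close> to the closed cell.\<close>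

lemma ccell_closest:
  assumes \<delta>: "0 < \<delta>" and i: "i \<in> {1..q}" and t: "\<And>j. j \<in> {1..q} \<Longrightarrow> t\<^sup>2 \<le> (pt \<delta> q i + t - pt \<delta> q j)\<^sup>2"
  shows "t \<in> ccell \<delta> q i"
proof -
  have e: "(pt \<delta> q i + t - pt \<delta> q j)\<^sup>2 - t\<^sup>2 = 4 * \<delta> * ((real i - real j) * (t + \<delta> * (real i - real j)))" for j
    unfolding pt_def by (simp add: power2_eq_square algebra_simps)
  have "- \<delta> \<le> t" if "i \<noteq> 1"
  proof -
    have "i - 1 \<in> {1..q}" "real i - real (i - 1) = 1" using that i by auto
    then have "0 \<le> 4 * \<delta> * (t + \<delta>)" using t[of "i - 1"] e[of "i - 1"] by simp
    then show ?thesis using \<delta> by (simp add: zero_le_mult_iff)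
  qed
  moreover have "t \<le> \<delta>" if "i \<noteq> q"
  proof -
    have "i + 1 \<in> {1..q}" "real i - real (i + 1) = -1" using that i by auto
    then have "0 \<le> 4 * \<delta> * (\<delta> - t)" using t[of "i + 1"] e[of "i + 1"] by simp
    then show ?thesis using \<delta> by (simp add: zero_le_mult_iff)
  qed
  ultimately show ?thesis by (simp add: ccell_def)
qed

lemma pam_eq:
  assumes "2 \<le> M"
  defines "\<delta> \<equiv> sqrt (3 / ((real M)\<^sup>2 - 1))"
  shows "0 < \<delta>" "pam M = (\<lambda>i. complex_of_real (pt \<delta> M i)) ` {1..M}" "card (pam M) = M" "finite (pam M)"
proof -
  have "1 < (real M)\<^sup>2" using assms(1) by (intro one_less_power) auto
  then show \<delta>: "0 < \<delta>" by (simp add: \<delta>_def)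
  show e: "pam M = (\<lambda>i. complex_of_real (pt \<delta> M i)) ` {1..M}"
    unfolding pam_def amplitudes_eq \<delta>_def by (simp add: image_image)
  have "inj_on (\<lambda>i. complex_of_real (pt \<delta> M i)) {1..M}"
    by (rule inj_onI) (simp add: pt_eq_iff[OF \<delta>])
  then show "card (pam M) = M" unfolding e by (simp add: card_image)
  show "finite (pam M)" unfolding e by simp
qed

text \<open>For real symbols the imaginary part of the noise adds equally to all squared distances,
  so the cells are vertical strips.\<close>

lemma serr_pam:
  assumes M: "2 \<le> M" and v: "0 < v"
  shows "serr (pam M) v = 2 * (real M - 1) / real M * Qfun (sqrt (3 / ((real M)\<^sup>2 - 1)) / sqrt v)"
proof -
  define \<delta> where "\<delta> = sqrt (3 / ((real M)\<^sup>2 - 1))"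
  note P = pam_eq[OF M, folded \<delta>_def]
  define Q where "Q = Qfun (\<delta> / sqrt v)"
  define x where "x i = complex_of_real (pt \<delta> M i)" for i
  have inj: "inj_on x {1..M}" by (rule inj_onI) (simp add: x_def pt_eq_iff[OF P(1)])
  have Px: "pam M = x ` {1..M}" unfolding P(2) x_def ..
  have ne: "pam M \<noteq> {}" unfolding Px using M by auto
  interpret prob_space "gauss v" by (rule prob_space_gauss)
  have cell: "measure (cgauss v) {z. decide (pam M) (x i + z) = x i} = cellprob Q M i" if i: "i \<in> {1..M}" for i
  proof (rule cell_measure[OF P(4) ne])
    have cm: "(cmod (x i + z - x j))\<^sup>2 = (pt \<delta> M i + Re z - pt \<delta> M j)\<^sup>2 + (Im z)\<^sup>2" for z j
      by (simp add: cmod_power2 x_def)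
    show "{z. Re z \<in> ocell \<delta> M i \<and> Im z \<in> UNIV} \<in> sets borel" "{z. Re z \<in> ccell \<delta> M i \<and> Im z \<in> UNIV} \<in> sets borel"
      by (rule rectangle_sets; simp)+
    show "measure (cgauss v) {z. Re z \<in> ocell \<delta> M i \<and> Im z \<in> UNIV} = cellprob Q M i"
      "measure (cgauss v) {z. Re z \<in> ccell \<delta> M i \<and> Im z \<in> UNIV} = cellprob Q M i"
      using prob_space by (simp_all add: cgauss_rectangle cell_prob[OF v P(1)] Q_def del: UNIV_I)
    fix z
    { assume "z \<in> {z. Re z \<in> ocell \<delta> M i \<and> Im z \<in> UNIV}"
      then have z: "Re z \<in> ocell \<delta> M i" by simp
      show "decide (pam M) (x i + z) = x i"
      proof (rule decide_eqI[OF P(4)])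
        show "x i \<in> pam M" unfolding Px using i by blast
        fix x' assume "x' \<in> pam M" "x' \<noteq> x i"
        then obtain j where j: "j \<in> {1..M}" "x' = x j" unfolding Px by blast
        then have ij: "i \<noteq> j" using \<open>x' \<noteq> x i\<close> by blast
        have "(cmod z)\<^sup>2 < (cmod (x i + z - x j))\<^sup>2"
          using ocell_closer[OF P(1) i j(1) ij z] unfolding cm by (simp add: cmod_power2)
        then show "cmod z < cmod (x i + z - x')" unfolding j(2) using power2_less_imp_less norm_ge_zero by blast
      qed }
    { assume d: "decide (pam M) (x i + z) = x i"
      have "(Re z)\<^sup>2 \<le> (pt \<delta> M i + Re z - pt \<delta> M j)\<^sup>2" if "j \<in> {1..M}" for j
      proof -
        have "cmod z \<le> cmod (x i + z - x j)" by (rule decide_eqD[OF P(4) ne d]) (use that Px in blast)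
        then have "(cmod z)\<^sup>2 \<le> (cmod (x i + z - x j))\<^sup>2" by (simp add: power_mono)
        then show ?thesis unfolding cm by (simp add: cmod_power2)
      qed
      then show "z \<in> {z. Re z \<in> ccell \<delta> M i \<and> Im z \<in> UNIV}" using ccell_closest[OF P(1) i] by simp }
  qed
  have "serr (pam M) v = 1 - (\<Sum>y\<in>pam M. cellprob Q M (the_inv_into {1..M} x y)) / card (pam M)"
    by (rule serr_correct[OF P(4) ne]) (use cell inj in \<open>auto simp: Px the_inv_into_f_f\<close>)
  also have "(\<Sum>y\<in>pam M. cellprob Q M (the_inv_into {1..M} x y)) = (\<Sum>i\<in>{1..M}. cellprob Q M i)"
    unfolding Px using inj by (subst sum.reindex) (auto simp: the_inv_into_f_f intro!: sum.cong)
  finally show ?thesis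
    unfolding sum_cellprob[OF M] P(3) Q_def \<delta>_def using M by (simp add: field_simps)
qed

lemma qam_eq:
  assumes q: "2 \<le> q" and M: "M = q\<^sup>2"
  defines "\<delta> \<equiv> sqrt (3 / (2 * (real M - 1)))"
  shows "0 < \<delta>" "square_qam M = (\<lambda>(i, j). Complex (pt \<delta> q i) (pt \<delta> q j)) ` ({1..q} \<times> {1..q})"
    "inj_on (\<lambda>(i, j). Complex (pt \<delta> q i) (pt \<delta> q j)) ({1..q} \<times> {1..q})"
    "card (square_qam M) = M" "finite (square_qam M)"
proof -
  have "1 < (real q)\<^sup>2" using q by (intro one_less_power) auto
  then show \<delta>: "0 < \<delta>" by (simp add: \<delta>_def M)
  have "sqrt (real M) = real q" by (simp add: M)
  then show e: "square_qam M = (\<lambda>(i, j). Complex (pt \<delta> q i) (pt \<delta> q j)) ` ({1..q} \<times> {1..q})"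
    unfolding square_qam_def Let_def \<delta>_def[symmetric] by (auto simp: amplitudes_eq image_iff)
  show i: "inj_on (\<lambda>(i, j). Complex (pt \<delta> q i) (pt \<delta> q j)) ({1..q} \<times> {1..q})"
    by (rule inj_onI) (auto simp: pt_eq_iff[OF \<delta>])
  show "card (square_qam M) = M" unfolding e card_image[OF i] by (simp add: M power2_eq_square)
  show "finite (square_qam M)" unfolding e by simp
qed

text \<open>Squared distances split into real and imaginary parts, so each cell is a product of two
  amplitude cells. The mean probability of a correct decision is therefore the square of
  \<open>1 - 2 * (q - 1) * Q / q\<close>.\<close>

lemma serr_qam:
  assumes q: "2 \<le> q" and M: "M = q\<^sup>2" and v: "0 < v"
  defines "Q \<equiv> Qfun (sqrt (3 / (2 * (real M - 1))) / sqrt v)"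
  shows "serr (square_qam M) v = 4 * (real q - 1) / real q * Q - 4 * (real q - 1)\<^sup>2 / real M * Q\<^sup>2"
proof -
  define \<delta> where "\<delta> = sqrt (3 / (2 * (real M - 1)))"
  note P = qam_eq[OF q M, folded \<delta>_def]
  define x where "x = (\<lambda>(i, j). Complex (pt \<delta> q i) (pt \<delta> q j))"
  define I where "I = {1..q} \<times> {1..q}"
  have inj: "inj_on x I" using P(3) by (simp add: x_def I_def)
  have Px: "square_qam M = x ` I" unfolding P(2) x_def I_def ..
  have ne: "square_qam M \<noteq> {}" unfolding Px using q by (auto simp: I_def)
  have Qd: "Q = Qfun (\<delta> / sqrt v)" by (simp add: Q_def \<delta>_def)
  have cell: "measure (cgauss v) {z. decide (square_qam M) (x a + z) = x a} = cellprob Q q (fst a) * cellprob Q q (snd a)" if a: "a \<in> I" for a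
  proof (rule cell_measure[OF P(5) ne])
    have ai: "fst a \<in> {1..q}" "snd a \<in> {1..q}" using a by (auto simp: I_def)
    have cm: "(cmod (x a + z - x b))\<^sup>2 = (pt \<delta> q (fst a) + Re z - pt \<delta> q (fst b))\<^sup>2 + (pt \<delta> q (snd a) + Im z - pt \<delta> q (snd b))\<^sup>2" for z b
      by (simp add: cmod_power2 x_def case_prod_beta)
    show "{z. Re z \<in> ocell \<delta> q (fst a) \<and> Im z \<in> ocell \<delta> q (snd a)} \<in> sets borel"
        "{z. Re z \<in> ccell \<delta> q (fst a) \<and> Im z \<in> ccell \<delta> q (snd a)} \<in> sets borel"
      by (rule rectangle_sets; rule cell_sets)+
    show "measure (cgauss v) {z. Re z \<in> ocell \<delta> q (fst a) \<and> Im z \<in> ocell \<delta> q (snd a)} = cellprob Q q (fst a) * cellprob Q q (snd a)"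
      "measure (cgauss v) {z. Re z \<in> ccell \<delta> q (fst a) \<and> Im z \<in> ccell \<delta> q (snd a)} = cellprob Q q (fst a) * cellprob Q q (snd a)"
      by (simp_all only: cgauss_rectangle cell_sets cell_prob[OF v P(1)] Qd)
    fix z
    { assume "z \<in> {z. Re z \<in> ocell \<delta> q (fst a) \<and> Im z \<in> ocell \<delta> q (snd a)}"
      then have z: "Re z \<in> ocell \<delta> q (fst a)" "Im z \<in> ocell \<delta> q (snd a)" by simp_all
      show "decide (square_qam M) (x a + z) = x a"
      proof (rule decide_eqI[OF P(5)])
        show "x a \<in> square_qam M" unfolding Px using a by blast
        fix x' assume "x' \<in> square_qam M" "x' \<noteq> x a"
        then obtain b where b: "b \<in> I" "x' = x b" unfolding Px by blast
        then have ab: "a \<noteq> b" using \<open>x' \<noteq> x a\<close> by blast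
        have bi: "fst b \<in> {1..q}" "snd b \<in> {1..q}" using b by (auto simp: I_def)
        have le: "t\<^sup>2 \<le> (pt \<delta> q i + t - pt \<delta> q j)\<^sup>2" if "i \<in> {1..q}" "j \<in> {1..q}" "t \<in> ocell \<delta> q i" for i j t
          using ocell_closer[OF P(1) that(1,2) _ that(3)] by (cases "i = j") (auto intro: less_imp_le)
        have "(Re z)\<^sup>2 + (Im z)\<^sup>2 < (cmod (x a + z - x b))\<^sup>2"
        proof (cases "fst a = fst b")
          case True
          then have "snd a \<noteq> snd b" using ab by (auto simp: prod_eq_iff)
          then show ?thesis unfolding cm
            by (intro add_le_less_mono le ocell_closer P(1) ai bi z)
        next
          case False
          then show ?thesis unfolding cm
            by (intro add_less_le_mono le ocell_closer P(1) ai bi z)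
        qed
        then have "(cmod z)\<^sup>2 < (cmod (x a + z - x b))\<^sup>2" by (simp add: cmod_power2)
        then show "cmod z < cmod (x a + z - x')" unfolding b(2) using power2_less_imp_less norm_ge_zero by blast
      qed }
    { assume d: "decide (square_qam M) (x a + z) = x a"
      have le: "(Re z)\<^sup>2 + (Im z)\<^sup>2 \<le> (pt \<delta> q (fst a) + Re z - pt \<delta> q (fst b))\<^sup>2 + (pt \<delta> q (snd a) + Im z - pt \<delta> q (snd b))\<^sup>2" if "b \<in> I" for b
      proof -
        have "cmod z \<le> cmod (x a + z - x b)" by (rule decide_eqD[OF P(5) ne d]) (use that Px in blast)
        then have "(cmod z)\<^sup>2 \<le> (cmod (x a + z - x b))\<^sup>2" by (simp add: power_mono)
        then show ?thesis unfolding cm by (simp add: cmod_power2)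
      qed
      have "Re z \<in> ccell \<delta> q (fst a)"
        by (rule ccell_closest[OF P(1) ai(1)]) (use le[of "(_, snd a)"] ai in \<open>auto simp: I_def\<close>)
      moreover have "Im z \<in> ccell \<delta> q (snd a)"
        by (rule ccell_closest[OF P(1) ai(2)]) (use le[of "(fst a, _)"] ai in \<open>auto simp: I_def\<close>)
      ultimately show "z \<in> {z. Re z \<in> ccell \<delta> q (fst a) \<and> Im z \<in> ccell \<delta> q (snd a)}" by simp }
  qed
  have "serr (square_qam M) v = 1 - (\<Sum>y\<in>square_qam M. cellprob Q q (fst (the_inv_into I x y)) * cellprob Q q (snd (the_inv_into I x y))) / card (square_qam M)"
    by (rule serr_correct[OF P(5) ne]) (use cell inj in \<open>auto simp: Px the_inv_into_f_f\<close>)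
  also have "(\<Sum>y\<in>square_qam M. cellprob Q q (fst (the_inv_into I x y)) * cellprob Q q (snd (the_inv_into I x y))) =
     (\<Sum>a\<in>I. cellprob Q q (fst a) * cellprob Q q (snd a))"
    unfolding Px using inj by (subst sum.reindex) (auto simp: the_inv_into_f_f intro!: sum.cong)
  also have "\<dots> = (\<Sum>i\<in>{1..q}. cellprob Q q i) * (\<Sum>j\<in>{1..q}. cellprob Q q j)"
    unfolding I_def sum_product by (simp add: sum.cartesian_product case_prod_beta)
  finally have "serr (square_qam M) v = 1 - (q - 2 * (real q - 1) * Q) * (q - 2 * (real q - 1) * Q) / (real q * real q)"
    unfolding sum_cellprob[OF q] P(4) by (simp add: M power2_eq_square)
  also have "\<dots> = 4 * (real q - 1) / real q * Q - 4 * (real q - 1)\<^sup>2 / real M * Q\<^sup>2"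
    using q by (simp add: M field_simps power2_eq_square)
  finally show ?thesis .
qed

section \<open>PSK\<close>

lemma nn_integral_gauss_ray:
  assumes k: "0 < (k::real)" and c: "0 \<le> c"
  shows "(\<integral>\<^sup>+y. ennreal (y * exp (- k * y\<^sup>2 / 2) / (2 * pi)) * indicator {c<..} y \<partial>lborel) = ennreal (exp (- k * c\<^sup>2 / 2) / (2 * pi * k))"
proof -
  let ?f = "\<lambda>y. y * exp (- k * y\<^sup>2 / 2) / (2 * pi)"
  let ?F = "\<lambda>y. - exp (- k * y\<^sup>2 / 2) / (2 * pi * k)"
  have "(\<integral>\<^sup>+y. ennreal (?f y) * indicator {c<..} y \<partial>lborel) = (\<integral>\<^sup>+y. ennreal (?f y) * indicator {c..} y \<partial>lborel)"
    by (rule nn_integral_cong_AE) (use AE_lborel_singleton[of c] in \<open>auto simp: indicator_def elim!: eventually_mono\<close>)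
  also have "\<dots> = ennreal (0 - ?F c)"
  proof (rule nn_integral_FTC_atLeast)
    show "(?F has_real_derivative ?f x) (at x)" for x
      using k by (auto intro!: derivative_eq_intros simp: field_simps power2_eq_square)
    show "0 \<le> ?f x" if "c \<le> x" for x using that c by simp
    have "((\<lambda>y. k * y\<^sup>2 / 2) \<longlongrightarrow> 0) (at 0)" by (auto intro!: tendsto_eq_intros)
    have "filterlim (\<lambda>y::real. k / 2 * (y * y)) at_top at_top"
      using k by (intro filterlim_tendsto_pos_mult_at_top[OF tendsto_const] filterlim_at_top_mult_at_top filterlim_ident) auto
    then have "filterlim (\<lambda>y::real. - (k / 2 * (y * y))) at_bot at_top" by (simp add: filterlim_uminus_at_bot)
    then have "((\<lambda>y. exp (- (k / 2 * (y * y)))) \<longlongrightarrow> 0) at_top"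
      by (rule filterlim_compose[OF exp_at_bot])
    then have "((\<lambda>y. - exp (- (k / 2 * (y * y))) / (2 * pi * k)) \<longlongrightarrow> - 0 / (2 * pi * k)) at_top"
      using k by (intro tendsto_intros) auto
    then show "(?F \<longlongrightarrow> 0) at_top" by (simp add: power2_eq_square mult.assoc)
  qed simp
  finally show ?thesis by simp
qed

text \<open>The variable \<open>u\<close> is the slope \<open>x / y\<close> of a ray. Putting
  \<open>u = tan t\<close> and \<open>b = pi / 2 - \<alpha>\<close>, the quotient in the exponent
  becomes \<open>K / (sin (b - t))\<^sup>2\<close> and the factor \<open>1 + u\<^sup>2\<close> is
  the Jacobian. The endpoint \<open>cos \<alpha> / sin \<alpha>\<close> is \<open>tan b\<close>, and
  \<open>\<theta> = b - t\<close> runs from 0 to \<open>pi - \<alpha>\<close>.\<close>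

lemma wedge_substitution:
  assumes \<alpha>: "0 < \<alpha>" "\<alpha> \<le> pi / 2" and K: "0 < K"
  defines "f \<equiv> \<lambda>u. exp (- ((1 + u\<^sup>2) * K / (cos \<alpha> - u * sin \<alpha>)\<^sup>2)) / (2 * pi * (1 + u\<^sup>2))"
  shows "(\<integral>\<^sup>+u. ennreal (f u) * indicator {..<cos \<alpha> / sin \<alpha>} u \<partial>lborel) =
    ennreal (integral {0..pi - \<alpha>} (\<lambda>\<theta>. exp (- (K / (sin \<theta>)\<^sup>2)) / (2 * pi)))"
proof -
  define b where "b = pi / 2 - \<alpha>"
  have sa: "0 < sin \<alpha>" using \<alpha> by (intro sin_gt_zero) auto
  define h where "h \<theta> = exp (- (K / (sin \<theta>)\<^sup>2)) / (2 * pi)" for \<theta> :: real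
  define g' where "g' t = inverse ((cos t)\<^sup>2)" for t :: real
  have hm[measurable]: "h \<in> borel_measurable borel" unfolding h_def by measurable
  have h01: "0 \<le> h \<theta>" "h \<theta> \<le> 1" for \<theta>
  proof -
    have "exp (- (K / (sin \<theta>)\<^sup>2)) \<le> 1" using K by simp
    then have "exp (- (K / (sin \<theta>)\<^sup>2)) \<le> 1 * (2 * pi)" using pi_gt3 by linarith
    then show "h \<theta> \<le> 1" unfolding h_def by (subst pos_divide_le_eq) simp_all
    show "0 \<le> h \<theta>" by (simp add: h_def)
  qed
  have ab: "- (pi / 2) < b" using \<alpha> pi_gt_zero by (simp add: b_def)
  have cosp: "0 < cos t" "0 < cos (t + \<alpha>)" if "- (pi / 2) < t" "t < b" for t
    using that \<alpha> by (intro cos_gt_zero_pi; simp add: b_def)+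
  have fg: "f (tan t) * g' t = h (b - t)" if t: "- (pi / 2) < t" "t < b" for t
  proof -
    note c = cosp[OF t]
    have 1: "1 + (tan t)\<^sup>2 = 1 / (cos t)\<^sup>2"
      using c by (simp add: tan_def power_divide add_divide_distrib[symmetric] field_simps)
    have 2: "cos \<alpha> - tan t * sin \<alpha> = cos (t + \<alpha>) / cos t" using c by (simp add: tan_def cos_add field_simps)
    have 3: "sin (b - t) = cos (t + \<alpha>)" by (simp add: b_def cos_sin_eq algebra_simps)
    show ?thesis unfolding f_def h_def g'_def 1 2 3 using c by (simp add: power_divide field_simps)
  qed
  have si: "set_integrable lborel (einterval (ereal (- (pi/2))) (ereal b)) (\<lambda>t. f (tan t) * g' t)"
  proof -
    have "set_integrable lborel {- (pi/2)<..<b} (\<lambda>t. h (b - t))"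
      unfolding set_integrable_def
    proof (rule integrableI_bounded_set[where A="{- (pi/2)<..<b}" and B=1])
      show "emeasure lborel {- (pi / 2)<..<b} < \<infinity>" using ab by simp
    qed (use h01 in \<open>auto simp: indicator_def\<close>)
    then show ?thesis
      unfolding einterval_eq by (rule set_integrable_cong[THEN iffD2, rotated -1]) (use fg in auto)
  qed
  have tanb: "tan b = cos \<alpha> / sin \<alpha>" by (simp add: b_def tan_def sin_diff cos_diff)
  note S = interval_integral_substitution_nonneg[where g=tan and g'=g' and f=f and a="ereal (- (pi/2))" and b="ereal b" and A="-\<infinity>" and B="ereal (cos \<alpha> / sin \<alpha>)"]
  have D: "0 < cos \<alpha> - u * sin \<alpha>" if "u < cos \<alpha> / sin \<alpha>" for u
    using that sa by (simp add: pos_less_divide_eq)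
  have pre: "ereal (- (pi/2)) < ereal b"
    "\<And>x. ereal (- (pi/2)) < ereal x \<Longrightarrow> ereal x < ereal b \<Longrightarrow> DERIV tan x :> g' x"
    "\<And>x. ereal (- (pi/2)) < ereal x \<Longrightarrow> ereal x < ereal b \<Longrightarrow> isCont f (tan x)"
    "\<And>x. ereal (- (pi/2)) < ereal x \<Longrightarrow> ereal x < ereal b \<Longrightarrow> isCont g' x"
    "\<And>x. ereal (- (pi/2)) < ereal x \<Longrightarrow> ereal x < ereal b \<Longrightarrow> 0 \<le> f (tan x)"
    "\<And>x. ereal (- (pi/2)) \<le> ereal x \<Longrightarrow> ereal x \<le> ereal b \<Longrightarrow> 0 \<le> g' x"
    "((ereal \<circ> tan \<circ> real_of_ereal) \<longlongrightarrow> -\<infinity>) (at_right (ereal (- (pi/2))))"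
    "((ereal \<circ> tan \<circ> real_of_ereal) \<longlongrightarrow> ereal (cos \<alpha> / sin \<alpha>)) (at_left (ereal b))"
  proof -
    show "ereal (- (pi/2)) < ereal b" using ab by simp
    fix x assume x: "ereal (- (pi/2)) < ereal x" "ereal x < ereal b"
    then have x': "- (pi/2) < x" "x < b" by auto
    show "DERIV tan x :> g' x" unfolding g'_def by (rule DERIV_tan) (use cosp[OF x'] in simp)
    have "cos \<alpha> - tan x * sin \<alpha> \<noteq> 0"
    proof -
      have "tan x < tan b" using x' \<alpha> by (intro tan_monotone) (auto simp: b_def)
      then show ?thesis using D unfolding tanb by fastforce
    qed
    moreover have "1 + (tan x)\<^sup>2 \<noteq> 0" using zero_le_power2[of "tan x"] by linarith
    ultimately show "isCont f (tan x)" unfolding f_def by (intro continuous_intros) auto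
    show "isCont g' x" unfolding g'_def using cosp[OF x'] by (intro continuous_intros) auto
    show "0 \<le> f (tan x)" unfolding f_def by (simp add: add_nonneg_nonneg)
  next
    fix x show "0 \<le> g' x" unfolding g'_def by simp
  next
    show "((ereal \<circ> tan \<circ> real_of_ereal) \<longlongrightarrow> -\<infinity>) (at_right (ereal (- (pi/2))))"
      unfolding ereal_tendsto_simps by (rule filterlim_tan_at_right)
    have "(tan \<longlongrightarrow> tan b) (at_left b)"
    proof (rule tendsto_mono)
      have "cos b \<noteq> 0" using cos_gt_zero_pi[of b] ab \<alpha> by (auto simp: b_def)
      then show "(tan \<longlongrightarrow> tan b) (at b)" by (rule isCont_tan[unfolded isCont_def])
    qed (simp add: at_le)
    then show "((ereal \<circ> tan \<circ> real_of_ereal) \<longlongrightarrow> ereal (cos \<alpha> / sin \<alpha>)) (at_left (ereal b))"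
      unfolding tanb ereal_tendsto_simps .
  qed
  have I: "set_integrable lborel {..<cos \<alpha> / sin \<alpha>} f"
    using S(1)[OF pre si] by simp
  have V: "(LBINT x=-\<infinity>..ereal (cos \<alpha> / sin \<alpha>). f x) = (LBINT t=ereal (- (pi/2))..ereal b. f (tan t) * g' t)"
    by (rule S(2)[OF pre si])
  have "(\<integral>\<^sup>+u. ennreal (f u) * indicator {..<cos \<alpha> / sin \<alpha>} u \<partial>lborel) = (\<integral>\<^sup>+u. ennreal (indicator {..<cos \<alpha> / sin \<alpha>} u *\<^sub>R f u) \<partial>lborel)"
    by (intro nn_integral_cong) (auto simp: indicator_def)
  also have "\<dots> = ennreal (\<integral>u. indicator {..<cos \<alpha> / sin \<alpha>} u *\<^sub>R f u \<partial>lborel)"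
    by (rule nn_integral_eq_integral[OF I[unfolded set_integrable_def]]) (auto simp: f_def indicator_def add_nonneg_nonneg)
  also have "(\<integral>u. indicator {..<cos \<alpha> / sin \<alpha>} u *\<^sub>R f u \<partial>lborel) = (LBINT x=-\<infinity>..ereal (cos \<alpha> / sin \<alpha>). f x)"
    by (simp add: interval_lebesgue_integral_def set_lebesgue_integral_def)
  also have "\<dots> = (LBINT t=ereal (- (pi/2))..ereal b. h (b - t))"
    unfolding V by (rule interval_integral_cong) (use ab fg in \<open>auto simp: einterval_iff min_def max_def split: if_splits\<close>)
  also have "\<dots> = integral {- (pi/2)..b} (\<lambda>t. h (b - t))"
  proof (rule interval_integral_eq_integral)
    show "- (pi/2) \<le> b" using ab by simp
    show "set_integrable lborel {- (pi/2)..b} (\<lambda>t. h (b - t))"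
      unfolding set_integrable_def
    proof (rule integrableI_bounded_set[where A="{- (pi/2)..b}" and B=1])
      show "emeasure lborel {- (pi / 2)..b} < \<infinity>" using ab by simp
    qed (use h01 in \<open>auto simp: indicator_def\<close>)
  qed
  also have "\<dots> = integral {-b..pi/2} (\<lambda>t. h (b + t))"
    using Henstock_Kurzweil_Integration.integral_reflect_real[of "pi/2" "-b" "\<lambda>t. h (b + t)"] by simp
  also have "\<dots> = integral {0..pi - \<alpha>} h"
    using integral_shift_Icc_real[of "-b" "pi/2" h b] by (simp add: comp_def b_def)
  finally show ?thesis unfolding h_def .
qed

text \<open>Craig's formula for the part of the PSK error region on one side of the axis through the symbol.\<close>

definition craig :: "real \<Rightarrow> real \<Rightarrow> real" where
  "craig \<alpha> K = integral {0..pi - \<alpha>} (\<lambda>\<theta>. exp (- (K / (sin \<theta>)\<^sup>2)) / (2 * pi))"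

lemma craig_nonneg: "0 \<le> craig \<alpha> K"
proof -
  have "0 \<le> integral A f" if "\<And>x. 0 \<le> f x" for f :: "real \<Rightarrow> real" and A
    using that Henstock_Kurzweil_Integration.integral_nonneg[of f A] by (cases "f integrable_on A") (auto simp: not_integrable_integral)
  then show ?thesis unfolding craig_def by simp
qed

text \<open>The set consists of the noise values that carry the symbol 1 across the ray at angle
  \<open>\<alpha>\<close> in the upper half plane. In the coordinates slope \<open>u = x / y\<close>
  and height \<open>y\<close> the integral over \<open>y\<close> is elementary, and the one over
  \<open>u\<close> is Craig's integral.\<close>

lemma wedge_half:
  assumes \<alpha>: "0 < \<alpha>" "\<alpha> \<le> pi / 2" and v: "0 < v"
  shows "emeasure (cgauss v) {z. 0 < Im z \<and> sin \<alpha> * (1 + Re z) < cos \<alpha> * Im z} = ennreal (craig \<alpha> ((sin \<alpha>)\<^sup>2 / (2 * v)))"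
proof -
  interpret S: prob_space std_normal_distribution by (rule prob_space_std_normal)
  interpret SS: pair_prob_space std_normal_distribution std_normal_distribution ..
  \<comment> \<open>Distance of the unit-modulus symbol from the origin in units of the noise
    deviation; the problem is rescaled to standard normal coordinates.\<close>
  define s where "s = 1 / sqrt v"
  have s: "0 < s" using v by (simp add: s_def)
  have sa: "0 < sin \<alpha>" using \<alpha> by (intro sin_gt_zero) auto
  define A where "A = {p::real\<times>real. 0 < snd p \<and> sin \<alpha> * (s + fst p) < cos \<alpha> * snd p}"
  let ?E = "{z. 0 < Im z \<and> sin \<alpha> * (1 + Re z) < cos \<alpha> * Im z}"
  have Em: "?E \<in> sets borel"
  proof -
    have "?E = {z\<in>space borel. 0 < Im z \<and> sin \<alpha> * (1 + Re z) < cos \<alpha> * Im z}" by simp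
    also have "\<dots> \<in> sets borel" by measurable
    finally show ?thesis .
  qed
  have Am[measurable]: "A \<in> sets (borel \<Otimes>\<^sub>M borel)"
  proof -
    have "A = {p\<in>space (borel \<Otimes>\<^sub>M borel). 0 < snd p \<and> sin \<alpha> * (s + fst p) < cos \<alpha> * snd p}" by (simp add: A_def space_pair_measure)
    also have "\<dots> \<in> sets (borel \<Otimes>\<^sub>M borel)" by measurable
    finally show ?thesis .
  qed
  have Am': "A \<in> sets (std_normal_distribution \<Otimes>\<^sub>M std_normal_distribution)"
    using Am by (simp cong: sets_pair_measure_cong)
  have scale: "sin \<alpha> * (1 + sqrt v * x) < cos \<alpha> * (sqrt v * y) \<longleftrightarrow> sin \<alpha> * (s + x) < cos \<alpha> * y" for x y
  proof -
    have sv: "sqrt v * s = 1" using v by (simp add: s_def)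
    have "sqrt v * (sin \<alpha> * (s + x)) = sin \<alpha> * (sqrt v * s + sqrt v * x)" by (simp only: distrib_left mult_ac)
    then have "sin \<alpha> * (1 + sqrt v * x) = sqrt v * (sin \<alpha> * (s + x))" by (simp only: sv)
    moreover have "cos \<alpha> * (sqrt v * y) = sqrt v * (cos \<alpha> * y)" by (simp only: mult.left_commute)
    ultimately show ?thesis using v by (simp only: mult_less_cancel_left_pos real_sqrt_gt_zero)
  qed
  have "emeasure (cgauss v) ?E = emeasure (std_normal_distribution \<Otimes>\<^sub>M std_normal_distribution) A"
    unfolding cgauss_def using Em v
    by (subst emeasure_distr) (auto simp: space_pair_measure A_def scale zero_less_mult_iff intro!: arg_cong[of _ _ "emeasure _"])
  also have "\<dots> = (\<integral>\<^sup>+y. emeasure std_normal_distribution ((\<lambda>x. (x, y)) -` A) \<partial>std_normal_distribution)"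
    by (rule SS.emeasure_pair_measure_alt2[OF Am'])
  also have "\<dots> = (\<integral>\<^sup>+y. ennreal (std_normal_density y) * emeasure std_normal_distribution ((\<lambda>x. (x, y)) -` A) \<partial>lborel)"
    using SS.measurable_emeasure_Pair2[OF Am'] by (subst nn_integral_density) auto
  also have "\<dots> = (\<integral>\<^sup>+y. \<integral>\<^sup>+u. ennreal (y * exp (- (1 + u\<^sup>2) * y\<^sup>2 / 2) / (2 * pi)) * indicator {p. 0 < snd p \<and> sin \<alpha> * s < snd p * (cos \<alpha> - fst p * sin \<alpha>)} (u, y) \<partial>lborel \<partial>lborel)"
  proof (rule nn_integral_cong)
    fix y :: real
    have Ay: "(\<lambda>x. (x, y)) -` A \<in> sets borel" using measurable_sets[OF _ Am, of "\<lambda>x. (x, y)" borel] by simp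
    have e1: "emeasure std_normal_distribution ((\<lambda>x. (x, y)) -` A) = (\<integral>\<^sup>+x. ennreal (std_normal_density x) * indicator A (x, y) \<partial>lborel)"
      using Ay by (subst emeasure_density) (auto intro!: nn_integral_cong simp: indicator_def)
    have e2: "ennreal (std_normal_density y) * (\<integral>\<^sup>+x. ennreal (std_normal_density x) * indicator A (x, y) \<partial>lborel) = (\<integral>\<^sup>+u. ennreal (y * exp (- (1 + u\<^sup>2) * y\<^sup>2 / 2) / (2 * pi)) * indicator {p. 0 < snd p \<and> sin \<alpha> * s < snd p * (cos \<alpha> - fst p * sin \<alpha>)} (u, y) \<partial>lborel)"
    proof (cases "0 < y")
      case False
      then have "A \<inter> {(x, y) |x. True} = {}" by (auto simp: A_def)
      then have "indicator A (x, y) = (0::ennreal)" for x using False by (auto simp: A_def indicator_def)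
      then show ?thesis using False by (simp add: indicator_def)
    next
      case True
      have m: "(\<lambda>x. ennreal (std_normal_density x) * indicator A (x, y)) \<in> borel_measurable borel" by measurable
      \<comment> \<open>Change to the slope, \<open>x = y * u\<close> with Jacobian
        \<open>y\<close>. The two Gaussian exponents merge to
        \<open>(1 + u\<^sup>2) * y\<^sup>2 / 2\<close>, and the Jacobian makes the later integral in
        \<open>y\<close> explicit.\<close>
      have "(\<integral>\<^sup>+x. ennreal (std_normal_density x) * indicator A (x, y) \<partial>lborel) =
          ennreal \<bar>y\<bar> * (\<integral>\<^sup>+u. ennreal (std_normal_density (0 + y * u)) * indicator A (0 + y * u, y) \<partial>lborel)"
        by (rule nn_integral_real_affine[OF m]) (use True in simp)
      then have "ennreal (std_normal_density y) * (\<integral>\<^sup>+x. ennreal (std_normal_density x) * indicator A (x, y) \<partial>lborel) =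
          (\<integral>\<^sup>+u. ennreal (std_normal_density y) * (ennreal y * (ennreal (std_normal_density (y * u)) * indicator A (y * u, y))) \<partial>lborel)"
        using True by (simp add: nn_integral_cmult)
      also have "\<dots> = (\<integral>\<^sup>+u. ennreal (y * exp (- (1 + u\<^sup>2) * y\<^sup>2 / 2) / (2 * pi)) * indicator {p. 0 < snd p \<and> sin \<alpha> * s < snd p * (cos \<alpha> - fst p * sin \<alpha>)} (u, y) \<partial>lborel)"
      proof (rule nn_integral_cong)
        fix u :: real
        have "std_normal_density y * (y * std_normal_density (y * u)) = y * (exp (- y\<^sup>2 / 2) * exp (- (y * u)\<^sup>2 / 2)) / (2 * pi)"
          by (simp add: std_normal_density_def)
        also have "exp (- y\<^sup>2 / 2) * exp (- (y * u)\<^sup>2 / 2) = exp (- (1 + u\<^sup>2) * y\<^sup>2 / 2)"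
          by (simp add: exp_add[symmetric] power_mult_distrib field_simps)
        finally have d: "ennreal (std_normal_density y) * (ennreal y * ennreal (std_normal_density (y * u))) = ennreal (y * exp (- (1 + u\<^sup>2) * y\<^sup>2 / 2) / (2 * pi))"
          using True by (simp add: ennreal_mult'[symmetric])
        have i: "indicator A (y * u, y) = (indicator {p. 0 < snd p \<and> sin \<alpha> * s < snd p * (cos \<alpha> - fst p * sin \<alpha>)} (u, y) :: ennreal)"
          by (auto simp: A_def indicator_def algebra_simps)
        show "ennreal (std_normal_density y) * (ennreal y * (ennreal (std_normal_density (y * u)) * indicator A (y * u, y))) =
          ennreal (y * exp (- (1 + u\<^sup>2) * y\<^sup>2 / 2) / (2 * pi)) * indicator {p. 0 < snd p \<and> sin \<alpha> * s < snd p * (cos \<alpha> - fst p * sin \<alpha>)} (u, y)"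
          unfolding i d[symmetric] by (simp only: mult.assoc)
      qed
      finally show ?thesis .
    qed
    show "ennreal (std_normal_density y) * emeasure std_normal_distribution ((\<lambda>x. (x, y)) -` A) =
      (\<integral>\<^sup>+u. ennreal (y * exp (- (1 + u\<^sup>2) * y\<^sup>2 / 2) / (2 * pi)) * indicator {p. 0 < snd p \<and> sin \<alpha> * s < snd p * (cos \<alpha> - fst p * sin \<alpha>)} (u, y) \<partial>lborel)"
      unfolding e1 by (rule e2)
  qed
  also have "\<dots> = (\<integral>\<^sup>+u. \<integral>\<^sup>+y. ennreal (y * exp (- (1 + u\<^sup>2) * y\<^sup>2 / 2) / (2 * pi)) * indicator {p. 0 < snd p \<and> sin \<alpha> * s < snd p * (cos \<alpha> - fst p * sin \<alpha>)} (u, y) \<partial>lborel \<partial>lborel)"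
  proof -
    have [measurable]: "{p::real\<times>real. 0 < snd p \<and> sin \<alpha> * s < snd p * (cos \<alpha> - fst p * sin \<alpha>)} \<in> sets (borel \<Otimes>\<^sub>M borel)"
    proof -
      have "{p::real\<times>real. 0 < snd p \<and> sin \<alpha> * s < snd p * (cos \<alpha> - fst p * sin \<alpha>)} =
        {p\<in>space (borel \<Otimes>\<^sub>M borel). 0 < snd p \<and> sin \<alpha> * s < snd p * (cos \<alpha> - fst p * sin \<alpha>)}" by (simp add: space_pair_measure)
      also have "\<dots> \<in> sets (borel \<Otimes>\<^sub>M borel)" by measurable
      finally show ?thesis .
    qed
    have "(\<lambda>p. ennreal (snd p * exp (- (1 + (fst p)\<^sup>2) * (snd p)\<^sup>2 / 2) / (2 * pi)) * indicator {p. 0 < snd p \<and> sin \<alpha> * s < snd p * (cos \<alpha> - fst p * sin \<alpha>)} p) \<in> borel_measurable (lborel \<Otimes>\<^sub>M lborel)"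
      by measurable
    from lborel_pair.Fubini[OF this] show ?thesis by simp
  qed
  also have "\<dots> = (\<integral>\<^sup>+u. ennreal (exp (- ((1 + u\<^sup>2) * ((sin \<alpha>)\<^sup>2 / (2 * v)) / (cos \<alpha> - u * sin \<alpha>)\<^sup>2)) / (2 * pi * (1 + u\<^sup>2))) * indicator {..<cos \<alpha> / sin \<alpha>} u \<partial>lborel)"
  proof (rule nn_integral_cong)
    fix u :: real
    define D where "D = cos \<alpha> - u * sin \<alpha>"
    have k: "0 < 1 + u\<^sup>2" by (simp add: add_pos_nonneg)
    show "(\<integral>\<^sup>+y. ennreal (y * exp (- (1 + u\<^sup>2) * y\<^sup>2 / 2) / (2 * pi)) * indicator {p. 0 < snd p \<and> sin \<alpha> * s < snd p * (cos \<alpha> - fst p * sin \<alpha>)} (u, y) \<partial>lborel)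
      = ennreal (exp (- ((1 + u\<^sup>2) * ((sin \<alpha>)\<^sup>2 / (2 * v)) / (cos \<alpha> - u * sin \<alpha>)\<^sup>2)) / (2 * pi * (1 + u\<^sup>2))) * indicator {..<cos \<alpha> / sin \<alpha>} u"
    proof (cases "0 < D")
      case True
      \<comment> \<open>Along a ray of slope \<open>u\<close> the wedge begins at height
        \<open>c\<close>. For \<open>D \<le> 0\<close> the ray misses the wedge, which explains the
        cut-off of \<open>u\<close> at \<open>cos \<alpha> / sin \<alpha>\<close>.\<close>
      define c where "c = sin \<alpha> * s / D"
      have c: "0 < c" using True sa s by (simp add: c_def)
      have ind: "indicator {p. 0 < snd p \<and> sin \<alpha> * s < snd p * (cos \<alpha> - fst p * sin \<alpha>)} (u, y) = (indicator {c<..} y :: ennreal)" for y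
      proof -
        have "sin \<alpha> * s < y * D \<longleftrightarrow> c < y" using True by (simp add: c_def pos_divide_less_eq)
        then show ?thesis using c unfolding D_def by (auto simp: indicator_def)
      qed
      have u: "u < cos \<alpha> / sin \<alpha>" using True sa by (simp add: D_def pos_less_divide_eq)
      have e: "- (1 + u\<^sup>2) * c\<^sup>2 / 2 = - ((1 + u\<^sup>2) * ((sin \<alpha>)\<^sup>2 / (2 * v)) / D\<^sup>2)"
      proof -
        have "c\<^sup>2 = (sin \<alpha>)\<^sup>2 / (v * D\<^sup>2)" using v by (simp add: c_def s_def power_divide power_mult_distrib)
        then have h: "c\<^sup>2 / 2 = (sin \<alpha>)\<^sup>2 / (2 * v) / D\<^sup>2" by simp
        have "- (1 + u\<^sup>2) * c\<^sup>2 / 2 = - ((1 + u\<^sup>2) * (c\<^sup>2 / 2))"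
          by (simp only: mult_minus_left times_divide_eq_right minus_divide_left)
        then show ?thesis unfolding h by (simp only: times_divide_eq_right)
      qed
      show ?thesis unfolding ind nn_integral_gauss_ray[OF k less_imp_le[OF c]] e D_def[symmetric] using u by simp
    next
      case False
      have "\<not> (0 < y \<and> sin \<alpha> * s < y * D)" for y
      proof (rule notI)
        assume y: "0 < y \<and> sin \<alpha> * s < y * D"
        have "y * D \<le> 0" using y False by (intro mult_nonneg_nonpos) auto
        moreover have "0 < sin \<alpha> * s" using sa s by simp
        ultimately show False using y by linarith
      qed
      then have "indicator {p. 0 < snd p \<and> sin \<alpha> * s < snd p * (cos \<alpha> - fst p * sin \<alpha>)} (u, y) = (0 :: ennreal)" for y
        unfolding D_def by (auto simp: indicator_def)
      moreover have "\<not> u < cos \<alpha> / sin \<alpha>" using False sa by (simp add: D_def pos_less_divide_eq)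
      ultimately show ?thesis by simp
    qed
  qed
  also have "\<dots> = ennreal (craig \<alpha> ((sin \<alpha>)\<^sup>2 / (2 * v)))"
    unfolding craig_def using sa v by (intro wedge_substitution[OF \<alpha>]) simp
  finally show ?thesis .
qed

text \<open>The characteristic function at \<open>c\<close> depends on \<open>cmod c\<close> only,
  so any map that sends each functional to one with a coefficient of equal modulus preserves the
  law.\<close>

lemma cgauss_distr_eq:
  assumes v: "0 \<le> v" and f[measurable]: "f \<in> borel_measurable borel"
    and eq: "\<And>c. \<exists>d. cmod d = cmod c \<and> (\<forall>z. Re (c * f z) = Re (d * z))"
  shows "distr (cgauss v) borel f = cgauss v"
proof (rule determinesD[OF determines_complex])
  interpret prob_space "cgauss v" by (rule prob_space_cgauss)
  show "finite_measure (distr (cgauss v) borel f)" by (rule finite_measure_distr) simp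
  show "finite_measure (cgauss v)" by (rule finite_measure_axioms)
  fix \<theta> :: "complex \<Rightarrow> real" assume "\<theta> \<in> range (\<lambda>c z. Re (c * z))"
  then obtain c where \<theta>: "\<theta> = (\<lambda>z. Re (c * z))" by blast
  obtain d where d: "cmod d = cmod c" "\<And>z. Re (c * f z) = Re (d * z)" using eq[of c] by blast
  have m: "(\<lambda>z. iexp (Re (c * z))) \<in> borel_measurable borel" by measurable
  have f': "f \<in> measurable (cgauss v) borel" by simp
  have "(\<integral>z. iexp (\<theta> z) \<partial>distr (cgauss v) borel f) = (\<integral>z. iexp (Re (d * z)) \<partial>cgauss v)"
    unfolding \<theta> integral_distr[OF f' m] d(2) ..
  then show "(\<integral>z. iexp (\<theta> z) \<partial>distr (cgauss v) borel f) = (\<integral>z. iexp (\<theta> z) \<partial>cgauss v)"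
    unfolding \<theta> integral_iexp_cgauss[OF v] d(1) .
qed auto

lemma cgauss_invariant:
  assumes "0 \<le> v" and A: "A \<in> sets borel"
  shows "cmod a = 1 \<Longrightarrow> measure (cgauss v) {z. a * z \<in> A} = measure (cgauss v) A"
    "measure (cgauss v) {z. cnj z \<in> A} = measure (cgauss v) A"
proof -
  have [measurable]: "cnj \<in> borel_measurable borel" by (intro borel_measurable_continuous_onI continuous_intros)
  have 1: "distr (cgauss v) borel cnj = cgauss v"
  proof (rule cgauss_distr_eq[OF assms(1)])
    fix c show "\<exists>d. cmod d = cmod c \<and> (\<forall>z. Re (c * cnj z) = Re (d * z))" by (rule exI[of _ "cnj c"]) simp
  qed simp
  show "measure (cgauss v) {z. cnj z \<in> A} = measure (cgauss v) A"
    by (subst (2) 1[symmetric], subst measure_distr) (use A in \<open>simp_all add: vimage_def\<close>)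
  assume a: "cmod a = 1"
  have 2: "distr (cgauss v) borel (\<lambda>z. a * z) = cgauss v"
  proof (rule cgauss_distr_eq[OF assms(1)])
    fix c show "\<exists>d. cmod d = cmod c \<and> (\<forall>z. Re (c * (a * z)) = Re (d * z))"
      using a by (intro exI[of _ "c * a"]) (simp add: norm_mult mult.assoc del: times_complex.sel)
  qed simp
  show "measure (cgauss v) {z. a * z \<in> A} = measure (cgauss v) A"
    by (subst (2) 2[symmetric], subst measure_distr) (use A in \<open>simp_all add: vimage_def\<close>)
qed

lemma cgauss_line_null:
  assumes v: "0 < v" and c: "c \<noteq> 0"
  shows "measure (cgauss v) {z. Re (c * z) = d} = 0"
proof -
  interpret prob_space "cgauss v" by (rule prob_space_cgauss)
  have m: "(\<lambda>z. Re (c * z)) \<in> borel_measurable (cgauss v)" by measurable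
  have "distr (cgauss v) borel (\<lambda>z. Re (c * z)) = gauss (v * (cmod c)\<^sup>2)"
  proof (rule Levy_uniqueness)
    show "real_distribution (distr (cgauss v) borel (\<lambda>z. Re (c * z)))" by (rule real_distribution_distr[OF m])
    have "char (distr (cgauss v) borel (\<lambda>z. Re (c * z))) t = char (gauss (v * (cmod c)\<^sup>2)) t" for t
    proof -
      have "char (distr (cgauss v) borel (\<lambda>z. Re (c * z))) t = (\<integral>z. iexp (t * Re (c * z)) \<partial>cgauss v)"
        unfolding char_def by (rule integral_distr[OF m]) simp
      also have "\<dots> = (\<integral>z. iexp (Re ((t * c) * z)) \<partial>cgauss v)" by (simp add: algebra_simps)
      also have "\<dots> = char (gauss (v * (cmod c)\<^sup>2)) t"
        using v by (subst integral_iexp_cgauss) (simp_all add: char_gauss norm_mult power_mult_distrib mult_ac)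
      finally show ?thesis .
    qed
    then show "char (distr (cgauss v) borel (\<lambda>z. Re (c * z))) = char (gauss (v * (cmod c)\<^sup>2))" by (rule ext)
  qed (rule real_distribution_gauss)
  then have "measure (cgauss v) ((\<lambda>z. Re (c * z)) -` {d} \<inter> space (cgauss v)) = measure (gauss (v * (cmod c)\<^sup>2)) {d}"
    using measure_distr[OF m, of "{d}"] by simp
  also have "\<dots> = 0" using v c by (intro gauss_null_singleton) simp
  finally show ?thesis by (simp add: vimage_def)
qed

text \<open>The complement of the closed wedge is the half region of \<open>wedge_half\<close> and
  its mirror image, up to a null part of the real axis. The open and closed wedges differ only by
  parts of two lines.\<close>

lemma wedge_measure:
  assumes \<alpha>: "0 < \<alpha>" "\<alpha> \<le> pi / 2" and v: "0 < v"
  defines "p \<equiv> 1 - 2 * craig \<alpha> ((sin \<alpha>)\<^sup>2 / (2 * v))"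
  shows "measure (cgauss v) {z. cos \<alpha> * \<bar>Im z\<bar> \<le> sin \<alpha> * (1 + Re z)} = p" (is "measure _ ?C = p")
    "measure (cgauss v) {z. cos \<alpha> * \<bar>Im z\<bar> < sin \<alpha> * (1 + Re z)} = p" (is "measure _ ?O = p")
    "{z. cos \<alpha> * \<bar>Im z\<bar> \<le> sin \<alpha> * (1 + Re z)} \<in> sets borel" "{z. cos \<alpha> * \<bar>Im z\<bar> < sin \<alpha> * (1 + Re z)} \<in> sets borel"
proof -
  interpret prob_space "cgauss v" by (rule prob_space_cgauss)
  have sa: "0 < sin \<alpha>" using \<alpha> by (intro sin_gt_zero) auto
  have ca: "0 \<le> cos \<alpha>" using \<alpha> by (intro cos_ge_zero) auto
  have setsI: "{z. P z} \<in> sets (borel :: complex measure)" if "{z\<in>space borel. P z} \<in> sets borel" for P using that by simp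
  show C[measurable]: "?C \<in> sets borel" by (rule setsI) measurable
  show O[measurable]: "?O \<in> sets borel" by (rule setsI) measurable
  define U where "U = {z. 0 < Im z \<and> sin \<alpha> * (1 + Re z) < cos \<alpha> * Im z}"
  define L where "L = {z. cnj z \<in> U}"
  have U[measurable]: "U \<in> sets borel" unfolding U_def by (rule setsI) measurable
  have L[measurable]: "L \<in> sets borel" unfolding L_def U_def by (rule setsI) (simp, measurable)
  define Z where "Z = {z. Im z = 0}"
  have Zm[measurable]: "Z \<in> sets borel" unfolding Z_def by (rule setsI) measurable
  have mU: "measure (cgauss v) U = craig \<alpha> ((sin \<alpha>)\<^sup>2 / (2 * v))"
  proof -
    have e: "ennreal (measure (cgauss v) U) = ennreal (craig \<alpha> ((sin \<alpha>)\<^sup>2 / (2 * v)))"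
      using wedge_half[OF \<alpha> v] unfolding U_def emeasure_eq_measure .
    show ?thesis using e by (simp add: craig_nonneg)
  qed
  have mL: "measure (cgauss v) L = measure (cgauss v) U"
    unfolding L_def by (rule cgauss_invariant(2)) (use v in auto)
  have mZ: "measure (cgauss v) Z = 0"
  proof -
    have "Z = {z. Re (- \<i> * z) = 0}" by (auto simp: Z_def)
    then show ?thesis using cgauss_line_null[OF v, of "-\<i>" 0] by simp
  qed
  have UL: "measure (cgauss v) (U \<union> L) = 2 * craig \<alpha> ((sin \<alpha>)\<^sup>2 / (2 * v))"
  proof -
    have "U \<inter> L = {}" by (auto simp: U_def L_def)
    then show ?thesis using mU mL by (subst finite_measure_Union) auto
  qed
  have sub1: "U \<union> L \<subseteq> UNIV - ?C" by (auto simp: U_def L_def)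
  have sub2: "UNIV - ?C \<subseteq> (U \<union> L) \<union> Z"
  proof
    fix z assume "z \<in> UNIV - ?C"
    then have "sin \<alpha> * (1 + Re z) < cos \<alpha> * \<bar>Im z\<bar>" by auto
    then show "z \<in> (U \<union> L) \<union> Z" by (cases "Im z" "0::real" rule: linorder_cases) (auto simp: U_def L_def Z_def)
  qed
  have "measure (cgauss v) (UNIV - ?C) = measure (cgauss v) (U \<union> L)"
  proof (rule antisym)
    have "measure (cgauss v) (UNIV - ?C) \<le> measure (cgauss v) ((U \<union> L) \<union> Z)"
      by (rule finite_measure_mono[OF sub2]) auto
    also have "\<dots> \<le> measure (cgauss v) (U \<union> L) + measure (cgauss v) Z" by (rule measure_Un_le) auto
    finally show "measure (cgauss v) (UNIV - ?C) \<le> measure (cgauss v) (U \<union> L)" using mZ by simp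
    show "measure (cgauss v) (U \<union> L) \<le> measure (cgauss v) (UNIV - ?C)"
      by (rule finite_measure_mono[OF sub1]) (use C in auto)
  qed
  moreover have "measure (cgauss v) (UNIV - ?C) = 1 - measure (cgauss v) ?C"
    using prob_compl[of ?C] C by simp
  ultimately show mC: "measure (cgauss v) ?C = p" using UL by (simp add: p_def)
  \<comment> \<open>The boundary rays lie on the lines \<open>Re (l1 * z) = - sin \<alpha>\<close>
    and \<open>Re (l2 * z) = - sin \<alpha>\<close>, which are null sets.\<close>
  define l1 where "l1 = Complex (sin \<alpha>) (cos \<alpha>)"
  define l2 where "l2 = Complex (sin \<alpha>) (- cos \<alpha>)"
  have n: "l1 \<noteq> 0" "l2 \<noteq> 0" using sa by (auto simp: l1_def l2_def complex_eq_iff)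
  have B: "{z. Re (l1 * z) = - sin \<alpha>} \<in> sets borel" "{z. Re (l2 * z) = - sin \<alpha>} \<in> sets borel" by (rule setsI, measurable)+
  have "?C \<subseteq> ?O \<union> ({z. Re (l1 * z) = - sin \<alpha>} \<union> {z. Re (l2 * z) = - sin \<alpha>})"
    by (auto simp: l1_def l2_def abs_if algebra_simps split: if_splits)
  then have "measure (cgauss v) ?C \<le> measure (cgauss v) (?O \<union> ({z. Re (l1 * z) = - sin \<alpha>} \<union> {z. Re (l2 * z) = - sin \<alpha>}))"
    by (rule finite_measure_mono) (use O B in auto)
  also have "\<dots> \<le> measure (cgauss v) ?O + measure (cgauss v) ({z. Re (l1 * z) = - sin \<alpha>} \<union> {z. Re (l2 * z) = - sin \<alpha>})"
    by (rule measure_Un_le) (use O B in auto)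
  also have "measure (cgauss v) ({z. Re (l1 * z) = - sin \<alpha>} \<union> {z. Re (l2 * z) = - sin \<alpha>}) \<le> 0 + 0"
    using measure_Un_le[where M="cgauss v" and A="{z. Re (l1 * z) = - sin \<alpha>}" and B="{z. Re (l2 * z) = - sin \<alpha>}"] B
    unfolding cgauss_line_null[OF v n(1)] cgauss_line_null[OF v n(2)] sets_cgauss by blast
  finally have "measure (cgauss v) ?C \<le> measure (cgauss v) ?O" by simp
  moreover have "measure (cgauss v) ?O \<le> measure (cgauss v) ?C"
    by (rule finite_measure_mono) (use C in auto)
  ultimately show "measure (cgauss v) ?O = p" using mC by simp
qed

lemma psk_shift:
  assumes M: "2 \<le> M" and x: "x \<in> psk M"
  shows "x * cis (2 * (pi / M) * real k) \<in> psk M"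
proof -
  obtain i where i: "x = cis (2 * pi * real i / real M)" using x by (auto simp: psk_def)
  have "x * cis (2 * (pi / M) * real k) = cis (2 * pi * real (i + k) / real M)"
    unfolding i cis_mult by (simp add: add_divide_distrib algebra_simps)
  also have "\<dots> = cis (2 * pi * real ((i + k) mod M) / real M)"
  proof -
    have "real (i + k) = real ((i + k) div M) * real M + real ((i + k) mod M)"
      by (metis div_mult_mod_eq of_nat_add of_nat_mult)
    then have "2 * pi * real (i + k) / real M = 2 * pi * real ((i + k) div M) + 2 * pi * real ((i + k) mod M) / real M"
      using M by (simp add: field_simps)
    moreover have "cis (2 * pi * real ((i + k) div M)) = 1" by simp
    ultimately show ?thesis by (simp only: cis_mult[symmetric] mult_1_left)
  qed
  finally show ?thesis using M by (auto simp: psk_def)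
qed

lemma psk_props:
  assumes M: "2 \<le> M"
  shows "finite (psk M)" "card (psk M) = M" "x \<in> psk M \<Longrightarrow> cmod x = 1"
    "x \<in> psk M \<Longrightarrow> x' \<in> psk M \<Longrightarrow> x' \<noteq> x \<Longrightarrow> \<exists>k\<in>{1..M-1}. x' = x * cis (2 * (pi / M) * real k)"
proof -
  show "finite (psk M)" by (simp add: psk_def)
  have "inj_on (\<lambda>i. cis (2 * pi * real i / real M)) {..<M}"
  proof (rule inj_onI)
    fix i j assume ij: "i \<in> {..<M}" "j \<in> {..<M}" and "cis (2 * pi * real i / real M) = cis (2 * pi * real j / real M)"
    then have "exp (2 * of_real pi * \<i> * of_nat i / of_nat M) = exp (2 * of_real pi * \<i> * of_nat j / of_nat M)"
      by (simp add: cis_conv_exp mult_ac)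
    then have "i mod M = j mod M" using complex_root_unity_eq[of M i j] M by simp
    then show "i = j" using ij by simp
  qed
  then show "card (psk M) = M" unfolding psk_def by (simp add: card_image)
  show "x \<in> psk M \<Longrightarrow> cmod x = 1" by (auto simp: psk_def)
  assume "x \<in> psk M" "x' \<in> psk M" and ne: "x' \<noteq> x"
  then obtain i j where i: "i < M" "x = cis (2 * pi * real i / real M)" and j: "j < M" "x' = cis (2 * pi * real j / real M)"
    by (auto simp: psk_def)
  have ij: "i \<noteq> j" using ne i j by auto
  show "\<exists>k\<in>{1..M-1}. x' = x * cis (2 * (pi / M) * real k)"
  proof (cases "i < j")
    case True
    have "x' = x * cis (2 * (pi / M) * real (j - i))"
      unfolding i j cis_mult using True by (simp add: of_nat_diff add_divide_distrib[symmetric] algebra_simps)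
    then show ?thesis using True j by (intro bexI[of _ "j - i"]) auto
  next
    case False
    then have lt: "j < i" using ij by simp
    have a: "2 * pi * real i / real M + 2 * (pi / M) * real (M + j - i) = 2 * pi * real j / real M + 2 * pi"
      using lt i M by (simp add: of_nat_diff field_simps)
    have "x * cis (2 * (pi / M) * real (M + j - i)) = x'"
      unfolding i(2) j(2) cis_mult a by (simp flip: cis_mult)
    then show ?thesis using lt i j by (intro bexI[of _ "M + j - i"]) auto
  qed
qed

text \<open>Multiplication by \<open>cnj x\<close> rotates the symbol to 1, and the half angle
  \<open>t\<close> lets the common factor \<open>sin t\<close> come out. For
  \<open>sin t > 0\<close> the comparison of distances becomes a linear inequality in
  \<open>w\<close>.\<close>

lemma psk_distance:
  fixes x z :: complex and t :: real
  assumes x: "cmod x = 1"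
  defines "w \<equiv> cnj x * z"
  shows "(cmod (x + z - x * cis (2 * t)))\<^sup>2 - (cmod z)\<^sup>2 = 4 * sin t * (sin t * (1 + Re w) - cos t * Im w)"
proof -
  have xx: "cnj x * x = 1" using x complex_norm_square[of x] by (simp add: mult.commute)
  have "cnj x * (x + z - x * cis (2 * t)) = (cnj x * x) + w - (cnj x * x) * cis (2 * t)" by (simp add: w_def algebra_simps)
  then have "cnj x * (x + z - x * cis (2 * t)) = 1 + w - cis (2 * t)" unfolding xx by simp
  then have 1: "cmod (x + z - x * cis (2 * t)) = cmod (1 + w - cis (2 * t))" by (metis complex_mod_cnj mult_1 norm_mult x)
  have 2: "cmod z = cmod w" by (simp add: w_def norm_mult x)
  have expand: "(2 * S\<^sup>2)\<^sup>2 + (2 * S * C)\<^sup>2 + 2 * a * (2 * S\<^sup>2) - 2 * b * (2 * S * C)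
      = 4 * S\<^sup>2 * (S\<^sup>2 + C\<^sup>2) + 4 * S * (S * a - C * b)" for S C a b :: real
    by (simp add: power2_eq_square algebra_simps)
  have sc: "(sin t)\<^sup>2 + (cos t)\<^sup>2 = 1" by simp
  have "(cmod (1 + w - cis (2 * t)))\<^sup>2 - (cmod w)\<^sup>2 = (1 - cos (2 * t))\<^sup>2 + (sin (2 * t))\<^sup>2 + 2 * Re w * (1 - cos (2 * t)) - 2 * Im w * sin (2 * t)"
    unfolding cmod_power2 by (simp add: power2_eq_square algebra_simps)
  also have "\<dots> = (2 * (sin t)\<^sup>2)\<^sup>2 + (2 * sin t * cos t)\<^sup>2 + 2 * Re w * (2 * (sin t)\<^sup>2) - 2 * Im w * (2 * sin t * cos t)"
    by (simp add: cos_double_sin sin_double)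
  also have "\<dots> = 4 * (sin t)\<^sup>2 * ((sin t)\<^sup>2 + (cos t)\<^sup>2) + 4 * sin t * (sin t * Re w - cos t * Im w)"
    by (rule expand)
  also have "\<dots> = 4 * sin t * (sin t * (1 + Re w) - cos t * Im w)"
    unfolding sc by (simp add: power2_eq_square algebra_simps)
  finally show ?thesis unfolding 1 2 .
qed

text \<open>After rotation to the symbol 1, the comparison with the point at angle
  \<open>2 * \<alpha> * k\<close> is a half plane condition. The conditions for the two neighbours,
  \<open>k = 1\<close> and \<open>k = M - 1\<close>, imply all others, so the decision region is a
  wedge.\<close>

lemma serr_psk:
  assumes M: "2 \<le> M" and v: "0 < v"
  shows "serr (psk M) v = 2 * craig (pi / M) ((sin (pi / M))\<^sup>2 / (2 * v))"
proof -
  define \<alpha> where "\<alpha> = pi / M"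
  have \<alpha>0: "0 < \<alpha>" using M by (simp add: \<alpha>_def)
  have \<alpha>2: "\<alpha> \<le> pi / 2" unfolding \<alpha>_def by (rule divide_left_mono) (use M in auto)
  note \<alpha> = \<alpha>0 \<alpha>2
  have Ma: "real M * \<alpha> = pi" using M by (simp add: \<alpha>_def)
  have sa: "0 < sin \<alpha>" using \<alpha> by (intro sin_gt_zero) auto
  have ca: "0 \<le> cos \<alpha>" using \<alpha> by (intro cos_ge_zero) auto
  define p where "p = 1 - 2 * craig \<alpha> ((sin \<alpha>)\<^sup>2 / (2 * v))"
  note W = wedge_measure[OF \<alpha> v, folded p_def]
  note P = psk_props[OF M, folded \<alpha>_def]
  have ne: "psk M \<noteq> {}" using P(2) M by (intro notI) simp
  \<comment> \<open>The angles \<open>\<alpha> * k\<close> lie between \<open>\<alpha>\<close> and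
    \<open>pi - \<alpha>\<close>; these two estimates are the reason why the neighbours give the
    tightest constraints.\<close>
  have trig: "sin \<alpha> \<le> sin (\<alpha> * real k)" "\<bar>cos (\<alpha> * real k)\<bar> \<le> cos \<alpha>" if k: "k \<in> {1..M-1}" for k
  proof -
    have "\<alpha> * 1 \<le> \<alpha> * real k" using k \<alpha> by (intro mult_left_mono) auto
    moreover have "\<alpha> * real k \<le> \<alpha> * (real M - 1)" using k \<alpha> by (intro mult_left_mono) auto
    ultimately have t: "\<alpha> \<le> \<alpha> * real k" "\<alpha> * real k \<le> pi - \<alpha>" using Ma by (simp_all add: algebra_simps)
    have "cos (\<alpha> * real k) \<le> cos \<alpha>" using t \<alpha> by (intro cos_monotone_0_pi_le) auto
    moreover have "cos (pi - \<alpha>) \<le> cos (\<alpha> * real k)" using t \<alpha> by (intro cos_monotone_0_pi_le) auto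
    ultimately show c: "\<bar>cos (\<alpha> * real k)\<bar> \<le> cos \<alpha>" by (simp add: abs_le_iff)
    have "(cos (\<alpha> * real k))\<^sup>2 \<le> (cos \<alpha>)\<^sup>2" using c ca by (metis abs_ge_zero power2_abs power_mono)
    then have "(sin \<alpha>)\<^sup>2 \<le> (sin (\<alpha> * real k))\<^sup>2" by (simp add: cos_squared_eq)
    moreover have "0 \<le> sin (\<alpha> * real k)" using t \<alpha> by (intro sin_ge_zero) auto
    ultimately show "sin \<alpha> \<le> sin (\<alpha> * real k)" by (rule power2_le_imp_le)
  qed
  have cell: "measure (cgauss v) {z. decide (psk M) (x + z) = x} = p" if x: "x \<in> psk M" for x
  proof (rule cell_measure[OF P(1) ne])
    let ?C = "{z. cos \<alpha> * \<bar>Im z\<bar> \<le> sin \<alpha> * (1 + Re z)}" and ?O = "{z. cos \<alpha> * \<bar>Im z\<bar> < sin \<alpha> * (1 + Re z)}"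
    have x1: "cmod x = 1" by (rule P(3)[OF x])
    have m: "(\<lambda>z. cnj x * z) \<in> measurable borel borel" by measurable
    show "{z. cnj x * z \<in> ?O} \<in> sets borel" "{z. cnj x * z \<in> ?C} \<in> sets borel"
      using measurable_sets[OF m W(4)] measurable_sets[OF m W(3)] by (simp_all only: vimage_def space_borel Int_UNIV_right)
    show "measure (cgauss v) {z. cnj x * z \<in> ?O} = p" "measure (cgauss v) {z. cnj x * z \<in> ?C} = p"
      using cgauss_invariant(1)[OF less_imp_le[OF v] W(4), of "cnj x"] cgauss_invariant(1)[OF less_imp_le[OF v] W(3), of "cnj x"] x1
      by (simp_all only: W(1,2) complex_mod_cnj)
    fix z
    have dist: "(cmod (x + z - x * cis (2 * \<alpha> * real k)))\<^sup>2 - (cmod z)\<^sup>2 =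
      4 * sin (\<alpha> * real k) * (sin (\<alpha> * real k) * (1 + Re (cnj x * z)) - cos (\<alpha> * real k) * Im (cnj x * z))" for k
      using psk_distance[OF x1, of z "\<alpha> * real k"] by (simp only: mult.assoc)
    { assume "z \<in> {z. cnj x * z \<in> ?O}"
      then have z: "cos \<alpha> * \<bar>Im (cnj x * z)\<bar> < sin \<alpha> * (1 + Re (cnj x * z))" by blast
      have "0 \<le> cos \<alpha> * \<bar>Im (cnj x * z)\<bar>" using ca by simp
      with z have u: "0 < 1 + Re (cnj x * z)" using sa by (smt (verit) mult_nonneg_nonpos)
      show "decide (psk M) (x + z) = x"
      proof (rule decide_eqI[OF P(1) x])
        fix x' assume x': "x' \<in> psk M" "x' \<noteq> x"
        then obtain k where k: "k \<in> {1..M-1}" "x' = x * cis (2 * \<alpha> * real k)" using P(4)[OF x] by blast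
        note t = trig[OF k(1)]
        have "cos (\<alpha> * real k) * Im (cnj x * z) \<le> \<bar>cos (\<alpha> * real k)\<bar> * \<bar>Im (cnj x * z)\<bar>" by (metis abs_ge_self abs_mult)
        also have "\<dots> \<le> cos \<alpha> * \<bar>Im (cnj x * z)\<bar>" using t by (intro mult_right_mono) auto
        also have "\<dots> < sin \<alpha> * (1 + Re (cnj x * z))" by (rule z)
        also have "\<dots> \<le> sin (\<alpha> * real k) * (1 + Re (cnj x * z))" using t u by (intro mult_right_mono) auto
        finally have "0 < (cmod (x + z - x * cis (2 * \<alpha> * real k)))\<^sup>2 - (cmod z)\<^sup>2"
          unfolding dist using t sa by (intro mult_pos_pos) auto
        then have "(cmod z)\<^sup>2 < (cmod (x + z - x'))\<^sup>2" unfolding k(2) by simp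
        then show "cmod z < cmod (x + z - x')" using power2_less_imp_less norm_ge_zero by blast
      qed }
    { assume d: "decide (psk M) (x + z) = x"
      have ge: "0 \<le> sin (\<alpha> * real k) * (1 + Re (cnj x * z)) - cos (\<alpha> * real k) * Im (cnj x * z)" if k: "k \<in> {1..M-1}" for k
      proof -
        have "x * cis (2 * \<alpha> * real k) \<in> psk M" using psk_shift[OF M x, of k] by (simp add: \<alpha>_def)
        from decide_eqD[OF P(1) ne d this] have "(cmod z)\<^sup>2 \<le> (cmod (x + z - x * cis (2 * \<alpha> * real k)))\<^sup>2" by (simp add: power_mono)
        then have "0 \<le> 4 * sin (\<alpha> * real k) * (sin (\<alpha> * real k) * (1 + Re (cnj x * z)) - cos (\<alpha> * real k) * Im (cnj x * z))"
          using dist[of k] by linarith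
        then show ?thesis using trig[OF k] sa by (simp only: zero_le_mult_iff) linarith
      qed
      have "\<alpha> * real (M - 1) = pi - \<alpha>" using Ma M by (simp add: of_nat_diff algebra_simps)
      then have "0 \<le> sin \<alpha> * (1 + Re (cnj x * z)) + cos \<alpha> * Im (cnj x * z)" using ge[of "M - 1"] M by simp
      moreover have "0 \<le> sin \<alpha> * (1 + Re (cnj x * z)) - cos \<alpha> * Im (cnj x * z)" using ge[of 1] M by simp
      ultimately have "cos \<alpha> * \<bar>Im (cnj x * z)\<bar> \<le> sin \<alpha> * (1 + Re (cnj x * z))"
        by (simp only: abs_if split: if_splits) linarith
      then show "z \<in> {z. cnj x * z \<in> ?C}" by blast }
  qed
  have "serr (psk M) v = 1 - (\<Sum>x\<in>psk M. p) / card (psk M)"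
    by (rule serr_correct[OF P(1) ne cell])
  then show ?thesis using M by (simp add: P(2) p_def \<alpha>_def)
qed

text \<open>Lipschitz continuity in \<open>\<gamma>\<close> away from 0, from \<open>x exp (- x) \<le> 1\<close>.\<close>

lemma isCont_craig:
  assumes \<alpha>: "0 < \<alpha>" "\<alpha> < pi" and c: "0 \<le> c" and g: "0 < \<gamma>"
  shows "isCont (\<lambda>\<gamma>. craig \<alpha> (\<gamma> * c)) \<gamma>"
proof -
  define h where "h g \<theta> = exp (- (g * c / (sin \<theta>)\<^sup>2)) / (2 * pi)" for g \<theta> :: real
  have hi: "h g integrable_on {0..pi - \<alpha>}" if "0 \<le> g" for g
  proof -
    have "set_integrable lborel {0..pi - \<alpha>} (h g)"
      unfolding set_integrable_def
    proof (rule integrableI_bounded_set[where A="{0..pi - \<alpha>}" and B=1])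
      have "h g \<theta> \<le> 1" for \<theta>
      proof -
        have "exp (- (g * c / (sin \<theta>)\<^sup>2)) \<le> 1" using c that by simp
        then have "exp (- (g * c / (sin \<theta>)\<^sup>2)) \<le> 1 * (2 * pi)" using pi_gt3 by linarith
        then show ?thesis unfolding h_def by (subst pos_divide_le_eq) simp_all
      qed
      then show "AE x in lborel. x \<in> {0..pi - \<alpha>} \<longrightarrow> norm (indicat_real {0..pi - \<alpha>} x *\<^sub>R h g x) \<le> 1"
        by (auto simp: indicator_def h_def)
      show "emeasure lborel {0..pi - \<alpha>} < \<infinity>" using \<alpha> by simp
    qed (auto simp: indicator_def h_def)
    then show ?thesis by (rule set_borel_integral_eq_integral(1))
  qed
  have lip: "\<bar>h g1 \<theta> - h g2 \<theta>\<bar> \<le> \<bar>g1 - g2\<bar> / m" if "0 < m" "m \<le> g1" "m \<le> g2" for g1 g2 m \<theta>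
  proof -
    define A where "A = c / (sin \<theta>)\<^sup>2"
    have A: "0 \<le> A" using c by (simp add: A_def)
    have key: "\<bar>exp (- (a * A)) - exp (- (b * A))\<bar> \<le> (b - a) / m" if ab: "m \<le> a" "a \<le> b" for a b
    proof -
      have "exp (- (b * A)) = exp (- (a * A)) * exp (- ((b - a) * A))" by (simp add: exp_add[symmetric] algebra_simps)
      then have e: "exp (- (a * A)) - exp (- (b * A)) = exp (- (a * A)) * (1 - exp (- ((b - a) * A)))" by (simp add: algebra_simps)
      have p: "0 \<le> (b - a) * A" using ab A by simp
      have "1 - exp (- ((b - a) * A)) \<le> (b - a) * A" using exp_ge_add_one_self[of "- ((b - a) * A)"] by linarith
      then have "exp (- (a * A)) * (1 - exp (- ((b - a) * A))) \<le> exp (- (a * A)) * ((b - a) * A)" by (intro mult_left_mono) auto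
      also have "\<dots> \<le> exp (- (m * A)) * ((b - a) * A)" using ab A p by (intro mult_right_mono) (auto intro: mult_right_mono)
      also have "\<dots> = (b - a) / m * (exp (- (m * A)) * (m * A))" using \<open>0 < m\<close> by simp
      also have "exp (- (m * A)) * (m * A) \<le> 1"
      proof -
        have "m * A \<le> exp (m * A)" using exp_ge_add_one_self[of "m * A"] by linarith
        then show ?thesis by (simp add: exp_minus field_simps)
      qed
      then have "(b - a) / m * (exp (- (m * A)) * (m * A)) \<le> (b - a) / m * 1" using ab \<open>0 < m\<close> by (intro mult_left_mono) auto
      finally have "exp (- (a * A)) - exp (- (b * A)) \<le> (b - a) / m" using e by simp
      moreover have "0 \<le> exp (- (a * A)) - exp (- (b * A))" using ab A by (simp add: mult_right_mono)
      ultimately show ?thesis by simp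
    qed
    have "\<bar>exp (- (g1 * A)) - exp (- (g2 * A))\<bar> \<le> \<bar>g1 - g2\<bar> / m"
      using key[of g1 g2] key[of g2 g1] that by (cases "g1 \<le> g2") (auto simp: abs_minus_commute)
    moreover have "\<bar>h g1 \<theta> - h g2 \<theta>\<bar> = \<bar>exp (- (g1 * A)) - exp (- (g2 * A))\<bar> / (2 * pi)"
      by (simp add: h_def A_def diff_divide_distrib[symmetric])
    moreover have "\<dots> \<le> \<bar>exp (- (g1 * A)) - exp (- (g2 * A))\<bar> / 1"
      using pi_gt3 by (intro divide_left_mono) auto
    ultimately show ?thesis by simp
  qed
  have bound: "\<bar>craig \<alpha> (g1 * c) - craig \<alpha> (\<gamma> * c)\<bar> \<le> \<bar>g1 - \<gamma>\<bar> / (\<gamma> / 2) * pi" if g1: "\<gamma> / 2 \<le> g1" for g1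
  proof -
    have e: "craig \<alpha> (g * c) = integral {0..pi - \<alpha>} (h g)" for g unfolding craig_def h_def ..
    have "craig \<alpha> (g1 * c) - craig \<alpha> (\<gamma> * c) = integral {0..pi - \<alpha>} (\<lambda>\<theta>. h g1 \<theta> - h \<gamma> \<theta>)"
      unfolding e by (rule Henstock_Kurzweil_Integration.integral_diff[symmetric]; rule hi; use g1 g in simp)
    moreover have "norm (integral {0..pi - \<alpha>} (\<lambda>\<theta>. h g1 \<theta> - h \<gamma> \<theta>)) \<le> integral {0..pi - \<alpha>} (\<lambda>_. \<bar>g1 - \<gamma>\<bar> / (\<gamma> / 2))"
    proof (rule Henstock_Kurzweil_Integration.integral_norm_bound_integral)
      show "(\<lambda>\<theta>. h g1 \<theta> - h \<gamma> \<theta>) integrable_on {0..pi - \<alpha>}"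
        by (rule Henstock_Kurzweil_Integration.integrable_diff; rule hi; use g1 g in simp)
      show "norm (h g1 \<theta> - h \<gamma> \<theta>) \<le> \<bar>g1 - \<gamma>\<bar> / (\<gamma> / 2)" for \<theta>
        using lip[of "\<gamma> / 2" g1 \<gamma> \<theta>] g g1 by simp
    qed auto
    moreover have "integral {0..pi - \<alpha>} (\<lambda>_. \<bar>g1 - \<gamma>\<bar> / (\<gamma> / 2)) = (pi - \<alpha>) * (\<bar>g1 - \<gamma>\<bar> / (\<gamma> / 2))" using \<alpha> by simp
    moreover have "\<dots> \<le> pi * (\<bar>g1 - \<gamma>\<bar> / (\<gamma> / 2))" using \<alpha> g by (intro mult_right_mono) auto
    ultimately show ?thesis by (simp only: real_norm_def mult.commute)
  qed
  show ?thesis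
    unfolding isCont_def
  proof (rule LIM_zero_cancel, rule Lim_null_comparison)
    have "\<forall>\<^sub>F g1 in at \<gamma>. \<gamma> / 2 < g1"
      using g by (intro order_tendstoD(1)[OF tendsto_ident_at]) simp
    then show "\<forall>\<^sub>F g1 in at \<gamma>. norm (craig \<alpha> (g1 * c) - craig \<alpha> (\<gamma> * c)) \<le> \<bar>g1 - \<gamma>\<bar> / (\<gamma> / 2) * pi"
      by eventually_elim (use bound in auto)
    show "((\<lambda>g1. \<bar>g1 - \<gamma>\<bar> / (\<gamma> / 2) * pi) \<longlongrightarrow> 0) (at \<gamma>)"
      using g by (auto intro!: tendsto_eq_intros)
  qed
qed

section \<open>Measurability of the receiver\<close>

lemma det_measurable:
  fixes f :: "'a \<Rightarrow> nat \<Rightarrow> nat \<Rightarrow> complex"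
  assumes "\<And>i j. i < n \<Longrightarrow> j < n \<Longrightarrow> (\<lambda>x. f x i j) \<in> borel_measurable M"
  shows "(\<lambda>x. Determinant.det (Matrix.mat n n (\<lambda>(i, j). f x i j))) \<in> borel_measurable M"
proof -
  have "Determinant.det (Matrix.mat n n (\<lambda>(i, j). f x i j)) =
    (\<Sum>p\<in>{p. p permutes {0..<n}}. signof p * (\<Prod>i = 0..<n. f x i (p i)))" for x
  proof -
    have "Determinant.det (Matrix.mat n n (\<lambda>(i, j). f x i j)) =
      (\<Sum>p\<in>{p. p permutes {0..<n}}. signof p * (\<Prod>i = 0..<n. Matrix.mat n n (\<lambda>(i, j). f x i j) $$ (i, p i)))"
      by (rule det_def') simp
    also have "\<dots> = (\<Sum>p\<in>{p. p permutes {0..<n}}. signof p * (\<Prod>i = 0..<n. f x i (p i)))"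
      by (intro sum.cong prod.cong arg_cong2[where f="(*)"] refl) (auto dest: permutes_in_image)
    finally show ?thesis .
  qed
  moreover have "(\<lambda>x. \<Sum>p\<in>{p. p permutes {0..<n}}. signof p * (\<Prod>i = 0..<n. f x i (p i))) \<in> borel_measurable M"
    by (intro borel_measurable_sum borel_measurable_times borel_measurable_const borel_measurable_prod assms)
       (auto dest: permutes_in_image)
  ultimately show ?thesis by simp
qed

lemma cnj_measurable[measurable]: "cnj \<in> borel_measurable borel"
  by (intro borel_measurable_continuous_onI continuous_intros)

lemma gram_measurable:
  fixes g :: "'a \<Rightarrow> nat \<Rightarrow> nat \<Rightarrow> complex"
  assumes g: "\<And>m j. m < N \<Longrightarrow> j < n \<Longrightarrow> (\<lambda>x. g x m j) \<in> borel_measurable M" and ij: "i < n" "j < n"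
  shows "(\<lambda>x. \<Sum>m<N. cnj (g x m i) * g x m j) \<in> borel_measurable M"
  by (intro borel_measurable_sum borel_measurable_times measurable_compose[OF _ cnj_measurable] g) (use ij in auto)

lemma indep_cols_measurable:
  fixes g :: "'a \<Rightarrow> nat \<Rightarrow> nat \<Rightarrow> complex"
  assumes g: "\<And>m j. m < N \<Longrightarrow> j < n \<Longrightarrow> (\<lambda>x. g x m j) \<in> borel_measurable M"
  shows "{x\<in>space M. indep_cols {..<n} N (\<lambda>j m. g x m j)} \<in> sets M"
proof -
  have "(\<lambda>x. Determinant.det (Matrix.mat n n (\<lambda>(i, j). \<Sum>m<N. cnj (g x m i) * g x m j))) \<in> borel_measurable M"
    by (intro det_measurable gram_measurable g)
  then show ?thesis unfolding gram_det[symmetric] by measurable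
qed

lemma left_pinv_measurable:
  fixes g :: "'a \<Rightarrow> nat \<Rightarrow> nat \<Rightarrow> complex"
  assumes g: "\<And>m j. m < N \<Longrightarrow> j < n \<Longrightarrow> (\<lambda>x. g x m j) \<in> borel_measurable M" and k: "k < n" and m: "m < N"
  shows "(\<lambda>x. left_pinv (Matrix.mat N n (\<lambda>(m, j). g x m j)) $$ (k, m)) \<in> borel_measurable M"
proof -
  define \<Gamma> where "\<Gamma> x i j = (\<Sum>m<N. cnj (g x m i) * g x m j)" for x i j
  define A where "A x = Matrix.mat n n (\<lambda>(i, j). \<Gamma> x i j)" for x
  \<comment> \<open>This is the adjugate entry \<open>(k, j)\<close>: a signed minor of the Gram
    matrix with row \<open>j\<close> and column \<open>k\<close> removed, the case distinctions
    skipping these indices. Each entry of the pseudoinverse is thereby a rational expression in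
    measurable functions.\<close>
  define C where "C x j = (-1) ^ (j + k) * Determinant.det (Matrix.mat (n - 1) (n - 1) (\<lambda>(i', j'). \<Gamma> x (if i' < j then i' else Suc i') (if j' < k then j' else Suc j')))" for x j
  have \<Gamma>m: "(\<lambda>x. \<Gamma> x i j) \<in> borel_measurable M" if "i < n" "j < n" for i j
    unfolding \<Gamma>_def by (rule gram_measurable[OF g that])
  have dm: "(\<lambda>x. Determinant.det (A x)) \<in> borel_measurable M" unfolding A_def by (intro det_measurable \<Gamma>m)
  have Cm: "(\<lambda>x. C x j) \<in> borel_measurable M" if "j < n" for j
    unfolding C_def by (intro borel_measurable_times borel_measurable_const det_measurable \<Gamma>m) (use that k in auto)
  have eq: "left_pinv (Matrix.mat N n (\<lambda>(m, j). g x m j)) $$ (k, m) =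
    (if Determinant.det (A x) = 0 then 0 else \<Sum>j<n. (1 / Determinant.det (A x) * C x j) * cnj (g x m j))" for x
  proof -
    define G where "G = Matrix.mat N n (\<lambda>(m, j). g x m j)"
    have G: "G \<in> carrier_mat N n" by (simp add: G_def)
    have Ax: "Matrix.mat n n (\<lambda>(i, j). \<Sum>m<N. cnj (G $$ (m, i)) * G $$ (m, j)) = A x"
      unfolding A_def \<Gamma>_def by (rule eq_matI) (auto simp: G_def)
    have Ac: "A x \<in> carrier_mat n n" by (simp add: A_def)
    have adjc: "adj_mat (A x) \<in> carrier_mat n n" by (rule adj_mat(1)[OF Ac])
    have adj: "adj_mat (A x) $$ (k, j) = C x j" if j: "j < n" for j
    proof -
      have "mat_delete (A x) j k = Matrix.mat (n - 1) (n - 1) (\<lambda>(i', j'). \<Gamma> x (if i' < j then i' else Suc i') (if j' < k then j' else Suc j'))"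
        unfolding mat_delete_def A_def by (rule eq_matI) (use j k in auto)
      then show ?thesis using j k by (simp add: adj_mat_def cofactor_def C_def A_def)
    qed
    have "left_pinv G = (if Determinant.det (A x) = 0 then 0\<^sub>m n N else (1 / Determinant.det (A x)) \<cdot>\<^sub>m adj_mat (A x) * mat_adjoint G)"
      using left_pinv_formula(1)[OF G] unfolding Ax .
    moreover have "((1 / Determinant.det (A x)) \<cdot>\<^sub>m adj_mat (A x) * mat_adjoint G) $$ (k, m) = (\<Sum>j<n. (1 / Determinant.det (A x) * C x j) * cnj (g x m j))"
    proof -
      have "((1 / Determinant.det (A x)) \<cdot>\<^sub>m adj_mat (A x) * mat_adjoint G) $$ (k, m) =
        (\<Sum>j<n. ((1 / Determinant.det (A x)) \<cdot>\<^sub>m adj_mat (A x)) $$ (k, j) * mat_adjoint G $$ (j, m))"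
        by (rule mult_index[OF _ mat_adjoint_carrier[OF G] k m]) (use adjc in simp)
      also have "\<dots> = (\<Sum>j<n. (1 / Determinant.det (A x) * C x j) * cnj (g x m j))"
        using adjc k m by (intro sum.cong refl) (simp add: adj, simp add: G_def)
      finally show ?thesis .
    qed
    ultimately show ?thesis using k m unfolding G_def[symmetric] by simp
  qed
  have "(\<lambda>x. \<Sum>j<n. (1 / Determinant.det (A x) * C x j) * cnj (g x m j)) \<in> borel_measurable M"
    by (intro borel_measurable_sum borel_measurable_times borel_measurable_divide borel_measurable_const dm Cm measurable_compose[OF _ cnj_measurable] g) (use m in auto)
  then show ?thesis unfolding eq using dm by (intro measurable_If) auto
qed

text \<open>Noise amplification of stream \<open>k\<close>, equal to the \<open>k\<close>-th
  diagonal entry of the inverse Gram matrix when that inverse exists.\<close>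

definition zf_norm :: "complex Matrix.mat \<Rightarrow> nat \<Rightarrow> real" where
  "zf_norm G k = (\<Sum>m<dim_row G. (cmod (left_pinv G $$ (k, m)))\<^sup>2)"

lemma zf_norm_measurable:
  fixes g :: "'a \<Rightarrow> nat \<Rightarrow> nat \<Rightarrow> complex"
  assumes g: "\<And>m j. m < N \<Longrightarrow> j < n \<Longrightarrow> (\<lambda>x. g x m j) \<in> borel_measurable M" and k: "k < n"
  shows "(\<lambda>x. zf_norm (Matrix.mat N n (\<lambda>(m, j). g x m j)) k) \<in> borel_measurable M"
proof -
  have "(\<lambda>x. \<Sum>m<N. (cmod (left_pinv (Matrix.mat N n (\<lambda>(m, j). g x m j)) $$ (k, m)))\<^sup>2) \<in> borel_measurable M"
    by (intro borel_measurable_sum borel_measurable_power measurable_compose[where g=cmod, OF left_pinv_measurable] g k) auto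
  then show ?thesis by (simp add: zf_norm_def)
qed

section \<open>The conditional symbol error probability\<close>

definition zf_stat :: "complex Matrix.mat \<Rightarrow> complex Matrix.mat \<Rightarrow> nat \<Rightarrow> complex Matrix.vec \<Rightarrow> complex Matrix.vec \<Rightarrow> complex" where
  "zf_stat F H k s \<xi> = (left_pinv (H * F) *\<^sub>v received H F s \<xi>) $ k"

lemma zf_decision_eq: "zf_decision S H F (received H F s \<xi>) k = decide S (zf_stat F H k s \<xi>)"
  by (simp add: zf_decision_def decide_def zf_stat_def Let_def)

lemma mult_mat_vec_index:
  fixes A :: "complex Matrix.mat"
  assumes "A \<in> carrier_mat a b" "v \<in> carrier_vec b" "i < a"
  shows "(A *\<^sub>v v) $ i = (\<Sum>k<b. A $$ (i, k) * v $ k)"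
  using assms by (auto simp: scalar_prod_def atLeast0LessThan intro!: sum.cong)

lemma zf_stat_expand:
  assumes H: "H \<in> carrier_mat N n" and F: "F \<in> carrier_mat n n" and s: "s \<in> carrier_vec n" and x: "\<xi> \<in> carrier_vec N" and k: "k < n"
  shows "zf_stat F H k s \<xi> = (\<Sum>m<N. left_pinv (H * F) $$ (k, m) * ((\<Sum>j<n. (H * F) $$ (m, j) * s $ j) + \<xi> $ m))"
proof -
  have G: "H * F \<in> carrier_mat N n" using H F by simp
  have r: "received H F s \<xi> \<in> carrier_vec N" unfolding received_def by (rule add_carrier_vec[OF mult_mat_vec_carrier[OF G s] x])
  have "received H F s \<xi> $ m = (\<Sum>j<n. (H * F) $$ (m, j) * s $ j) + \<xi> $ m" if "m < N" for m
    unfolding received_def using x that mult_mat_vec_index[OF G s that] by simp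
  then show ?thesis
    unfolding zf_stat_def mult_mat_vec_index[OF left_pinv_carrier[OF G] r k] by (intro sum.cong) auto
qed

lemma zf_stat_injective:
  assumes H: "H \<in> carrier_mat N n" and F: "F \<in> carrier_mat n n" and s: "s \<in> carrier_vec n" and x: "\<xi> \<in> carrier_vec N" and k: "k < n"
    and ind: "indep_cols {..<n} N (\<lambda>j m. (H * F) $$ (m, j))"
  shows "zf_stat F H k s \<xi> = s $ k + (\<Sum>m<N. left_pinv (H * F) $$ (k, m) * \<xi> $ m)"
proof -
  have G: "H * F \<in> carrier_mat N n" using H F by simp
  let ?L = "left_pinv (H * F)"
  have L: "?L \<in> carrier_mat n N" by (rule left_pinv_carrier[OF G])
  have "?L * (H * F) = 1\<^sub>m n" by (rule left_pinv_formula(2)[OF G]) (unfold gram_det, rule ind)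
  then have LG: "(\<Sum>m<N. ?L $$ (k, m) * (H * F) $$ (m, j)) = (if k = j then 1 else 0)" if "j < n" for j
    using mult_index[OF L G k that] k that by simp
  have "(\<Sum>m<N. ?L $$ (k, m) * (\<Sum>j<n. (H * F) $$ (m, j) * s $ j)) = (\<Sum>m<N. \<Sum>j<n. s $ j * (?L $$ (k, m) * (H * F) $$ (m, j)))"
    by (simp only: sum_distrib_left mult_ac)
  also have "\<dots> = (\<Sum>j<n. s $ j * (\<Sum>m<N. ?L $$ (k, m) * (H * F) $$ (m, j)))"
    unfolding sum_distrib_left by (rule sum.swap)
  also have "\<dots> = (\<Sum>j<n. s $ j * (if k = j then 1 else 0))" by (intro sum.cong) (auto simp: LG)
  also have "\<dots> = s $ k" by (rule sum_mult_delta[OF k])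
  finally show ?thesis
    unfolding zf_stat_expand[OF H F s x k] distrib_left sum.distrib by simp
qed

lemma mat_mult_as_mat:
  fixes H F :: "complex Matrix.mat"
  assumes "H \<in> carrier_mat N n" "F \<in> carrier_mat n n"
  shows "H * F = Matrix.mat N n (\<lambda>(m, j). \<Sum>i<n. H $$ (m, i) * F $$ (i, j))"
  using assms by (intro eq_matI) (auto simp: mult_index[OF assms] simp del: index_mult_mat(1))

context mimo_system
begin

text \<open>The factor 1/2 converts the complex variance of the noise into the per-coordinate
  variance used by \<open>cgauss\<close>.\<close>

lemma noise_linear_law:
  assumes \<sigma>: "0 \<le> \<sigma>2"
  shows "distr P borel (\<lambda>\<omega>. \<Sum>m<nr. y m * \<xi> \<omega> $ m) = cgauss (\<sigma>2 * (\<Sum>m<nr. (cmod (y m))\<^sup>2) / 2)" (is "distr P borel ?Z = cgauss ?v")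
proof (rule determinesD[OF determines_complex])
  have xm: "\<xi> \<in> measurable P (vec_borel nr)" using noise_law by (simp add: zero_mean_cscg_def complex_gaussian_vec_def)
  have em: "(\<lambda>\<omega>. \<xi> \<omega> $ m) \<in> borel_measurable P" if "m < nr" for m
    using measurable_compose[OF xm measurable_vec_entry[OF that]] .
  have Zm: "?Z \<in> borel_measurable P" by (intro borel_measurable_sum borel_measurable_times borel_measurable_const em) simp
  show "finite_measure (distr P borel ?Z)" by (rule finite_measure_distr[OF Zm])
  show "finite_measure (cgauss ?v)" using prob_space_cgauss by (rule prob_space.finite_measure)
  fix \<theta> :: "complex \<Rightarrow> real" assume "\<theta> \<in> range (\<lambda>c z. Re (c * z))"
  then obtain c where \<theta>: "\<theta> = (\<lambda>z. Re (c * z))" by blast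
  have m: "(\<lambda>z. iexp (Re (c * z))) \<in> borel_measurable borel" by measurable
  have h: "herm nr (complex_of_real \<sigma>2 \<cdot>\<^sub>m 1\<^sub>m nr) (\<lambda>m. c * y m) (\<lambda>m. c * y m) = complex_of_real (\<sigma>2 * ((cmod c)\<^sup>2 * (\<Sum>m<nr. (cmod (y m))\<^sup>2)))"
  proof -
    have "herm nr (complex_of_real \<sigma>2 \<cdot>\<^sub>m 1\<^sub>m nr) (\<lambda>m. c * y m) (\<lambda>m. c * y m) =
      (\<Sum>i<nr. \<Sum>j<nr. (cnj (c * y i) * (c * y j) * complex_of_real \<sigma>2) * (if i = j then 1 else 0))"
      unfolding herm_def by (intro sum.cong refl) auto
    also have "\<dots> = (\<Sum>i<nr. cnj (c * y i) * (c * y i) * complex_of_real \<sigma>2)"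
      by (intro sum.cong refl sum_mult_delta) simp
    also have "\<dots> = complex_of_real \<sigma>2 * complex_of_real (\<Sum>m<nr. (cmod (c * y m))\<^sup>2)"
      unfolding complex_sum_cmod2 sum_distrib_left by (simp only: mult_ac)
    also have "(\<Sum>m<nr. (cmod (c * y m))\<^sup>2) = (cmod c)\<^sup>2 * (\<Sum>m<nr. (cmod (y m))\<^sup>2)"
      by (simp only: norm_mult power_mult_distrib sum_distrib_left)
    finally show ?thesis by (simp only: of_real_mult)
  qed
  have "(\<integral>z. iexp (\<theta> z) \<partial>distr P borel ?Z) = (\<integral>\<omega>. iexp (Re (c * ?Z \<omega>)) \<partial>P)"
    unfolding \<theta> by (rule integral_distr[OF Zm m])
  also have "\<dots> = (\<integral>\<omega>. iexp (Re (\<Sum>m<nr. (c * y m) * \<xi> \<omega> $ m)) \<partial>P)"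
    by (simp only: sum_distrib_left mult.assoc)
  also have "\<dots> = exp (- Re (herm nr (complex_of_real \<sigma>2 \<cdot>\<^sub>m 1\<^sub>m nr) (\<lambda>m. c * y m) (\<lambda>m. c * y m)) / 4)"
    unfolding herm_def by (rule cscg_char[OF noise_law])
  also have "\<dots> = (\<integral>z. iexp (\<theta> z) \<partial>cgauss ?v)"
    unfolding h \<theta> using \<sigma> by (subst integral_iexp_cgauss) (auto simp: sum_nonneg mult_ac)
  finally show "(\<integral>z. iexp (\<theta> z) \<partial>distr P borel ?Z) = (\<integral>z. iexp (\<theta> z) \<partial>cgauss ?v)" .
qed auto

abbreviation "XH \<equiv> distr P (mat_borel nr nt) H"
abbreviation "Xs \<equiv> distr P (vec_borel nt) s"
abbreviation "X\<xi> \<equiv> distr P (vec_borel nr) \<xi>"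

lemma noise_measurable: "\<xi> \<in> measurable P (vec_borel nr)"
  using noise_law by (simp add: zero_mean_cscg_def complex_gaussian_vec_def)

lemma zf_stat_measurable:
  assumes F: "F \<in> carrier_mat nt nt" and k: "k < nt"
  shows "(\<lambda>p. zf_stat F (fst p) k (fst (snd p)) (snd (snd p))) \<in> borel_measurable (mat_borel nr nt \<Otimes>\<^sub>M (vec_borel nt \<Otimes>\<^sub>M vec_borel nr))"
    (is "_ \<in> borel_measurable ?X")
proof -
  define g where "g = (\<lambda>(p :: complex Matrix.mat \<times> complex Matrix.vec \<times> complex Matrix.vec) m j. \<Sum>i<nt. fst p $$ (m, i) * F $$ (i, j))"
  have hm: "(\<lambda>p. fst p $$ (m, i)) \<in> borel_measurable ?X" if "m < nr" "i < nt" for m i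
    by (rule measurable_compose[OF measurable_fst measurable_mat_entry[OF that]])
  have sm: "(\<lambda>p. fst (snd p) $ j) \<in> borel_measurable ?X" if "j < nt" for j
    by (rule measurable_compose[OF measurable_snd measurable_compose[OF measurable_fst measurable_vec_entry[OF that]]])
  have xm: "(\<lambda>p. snd (snd p) $ m) \<in> borel_measurable ?X" if "m < nr" for m
    by (rule measurable_compose[OF measurable_snd measurable_compose[OF measurable_snd measurable_vec_entry[OF that]]])
  have gm: "(\<lambda>p. g p m j) \<in> borel_measurable ?X" if "m < nr" "j < nt" for m j
    unfolding g_def by (intro borel_measurable_sum borel_measurable_times borel_measurable_const hm that) simp
  have "(\<lambda>p. \<Sum>m<nr. left_pinv (Matrix.mat nr nt (\<lambda>(m, j). g p m j)) $$ (k, m) * ((\<Sum>j<nt. g p m j * fst (snd p) $ j) + snd (snd p) $ m)) \<in> borel_measurable ?X"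
    by (intro borel_measurable_sum borel_measurable_times borel_measurable_add left_pinv_measurable gm sm xm k) auto
  then show ?thesis
  proof (rule measurable_cong[THEN iffD1, rotated])
    fix p assume "p \<in> space ?X"
    then have p: "fst p \<in> carrier_mat nr nt" "fst (snd p) \<in> carrier_vec nt" "snd (snd p) \<in> carrier_vec nr"
      by (auto simp: space_pair_measure)
    have HF: "fst p * F = Matrix.mat nr nt (\<lambda>(m, j). g p m j)"
      unfolding g_def by (rule mat_mult_as_mat[OF p(1) F])
    show "(\<Sum>m<nr. left_pinv (Matrix.mat nr nt (\<lambda>(m, j). g p m j)) $$ (k, m) * ((\<Sum>j<nt. g p m j * fst (snd p) $ j) + snd (snd p) $ m)) =
      zf_stat F (fst p) k (fst (snd p)) (snd (snd p))"
      unfolding zf_stat_expand[OF p(1) F p(2,3) k] HF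
      by (intro sum.cong refl arg_cong2[where f="(*)"] arg_cong2[where f="(+)"]) auto
  qed
qed

text \<open>For a fixed channel with independent columns the interference cancels and the statistic
  is the symbol plus a linear form of the noise. Independence of symbol and noise then gives the
  average over the constellation that defines \<open>serr\<close>.\<close>

lemma section_error:
  assumes F: "F \<in> carrier_mat nt nt" and k: "k < nt" and S: "finite S" "S \<noteq> {}" and \<sigma>: "0 \<le> \<sigma>2"
    and h: "h \<in> carrier_mat nr nt" and ind: "indep_cols {..<nt} nr (\<lambda>j m. (h * F) $$ (m, j))"
  defines "E \<equiv> {p\<in>space (vec_borel nt \<Otimes>\<^sub>M vec_borel nr). decide S (zf_stat F h k (fst p) (snd p)) \<noteq> fst p $ k}"
  assumes E: "E \<in> sets (vec_borel nt \<Otimes>\<^sub>M vec_borel nr)"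
  shows "measure (Xs \<Otimes>\<^sub>M X\<xi>) E = serr S (\<sigma>2 * zf_norm (h * F) k / 2)"
proof -
  interpret s: prob_space Xs by (rule prob_space_distr[OF s_measurable])
  interpret x: prob_space X\<xi> by (rule prob_space_distr[OF noise_measurable])
  interpret sx: pair_prob_space Xs X\<xi> ..
  define y where "y m = left_pinv (h * F) $$ (k, m)" for m
  define v where "v = \<sigma>2 * zf_norm (h * F) k / 2"
  have vy: "v = \<sigma>2 * (\<Sum>m<nr. (cmod (y m))\<^sup>2) / 2" using h by (simp add: v_def zf_norm_def y_def)
  define A where "A x = {u\<in>carrier_vec nt. u $ k = x}" for x :: complex
  define B where "B x = {w\<in>carrier_vec nr. decide S (x + (\<Sum>m<nr. y m * w $ m)) \<noteq> x}" for x :: complex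
  have [measurable]: "A x \<in> sets (vec_borel nt)" for x
  proof -
    have "(\<lambda>u. u $ k) -` {x} \<inter> space (vec_borel nt) \<in> sets (vec_borel nt)"
      by (rule measurable_sets[OF measurable_vec_entry[OF k]]) simp
    moreover have "(\<lambda>u. u $ k) -` {x} \<inter> space (vec_borel nt) = A x" by (auto simp: A_def)
    ultimately show ?thesis by simp
  qed
  have ym: "(\<lambda>w. \<Sum>m<nr. y m * w $ m) \<in> borel_measurable (vec_borel nr)"
    by (intro borel_measurable_sum borel_measurable_times borel_measurable_const measurable_vec_entry) simp
  have Beq: "B x = (\<lambda>w. \<Sum>m<nr. y m * w $ m) -` {z. decide S (x + z) \<noteq> x} \<inter> space (vec_borel nr)" for x
    by (auto simp: B_def)
  have [measurable]: "B x \<in> sets (vec_borel nr)" for x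
    unfolding Beq by (rule measurable_sets[OF ym decide_shift_measurable(2)[OF S(1)]])
  have mA: "measure Xs (A x) = 1 / card S" if "x \<in> S" for x
  proof -
    have "measure Xs (A x) = measure P (s -` A x \<inter> space P)" by (rule measure_distr[OF s_measurable]) simp
    also have "s -` A x \<inter> space P = {\<omega>\<in>space P. s \<omega> $ k = x}"
      using measurable_space[OF s_measurable] by (auto simp: A_def)
    finally show ?thesis using s_uniform[OF k that] by simp
  qed
  have mB: "measure X\<xi> (B x) = measure (cgauss v) {z. decide S (x + z) \<noteq> x}" for x
  proof -
    have em: "(\<lambda>\<omega>. \<xi> \<omega> $ m) \<in> borel_measurable P" if "m < nr" for m
      using measurable_compose[OF noise_measurable measurable_vec_entry[OF that]] .
    have Zm: "(\<lambda>\<omega>. \<Sum>m<nr. y m * \<xi> \<omega> $ m) \<in> borel_measurable P"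
      by (intro borel_measurable_sum borel_measurable_times borel_measurable_const em) simp
    have "measure X\<xi> (B x) = measure P (\<xi> -` B x \<inter> space P)" by (rule measure_distr[OF noise_measurable]) simp
    also have "\<xi> -` B x \<inter> space P = (\<lambda>\<omega>. \<Sum>m<nr. y m * \<xi> \<omega> $ m) -` {z. decide S (x + z) \<noteq> x} \<inter> space P"
      using measurable_space[OF noise_measurable] by (auto simp: B_def)
    also have "measure P \<dots> = measure (distr P borel (\<lambda>\<omega>. \<Sum>m<nr. y m * \<xi> \<omega> $ m)) {z. decide S (x + z) \<noteq> x}"
      by (rule measure_distr[symmetric, OF Zm decide_shift_measurable(2)[OF S(1)]])
    also have "\<dots> = measure (cgauss v) {z. decide S (x + z) \<noteq> x}"
      unfolding noise_linear_law[OF \<sigma>] vy ..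
    finally show ?thesis .
  qed
  have times: "measure (Xs \<Otimes>\<^sub>M X\<xi>) (A' \<times> B') = measure Xs A' * measure X\<xi> B'"
    if "A' \<in> sets (vec_borel nt)" "B' \<in> sets (vec_borel nr)" for A' B'
    using x.emeasure_pair_measure_Times[of A' Xs B'] that
    by (simp add: measure_def enn2real_mult)
  \<comment> \<open>The symbol lies in \<open>S\<close> only almost surely. \<open>U\<close>
    collects the errors for symbols in \<open>S\<close>, and the null set \<open>N\<close> contains
    the rest, so \<open>E\<close> is enclosed between \<open>U\<close> and
    \<open>U \<union> N\<close>.\<close>
  define U where "U = (\<Union>x\<in>S. A x \<times> B x)"
  define N :: "(complex Matrix.vec \<times> complex Matrix.vec) set" where "N = (carrier_vec nt - (\<Union>x\<in>S. A x)) \<times> carrier_vec nr"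
  have Us[measurable]: "U \<in> sets (vec_borel nt \<Otimes>\<^sub>M vec_borel nr)" unfolding U_def using S(1) by (intro sets.finite_UN) auto
  have cv: "carrier_vec nt \<in> sets (vec_borel nt)" "carrier_vec nr \<in> sets (vec_borel nr)"
    using sets.top[of "vec_borel nt"] sets.top[of "vec_borel nr"] by simp_all
  have UA: "(\<Union>x\<in>S. A x) \<in> sets (vec_borel nt)" using S(1) by (intro sets.finite_UN) auto
  have Ns[measurable]: "N \<in> sets (vec_borel nt \<Otimes>\<^sub>M vec_borel nr)" unfolding N_def using cv UA by auto
  have st: "zf_stat F h k u w = u $ k + (\<Sum>m<nr. y m * w $ m)" if "u \<in> carrier_vec nt" "w \<in> carrier_vec nr" for u w
    unfolding y_def by (rule zf_stat_injective[OF h F that k ind])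
  have sub1: "U \<subseteq> E" unfolding U_def E_def by (auto simp: space_pair_measure A_def B_def st)
  have sub2: "E \<subseteq> U \<union> N"
  proof
    fix p assume "p \<in> E"
    then have p: "fst p \<in> carrier_vec nt" "snd p \<in> carrier_vec nr" "decide S (fst p $ k + (\<Sum>m<nr. y m * snd p $ m)) \<noteq> fst p $ k"
      by (auto simp: E_def space_pair_measure st)
    show "p \<in> U \<union> N"
    proof (cases "fst p $ k \<in> S")
      case True
      then have "p \<in> A (fst p $ k) \<times> B (fst p $ k)" using p by (cases p) (auto simp: A_def B_def)
      then show ?thesis using True by (auto simp: U_def)
    next
      case False
      then show ?thesis using p by (cases p) (auto simp: N_def A_def)
    qed
  qed
  have AB: "A x \<times> B x \<in> sets (Xs \<Otimes>\<^sub>M X\<xi>)" for x by (rule pair_measureI) auto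
  have disj: "disjoint_family_on A S" by (auto simp: disjoint_family_on_def A_def)
  have "measure Xs (\<Union>x\<in>S. A x) = (\<Sum>x\<in>S. measure Xs (A x))"
    by (rule s.finite_measure_finite_Union[OF S(1) _ disj]) auto
  also have "\<dots> = 1" using S by (simp add: mA)
  finally have "measure Xs (carrier_vec nt - (\<Union>x\<in>S. A x)) = 0"
    using s.prob_compl[of "\<Union>x\<in>S. A x"] UA by simp
  then have mN: "measure (Xs \<Otimes>\<^sub>M X\<xi>) N = 0"
    unfolding N_def using cv UA by (subst times) auto
  have "measure (Xs \<Otimes>\<^sub>M X\<xi>) U = (\<Sum>x\<in>S. measure (Xs \<Otimes>\<^sub>M X\<xi>) (A x \<times> B x))"
    unfolding U_def by (rule sx.P.finite_measure_finite_Union[OF S(1)]) (use AB in blast, auto simp: disjoint_family_on_def A_def)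
  also have "\<dots> = (\<Sum>x\<in>S. 1 / card S * measure (cgauss v) {z. decide S (x + z) \<noteq> x})"
    by (intro sum.cong refl) (subst times, auto simp: mA mB)
  also have "\<dots> = serr S v" by (simp add: serr_def sum_divide_distrib)
  finally have mU: "measure (Xs \<Otimes>\<^sub>M X\<xi>) U = serr S v" .
  have Es: "E \<in> sets (Xs \<Otimes>\<^sub>M X\<xi>)" "U \<in> sets (Xs \<Otimes>\<^sub>M X\<xi>)" "N \<in> sets (Xs \<Otimes>\<^sub>M X\<xi>)"
    using E Us Ns by (simp_all cong: sets_pair_measure_cong)
  have "measure (Xs \<Otimes>\<^sub>M X\<xi>) E \<le> measure (Xs \<Otimes>\<^sub>M X\<xi>) (U \<union> N)"
    by (rule sx.P.finite_measure_mono[OF sub2]) (use Es in auto)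
  also have "\<dots> \<le> measure (Xs \<Otimes>\<^sub>M X\<xi>) U + measure (Xs \<Otimes>\<^sub>M X\<xi>) N" by (rule measure_Un_le) (use Es in auto)
  finally have "measure (Xs \<Otimes>\<^sub>M X\<xi>) E \<le> serr S v" using mU mN by simp
  moreover have "serr S v \<le> measure (Xs \<Otimes>\<^sub>M X\<xi>) E"
    unfolding mU[symmetric] by (rule sx.P.finite_measure_mono[OF sub1 Es(1)])
  ultimately show ?thesis by (simp add: v_def)
qed

text \<open>By Fubini the error probability is the expectation of the section measure
  \<open>\<phi> (H \<omega>)\<close>. Off \<open>Bad\<close> this is within
  \<open>\<epsilon>\<close> of \<open>L\<close>; on \<open>Bad\<close> it differs from
  \<open>L\<close> by at most 1, whence the term \<open>prob Bad\<close>.\<close>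

lemma error_bound:
  assumes F: "F \<in> carrier_mat nt nt" and k: "k < nt" and S: "finite S" "S \<noteq> {}" and \<sigma>: "0 \<le> \<sigma>2"
    and Bad: "Bad \<in> sets P"
    and good: "AE \<omega> in P. \<omega> \<notin> Bad \<longrightarrow> indep_cols {..<nt} nr (\<lambda>j m. (H \<omega> * F) $$ (m, j)) \<and>
       \<bar>serr S (\<sigma>2 * zf_norm (H \<omega> * F) k / 2) - L\<bar> \<le> \<epsilon>"
    and L: "0 \<le> L" "L \<le> 1" and \<epsilon>: "0 \<le> \<epsilon>"
  shows "\<bar>\<P>(\<omega> in P. zf_decision S (H \<omega>) F (received (H \<omega>) F (s \<omega>) (\<xi> \<omega>)) k \<noteq> s \<omega> $ k) - L\<bar> \<le> \<epsilon> + prob Bad"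
proof -
  interpret h: prob_space XH by (rule prob_space_distr[OF H_measurable])
  interpret s: prob_space Xs by (rule prob_space_distr[OF s_measurable])
  interpret x: prob_space X\<xi> by (rule prob_space_distr[OF noise_measurable])
  interpret sx: pair_prob_space Xs X\<xi> ..
  interpret hsx: pair_prob_space XH "Xs \<Otimes>\<^sub>M X\<xi>" ..
  let ?X = "mat_borel nr nt \<Otimes>\<^sub>M (vec_borel nt \<Otimes>\<^sub>M vec_borel nr)"
  let ?st = "\<lambda>p. zf_stat F (fst p) k (fst (snd p)) (snd (snd p))"
  define E where "E = {p\<in>space ?X. decide S (?st p) \<noteq> fst (snd p) $ k}"
  have stm: "?st \<in> borel_measurable ?X" by (rule zf_stat_measurable[OF F k])
  have sm: "(\<lambda>p. fst (snd p) $ k) \<in> borel_measurable ?X"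
    by (rule measurable_compose[OF measurable_snd measurable_compose[OF measurable_fst measurable_vec_entry[OF k]]])
  have E: "E \<in> sets ?X"
  proof -
    have "E = space ?X - (\<Union>x\<in>S. (?st -` {y. decide S y = x} \<inter> space ?X) \<inter> ((\<lambda>p. fst (snd p) $ k) -` {x} \<inter> space ?X))"
      using decide_nearest(1)[OF S] by (auto simp: E_def)
    also have "\<dots> \<in> sets ?X"
      by (intro sets.Diff sets.top sets.finite_UN S sets.Int measurable_sets[OF stm] measurable_sets[OF sm] decide_measurable) auto
    finally show ?thesis .
  qed
  have joint: "(\<lambda>\<omega>. (H \<omega>, s \<omega>, \<xi> \<omega>)) \<in> measurable P ?X"
    by (intro measurable_Pair H_measurable s_measurable noise_measurable)
  have E': "E \<in> sets (XH \<Otimes>\<^sub>M (Xs \<Otimes>\<^sub>M X\<xi>))" using E by (simp cong: sets_pair_measure_cong)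
  define \<phi> where "\<phi> h = measure (Xs \<Otimes>\<^sub>M X\<xi>) (Pair h -` E)" for h
  have \<phi>m: "\<phi> \<in> borel_measurable (mat_borel nr nt)"
    using sx.P.measurable_emeasure_Pair[OF E'] unfolding \<phi>_def measure_def by simp
  have \<phi>01: "0 \<le> \<phi> h" "\<phi> h \<le> 1" for h unfolding \<phi>_def by simp_all
  have "{\<omega>\<in>space P. zf_decision S (H \<omega>) F (received (H \<omega>) F (s \<omega>) (\<xi> \<omega>)) k \<noteq> s \<omega> $ k} =
    (\<lambda>\<omega>. (H \<omega>, s \<omega>, \<xi> \<omega>)) -` E \<inter> space P"
    using measurable_space[OF joint] by (auto simp: E_def zf_decision_eq)
  then have "\<P>(\<omega> in P. zf_decision S (H \<omega>) F (received (H \<omega>) F (s \<omega>) (\<xi> \<omega>)) k \<noteq> s \<omega> $ k) =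
     measure (distr P ?X (\<lambda>\<omega>. (H \<omega>, s \<omega>, \<xi> \<omega>))) E"
    using measure_distr[OF joint E] by simp
  also have "\<dots> = measure (XH \<Otimes>\<^sub>M (Xs \<Otimes>\<^sub>M X\<xi>)) E" unfolding indep ..
  also have "\<dots> = (\<integral>h. \<phi> h \<partial>XH)"
  proof -
    have "emeasure (XH \<Otimes>\<^sub>M (Xs \<Otimes>\<^sub>M X\<xi>)) E = (\<integral>\<^sup>+h. ennreal (\<phi> h) \<partial>XH)"
      unfolding sx.P.emeasure_pair_measure_alt[OF E'] \<phi>_def by (simp add: sx.P.emeasure_eq_measure)
    also have "\<dots> = ennreal (\<integral>h. \<phi> h \<partial>XH)"
      using \<phi>m \<phi>01 by (intro nn_integral_eq_integral h.integrable_const_bound[where B=1]) auto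
    finally show ?thesis using \<phi>01 by (simp add: hsx.P.emeasure_eq_measure integral_nonneg_AE)
  qed
  also have "\<dots> = (\<integral>\<omega>. \<phi> (H \<omega>) \<partial>P)" by (rule integral_distr[OF H_measurable \<phi>m])
  finally have main: "\<P>(\<omega> in P. zf_decision S (H \<omega>) F (received (H \<omega>) F (s \<omega>) (\<xi> \<omega>)) k \<noteq> s \<omega> $ k) = (\<integral>\<omega>. \<phi> (H \<omega>) \<partial>P)" .
  have \<phi>Hm: "(\<lambda>\<omega>. \<phi> (H \<omega>)) \<in> borel_measurable P" by (rule measurable_compose[OF H_measurable \<phi>m])
  have \<phi>i: "integrable P (\<lambda>\<omega>. \<phi> (H \<omega>))" by (rule integrable_const_bound[where B=1]) (use \<phi>Hm \<phi>01 in auto)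
  have "AE \<omega> in P. \<bar>\<phi> (H \<omega>) - L\<bar> \<le> \<epsilon> + indicator Bad \<omega>"
    using good AE_space
  proof eventually_elim
    fix \<omega> assume g: "\<omega> \<notin> Bad \<longrightarrow> indep_cols {..<nt} nr (\<lambda>j m. (H \<omega> * F) $$ (m, j)) \<and> \<bar>serr S (\<sigma>2 * zf_norm (H \<omega> * F) k / 2) - L\<bar> \<le> \<epsilon>"
      and w: "\<omega> \<in> space P"
    show "\<bar>\<phi> (H \<omega>) - L\<bar> \<le> \<epsilon> + indicator Bad \<omega>"
    proof (cases "\<omega> \<in> Bad")
      case False
      have Hc: "H \<omega> \<in> carrier_mat nr nt" by (rule H_carrier[OF w])
      have "Pair (H \<omega>) -` E = {p\<in>space (vec_borel nt \<Otimes>\<^sub>M vec_borel nr). decide S (zf_stat F (H \<omega>) k (fst p) (snd p)) \<noteq> fst p $ k}"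
        using Hc by (auto simp: E_def space_pair_measure)
      moreover have "Pair (H \<omega>) -` E \<in> sets (vec_borel nt \<Otimes>\<^sub>M vec_borel nr)" by (rule sets_Pair1[OF E])
      ultimately have "\<phi> (H \<omega>) = serr S (\<sigma>2 * zf_norm (H \<omega> * F) k / 2)"
        unfolding \<phi>_def using section_error[OF F k S \<sigma> Hc] g False by simp
      then show ?thesis using g False by simp
    next
      case True
      have "\<bar>\<phi> (H \<omega>) - L\<bar> \<le> 1" using \<phi>01[of "H \<omega>"] L by linarith
      then show ?thesis using \<epsilon> True by simp
    qed
  qed
  then have "(\<integral>\<omega>. \<bar>\<phi> (H \<omega>) - L\<bar> \<partial>P) \<le> (\<integral>\<omega>. \<epsilon> + indicator Bad \<omega> \<partial>P)"
    using \<phi>i Bad by (intro integral_mono_AE Bochner_Integration.integrable_add Bochner_Integration.integrable_diff integrable_abs integrable_const integrable_real_indicator)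
      (auto simp: emeasure_eq_measure)
  also have "\<dots> = \<epsilon> + prob Bad"
    using Bad by (subst Bochner_Integration.integral_add) (auto simp: prob_space emeasure_eq_measure intro!: integrable_real_indicator)
  finally have "(\<integral>\<omega>. \<bar>\<phi> (H \<omega>) - L\<bar> \<partial>P) \<le> \<epsilon> + prob Bad" .
  moreover have "\<bar>(\<integral>\<omega>. \<phi> (H \<omega>) - L \<partial>P)\<bar> \<le> (\<integral>\<omega>. \<bar>\<phi> (H \<omega>) - L\<bar> \<partial>P)" by (rule integral_abs_bound)
  moreover have "(\<integral>\<omega>. \<phi> (H \<omega>) - L \<partial>P) = (\<integral>\<omega>. \<phi> (H \<omega>) \<partial>P) - L"
    using \<phi>i by (simp add: prob_space)
  ultimately show ?thesis unfolding main by linarith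
qed

end

section \<open>Concentration of the post-detection noise\<close>

text \<open>The columns of \<open>F\<close> have a dual basis \<open>dual k\<close> with respect to the covariance form, so \<open>H (dual k)\<close> is
  independent of the columns \<open>j \<noteq> k\<close> of \<open>HF\<close>, while column \<open>k\<close> is an affine function of it.\<close>

locale precoded_mimo = mimo_system +
  fixes F :: "complex Matrix.mat" and \<kappa> :: "nat \<Rightarrow> nat \<Rightarrow> complex" and \<tau> :: real
  assumes F: "F \<in> carrier_mat nt nt" and tau: "0 < \<tau>" and nt_nr: "nt \<le> nr"
    and \<Sigma>_herm: "\<And>i j. i < nt \<Longrightarrow> j < nt \<Longrightarrow> \<Sigma> $$ (j, i) = cnj (\<Sigma> $$ (i, j))"
    and dual: "\<And>j k. j < nt \<Longrightarrow> k < nt \<Longrightarrow>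
      herm nt \<Sigma> (\<lambda>i. F $$ (i, j)) (\<lambda>i. \<Sum>j'<nt. \<kappa> k j' * F $$ (i, j')) = (if j = k then 1 else 0)"
    and \<kappa>_diag: "\<And>k. k < nt \<Longrightarrow> \<kappa> k k = complex_of_real \<tau>"
begin

abbreviation "colF j i \<equiv> F $$ (i, j)"
abbreviation "dual k i \<equiv> \<Sum>j<nt. \<kappa> k j * F $$ (i, j)"
abbreviation "others k \<equiv> {..<nt} - {k}"
abbreviation "MW \<equiv> PiM {..<nr} (\<lambda>_. borel :: complex measure)"
abbreviation "MR k \<equiv> PiM ({..<nr} \<times> others k) (\<lambda>_. borel :: complex measure)"

text \<open>Solves the relation between the image of \<open>dual k\<close> and the columns for
  column \<open>k\<close>, whose coefficient is \<open>\<tau>\<close>. The whole matrix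
  \<open>HF\<close> becomes a function of two independent variables.\<close>

definition rebuild :: "nat \<Rightarrow> (nat \<Rightarrow> complex) \<times> (nat \<times> nat \<Rightarrow> complex) \<Rightarrow> nat \<Rightarrow> nat \<Rightarrow> complex" where
  "rebuild k q m j = (if j = k then (fst q m - (\<Sum>j'\<in>others k. \<kappa> k j' * snd q (m, j'))) / complex_of_real \<tau> else snd q (m, j))"

lemma HF_entry:
  assumes "\<omega> \<in> space P" "m < nr" "j < nt"
  shows "(H \<omega> * F) $$ (m, j) = lin nt H (colF j) \<omega> m"
  unfolding lin_def by (rule mult_index[OF H_carrier[OF assms(1)] F assms(2,3)])

lemma lin_dual: "lin nt H (dual k) \<omega> m = (\<Sum>j<nt. \<kappa> k j * lin nt H (colF j) \<omega> m)"
proof -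
  have "lin nt H (dual k) \<omega> m = (\<Sum>i<nt. \<Sum>j<nt. \<kappa> k j * (H \<omega> $$ (m, i) * F $$ (i, j)))"
    unfolding lin_def sum_distrib_left by (simp only: mult_ac)
  also have "\<dots> = (\<Sum>j<nt. \<Sum>i<nt. \<kappa> k j * (H \<omega> $$ (m, i) * F $$ (i, j)))" by (rule sum.swap)
  finally show ?thesis by (simp only: lin_def sum_distrib_left)
qed

lemma rebuild_eq:
  assumes k: "k < nt" and m: "m < nr" and j: "j < nt"
  shows "rebuild k (W_of (dual k) \<omega>, R_of (others k) colF \<omega>) m j = lin nt H (colF j) \<omega> m"
proof (cases "j = k")
  case True
  have "lin nt H (dual k) \<omega> m = complex_of_real \<tau> * lin nt H (colF k) \<omega> m + (\<Sum>j\<in>others k. \<kappa> k j * lin nt H (colF j) \<omega> m)"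
    unfolding lin_dual using k by (subst sum.remove[of _ k]) (simp_all add: \<kappa>_diag)
  then show ?thesis using True m tau by (simp add: rebuild_def W_of_def R_of_def)
next
  case False
  then show ?thesis using m j by (simp add: rebuild_def R_of_def)
qed

lemma rebuild_measurable:
  assumes "k < nt" "m < nr" "j < nt"
  shows "(\<lambda>q. rebuild k q m j) \<in> borel_measurable (MW \<Otimes>\<^sub>M MR k)"
proof -
  have 1: "(\<lambda>q. fst q m) \<in> borel_measurable (MW \<Otimes>\<^sub>M MR k)"
    by (rule measurable_compose[OF measurable_fst measurable_component_singleton]) (use assms in simp)
  have 2: "(\<lambda>q. snd q (m, j)) \<in> borel_measurable (MW \<Otimes>\<^sub>M MR k)" if "j \<in> others k" for j
    by (rule measurable_compose[OF measurable_snd measurable_component_singleton]) (use that assms in simp)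
  show ?thesis
  proof (cases "j = k")
    case True
    have "(\<lambda>q. (fst q m - (\<Sum>j'\<in>others k. \<kappa> k j' * snd q (m, j'))) / complex_of_real \<tau>) \<in> borel_measurable (MW \<Otimes>\<^sub>M MR k)"
      by (intro borel_measurable_divide borel_measurable_diff borel_measurable_sum borel_measurable_times borel_measurable_const 1 2)
    then show ?thesis using True by (simp add: rebuild_def)
  next
    case False
    then show ?thesis using 2[of j] assms by (simp add: rebuild_def)
  qed
qed

text \<open>Only the coefficient of column \<open>k\<close> survives the duality relation. Since
  \<open>rebuild\<close> divides by \<open>\<tau>\<close>, column \<open>k\<close> has conditional
  variance \<open>\<tau> / \<tau>\<^sup>2\<close>, that is, \<open>1 / \<tau>\<close>.\<close>

lemma herm_dual: "k < nt \<Longrightarrow> herm nt \<Sigma> (dual k) (dual k) = complex_of_real \<tau>"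
  unfolding herm_sum_left using dual[of _ k]
  by (subst sum.cong[OF refl, where h="\<lambda>j. if j = k then complex_of_real \<tau> else 0"]) (auto simp: \<kappa>_diag)

lemma W_dual_law: "k < nt \<Longrightarrow> iid_cgauss nr \<tau> (distr P MW (W_of (dual k)))"
  using W_law[of "dual k"] tau by (simp only: herm_dual Re_complex_of_real less_imp_le)

text \<open>Independence makes the joint law a product, so a bound on all sections with
  \<open>R\<close> fixed bounds the probability. As \<open>sec\<close> is proved for each
  \<open>R\<close> separately, auxiliary vectors may depend on \<open>R\<close> without a measurable
  selection.\<close>

lemma section_bound:
  assumes k: "k < nt" and B: "B \<in> sets (MW \<Otimes>\<^sub>M MR k)" and c: "0 \<le> c"
    and sec: "\<And>R. measure (distr P MW (W_of (dual k))) {w\<in>space MW. (w, R) \<in> B} \<le> c"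
  shows "prob {\<omega>\<in>space P. (W_of (dual k) \<omega>, R_of (others k) colF \<omega>) \<in> B} \<le> c"
proof -
  let ?A = "distr P MW (W_of (dual k))" and ?B = "distr P (MR k) (R_of (others k) colF)"
  interpret A: prob_space ?A by (rule prob_space_distr) measurable
  interpret B: prob_space ?B by (rule prob_space_distr) measurable
  interpret AB: pair_prob_space ?A ?B ..
  have B': "B \<in> sets (?A \<Otimes>\<^sub>M ?B)" using B by (simp cong: sets_pair_measure_cong)
  have WR: "(\<lambda>\<omega>. (W_of (dual k) \<omega>, R_of (others k) colF \<omega>)) \<in> measurable P (MW \<Otimes>\<^sub>M MR k)"
    by (rule measurable_Pair[OF W_of_measurable R_of_measurable])
  have "prob {\<omega>\<in>space P. (W_of (dual k) \<omega>, R_of (others k) colF \<omega>) \<in> B} =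
    measure (distr P (MW \<Otimes>\<^sub>M MR k) (\<lambda>\<omega>. (W_of (dual k) \<omega>, R_of (others k) colF \<omega>))) B"
    unfolding measure_distr[OF WR B] by (rule arg_cong[of _ _ prob]) auto
  also have "\<dots> = measure (?A \<Otimes>\<^sub>M ?B) B"
    by (rule arg_cong[where f="\<lambda>N. measure N B", OF W_R_indep[OF _ _ \<Sigma>_herm]]) (simp_all add: dual k)
  finally have eq: "prob {\<omega>\<in>space P. (W_of (dual k) \<omega>, R_of (others k) colF \<omega>) \<in> B} = measure (?A \<Otimes>\<^sub>M ?B) B" .
  have "emeasure (?A \<Otimes>\<^sub>M ?B) B = (\<integral>\<^sup>+R. emeasure ?A ((\<lambda>w. (w, R)) -` B) \<partial>?B)"
    by (rule AB.emeasure_pair_measure_alt2[OF B'])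
  also have "\<dots> \<le> (\<integral>\<^sup>+R. ennreal c \<partial>?B)"
  proof (rule nn_integral_mono)
    fix R
    have "(\<lambda>w. (w, R)) -` B = {w\<in>space MW. (w, R) \<in> B}" using sets.sets_into_space[OF B] by (auto simp: space_pair_measure)
    then show "emeasure ?A ((\<lambda>w. (w, R)) -` B) \<le> ennreal c" using sec[of R] by (simp add: A.emeasure_eq_measure ennreal_leI)
  qed
  also have "\<dots> = ennreal c" using B.emeasure_space_1 by simp
  finally show ?thesis unfolding eq using c by (simp add: AB.P.emeasure_eq_measure)
qed

lemma indep_cols_cong:
  assumes "\<And>j m. j \<in> J \<Longrightarrow> m < N \<Longrightarrow> r j m = r' j m"
  shows "indep_cols J N r \<longleftrightarrow> indep_cols J N r'"
  using assms by (simp add: indep_cols_def cong: sum.cong)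

text \<open>The shift of column \<open>k\<close> is a combination of the other columns, which
  \<open>v\<close> does not see.\<close>

lemma orthogonal_rebuild:
  assumes "\<And>j. j \<in> others k \<Longrightarrow> (\<Sum>m<nr. cnj (v m) * snd q (m, j)) = 0"
  shows "(\<Sum>m<nr. cnj (v m) * rebuild k q m k) = (\<Sum>m<nr. cnj (v m) * fst q m) / complex_of_real \<tau>"
proof -
  have "(\<Sum>m<nr. cnj (v m) * (\<Sum>j\<in>others k. \<kappa> k j * snd q (m, j))) = (\<Sum>m<nr. \<Sum>j\<in>others k. \<kappa> k j * (cnj (v m) * snd q (m, j)))"
    by (simp only: sum_distrib_left mult.left_commute)
  also have "\<dots> = (\<Sum>j\<in>others k. \<kappa> k j * (\<Sum>m<nr. cnj (v m) * snd q (m, j)))"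
    unfolding sum_distrib_left by (rule sum.swap)
  also have "\<dots> = 0" by (rule sum.neutral) (use assms in auto)
  finally show ?thesis
    by (simp add: rebuild_def right_diff_distrib sum_subtractf flip: sum_divide_distrib)
qed

text \<open>Induction on the number of columns. If column \<open>k\<close> depends on the earlier
  ones, then a unit vector \<open>v\<close> orthogonal to those is orthogonal to it as well. With
  the other columns fixed this confines the image of \<open>dual k\<close> to a hyperplane, a null
  set. Such \<open>v\<close> exists because \<open>k < nt \<le> nr\<close>.\<close>

lemma indep_cols_AE: "n \<le> nt \<Longrightarrow> AE \<omega> in P. indep_cols {..<n} nr (\<lambda>j m. lin nt H (colF j) \<omega> m)"
proof (induction n)
  case 0
  then show ?case by (simp add: indep_cols_def)
next
  case (Suc k)
  then have k: "k < nt" by simp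
  let ?X = "MW \<Otimes>\<^sub>M MR k"
  define B where "B = {q\<in>space ?X. indep_cols {..<k} nr (\<lambda>j m. rebuild k q m j)} - {q\<in>space ?X. indep_cols {..<Suc k} nr (\<lambda>j m. rebuild k q m j)}"
  have B: "B \<in> sets ?X" unfolding B_def
    by (intro sets.Diff indep_cols_measurable rebuild_measurable k) (use k in auto)
  have "prob {\<omega>\<in>space P. (W_of (dual k) \<omega>, R_of (others k) colF \<omega>) \<in> B} \<le> 0"
  proof (rule section_bound[OF k B])
    fix R
    let ?\<mu> = "distr P MW (W_of (dual k))"
    interpret A: prob_space ?\<mu> by (rule prob_space_distr) measurable
    obtain v where v: "(\<Sum>m<nr. (cmod (v m))\<^sup>2) = 1" "\<forall>j\<in>{..<k}. (\<Sum>m<nr. cnj (v m) * R (m, j)) = 0"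
      using orthogonal_vector_exists[of "{..<k}" nr "\<lambda>j m. R (m, j)"] k nt_nr by auto
    \<comment> \<open>The vector \<open>v\<close> is orthogonal to the columns before
      \<open>k\<close> only, so later columns may contribute to the offset of the
      hyperplane.\<close>
    define c where "c = (\<Sum>m<nr. cnj (v m) * (\<Sum>j\<in>others k. \<kappa> k j * R (m, j)))"
    have "{w\<in>space MW. (w, R) \<in> B} \<subseteq> {w\<in>space ?\<mu>. (\<Sum>m<nr. cnj (v m) * w m) = c}"
    proof safe
      fix w assume w: "w \<in> space MW" "(w, R) \<in> B"
      let ?r = "\<lambda>m. rebuild k (w, R) m k"
      have rb: "rebuild k (w, R) m j = R (m, j)" if "j \<noteq> k" for m j using that by (simp add: rebuild_def)
      from w have ind: "indep_cols {..<k} nr (\<lambda>j m. R (m, j))" and dep: "\<not> indep_cols {..<Suc k} nr (\<lambda>j m. rebuild k (w, R) m j)"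
        using indep_cols_cong[of "{..<k}" nr "\<lambda>j m. rebuild k (w, R) m j" "\<lambda>j m. R (m, j)"] by (auto simp: B_def rb)
      from dep obtain b where b: "\<And>m. m < nr \<Longrightarrow> (\<Sum>j<k. b j * rebuild k (w, R) m j) + b k * ?r m = 0" "\<exists>j\<in>{..<Suc k}. b j \<noteq> 0"
        by (auto simp: indep_cols_def)
      have b1: "(\<Sum>j<k. b j * R (m, j)) + b k * ?r m = 0" if "m < nr" for m
        using b(1)[OF that] by (simp add: rb cong: sum.cong_simp)
      have bk: "b k \<noteq> 0"
      proof
        assume "b k = 0"
        then have "\<forall>m<nr. (\<Sum>j<k. b j * R (m, j)) = 0" using b1 by simp
        then have "\<forall>j\<in>{..<k}. b j = 0" using ind by (simp add: indep_cols_def)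
        then show False using b(2) \<open>b k = 0\<close> by (auto simp: less_Suc_eq)
      qed
      have "(\<Sum>m<nr. cnj (v m) * (\<Sum>j<k. b j * R (m, j))) = (\<Sum>m<nr. \<Sum>j<k. b j * (cnj (v m) * R (m, j)))"
        by (simp only: sum_distrib_left mult.left_commute)
      also have "\<dots> = (\<Sum>j<k. b j * (\<Sum>m<nr. cnj (v m) * R (m, j)))"
        unfolding sum_distrib_left by (rule sum.swap)
      also have "\<dots> = 0" by (rule sum.neutral) (use v(2) in auto)
      finally have z: "(\<Sum>m<nr. cnj (v m) * (\<Sum>j<k. b j * R (m, j))) = 0" .
      have "0 = (\<Sum>m<nr. cnj (v m) * ((\<Sum>j<k. b j * R (m, j)) + b k * ?r m))" using b1 by simp
      also have "\<dots> = (\<Sum>m<nr. cnj (v m) * (\<Sum>j<k. b j * R (m, j))) + b k * (\<Sum>m<nr. cnj (v m) * ?r m)"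
        by (simp only: distrib_left sum.distrib sum_distrib_left mult.left_commute)
      finally have "(\<Sum>m<nr. cnj (v m) * ?r m) = 0" using bk z by simp
      moreover have "(\<Sum>m<nr. cnj (v m) * ?r m) = ((\<Sum>m<nr. cnj (v m) * w m) - c) / complex_of_real \<tau>"
        by (simp add: rebuild_def c_def right_diff_distrib sum_subtractf flip: sum_divide_distrib)
      ultimately show "(\<Sum>m<nr. cnj (v m) * w m) = c" using tau by simp
    qed (simp)
    moreover have "{w\<in>space ?\<mu>. (\<Sum>m<nr. cnj (v m) * w m) = c} \<in> sets ?\<mu>" by measurable
    ultimately have "measure ?\<mu> {w\<in>space MW. (w, R) \<in> B} \<le> measure ?\<mu> {w\<in>space ?\<mu>. (\<Sum>m<nr. cnj (v m) * w m) = c}"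
      by (intro A.finite_measure_mono)
    also have "\<dots> = 0" by (rule iid_cgauss_null_hyperplane[OF W_dual_law[OF k] tau]) (use v(1) in simp)
    finally show "measure ?\<mu> {w\<in>space MW. (w, R) \<in> B} \<le> 0" .
  qed simp
  moreover have WR: "(\<lambda>\<omega>. (W_of (dual k) \<omega>, R_of (others k) colF \<omega>)) \<in> measurable P ?X"
    by (rule measurable_Pair[OF W_of_measurable R_of_measurable])
  have "{\<omega>\<in>space P. (W_of (dual k) \<omega>, R_of (others k) colF \<omega>) \<in> B} \<in> sets P"
    using measurable_sets[OF WR B] by (simp add: vimage_def Int_def conj_commute)
  ultimately have "AE \<omega> in P. (W_of (dual k) \<omega>, R_of (others k) colF \<omega>) \<notin> B"
    by (subst AE_iff_measurable[OF _ refl]) (auto simp: emeasure_eq_measure measure_le_0_iff)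
  then show ?case using Suc.IH[OF Suc_leD[OF Suc.prems]] AE_space
  proof eventually_elim
    case (elim \<omega>)
    have "indep_cols {..<n} nr (\<lambda>j m. rebuild k (W_of (dual k) \<omega>, R_of (others k) colF \<omega>) m j) \<longleftrightarrow>
      indep_cols {..<n} nr (\<lambda>j m. lin nt H (colF j) \<omega> m)" if "n \<le> nt" for n
      using that by (intro indep_cols_cong rebuild_eq k) auto
    then show ?case using elim k measurable_space[OF WR elim(3)] by (auto simp: B_def)
  qed
qed

text \<open>Combines the distance formula of \<open>left_pinv_row_norm\<close> with
  \<open>orthogonal_rebuild\<close>. The number \<open>d\<close> is the dimension of the complement
  of the \<open>nt - 1\<close> other columns.\<close>

lemma zf_norm_rebuild:
  assumes k: "k < nt" and d: "nt + d = Suc nr"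
    and ind: "indep_cols {..<nt} nr (\<lambda>j m. rebuild k q m j)"
    and on: "\<And>i j. i < d \<Longrightarrow> j < d \<Longrightarrow> (\<Sum>m<nr. cnj (v i m) * v j m) = (if i = j then 1 else 0)"
    and vR: "\<And>i j. i < d \<Longrightarrow> j \<in> others k \<Longrightarrow> (\<Sum>m<nr. cnj (v i m) * snd q (m, j)) = 0"
  defines "a \<equiv> zf_norm (Matrix.mat nr nt (\<lambda>(m, j). rebuild k q m j)) k"
  shows "0 < a" "1 / a = (\<Sum>i<d. (cmod (\<Sum>m<nr. cnj (v i m) * fst q m))\<^sup>2) / \<tau>\<^sup>2"
proof -
  let ?G = "Matrix.mat nr nt (\<lambda>(m, j). rebuild k q m j)"
  have G: "?G \<in> carrier_mat nr nt" by simp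
  have ind': "indep_cols {..<nt} nr (\<lambda>j m. ?G $$ (m, j))"
    using ind by (rule indep_cols_cong[THEN iffD1, rotated]) simp
  have vr: "(\<Sum>m<nr. cnj (v i m) * ?G $$ (m, j)) = 0" if "i < d" "j < nt" "j \<noteq> k" for i j
    using vR[of i j] that by (simp add: rebuild_def)
  have a: "a = (\<Sum>m<nr. (cmod (left_pinv ?G $$ (k, m)))\<^sup>2)" by (simp add: a_def zf_norm_def)
  show "0 < a" unfolding a by (rule left_pinv_row_norm(1)[OF G k d ind' on vr])
  have "1 / a = (\<Sum>i<d. (cmod (\<Sum>m<nr. cnj (v i m) * ?G $$ (m, k)))\<^sup>2)"
    unfolding a by (rule left_pinv_row_norm(2)[OF G k d ind' on vr])
  also have "\<dots> = (\<Sum>i<d. (cmod (\<Sum>m<nr. cnj (v i m) * fst q m))\<^sup>2 / \<tau>\<^sup>2)"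
  proof (rule sum.cong[OF refl])
    fix i assume "i \<in> {..<d}"
    then have "(\<Sum>m<nr. cnj (v i m) * rebuild k q m k) = (\<Sum>m<nr. cnj (v i m) * fst q m) / complex_of_real \<tau>"
      by (intro orthogonal_rebuild vR) auto
    then show "(cmod (\<Sum>m<nr. cnj (v i m) * ?G $$ (m, k)))\<^sup>2 = (cmod (\<Sum>m<nr. cnj (v i m) * fst q m))\<^sup>2 / \<tau>\<^sup>2"
      using k tau by (simp add: norm_divide power_divide)
  qed
  finally show "1 / a = (\<Sum>i<d. (cmod (\<Sum>m<nr. cnj (v i m) * fst q m))\<^sup>2) / \<tau>\<^sup>2" by (simp add: sum_divide_distrib)
qed

lemma complement_of_others:
  assumes "k < nt" "nt + d = Suc nr"
  shows "\<exists>v. (\<forall>i<d. \<forall>j<d. (\<Sum>m<nr. cnj (v i m) * v j m) = (if i = j then 1 else 0)) \<and>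
    (\<forall>i<d. \<forall>j\<in>others k. (\<Sum>m<nr. cnj (v i m) * R (m, j)) = 0)"
  by (rule orthonormal_complement_exists) (use assms in auto)

lemma HF_rebuild:
  assumes "\<omega> \<in> space P" "k < nt"
  shows "H \<omega> * F = Matrix.mat nr nt (\<lambda>(m, j). rebuild k (W_of (dual k) \<omega>, R_of (others k) colF \<omega>) m j)"
proof (rule eq_matI)
  show "dim_row (H \<omega> * F) = dim_row (Matrix.mat nr nt (\<lambda>(m, j). rebuild k (W_of (dual k) \<omega>, R_of (others k) colF \<omega>) m j))"
    and "dim_col (H \<omega> * F) = dim_col (Matrix.mat nr nt (\<lambda>(m, j). rebuild k (W_of (dual k) \<omega>, R_of (others k) colF \<omega>) m j))"
    using H_carrier[OF assms(1)] F by auto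
qed (simp del: index_mult_mat(1) add: HF_entry[OF assms(1)] rebuild_eq[OF assms(2)])

lemma zf_norm_concentration:
  assumes k: "k < nt" and d: "nt + d = Suc nr" and \<epsilon>: "0 < \<epsilon>"
  defines "Bad \<equiv> {\<omega>\<in>space P. indep_cols {..<nt} nr (\<lambda>j m. (H \<omega> * F) $$ (m, j)) \<and> \<epsilon> \<le> \<bar>1 / zf_norm (H \<omega> * F) k - d / \<tau>\<bar>}"
  shows "Bad \<in> sets P" "prob Bad \<le> d / (\<epsilon> * \<tau>)\<^sup>2"
proof -
  let ?X = "MW \<Otimes>\<^sub>M MR k" and ?zf = "\<lambda>q. zf_norm (Matrix.mat nr nt (\<lambda>(m, j). rebuild k q m j)) k"
  let ?WR = "\<lambda>\<omega>. (W_of (dual k) \<omega>, R_of (others k) colF \<omega>)"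
  define B where "B = {q\<in>space ?X. indep_cols {..<nt} nr (\<lambda>j m. rebuild k q m j)} \<inter> {q\<in>space ?X. \<epsilon> \<le> \<bar>1 / ?zf q - d / \<tau>\<bar>}"
  have zfm: "?zf \<in> borel_measurable ?X" by (intro zf_norm_measurable rebuild_measurable k)
  have B: "B \<in> sets ?X" unfolding B_def
    by (intro sets.Int indep_cols_measurable rebuild_measurable k) (use zfm in measurable)
  have WR: "?WR \<in> measurable P ?X" by (rule measurable_Pair[OF W_of_measurable R_of_measurable])
  have eq: "Bad = {\<omega>\<in>space P. ?WR \<omega> \<in> B}"
  proof -
    have 1: "indep_cols {..<nt} nr (\<lambda>j m. (H \<omega> * F) $$ (m, j)) \<longleftrightarrow> indep_cols {..<nt} nr (\<lambda>j m. rebuild k (?WR \<omega>) m j)"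
      if "\<omega> \<in> space P" for \<omega>
      by (rule indep_cols_cong) (simp add: HF_entry[OF that] rebuild_eq[OF k] del: index_mult_mat(1))
    have 2: "zf_norm (H \<omega> * F) k = ?zf (?WR \<omega>)" if "\<omega> \<in> space P" for \<omega>
      by (simp only: HF_rebuild[OF that k])
    show ?thesis
    proof (rule Set.set_eqI)
      fix \<omega> show "\<omega> \<in> Bad \<longleftrightarrow> \<omega> \<in> {\<omega>\<in>space P. ?WR \<omega> \<in> B}"
      proof (cases "\<omega> \<in> space P")
        case True
        note q = measurable_space[OF WR True]
        show ?thesis unfolding Bad_def B_def mem_Collect_eq Int_iff 1[OF True] 2[OF True] using True q by blast
      qed (simp only: Bad_def mem_Collect_eq simp_thms)
    qed
  qed
  have "{\<omega>\<in>space P. ?WR \<omega> \<in> B} = ?WR -` B \<inter> space P" by blast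
  then show "Bad \<in> sets P" unfolding eq using measurable_sets[OF WR B] by (simp only:)
  show "prob Bad \<le> d / (\<epsilon> * \<tau>)\<^sup>2" unfolding eq
  proof (rule section_bound[OF k B])
    fix R
    let ?\<mu> = "distr P MW (W_of (dual k))"
    interpret A: prob_space ?\<mu> by (rule prob_space_distr) measurable
    obtain v where on: "\<And>i j. i < d \<Longrightarrow> j < d \<Longrightarrow> (\<Sum>m<nr. cnj (v i m) * v j m) = (if i = j then 1 else 0)"
      and vR: "\<And>i j. i < d \<Longrightarrow> j \<in> others k \<Longrightarrow> (\<Sum>m<nr. cnj (v i m) * R (m, j)) = 0"
      using complement_of_others[OF k d, of R] by blast
    let ?Y = "\<lambda>w. \<Sum>i<d. (cmod (\<Sum>m<nr. cnj (v i m) * w m))\<^sup>2"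
    \<comment> \<open>The projected norm has mean \<open>d * \<tau>\<close> and enters divided by
      \<open>\<tau>\<^sup>2\<close>. A deviation \<open>\<epsilon>\<close> from
      \<open>d / \<tau>\<close> is therefore a deviation \<open>\<epsilon> * \<tau>\<^sup>2\<close>
      of that norm.\<close>
    have "{w\<in>space MW. (w, R) \<in> B} \<subseteq> {w\<in>space ?\<mu>. \<epsilon> * \<tau>\<^sup>2 \<le> \<bar>?Y w - d * \<tau>\<bar>}"
    proof safe
      fix w assume "(w, R) \<in> B"
      then have "indep_cols {..<nt} nr (\<lambda>j m. rebuild k (w, R) m j)" "\<epsilon> \<le> \<bar>1 / ?zf (w, R) - d / \<tau>\<bar>" by (auto simp: B_def)
      moreover from zf_norm_rebuild(2)[OF k d this(1) on] vR have "1 / ?zf (w, R) = ?Y w / \<tau>\<^sup>2" by simp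
      moreover have "?Y w / \<tau>\<^sup>2 - d / \<tau> = (?Y w - d * \<tau>) / \<tau>\<^sup>2" using tau by (simp add: field_simps power2_eq_square)
      ultimately have "\<epsilon> \<le> \<bar>?Y w - d * \<tau>\<bar> / \<tau>\<^sup>2" using tau by simp
      then show "\<epsilon> * \<tau>\<^sup>2 \<le> \<bar>?Y w - d * \<tau>\<bar>" using tau by (simp add: le_divide_eq)
    qed simp
    moreover have "{w\<in>space ?\<mu>. \<epsilon> * \<tau>\<^sup>2 \<le> \<bar>?Y w - d * \<tau>\<bar>} \<in> sets ?\<mu>" by measurable
    ultimately have "measure ?\<mu> {w\<in>space MW. (w, R) \<in> B} \<le> measure ?\<mu> {w\<in>space ?\<mu>. \<epsilon> * \<tau>\<^sup>2 \<le> \<bar>?Y w - d * \<tau>\<bar>}"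
      by (intro A.finite_measure_mono)
    also have "\<dots> \<le> d * \<tau>\<^sup>2 / (\<epsilon> * \<tau>\<^sup>2)\<^sup>2"
      by (rule iid_cgauss_projection[OF W_dual_law[OF k] _ on]) (use \<epsilon> tau in auto)
    also have "\<dots> = d / (\<epsilon> * \<tau>)\<^sup>2" using tau by (simp add: power2_eq_square)
    finally show "measure ?\<mu> {w\<in>space MW. (w, R) \<in> B} \<le> d / (\<epsilon> * \<tau>)\<^sup>2" .
  qed simp
qed

lemma zf_norm_pos:
  assumes "\<omega> \<in> space P" and k: "k < nt" and "indep_cols {..<nt} nr (\<lambda>j m. (H \<omega> * F) $$ (m, j))"
  shows "0 < zf_norm (H \<omega> * F) k"
proof -
  define d where "d = Suc nr - nt"
  have d: "nt + d = Suc nr" using nt_nr by (simp add: d_def)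
  let ?q = "(W_of (dual k) \<omega>, R_of (others k) colF \<omega>)"
  obtain v where on: "\<And>i j. i < d \<Longrightarrow> j < d \<Longrightarrow> (\<Sum>m<nr. cnj (v i m) * v j m) = (if i = j then 1 else 0)"
    and vR: "\<And>i j. i < d \<Longrightarrow> j \<in> others k \<Longrightarrow> (\<Sum>m<nr. cnj (v i m) * snd ?q (m, j)) = 0"
    using complement_of_others[OF k d, of "snd ?q"] by blast
  have "indep_cols {..<nt} nr (\<lambda>j m. rebuild k ?q m j)"
    using assms(3) by (rule indep_cols_cong[THEN iffD1, rotated])
      (simp add: HF_entry[OF assms(1)] rebuild_eq[OF k] del: index_mult_mat(1))
  from zf_norm_rebuild(1)[OF k d this on vR] show ?thesis by (simp add: HF_rebuild[OF assms(1) k])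
qed

text \<open>Concentration is available for the reciprocal of \<open>zf_norm\<close>, so the
  continuity assumption is phrased in terms of \<open>1 / a\<close>. The bound does not depend on
  the stream \<open>k\<close>.\<close>

lemma error_rate:
  assumes k: "k < nt" and d: "nt + d = Suc nr" and \<epsilon>: "0 < \<epsilon>" and \<delta>: "0 \<le> \<delta>" and L: "0 \<le> L" "L \<le> 1"
    and S: "finite S" "S \<noteq> {}" and \<sigma>: "0 \<le> \<sigma>2"
    and cont: "\<And>a. 0 < a \<Longrightarrow> \<bar>1 / a - d / \<tau>\<bar> < \<epsilon> \<Longrightarrow> \<bar>serr S (\<sigma>2 * a / 2) - L\<bar> \<le> \<delta>"
  shows "\<bar>\<P>(\<omega> in P. zf_decision S (H \<omega>) F (received (H \<omega>) F (s \<omega>) (\<xi> \<omega>)) k \<noteq> s \<omega> $ k) - L\<bar> \<le> \<delta> + d / (\<epsilon> * \<tau>)\<^sup>2"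
proof -
  note Bad = zf_norm_concentration[OF k d \<epsilon>]
  let ?Bad = "{\<omega>\<in>space P. indep_cols {..<nt} nr (\<lambda>j m. (H \<omega> * F) $$ (m, j)) \<and> \<epsilon> \<le> \<bar>1 / zf_norm (H \<omega> * F) k - d / \<tau>\<bar>}"
  have "AE \<omega> in P. \<omega> \<notin> ?Bad \<longrightarrow> indep_cols {..<nt} nr (\<lambda>j m. (H \<omega> * F) $$ (m, j)) \<and> \<bar>serr S (\<sigma>2 * zf_norm (H \<omega> * F) k / 2) - L\<bar> \<le> \<delta>"
    using indep_cols_AE[OF order_refl] AE_space
  proof eventually_elim
    fix \<omega> assume i: "indep_cols {..<nt} nr (\<lambda>j m. lin nt H (colF j) \<omega> m)" and w: "\<omega> \<in> space P"
    have ind: "indep_cols {..<nt} nr (\<lambda>j m. (H \<omega> * F) $$ (m, j))"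
      using i by (rule indep_cols_cong[THEN iffD1, rotated]) (simp add: HF_entry[OF w] del: index_mult_mat(1))
    show "\<omega> \<notin> ?Bad \<longrightarrow> indep_cols {..<nt} nr (\<lambda>j m. (H \<omega> * F) $$ (m, j)) \<and> \<bar>serr S (\<sigma>2 * zf_norm (H \<omega> * F) k / 2) - L\<bar> \<le> \<delta>"
      using ind w cont[OF zf_norm_pos[OF w k ind]] by auto
  qed
  from error_bound[OF F k S \<sigma> Bad(1) this L \<delta>] Bad(2) show ?thesis by linarith
qed

end

section \<open>The precoder\<close>

lemma kms_hermitian: "i < n \<Longrightarrow> j < n \<Longrightarrow> kms n \<rho> $$ (j, i) = cnj (kms n \<rho> $$ (i, j))"
  by (cases "i < j"; cases "i = j") (auto simp: kms_def)

lemma herm_cong: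
  "(\<And>i. i < n \<Longrightarrow> x i = x' i) \<Longrightarrow> (\<And>i. i < n \<Longrightarrow> y i = y' i) \<Longrightarrow> herm n C x y = herm n C x' y'"
  by (simp add: herm_def)

lemma herm_eigenbasis:
  assumes w: "complete_onb n w"
    and eig: "\<And>i j. i < n \<Longrightarrow> j < n \<Longrightarrow> (\<Sum>m<n. C $$ (i, m) * w j m) = complex_of_real (l j) * w j i"
  shows "herm n C (\<lambda>i. \<Sum>q<n. t q * w q i) (\<lambda>i. \<Sum>q<n. u q * w q i) = (\<Sum>q<n. cnj (t q) * (complex_of_real (l q) * u q))"
  unfolding herm_sum_left
proof (intro sum.cong refl arg_cong2[where f="(*)"])
  fix q assume "q \<in> {..<n}"
  then have q: "q < n" by simp
  have "herm n C (w q) (\<lambda>i. \<Sum>q<n. u q * w q i) = (\<Sum>i<n. cnj (w q i) * (\<Sum>q<n. complex_of_real (l q) * u q * w q i))"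
    unfolding herm_def
  proof (intro sum.cong refl)
    fix i assume "i \<in> {..<n}"
    then have i: "i < n" by simp
    have "(\<Sum>m<n. cnj (w q i) * (\<Sum>q<n. u q * w q m) * C $$ (i, m)) = (\<Sum>m<n. \<Sum>q'<n. cnj (w q i) * (u q' * (C $$ (i, m) * w q' m)))"
      by (simp only: sum_distrib_left sum_distrib_right mult_ac)
    also have "\<dots> = (\<Sum>q'<n. cnj (w q i) * (u q' * (\<Sum>m<n. C $$ (i, m) * w q' m)))"
      unfolding sum_distrib_left by (rule sum.swap)
    also have "\<dots> = (\<Sum>q'<n. cnj (w q i) * (u q' * (complex_of_real (l q') * w q' i)))"
      by (intro sum.cong refl) (simp add: eig i)
    finally show "(\<Sum>m<n. cnj (w q i) * (\<Sum>q<n. u q * w q m) * C $$ (i, m)) = cnj (w q i) * (\<Sum>q<n. complex_of_real (l q) * u q * w q i)"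
      by (simp only: sum_distrib_left mult_ac)
  qed
  also have "\<dots> = (\<Sum>i<n. \<Sum>q'<n. (complex_of_real (l q') * u q') * (cnj (w q i) * w q' i))"
    by (simp only: sum_distrib_left mult_ac)
  also have "\<dots> = (\<Sum>q'<n. (complex_of_real (l q') * u q') * (\<Sum>i<n. cnj (w q i) * w q' i))"
    unfolding sum_distrib_left by (rule sum.swap)
  also have "\<dots> = (\<Sum>q'<n. (complex_of_real (l q') * u q') * (if q = q' then 1 else 0))"
    using w q by (intro sum.cong refl) (simp add: complete_onb_def)
  also have "\<dots> = complex_of_real (l q) * u q" by (rule sum_mult_delta[OF q])
  finally show "herm n C (w q) (\<lambda>i. \<Sum>q<n. u q * w q i) = complex_of_real (l q) * u q" .
qed

lemma dft_carrier: "dft n \<in> carrier_mat n n" by (simp add: dft_def)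

lemma dft_unitary:
  assumes n: "0 < n" and ij: "i < n" "j < n"
  shows "(\<Sum>q<n. cnj (dft n $$ (q, i)) * dft n $$ (q, j)) = (if i = j then 1 else 0)"
    and "(\<Sum>q<n. cnj (dft n $$ (i, q)) * dft n $$ (j, q)) = (if i = j then 1 else 0)"
    and "(cmod (dft n $$ (i, j)))\<^sup>2 = 1 / n"
proof -
  \<comment> \<open>As \<open>Arg 1 = 0\<close>, \<open>fourier n 1\<close> is the untwisted basis.
    The transform has the opposite sign in the exponent, hence the conjugate.\<close>
  have d: "dft n $$ (q, i) = cnj (fourier n 1 i q)" and d': "dft n $$ (i, q) = cnj (fourier n 1 i q)" if "q < n" "i < n" for q i
    using that by (simp_all add: dft_def fourier_def cis_cnj mult_ac)
  have o: "(\<Sum>m<n. cnj (fourier n 1 i m) * fourier n 1 j m) = (if i = j then 1 else 0)" if "i < n" "j < n" for i j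
    using fourier_onb[OF n, of 1] that by (simp add: complete_onb_def)
  have o': "(\<Sum>m<n. cnj (cnj (fourier n 1 i m)) * cnj (fourier n 1 j m)) = (if i = j then 1 else 0)" if "i < n" "j < n" for i j
    using o[OF that(2,1)] by (auto simp: mult.commute)
  show "(\<Sum>q<n. cnj (dft n $$ (q, i)) * dft n $$ (q, j)) = (if i = j then 1 else 0)"
    unfolding o'[OF ij, symmetric] by (intro sum.cong refl) (simp only: d[OF _ ij(1)] d[OF _ ij(2)] lessThan_iff)
  show "(\<Sum>q<n. cnj (dft n $$ (i, q)) * dft n $$ (j, q)) = (if i = j then 1 else 0)"
    unfolding o'[OF ij, symmetric] by (intro sum.cong refl) (simp only: d'[OF _ ij(1)] d'[OF _ ij(2)] lessThan_iff)
  show "(cmod (dft n $$ (i, j)))\<^sup>2 = 1 / n" using ij by (simp add: dft_def norm_mult norm_divide power_divide)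
qed

definition inv_sqrt_sum :: "nat \<Rightarrow> (nat \<Rightarrow> real) \<Rightarrow> real" where
  "inv_sqrt_sum n l = (\<Sum>i<n. l i powr (-1/2))"

lemma precoder_index:
  assumes W: "W \<in> carrier_mat n n" and ij: "i < n" "j < n"
  shows "precoder n W l $$ (i, j) =
    (\<Sum>q<n. (complex_of_real (1 / sqrt (inv_sqrt_sum n l) * l q powr (-1/4)) * dft n $$ (q, j)) * W $$ (i, q))"
proof -
  let ?D = "mat_diag n (\<lambda>i. complex_of_real (l i powr (-1/4)))"
  have D: "?D \<in> carrier_mat n n" by (simp add: mat_diag_def)
  have WD: "W * ?D \<in> carrier_mat n n" using W D by simp
  have wd: "(W * ?D) $$ (i, q) = complex_of_real (l q powr (-1/4)) * W $$ (i, q)" if "q < n" for q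
  proof -
    have "(W * ?D) $$ (i, q) = (\<Sum>m<n. W $$ (i, m) * ?D $$ (m, q))" by (rule mult_index[OF W D ij(1) that])
    also have "\<dots> = (\<Sum>m<n. (W $$ (i, m) * complex_of_real (l m powr (-1/4))) * (if q = m then 1 else 0))"
      by (intro sum.cong refl) (use that in \<open>auto simp: mat_diag_def\<close>)
    also have "\<dots> = W $$ (i, q) * complex_of_real (l q powr (-1/4))" by (rule sum_mult_delta[OF that])
    finally show ?thesis by (simp only: mult.commute)
  qed
  have "precoder n W l $$ (i, j) = complex_of_real (1 / sqrt (inv_sqrt_sum n l)) * (W * ?D * dft n) $$ (i, j)"
    unfolding precoder_def inv_sqrt_sum_def using WD dft_carrier[of n] ij by (intro index_smult_mat(1)) auto
  also have "(W * ?D * dft n) $$ (i, j) = (\<Sum>q<n. complex_of_real (l q powr (-1/4)) * W $$ (i, q) * dft n $$ (q, j))"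
    unfolding mult_index[OF WD dft_carrier ij] by (intro sum.cong refl) (simp only: wd lessThan_iff)
  finally show ?thesis by (simp only: sum_distrib_left of_real_mult mult_ac)
qed

lemma precoder_carrier: "W \<in> carrier_mat n n \<Longrightarrow> precoder n W l \<in> carrier_mat n n"
  unfolding precoder_def by (intro smult_carrier_mat mult_carrier_mat[of _ n n]) (auto simp: mat_diag_def dft_carrier)

text \<open>For this precoder \<open>F\<^sup>H \<Sigma> F\<close> is the Fourier conjugate of the
  square root of \<open>\<Lambda>\<close>, divided by \<open>inv_sqrt_sum n l\<close>. Its inverse
  is explicit, and the coefficient \<open>\<kappa> k j\<close> is the entry \<open>(j, k)\<close> of
  that inverse.\<close>

lemma precoder_precoded_mimo:
  assumes mimo: "mimo_system P nr n C \<sigma>2 S H s \<xi>"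
    and n: "0 < n" "n \<le> nr" and W: "W \<in> carrier_mat n n"
    and w: "complete_onb n (\<lambda>j m. W $$ (m, j))"
    and eig: "\<And>i j. i < n \<Longrightarrow> j < n \<Longrightarrow> (\<Sum>m<n. C $$ (i, m) * W $$ (m, j)) = complex_of_real (l j) * W $$ (i, j)"
    and l: "\<And>j. j < n \<Longrightarrow> 0 < l j"
    and C: "\<And>i j. i < n \<Longrightarrow> j < n \<Longrightarrow> C $$ (j, i) = cnj (C $$ (i, j))"
  defines "\<tau> \<equiv> (inv_sqrt_sum n l)\<^sup>2 / n"
  shows "precoded_mimo P nr n C \<sigma>2 S H s \<xi> (precoder n W l)
    (\<lambda>k j. complex_of_real (inv_sqrt_sum n l) * (\<Sum>i<n. cnj (dft n $$ (i, j)) * (complex_of_real (l i powr (-1/2)) * dft n $$ (i, k)))) \<tau>"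
    (is "precoded_mimo _ _ _ _ _ _ _ _ _ ?F ?\<kappa> _")
proof -
  interpret mimo_system P nr n C \<sigma>2 S H s \<xi> by (rule mimo)
  define \<Lambda> where "\<Lambda> = inv_sqrt_sum n l"
  have \<Lambda>: "0 < \<Lambda>" unfolding \<Lambda>_def inv_sqrt_sum_def using n(1) l by (intro sum_pos) force+
  let ?D = "\<lambda>q j. dft n $$ (q, j)"
  \<comment> \<open>\<open>t j\<close> and \<open>u k\<close> are the coordinates, in the eigenbasis
    of the covariance, of column \<open>j\<close> of the precoder and of the dual vector
    \<open>k\<close>. The exponents -1/4 and -3/4 add up to -1 and cancel the eigenvalue in the
    covariance form.\<close>
  define t where "t j q = complex_of_real (1 / sqrt \<Lambda> * l q powr (-1/4)) * ?D q j" for j q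
  define u where "u k q = complex_of_real (sqrt \<Lambda> * l q powr (-3/4)) * ?D q k" for k q
  have F: "?F $$ (i, j) = (\<Sum>q<n. t j q * W $$ (i, q))" if "i < n" "j < n" for i j
    unfolding t_def \<Lambda>_def by (rule precoder_index[OF W that])
  have \<kappa>t: "(\<Sum>j<n. ?\<kappa> k j * t j q) = u k q" if q: "q < n" and k: "k < n" for k q
  proof -
    have "(\<Sum>j<n. ?\<kappa> k j * t j q) = (\<Sum>j<n. \<Sum>i<n. complex_of_real (\<Lambda> * (1 / sqrt \<Lambda> * l q powr (-1/4))) * (complex_of_real (l i powr (-1/2)) * ?D i k) * (cnj (?D i j) * ?D q j))"
      unfolding t_def \<Lambda>_def[symmetric] by (simp only: sum_distrib_left sum_distrib_right of_real_mult mult_ac)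
    also have "\<dots> = (\<Sum>i<n. complex_of_real (\<Lambda> * (1 / sqrt \<Lambda> * l q powr (-1/4))) * (complex_of_real (l i powr (-1/2)) * ?D i k) * (\<Sum>j<n. cnj (?D i j) * ?D q j))"
      unfolding sum_distrib_left by (rule sum.swap)
    also have "\<dots> = (\<Sum>i<n. complex_of_real (\<Lambda> * (1 / sqrt \<Lambda> * l q powr (-1/4))) * (complex_of_real (l i powr (-1/2)) * ?D i k) * (if q = i then 1 else 0))"
      by (intro sum.cong refl arg_cong2[where f="(*)"]) (use q n in \<open>auto simp: dft_unitary(2)\<close>)
    also have "\<dots> = complex_of_real (\<Lambda> * (1 / sqrt \<Lambda> * l q powr (-1/4))) * (complex_of_real (l q powr (-1/2)) * ?D q k)"
      by (rule sum_mult_delta[OF q])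
    also have "\<dots> = complex_of_real (\<Lambda> * (1 / sqrt \<Lambda>) * (l q powr (-1/4) * l q powr (-1/2))) * ?D q k"
      by (simp only: of_real_mult mult.assoc)
    also have "l q powr (-1/4) * l q powr (-1/2) = l q powr (-3/4)" by (simp flip: powr_add)
    also have "\<Lambda> * (1 / sqrt \<Lambda>) = sqrt \<Lambda>" using \<Lambda> by (simp add: real_div_sqrt)
    finally show ?thesis unfolding u_def .
  qed
  have push: "c * (\<Sum>q<n. t j q * W $$ (i, q)) = (\<Sum>q<n. (c * t j q) * W $$ (i, q))" for c i j
    by (simp only: sum_distrib_left mult.assoc)
  have dual: "(\<Sum>j<n. ?\<kappa> k j * ?F $$ (i, j)) = (\<Sum>q<n. u k q * W $$ (i, q))" if "i < n" "k < n" for i k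
  proof -
    have "(\<Sum>j<n. ?\<kappa> k j * ?F $$ (i, j)) = (\<Sum>j<n. \<Sum>q<n. (?\<kappa> k j * t j q) * W $$ (i, q))"
    proof (intro sum.cong refl)
      fix j assume "j \<in> {..<n}"
      then have "?F $$ (i, j) = (\<Sum>q<n. t j q * W $$ (i, q))" by (intro F that) simp
      then show "?\<kappa> k j * ?F $$ (i, j) = (\<Sum>q<n. (?\<kappa> k j * t j q) * W $$ (i, q))"
        by (simp only: push)
    qed
    also have "\<dots> = (\<Sum>q<n. (\<Sum>j<n. ?\<kappa> k j * t j q) * W $$ (i, q))"
      unfolding sum_distrib_right[of _ _ "W $$ (i, _)"] by (rule sum.swap)
    also have "\<dots> = (\<Sum>q<n. u k q * W $$ (i, q))" by (intro sum.cong refl) (simp only: \<kappa>t that(2) lessThan_iff)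
    finally show ?thesis .
  qed
  show ?thesis
  proof unfold_locales
    show "?F \<in> carrier_mat n n" by (rule precoder_carrier[OF W])
    show "0 < \<tau>" unfolding \<tau>_def using \<Lambda> n by (simp add: \<Lambda>_def)
    show "n \<le> nr" by fact
    show "C $$ (j, i) = cnj (C $$ (i, j))" if "i < n" "j < n" for i j using that by (rule C)
    fix k assume k: "k < n"
    have "?\<kappa> k k = complex_of_real \<Lambda> * (\<Sum>i<n. complex_of_real (l i powr (-1/2) / n))"
      unfolding \<Lambda>_def
    proof (intro arg_cong2[where f="(*)"] sum.cong refl)
      fix i assume "i \<in> {..<n}"
      then have i: "i < n" by simp
      have "cnj (?D i k) * (complex_of_real (l i powr (-1/2)) * ?D i k) = complex_of_real (l i powr (-1/2)) * (?D i k * cnj (?D i k))"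
        by (simp only: mult_ac)
      also have "?D i k * cnj (?D i k) = complex_of_real (1 / n)"
        unfolding complex_norm_square[symmetric] dft_unitary(3)[OF n(1) i k] ..
      finally show "cnj (?D i k) * (complex_of_real (l i powr (-1/2)) * ?D i k) = complex_of_real (l i powr (-1/2) / n)"
        by (simp flip: of_real_mult)
    qed
    also have "\<dots> = complex_of_real (\<Lambda> * (\<Lambda> / n))"
      unfolding \<Lambda>_def inv_sqrt_sum_def by (simp only: of_real_mult of_real_sum sum_divide_distrib)
    finally show "?\<kappa> k k = complex_of_real \<tau>" by (simp add: \<tau>_def \<Lambda>_def power2_eq_square)
    fix j assume j: "j < n"
    have "herm n C (\<lambda>i. ?F $$ (i, j)) (\<lambda>i. \<Sum>j'<n. ?\<kappa> k j' * ?F $$ (i, j')) =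
      herm n C (\<lambda>i. \<Sum>q<n. t j q * W $$ (i, q)) (\<lambda>i. \<Sum>q<n. u k q * W $$ (i, q))"
      by (rule herm_cong) (simp_all only: F dual j k)
    also have "\<dots> = (\<Sum>q<n. cnj (t j q) * (complex_of_real (l q) * u k q))"
      by (rule herm_eigenbasis[OF w eig])
    also have "\<dots> = (\<Sum>q<n. cnj (?D q j) * ?D q k)"
    proof (intro sum.cong refl)
      fix q assume "q \<in> {..<n}"
      then have lq: "0 < l q" using l by simp
      have "l q powr (-1/4) * (l q powr 1 * l q powr (-3/4)) = 1" using lq by (simp only: powr_add[symmetric]) simp
      then have "(1 / sqrt \<Lambda> * l q powr (-1/4)) * (l q * (sqrt \<Lambda> * l q powr (-3/4))) = 1"
        using lq \<Lambda> by (simp add: field_simps)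
      then have "complex_of_real (1 / sqrt \<Lambda> * l q powr (-1/4)) * (complex_of_real (l q) * complex_of_real (sqrt \<Lambda> * l q powr (-3/4))) = 1"
        by (metis of_real_mult of_real_1)
      moreover have "cnj (t j q) * (complex_of_real (l q) * u k q) =
        (complex_of_real (1 / sqrt \<Lambda> * l q powr (-1/4)) * (complex_of_real (l q) * complex_of_real (sqrt \<Lambda> * l q powr (-3/4)))) * (cnj (?D q j) * ?D q k)"
        unfolding t_def u_def complex_cnj_mult complex_cnj_complex_of_real by (simp only: mult_ac)
      ultimately show "cnj (t j q) * (complex_of_real (l q) * u k q) = cnj (?D q j) * ?D q k" by simp
    qed
    also have "\<dots> = (if j = k then 1 else 0)" by (rule dft_unitary(1)[OF n(1) j k])
    finally show "herm n C (\<lambda>i. ?F $$ (i, j)) (\<lambda>i. \<Sum>j'<n. ?\<kappa> k j' * ?F $$ (i, j')) = (if j = k then 1 else 0)" .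
  qed
qed

section \<open>The large system limit\<close>

text \<open>Multiplied by the square root of \<open>1 - (cmod \<rho>)\<^sup>2\<close>, the sum
  becomes that of the square roots of the scaled inverse eigenvalues. By \<open>kms_spectrum\<close>
  it differs from the Riemann sum numerator by a constant independent of \<open>n\<close>, which
  vanishes after division by \<open>n\<close>.\<close>

lemma inv_sqrt_sum_limit:
  fixes \<rho> :: complex and W :: "nat \<Rightarrow> complex Matrix.mat" and l :: "nat \<Rightarrow> nat \<Rightarrow> real"
  assumes r: "0 < cmod \<rho>" "cmod \<rho> < 1"
    and dec: "\<And>n. n \<in> A \<Longrightarrow> sorted_eigendecomposition n (kms n \<rho>) (W n) (l n)"
  shows "((\<lambda>n. inv_sqrt_sum n (l n) / real n) \<longlongrightarrow>
     2 / pi * (1 + cmod \<rho>) * ellE (2 * sqrt (cmod \<rho>) / (1 + cmod \<rho>)) / sqrt (1 - (cmod \<rho>)\<^sup>2)) (inf sequentially (principal A))"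
    (is "(?m \<longlongrightarrow> ?I / ?c) ?F")
proof -
  have c: "0 < 1 - (cmod \<rho>)\<^sup>2" using r by (simp add: abs_square_less_1)
  define a where "a n = (\<Sum>k<n. sqrt (symbol (cmod \<rho>) (real k / real n))) / real n" for n
  define b where "b n = ?c * ?m n - a n" for n
  have F: "?F \<le> sequentially" by simp
  have a: "(a \<longlongrightarrow> ?I) ?F"
    using symbol_riemann[of "cmod \<rho>"] symbol_integral[of "cmod \<rho>"] r unfolding a_def by (intro tendsto_mono[OF F]) simp
  have "\<forall>\<^sub>F n in ?F. norm (b n) \<le> 2 / (1 - cmod \<rho>) / real n"
    unfolding eventually_inf_principal using eventually_ge_at_top[of 2]
  proof eventually_elim
    case (elim n)
    show ?case
    proof
      assume "n \<in> A"
      have kc: "kms n \<rho> \<in> carrier_mat n n" by (simp add: kms_def)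
      note D = sorted_eigendecompositionD[OF dec[OF \<open>n \<in> A\<close>] kc]
      have l: "0 < l n j" if "j < n" for j
        by (rule kms_spectrum(1)[OF elim r D(1)]; fact)
      have spec: "\<bar>(\<Sum>j<n. sqrt ((1 - (cmod \<rho>)\<^sup>2) / l n j)) - (\<Sum>k<n. sqrt (symbol (cmod \<rho>) (real k / real n)))\<bar> \<le> 2 / (1 - cmod \<rho>)"
        by (rule kms_spectrum(2)[OF elim r D(1)]; fact)
      have "?c * (l n j powr (-1/2)) = sqrt ((1 - (cmod \<rho>)\<^sup>2) / l n j)" if "j < n" for j
        using l[OF that] by (simp add: real_sqrt_divide powr_minus_divide powr_half_sqrt[OF less_imp_le])
      then have "?c * inv_sqrt_sum n (l n) = (\<Sum>j<n. sqrt ((1 - (cmod \<rho>)\<^sup>2) / l n j))"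
        unfolding inv_sqrt_sum_def sum_distrib_left by (intro sum.cong) auto
      then have "b n = ((\<Sum>j<n. sqrt ((1 - (cmod \<rho>)\<^sup>2) / l n j)) - (\<Sum>k<n. sqrt (symbol (cmod \<rho>) (real k / real n)))) / real n"
        by (simp add: b_def a_def diff_divide_distrib)
      then show "norm (b n) \<le> 2 / (1 - cmod \<rho>) / real n"
        using divide_right_mono[OF spec, of "real n"] by simp
    qed
  qed
  moreover have "((\<lambda>n. 2 / (1 - cmod \<rho>) / real n) \<longlongrightarrow> 0) ?F"
    by (rule tendsto_mono[OF F]) (rule lim_const_over_n)
  ultimately have "(b \<longlongrightarrow> 0) ?F" by (rule Lim_null_comparison)
  from tendsto_divide[OF tendsto_add[OF a this] tendsto_const, of ?c] c
  show ?thesis by (simp add: b_def)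
qed

text \<open>Read off from \<open>symbol_integral\<close>, whose integrand is at least
  \<open>1 - r\<close>.\<close>

lemma ellE_pos:
  assumes "0 \<le> r" "r < 1"
  shows "0 < ellE (2 * sqrt r / (1 + r))"
proof -
  have "continuous_on {0..1} (\<lambda>x. sqrt (symbol r x))" unfolding symbol_def by (intro continuous_intros)
  then have "integral {0..1} (\<lambda>x::real. 1 - r) \<le> integral {0..1} (\<lambda>x. sqrt (symbol r x))"
    using symbol_bounds[OF assms] assms
    by (intro Henstock_Kurzweil_Integration.integral_le integrable_continuous_interval) (auto intro: real_le_rsqrt)
  then have "0 < integral {0..1} (\<lambda>x. sqrt (symbol r x))" using assms by simp
  then have "0 < 2 / pi * (1 + r) * ellE (2 * sqrt r / (1 + r))" unfolding symbol_integral[OF assms] .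
  moreover have "0 < 2 / pi * (1 + r)" using assms by simp
  ultimately show ?thesis by (rule zero_less_mult_pos)
qed

lemma abs_mean_less:
  fixes f :: "nat \<Rightarrow> real"
  assumes n: "0 < n" and f: "\<And>k. k < n \<Longrightarrow> \<bar>f k - c\<bar> < e"
  shows "\<bar>(\<Sum>k<n. f k) / real n - c\<bar> < e"
proof -
  have "(\<Sum>k<n. f k) / real n - c = (\<Sum>k<n. f k - c) / real n"
    unfolding sum_subtractf using n by (simp add: field_simps)
  moreover have "\<bar>\<Sum>k<n. f k - c\<bar> < real n * e"
  proof -
    have "\<bar>\<Sum>k<n. f k - c\<bar> \<le> (\<Sum>k<n. \<bar>f k - c\<bar>)" by (rule sum_abs)
    also have "\<dots> < (\<Sum>k<n. e)" by (rule sum_strict_mono) (use n f in auto)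
    finally show ?thesis by simp
  qed
  ultimately show ?thesis using n by (simp add: divide_less_eq mult.commute)
qed

text \<open>The function \<open>g\<close> gives the error probability in terms of
  \<open>1 / (2 * v)\<close>. With \<open>v = a / (2 * \<eta>)\<close> and \<open>a\<close> the
  noise amplification this argument is \<open>\<eta> / a\<close>, which concentrates at
  \<open>\<eta> * d / \<tau>\<close> and hence tends to \<open>\<gamma>\<close>. The estimate is the
  same for all streams, so it passes to their average.\<close>

lemma avg_sep_limit:
  fixes \<beta> \<eta> :: real and \<rho> :: complex and Nr :: "nat \<Rightarrow> nat" and S :: "complex set"
    and P :: "nat \<Rightarrow> 'a measure" and H :: "nat \<Rightarrow> 'a \<Rightarrow> complex Matrix.mat" and s \<xi> :: "nat \<Rightarrow> 'a \<Rightarrow> complex Matrix.vec"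
    and W :: "nat \<Rightarrow> complex Matrix.mat" and l :: "nat \<Rightarrow> nat \<Rightarrow> real" and A :: "nat set"
  assumes \<beta>: "1 < \<beta>" and \<eta>: "0 < \<eta>" and r: "0 < cmod \<rho>" "cmod \<rho> < 1"
    and Nr: "\<And>n. n \<in> A \<Longrightarrow> real (Nr n) = \<beta> * real n"
    and mimo: "\<And>n. n \<in> A \<Longrightarrow> mimo_system (P n) (Nr n) n (kms n \<rho>) (1 / \<eta>) S (H n) (s n) (\<xi> n)"
    and dec: "\<And>n. n \<in> A \<Longrightarrow> sorted_eigendecomposition n (kms n \<rho>) (W n) (l n)"
    and S: "finite S" "S \<noteq> {}" and g: "\<And>v. 0 < v \<Longrightarrow> serr S v = g (1 / (2 * v))"
    and cont: "\<And>\<gamma>. 0 < \<gamma> \<Longrightarrow> isCont g \<gamma>"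
  defines "\<gamma> \<equiv> pi\<^sup>2 * \<eta> * (1 - cmod \<rho>) * (\<beta> - 1) / (4 * (1 + cmod \<rho>) * (ellE (2 * sqrt (cmod \<rho>) / (1 + cmod \<rho>)))\<^sup>2)"
  shows "((\<lambda>n. avg_sep (P n) n S (H n) (s n) (\<xi> n) (precoder n (W n) (l n))) \<longlongrightarrow> g \<gamma>) (inf sequentially (principal A))"
    (is "(?sep \<longlongrightarrow> _) ?F")
proof -
  define E where "E = ellE (2 * sqrt (cmod \<rho>) / (1 + cmod \<rho>))"
  have E: "0 < E" unfolding E_def using r by (intro ellE_pos) auto
  define m where "m = 2 / pi * (1 + cmod \<rho>) * E / sqrt (1 - (cmod \<rho>)\<^sup>2)"
  have c: "0 < 1 - (cmod \<rho>)\<^sup>2" using r by (simp add: abs_square_less_1)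
  have rp: "0 < 1 + cmod \<rho>" using r by linarith
  have m: "0 < m" unfolding m_def using E rp c by (intro divide_pos_pos mult_pos_pos) auto
  have m2: "m\<^sup>2 = 4 * (1 + cmod \<rho>) * E\<^sup>2 / (pi\<^sup>2 * (1 - cmod \<rho>))"
  proof -
    \<comment> \<open>One of the two factors \<open>1 + cmod \<rho>\<close> in the square cancels
      against this factorisation, leaving the ratio of \<open>1 + cmod \<rho>\<close> to
      \<open>1 - cmod \<rho>\<close>.\<close>
    have "1 - (cmod \<rho>)\<^sup>2 = (1 + cmod \<rho>) * (1 - cmod \<rho>)" by (simp add: power2_eq_square algebra_simps)
    then have "m\<^sup>2 = (2 / pi * (1 + cmod \<rho>) * E)\<^sup>2 / ((1 + cmod \<rho>) * (1 - cmod \<rho>))"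
      unfolding m_def power_divide using c by simp
    also have "(2 / pi * (1 + cmod \<rho>) * E)\<^sup>2 = (1 + cmod \<rho>) * (4 * (1 + cmod \<rho>) * E\<^sup>2 / pi\<^sup>2)"
      by (simp add: power2_eq_square algebra_simps)
    also have "\<dots> / ((1 + cmod \<rho>) * (1 - cmod \<rho>)) = 4 * (1 + cmod \<rho>) * E\<^sup>2 / pi\<^sup>2 / (1 - cmod \<rho>)"
      using rp by (intro nonzero_mult_divide_mult_cancel_left) simp
    finally show ?thesis by simp
  qed
  have \<gamma>m: "\<gamma> = \<eta> * ((\<beta> - 1) / m\<^sup>2)"
    unfolding m2 \<gamma>_def E_def[symmetric] using E r by (simp add: divide_simps)
  have \<gamma>: "0 < \<gamma>" unfolding \<gamma>m using \<eta> \<beta> m by simp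
  have L: "0 \<le> g \<gamma>" "g \<gamma> \<le> 1"
    using g[of "1 / (2 * \<gamma>)"] serr_bounds[OF S, of "1 / (2 * \<gamma>)"] \<gamma> by simp_all
  define \<mu> where "\<mu> n = inv_sqrt_sum n (l n) / real n" for n
  \<comment> \<open>\<open>x n\<close> equals \<open>d / \<tau>\<close>, because
    \<open>d = (\<beta> - 1) * n + 1\<close> and \<open>\<tau> = n * (\<mu> n)\<^sup>2\<close>.
    Likewise \<open>z n\<close> equals \<open>d / \<tau>\<^sup>2\<close>, the Chebyshev bound up to
    the factor \<open>1 / \<epsilon>\<^sup>2\<close>; its extra \<open>1 / n\<close> sends it to
    0.\<close>
  define x where "x n = ((\<beta> - 1) + 1 / real n) / (\<mu> n)\<^sup>2" for n
  define z where "z n = x n / (\<mu> n)\<^sup>2 / real n" for n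
  have F: "?F \<le> sequentially" by simp
  have \<mu>: "(\<mu> \<longlongrightarrow> m) ?F" unfolding \<mu>_def m_def E_def by (rule inv_sqrt_sum_limit[OF r dec])
  have inv: "((\<lambda>n. 1 / real n) \<longlongrightarrow> 0) ?F" by (rule tendsto_mono[OF F lim_const_over_n])
  have x: "(x \<longlongrightarrow> (\<beta> - 1) / m\<^sup>2) ?F"
  proof -
    have "(x \<longlongrightarrow> ((\<beta> - 1) + 0) / m\<^sup>2) ?F"
      unfolding x_def using m by (intro tendsto_divide tendsto_add tendsto_const tendsto_power \<mu> inv) auto
    then show ?thesis by simp
  qed
  have z: "(z \<longlongrightarrow> 0) ?F"
  proof -
    have "((\<lambda>n. x n / (\<mu> n)\<^sup>2 * (1 / real n)) \<longlongrightarrow> (\<beta> - 1) / m\<^sup>2 / m\<^sup>2 * 0) ?F"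
      using m by (intro tendsto_mult tendsto_divide tendsto_power x \<mu> inv) auto
    then show ?thesis unfolding z_def by simp
  qed
  show ?thesis
  proof (rule tendstoI)
    fix e :: real assume e: "0 < e"
    obtain \<delta> where \<delta>: "0 < \<delta>" "\<And>\<gamma>'. dist \<gamma>' \<gamma> < \<delta> \<Longrightarrow> dist (g \<gamma>') (g \<gamma>) < e / 2"
      using cont[OF \<gamma>] e unfolding continuous_at_eps_delta by (meson half_gt_zero)
    \<comment> \<open>The reciprocal amplification is within \<open>\<epsilon>\<close> of
      \<open>d / \<tau>\<close>, and this is within \<open>\<epsilon>\<close> of its limit. The
      choice makes \<open>\<eta> * (2 * \<epsilon>)\<close> equal to
      \<open>\<delta>\<close>.\<close>
    define \<epsilon> where "\<epsilon> = \<delta> / (2 * \<eta>)"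
    have \<epsilon>: "0 < \<epsilon>" using \<delta> \<eta> by (simp add: \<epsilon>_def)
    have "\<forall>\<^sub>F n in ?F. dist (x n) ((\<beta> - 1) / m\<^sup>2) < \<epsilon>" by (rule tendstoD[OF x \<epsilon>])
    moreover have "\<forall>\<^sub>F n in ?F. dist (z n) 0 < e * \<epsilon>\<^sup>2 / 2" by (rule tendstoD[OF z]) (use e \<epsilon> in simp)
    moreover have "\<forall>\<^sub>F n in ?F. n \<in> A" by (simp add: eventually_inf_principal)
    moreover have "\<forall>\<^sub>F n in ?F. 2 \<le> n" by (rule filter_leD[OF F eventually_ge_at_top])
    ultimately show "\<forall>\<^sub>F n in ?F. dist (?sep n) (g \<gamma>) < e"
    proof eventually_elim
      case (elim n)
      have n: "0 < n" using elim(4) by simp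
      have kc: "kms n \<rho> \<in> carrier_mat n n" by (simp add: kms_def)
      note dn = dec[OF elim(3)]
      note D = sorted_eigendecompositionD[OF dn kc]
      have Wc: "W n \<in> carrier_mat n n" using dn by (simp add: sorted_eigendecomposition_def)
      have l: "0 < l n j" if "j < n" for j
        by (rule kms_spectrum(1)[OF elim(4) r D(1)]; fact)
      have "1 * real n \<le> \<beta> * real n" using \<beta> by (intro mult_right_mono) auto
      then have nNr: "n \<le> Nr n" unfolding Nr[OF elim(3), symmetric] by simp
      define d where "d = Suc (Nr n) - n"
      have d: "n + d = Suc (Nr n)" using nNr by (simp add: d_def)
      have dr: "real d = (\<beta> - 1) * real n + 1"
      proof -
        have "real n + real d = real (Nr n) + 1" using d by linarith
        then show ?thesis unfolding Nr[OF elim(3)] by (simp add: algebra_simps)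
      qed
      define \<tau> where "\<tau> = (inv_sqrt_sum n (l n))\<^sup>2 / n"
      have \<tau>: "\<tau> = real n * (\<mu> n)\<^sup>2" using n by (simp add: \<tau>_def \<mu>_def power2_eq_square)
      interpret precoded_mimo "P n" "Nr n" n "kms n \<rho>" "1 / \<eta>" S "H n" "s n" "\<xi> n" "precoder n (W n) (l n)"
        "\<lambda>k j. complex_of_real (inv_sqrt_sum n (l n)) * (\<Sum>i<n. cnj (dft n $$ (i, j)) * (complex_of_real (l n i powr (-1/2)) * dft n $$ (i, k)))" \<tau>
        unfolding \<tau>_def
        by (rule precoder_precoded_mimo[OF mimo[OF elim(3)] n nNr Wc D(1)]) (fact D(2), fact l, rule kms_hermitian)
      have \<mu>n: "(\<mu> n)\<^sup>2 \<noteq> 0" using tau unfolding \<tau> by auto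
      have dx: "d / \<tau> = x n"
      proof -
        have "d / \<tau> = (real n * ((\<beta> - 1) + 1 / real n)) / (real n * (\<mu> n)\<^sup>2)" unfolding \<tau> dr using n by (simp add: algebra_simps)
        then show ?thesis unfolding x_def using n by simp
      qed
      have bad: "d / (\<epsilon> * \<tau>)\<^sup>2 < e / 2"
      proof -
        have "d / (\<epsilon> * \<tau>)\<^sup>2 = (d / \<tau>) / \<tau> / \<epsilon>\<^sup>2" by (simp add: power2_eq_square)
        also have "(d / \<tau>) / \<tau> = z n" unfolding dx unfolding z_def \<tau> by (simp add: mult.commute)
        also have "z n / \<epsilon>\<^sup>2 < e / 2" using elim(2) \<epsilon> by (simp add: dist_real_def divide_less_eq)
        finally show ?thesis .
      qed
      have "\<bar>\<P>(\<omega> in P n. zf_decision S (H n \<omega>) (precoder n (W n) (l n)) (received (H n \<omega>) (precoder n (W n) (l n)) (s n \<omega>) (\<xi> n \<omega>)) k \<noteq> s n \<omega> $ k) - g \<gamma>\<bar> < e"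
        if k: "k < n" for k
      proof -
        have "\<bar>serr S (1 / \<eta> * a / 2) - g \<gamma>\<bar> \<le> e / 2" if a: "0 < a" "\<bar>1 / a - d / \<tau>\<bar> < \<epsilon>" for a
        proof -
          have "serr S (1 / \<eta> * a / 2) = g (\<eta> * (1 / a))" using g[of "1 / \<eta> * a / 2"] a \<eta> by simp
          moreover have "\<bar>1 / a - (\<beta> - 1) / m\<^sup>2\<bar> < 2 * \<epsilon>" using a(2) elim(1) unfolding dx dist_real_def by linarith
          then have "\<eta> * \<bar>1 / a - (\<beta> - 1) / m\<^sup>2\<bar> < \<eta> * (2 * \<epsilon>)" using \<eta> by (rule mult_strict_left_mono)
          then have "dist (\<eta> * (1 / a)) \<gamma> < \<delta>"
            unfolding \<gamma>m dist_real_def right_diff_distrib[symmetric] abs_mult using \<eta> by (simp add: \<epsilon>_def)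
          ultimately show ?thesis using \<delta>(2)[of "\<eta> * (1 / a)"] by (simp add: dist_real_def)
        qed
        then have "\<bar>\<P>(\<omega> in P n. zf_decision S (H n \<omega>) (precoder n (W n) (l n)) (received (H n \<omega>) (precoder n (W n) (l n)) (s n \<omega>) (\<xi> n \<omega>)) k \<noteq> s n \<omega> $ k) - g \<gamma>\<bar> \<le> e / 2 + d / (\<epsilon> * \<tau>)\<^sup>2"
          by (intro error_rate k d \<epsilon> L S) (use e \<eta> in auto)
        then show ?thesis using bad by linarith
      qed
      then show ?case unfolding avg_sep_def dist_real_def by (intro abs_mean_less n)
    qed
  qed
qed

text \<open>The filter runs over those \<open>n\<close> for which \<open>\<beta> * n\<close> is an
  integer. For each constellation it remains to exhibit the error probability as a continuous
  function \<open>g\<close> of \<open>1 / (2 * v)\<close> and to rewrite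
  \<open>g \<gamma>\<close>.\<close>

theorem corollary1:
  fixes M :: nat and \<beta> \<eta> :: real and \<rho> :: complex
    and Nr :: "nat \<Rightarrow> nat"
    and S :: "complex set"
    and P :: "nat \<Rightarrow> 'a measure"
    and H :: "nat \<Rightarrow> 'a \<Rightarrow> complex Matrix.mat"
    and s \<xi> :: "nat \<Rightarrow> 'a \<Rightarrow> complex Matrix.vec"
    and W :: "nat \<Rightarrow> complex Matrix.mat"
    and l :: "nat \<Rightarrow> nat \<Rightarrow> real"
  defines "lim_Nt \<equiv> inf sequentially (principal {n. 0 < n \<and> \<beta> * real n \<in> \<nat>})"
    and "E \<equiv> ellE (2 * sqrt (cmod \<rho>) / (1 + cmod \<rho>))"
    and "sep \<equiv> (\<lambda>n. avg_sep (P n) n S (H n) (s n) (\<xi> n) (precoder n (W n) (l n)))"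
  assumes "1 < \<beta>" and "0 < \<eta>" and "0 < cmod \<rho>" and "cmod \<rho> < 1" and "2 \<le> M"
    and "\<And>n. 0 < n \<Longrightarrow> \<beta> * real n \<in> \<nat> \<Longrightarrow> real (Nr n) = \<beta> * real n"
    and "\<And>n. 0 < n \<Longrightarrow> \<beta> * real n \<in> \<nat> \<Longrightarrow>
           mimo_system (P n) (Nr n) n (kms n \<rho>) (1 / \<eta>) S (H n) (s n) (\<xi> n)"
    and "\<And>n. 0 < n \<Longrightarrow> \<beta> * real n \<in> \<nat> \<Longrightarrow> sorted_eigendecomposition n (kms n \<rho>) (W n) (l n)"
  shows
    "(S = pam M \<longrightarrow>
       (sep \<longlongrightarrow>
          2 * (real M - 1) / real M *
          Qfun (sqrt (3 * pi\<^sup>2 * \<eta> * (1 - cmod \<rho>) * (\<beta> - 1) /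
                       (2 * (1 + cmod \<rho>) * ((real M)\<^sup>2 - 1) * E\<^sup>2)))) lim_Nt) \<and>
     (S = psk M \<longrightarrow>
       (sep \<longlongrightarrow>
          1 / pi * integral {0 .. (real M - 1) * pi / real M}
            (\<lambda>\<theta>. exp (- (pi\<^sup>2) * \<eta> * (1 - cmod \<rho>) * (\<beta> - 1) * (sin (pi / real M))\<^sup>2 /
                       (4 * (1 + cmod \<rho>) * E\<^sup>2 * (sin \<theta>)\<^sup>2)))) lim_Nt) \<and>
     ((\<exists>q\<ge>2. M = q\<^sup>2) \<and> S = square_qam M \<longrightarrow>
       (sep \<longlongrightarrow>
          4 * (sqrt (real M) - 1) / sqrt (real M) *
          Qfun (sqrt (3 * pi\<^sup>2 * \<eta> * (1 - cmod \<rho>) * (\<beta> - 1) /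
                       (4 * (1 + cmod \<rho>) * (real M - 1) * E\<^sup>2))) -
          4 * (sqrt (real M) - 1)\<^sup>2 / real M *
          (Qfun (sqrt (3 * pi\<^sup>2 * \<eta> * (1 - cmod \<rho>) * (\<beta> - 1) /
                       (4 * (1 + cmod \<rho>) * (real M - 1) * E\<^sup>2))))\<^sup>2) lim_Nt)"
proof -
  define A where "A = {n. 0 < n \<and> \<beta> * real n \<in> \<nat>}"
  define \<gamma> where "\<gamma> = pi\<^sup>2 * \<eta> * (1 - cmod \<rho>) * (\<beta> - 1) / (4 * (1 + cmod \<rho>) * E\<^sup>2)"
  have lim_Nt: "lim_Nt = inf sequentially (principal A)" by (simp add: lim_Nt_def A_def)
  have M: "2 \<le> M" by fact
  have main: "(sep \<longlongrightarrow> g \<gamma>) lim_Nt"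
    if "finite S" "S \<noteq> {}" and "\<And>v. 0 < v \<Longrightarrow> serr S v = g (1 / (2 * v))" and "\<And>\<gamma>. 0 < \<gamma> \<Longrightarrow> isCont g \<gamma>" for g
    unfolding lim_Nt sep_def \<gamma>_def E_def
    by (rule avg_sep_limit[where Nr=Nr, OF \<open>1 < \<beta>\<close> \<open>0 < \<eta>\<close> \<open>0 < cmod \<rho>\<close> \<open>cmod \<rho> < 1\<close> _ _ _ that])
       (auto simp: A_def intro: assms(9-11))
  \<comment> \<open>Half the point distance over the noise deviation becomes a function of
    \<open>1 / (2 * v)\<close> with coefficient twice the squared half distance:
    \<open>6 / (M\<^sup>2 - 1)\<close> for PAM and \<open>3 / (M - 1)\<close> for QAM.\<close>
  have scale: "a / sqrt v = sqrt (a\<^sup>2 * 2 * (1 / (2 * v)))" if "0 < a" "0 < v" for a v :: real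
    using that by (simp add: real_sqrt_divide)
  have contQ: "isCont (\<lambda>\<gamma>. Qfun (sqrt (c * \<gamma>))) \<gamma>'" for c \<gamma>' :: real
    by (rule isCont_o2[of _ "\<lambda>\<gamma>. sqrt (c * \<gamma>)"]) (auto intro!: continuous_intros isCont_Qfun)
  have pam_arg: "6 / D * (a * b * c * d / (4 * R * e)) = 3 * a * b * c * d / (2 * R * D * e)"
    and qam_arg: "3 / D * (a * b * c * d / (4 * R * e)) = 3 * a * b * c * d / (4 * R * D * e)" for D a b c d R e :: real
    by (simp_all add: mult_ac)
  have qam_scale: "(sqrt (3 / (2 * x)))\<^sup>2 * 2 * t = 3 / x * t" if "0 < x" for x t :: real
    using that by simp
  show ?thesis
  proof (intro conjI impI)
    assume S: "S = pam M"
    note P = pam_eq[OF M]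
    define g where "g \<gamma> = 2 * (real M - 1) / real M * Qfun (sqrt (6 / ((real M)\<^sup>2 - 1) * \<gamma>))" for \<gamma>
    have cont: "isCont g \<gamma>" for \<gamma> unfolding g_def by (intro isCont_mult continuous_const contQ)
    have "1 < (real M)\<^sup>2" using M by (intro one_less_power) auto
    then have "serr S v = g (1 / (2 * v))" if "0 < v" for v
      unfolding S serr_pam[OF M that] scale[OF P(1) that] g_def by simp
    then have "(sep \<longlongrightarrow> g \<gamma>) lim_Nt"
      using cont P M unfolding S[symmetric] by (intro main) auto
    moreover have "6 / ((real M)\<^sup>2 - 1) * \<gamma> = 3 * pi\<^sup>2 * \<eta> * (1 - cmod \<rho>) * (\<beta> - 1) / (2 * (1 + cmod \<rho>) * ((real M)\<^sup>2 - 1) * E\<^sup>2)"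
      unfolding \<gamma>_def by (rule pam_arg)
    ultimately show "(sep \<longlongrightarrow> 2 * (real M - 1) / real M * Qfun (sqrt (3 * pi\<^sup>2 * \<eta> * (1 - cmod \<rho>) * (\<beta> - 1) /
        (2 * (1 + cmod \<rho>) * ((real M)\<^sup>2 - 1) * E\<^sup>2)))) lim_Nt"
      unfolding g_def by (simp only:)
  next
    assume S: "S = psk M"
    note P = psk_props[OF M]
    have a: "0 < pi / M" "pi / M < pi" using M by (auto simp: divide_less_eq)
    define g where "g \<gamma> = 2 * craig (pi / M) (\<gamma> * (sin (pi / M))\<^sup>2)" for \<gamma>
    have "serr S v = g (1 / (2 * v))" if "0 < v" for v
      unfolding S serr_psk[OF M that] g_def by simp
    moreover have "isCont g \<gamma>" if "0 < \<gamma>" for \<gamma>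
      unfolding g_def by (intro isCont_mult continuous_const isCont_craig a that) simp
    ultimately have "(sep \<longlongrightarrow> g \<gamma>) lim_Nt"
      using P M unfolding S[symmetric] by (intro main) auto
    moreover have "g \<gamma> = 1 / pi * integral {0 .. (real M - 1) * pi / real M}
        (\<lambda>\<theta>. exp (- (pi\<^sup>2) * \<eta> * (1 - cmod \<rho>) * (\<beta> - 1) * (sin (pi / real M))\<^sup>2 / (4 * (1 + cmod \<rho>) * E\<^sup>2 * (sin \<theta>)\<^sup>2)))"
    proof -
      \<comment> \<open>The factor 2 for the two half regions and the factor
        \<open>1 / (2 * pi)\<close> inside \<open>craig\<close> combine to
        \<open>1 / pi\<close>.\<close>
      have "pi - pi / M = (real M - 1) * pi / M" using M by (simp add: field_simps)
      then show ?thesis unfolding g_def craig_def \<gamma>_def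
        by (simp add: integral_divide)
    qed
    ultimately show "(sep \<longlongrightarrow> 1 / pi * integral {0 .. (real M - 1) * pi / real M}
        (\<lambda>\<theta>. exp (- (pi\<^sup>2) * \<eta> * (1 - cmod \<rho>) * (\<beta> - 1) * (sin (pi / real M))\<^sup>2 / (4 * (1 + cmod \<rho>) * E\<^sup>2 * (sin \<theta>)\<^sup>2)))) lim_Nt"
      by simp
  next
    assume "(\<exists>q\<ge>2. M = q\<^sup>2) \<and> S = square_qam M"
    then obtain q :: nat where q: "2 \<le> q" "M = q\<^sup>2" and S: "S = square_qam M" by blast
    note P = qam_eq[OF q]
    have sq: "sqrt (real M) = real q" using q by simp
    define g where "g \<gamma> = 4 * (real q - 1) / real q * Qfun (sqrt (3 / (real M - 1) * \<gamma>))
      - 4 * (real q - 1)\<^sup>2 / real M * (Qfun (sqrt (3 / (real M - 1) * \<gamma>)))\<^sup>2" for \<gamma>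
    have cont: "isCont g \<gamma>" for \<gamma> unfolding g_def by (intro isCont_diff isCont_mult continuous_const isCont_power contQ)
    have M1: "0 < real M - 1" using M by simp
    have "serr S v = g (1 / (2 * v))" if "0 < v" for v
      unfolding S serr_qam[OF q that] scale[OF P(1) that] g_def qam_scale[OF M1] ..
    then have "(sep \<longlongrightarrow> g \<gamma>) lim_Nt"
      using cont P(4,5) M unfolding S[symmetric] by (intro main) auto
    moreover have "3 / (real M - 1) * \<gamma> = 3 * pi\<^sup>2 * \<eta> * (1 - cmod \<rho>) * (\<beta> - 1) / (4 * (1 + cmod \<rho>) * (real M - 1) * E\<^sup>2)"
      unfolding \<gamma>_def by (rule qam_arg)
    ultimately show "(sep \<longlongrightarrow> 4 * (sqrt (real M) - 1) / sqrt (real M) *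
          Qfun (sqrt (3 * pi\<^sup>2 * \<eta> * (1 - cmod \<rho>) * (\<beta> - 1) / (4 * (1 + cmod \<rho>) * (real M - 1) * E\<^sup>2))) -
          4 * (sqrt (real M) - 1)\<^sup>2 / real M *
          (Qfun (sqrt (3 * pi\<^sup>2 * \<eta> * (1 - cmod \<rho>) * (\<beta> - 1) / (4 * (1 + cmod \<rho>) * (real M - 1) * E\<^sup>2))))\<^sup>2) lim_Nt"
      unfolding g_def sq by (simp only:)
  qed
qed

end
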